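(* Assume the monotonicity condition (M) stated in the context holds and let $T>0$ be fixed. Let $(\Delta x_p)_{p\in\mathbb{N}}$ be a sequence of positive space-steps with $\lim_{p\to+\infty}\Delta x_p=0$ (possibly already a subsequence of a given sequence) along which the reconstructions of the numerical solution converge, i.e. $\boldsymbol{f}_{\Delta_p}\to\overline{\boldsymbol{f}}$ and $u_{\Delta_p}\to\overline{u}=\sum_{i\in I}\overline f_i$ in $L^\infty_t(0,T)L^1_{\boldsymbol{x}}((\mathbb{R}_+^* )^2)$, where $\overline{\boldsymbol{f}}(t,\cdot)\in L^1((\mathbb{R}_+^* )^2)$, $\overline{\boldsymbol{f}}(t,\boldsymbol{x})\in K$, $\overline u(t,\boldsymbol{x})\in[-u_\infty,u_\infty]$ and $\overline{\boldsymbol{f}}(t,\boldsymbol{x})=\boldsymbol{f}^{\mathrm{eq}}(\overline u(t,\boldsymbol{x}))$ for a.e. $\boldsymbol{x}$, for $t\in(0,T)$. Then $\overline u$ is a weak entropy solution (in the sense defined in the context) of $$\partial_tu+\partial_x(\varphi_x(u))+\partial_y(\varphi_y(u))=0\quad\text{on }(0,T)\times(\mathbb{R}_+^* )^2$$ with initial datum $u^\circ$ and boundary data $\tilde u_W$ on $\{x=0\}$ and $\tilde u_S$ on $\{y=0\}$.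
   Context: Setting (scalar two-relaxation-times D2Q5 lattice Boltzmann scheme on a quarter plane, with equilibrium boundary conditions). $\mathbb{R}_+^*=(0,+\infty)$; $\boldsymbol{x}=(x,y)$; $\boldsymbol{e}_x=(1,0)$, $\boldsymbol{e}_y=(0,1)$. Data and parameters. $T>0$ and $\lambda>0$ are fixed. Fluxes $\varphi_x,\varphi_y\in C^1(\mathbb{R})$ with $\varphi_x(0)=\varphi_y(0)=0$. Initial datum $u^\circ\in L^\infty\cap BV\cap L^1((\mathbb{R}_+^* )^2)$. Western and southern boundary data $\tilde u_W,\tilde u_S\in L^\infty\cap BV\cap L^1((0,T)\times\mathbb{R}_+^* )$, with $\tilde u_W=\tilde u_W(t,y)$ and $\tilde u_S=\tilde u_S(t,x)$. Set $u_\infty:=\max(\|u^\circ\|_{L^\infty},\|\tilde u_W\|_{L^\infty},\|\tilde u_S\|_{L^\infty})$. Relaxation parameters $\omega_s,\omega_a\in(0,2]$ and $L_x,L_y\in\mathbb{R}$. Grid. $\Delta x>0$, $\Delta t:=\Delta x/\lambda$, with $N\Delta t=T$ for some integer $N\ge1$; $t^n:=n\Delta t$. Cells $C_{\boldsymbol{j}}:=(j_x\Delta x,(j_x+1)\Delta x)\times(j_y\Delta x,(j_y+1)\Delta x)$, $\boldsymbol{j}=(j_x,j_y)\in\mathbb{N}^2$ ($0\in\mathbb{N}$). Equilibria. Index set $I=\{0,x+,x-,y+,y-\}$ and $f^{\mathrm{eq}}_0(u)=(1-2L_x-2L_y)u$, $f^{\mathrm{eq}}_{x\pm}(u)=L_xu\pm\frac{1}{2\lambda}\varphi_x(u)$,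 $f^{\mathrm{eq}}_{y\pm}(u)=L_yu\pm\frac{1}{2\lambda}\varphi_y(u)$; $\boldsymbol{f}^{\mathrm{eq}}=(f^{\mathrm{eq}}_i)_{i\in I}$. Scheme. Initialization: $f^0_{i,\boldsymbol{j}}=f^{\mathrm{eq}}_i\big(\frac{1}{\Delta x^2}\int_{C_{\boldsymbol{j}}}u^\circ\,d\boldsymbol{x}\big)$. For $n=0,\dots,N-1$, with $u^n_{\boldsymbol{j}}:=\sum_{i\in I}f^n_{i,\boldsymbol{j}}$ (at all times), relaxation: $f^{n,\star}_{0,\boldsymbol{j}}=(1-\omega_s)f^n_{0,\boldsymbol{j}}+\omega_sf^{\mathrm{eq}}_0(u^n_{\boldsymbol{j}})$ and, for $a\in\{x,y\}$, $$f^{n,\star}_{a\pm,\boldsymbol{j}}=\big(1-\tfrac12(\omega_s+\omega_a)\big)f^n_{a\pm,\boldsymbol{j}}+\tfrac12(\omega_s+\omega_a)f^{\mathrm{eq}}_{a\pm}(u^n_{\boldsymbol{j}})+\tfrac12(\omega_s-\omega_a)\big(f^{\mathrm{eq}}_{a\mp}(u^n_{\boldsymbol{j}})-f^n_{a\mp,\boldsymbol{j}}\big).$$ Transport: $f^{n+1}_{0,\boldsymbol{j}}=f^{n,\star}_{0,\boldsymbol{j}}$, $f^{n+1}_{a\pm,\boldsymbol{j}}=f^{n,\star}_{a\pm,\boldsymbol{j}\mp\boldsymbol{e}_a}$ for $a\in\{x,y\}$, where ghost values are $f^{n,\star}_{x+,(-1,j_y)}=f^{\mathrm{eq}}_{x+}(\tilde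 u^n_{W,j_y})$ and $f^{n,\star}_{y+,(j_x,-1)}=f^{\mathrm{eq}}_{y+}(\tilde u^n_{S,j_x})$, with $\tilde u^n_{\alpha,j}:=\frac{1}{\Delta t\Delta x}\int_{t^n}^{t^{n+1}}\int_{j\Delta x}^{(j+1)\Delta x}\tilde u_\alpha(t,s)\,ds\,dt$, $\alpha\in\{W,S\}$. Monotonicity condition (M): $$\omega_s(1-2L_x-2L_y)\ge\max(0,\omega_s-1),\qquad \frac{\omega_a}{2}\max_{|u|\le u_\infty}\frac{|\varphi_a'(u)|}{\lambda}\le\omega_sL_a+\tfrac12\min(2-\omega_s-\omega_a,0,\omega_a-\omega_s)\quad(a=x,y).$$ The trivial case where both $\max_{|u|\le u_\infty}|\varphi_x'(u)|=0$ and $\max_{|u|\le u_\infty}|\varphi_y'(u)|=0$ is excluded throughout. Reconstructions. $\boldsymbol{f}_\Delta(t,\boldsymbol{x}):=\sum_{n=0}^{N-1}\sum_{\boldsymbol{j}}(f^n_{i,\boldsymbol{j}})_{i\in I}\mathbf{1}_{C_{\boldsymbol{j}}}(\boldsymbol{x})\mathbf{1}_{[t^n,t^{n+1})}(t)$, and likewise $u_\Delta$ from $u^n_{\boldsymbol{j}}$; $\boldsymbol{f}_{\Delta_p},u_{\Delta_p}$ are those with space-step $\Delta x_p$. Norms of vector-valued functions use the $\ell^1$-norm over $i\in I$. $K:=\prod_{i\in I}[f^{\mathrm{eq}}_i(-u_\infty),f^{\mathrm{eq}}_i(u_\infty)]$. All space-steps are such that $T/\Delta t$ is an integer, with $\lambda,\omega_s,\omega_a,L_x,L_y$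 and the data fixed. Weak entropy solution (Bardos–Leroux–Nédelec). A function $u\in BV((0,T)\times(\mathbb{R}_+^* )^2)$ is a weak entropy solution if for all $\kappa\in\mathbb{R}$ and all $\psi\in C_c^2([0,T)\times[0,+\infty)^2)$ with $\psi\ge0$, $$\begin{aligned}&\int_0^T\!\!\int_{(\mathbb{R}_+^* )^2}\Big(|u-\kappa|\,\partial_t\psi+\operatorname{sgn}(u-\kappa)\big((\varphi_x(u)-\varphi_x(\kappa))\partial_x\psi+(\varphi_y(u)-\varphi_y(\kappa))\partial_y\psi\big)\Big)\,d\boldsymbol{x}\,dt\\&+\int_0^T\!\!\int_0^{+\infty}\operatorname{sgn}(\tilde u_W(t,y)-\kappa)\big(\varphi_x(\gamma_W(u)(t,y))-\varphi_x(\kappa)\big)\psi(t,0,y)\,dy\,dt\\&+\int_0^T\!\!\int_0^{+\infty}\operatorname{sgn}(\tilde u_S(t,x)-\kappa)\big(\varphi_y(\gamma_S(u)(t,x))-\varphi_y(\kappa)\big)\psi(t,x,0)\,dx\,dt\\&+\int_{(\mathbb{R}_+^* )^2}|u^\circ(\boldsymbol{x})-\kappa|\,\psi(0,\boldsymbol{x})\,d\boldsymbol{x}\ \ge\ 0,\end{aligned}$$ where $\gamma_W(u)$, $\gamma_S(u)$ are the traces of $u$ on $\{x=0\}$ and $\{y=0\}$ (well defined for $BV$ functions), and $\operatorname{sgn}(0)=0$. *)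

theory Defs
  imports "HOL-Analysis.Analysis" "HOL-Probability.Essential_Supremum"
begin

section \<open>Domains\<close>

text \<open>A point of space-time is a triple \<open>(t, x, y)\<close>, i.e. a pair of a time and a point \<open>(x, y)\<close>
  of the plane.\<close>

definition quarter :: "(real \<times> real) set" where
  "quarter = {0<..} \<times> {0<..}"

definition space_time :: "real \<Rightarrow> (real \<times> real \<times> real) set" where
  "space_time T = {0<..<T} \<times> quarter"

definition face :: "real \<Rightarrow> (real \<times> real) set" where
  "face T = {0<..<T} \<times> {0<..}"

definition test_domain :: "real \<Rightarrow> (real \<times> real \<times> real) set" where
  "test_domain T = {0..<T} \<times> {0..} \<times> {0..}"

section \<open>Differentiability up to the boundary and functions of bounded variation\<close>

text \<open>Derivatives are taken within the set \<open>S\<close>. On an open set they are the ordinary ones; on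
  \<open>test_domain T\<close> they are one-sided at the boundary (and still unique).\<close>

definition partial ::
    "'a::euclidean_space set \<Rightarrow> 'a \<Rightarrow> ('a \<Rightarrow> 'b::real_normed_vector) \<Rightarrow> 'a \<Rightarrow> 'b" where
  "partial S b f p = frechet_derivative f (at p within S) b"

definition C1_on :: "'a::euclidean_space set \<Rightarrow> ('a \<Rightarrow> 'b::real_normed_vector) \<Rightarrow> bool" where
  "C1_on S f \<longleftrightarrow>
     (\<forall>p\<in>S. f differentiable (at p within S)) \<and> (\<forall>b\<in>Basis. continuous_on S (partial S b f))"

definition C2_on :: "'a::euclidean_space set \<Rightarrow> ('a \<Rightarrow> 'b::real_normed_vector) \<Rightarrow> bool" where
  "C2_on S f \<longleftrightarrow> C1_on S f \<and> (\<forall>b\<in>Basis. C1_on S (partial S b f))"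

definition compact_support_in :: "'a::topological_space set \<Rightarrow> ('a \<Rightarrow> 'b::zero) \<Rightarrow> bool" where
  "compact_support_in S f \<longleftrightarrow> (\<exists>K. compact K \<and> K \<subseteq> S \<and> (\<forall>p\<in>S - K. f p = 0))"

definition divergence :: "'a::euclidean_space set \<Rightarrow> ('a \<Rightarrow> 'a) \<Rightarrow> 'a \<Rightarrow> real" where
  "divergence S \<Phi> p = (\<Sum>b\<in>Basis. partial S b \<Phi> p \<bullet> b)"

text \<open>\<open>BV(\<Omega>)\<close> for an open set \<open>\<Omega>\<close>: integrable functions with finite total variation.\<close>

definition BV :: "'a::euclidean_space set \<Rightarrow> ('a \<Rightarrow> real) \<Rightarrow> bool" where
  "BV \<Omega> u \<longleftrightarrow> integrable (lebesgue_on \<Omega>) u \<and>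
     (\<exists>M. \<forall>\<Phi>. C1_on \<Omega> \<Phi> \<and> compact_support_in \<Omega> \<Phi> \<and> (\<forall>p\<in>\<Omega>. norm (\<Phi> p) \<le> 1)
        \<longrightarrow> (LINT p|lebesgue_on \<Omega>. u p * divergence \<Omega> \<Phi> p) \<le> M)"

definition Linf_norm :: "'a::euclidean_space set \<Rightarrow> ('a \<Rightarrow> real) \<Rightarrow> ennreal" where
  "Linf_norm \<Omega> u = esssup (lebesgue_on \<Omega>) (\<lambda>p. ennreal \<bar>u p\<bar>)"

definition Linf_BV_L1 :: "'a::euclidean_space set \<Rightarrow> ('a \<Rightarrow> real) \<Rightarrow> bool" where
  "Linf_BV_L1 \<Omega> u \<longleftrightarrow> Linf_norm \<Omega> u < \<infinity> \<and> BV \<Omega> u \<and> integrable (lebesgue_on \<Omega>) u"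

section \<open>Weak entropy solutions\<close>

text \<open>The traces on \<open>{x = 0}\<close> and \<open>{y = 0}\<close> are the limits in \<open>L\<^sup>1\<close> of \<open>u(t, s, y)\<close> and \<open>u(t, x, s)\<close>
  as \<open>s \<rightarrow> 0+\<close>. The limit is an essential one, since \<open>u\<close> only matters up to null sets. It is unique
  up to null sets, and it exists for every function in \<open>BV (space_time T)\<close>.\<close>

definition is_trace_W ::
    "real \<Rightarrow> (real \<times> real \<times> real \<Rightarrow> real) \<Rightarrow> (real \<times> real \<Rightarrow> real) \<Rightarrow> bool" where
  "is_trace_W T u \<gamma> \<longleftrightarrow> integrable (lebesgue_on (face T)) \<gamma> \<and>
     (\<forall>\<epsilon>>0. \<exists>\<delta>>0. AE s in lebesgue. 0 < s \<and> s < \<delta> \<longrightarrow>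
        (\<integral>\<^sup>+ (t, y). ennreal \<bar>u (t, s, y) - \<gamma> (t, y)\<bar> \<partial>lebesgue_on (face T)) < ennreal \<epsilon>)"

definition is_trace_S ::
    "real \<Rightarrow> (real \<times> real \<times> real \<Rightarrow> real) \<Rightarrow> (real \<times> real \<Rightarrow> real) \<Rightarrow> bool" where
  "is_trace_S T u \<gamma> \<longleftrightarrow> integrable (lebesgue_on (face T)) \<gamma> \<and>
     (\<forall>\<epsilon>>0. \<exists>\<delta>>0. AE s in lebesgue. 0 < s \<and> s < \<delta> \<longrightarrow>
        (\<integral>\<^sup>+ (t, x). ennreal \<bar>u (t, x, s) - \<gamma> (t, x)\<bar> \<partial>lebesgue_on (face T)) < ennreal \<epsilon>)"

definition entropy_functional ::
    "real \<Rightarrow> (real \<Rightarrow> real) \<Rightarrow> (real \<Rightarrow> real) \<Rightarrow> (real \<times> real \<Rightarrow> real) \<Rightarrow> (real \<times> real \<Rightarrow> real) \<Rightarrow>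
     (real \<times> real \<Rightarrow> real) \<Rightarrow> (real \<times> real \<times> real \<Rightarrow> real) \<Rightarrow> (real \<times> real \<Rightarrow> real) \<Rightarrow>
     (real \<times> real \<Rightarrow> real) \<Rightarrow> real \<Rightarrow> (real \<times> real \<times> real \<Rightarrow> real) \<Rightarrow> real" where
  "entropy_functional T \<phi>x \<phi>y u0 uW uS u \<gamma>W \<gamma>S \<kappa> \<psi> =
     (LINT p|lebesgue_on (space_time T).
        \<bar>u p - \<kappa>\<bar> * partial (test_domain T) (1, 0, 0) \<psi> p
        + sgn (u p - \<kappa>) *
            ((\<phi>x (u p) - \<phi>x \<kappa>) * partial (test_domain T) (0, 1, 0) \<psi> p
             + (\<phi>y (u p) - \<phi>y \<kappa>) * partial (test_domain T) (0, 0, 1) \<psi> p))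
     + (LINT (t, y)|lebesgue_on (face T).
          sgn (uW (t, y) - \<kappa>) * (\<phi>x (\<gamma>W (t, y)) - \<phi>x \<kappa>) * \<psi> (t, 0, y))
     + (LINT (t, x)|lebesgue_on (face T).
          sgn (uS (t, x) - \<kappa>) * (\<phi>y (\<gamma>S (t, x)) - \<phi>y \<kappa>) * \<psi> (t, x, 0))
     + (LINT (x, y)|lebesgue_on quarter. \<bar>u0 (x, y) - \<kappa>\<bar> * \<psi> (0, x, y))"

definition weak_entropy_solution ::
    "real \<Rightarrow> (real \<Rightarrow> real) \<Rightarrow> (real \<Rightarrow> real) \<Rightarrow> (real \<times> real \<Rightarrow> real) \<Rightarrow> (real \<times> real \<Rightarrow> real) \<Rightarrow>
     (real \<times> real \<Rightarrow> real) \<Rightarrow> (real \<times> real \<times> real \<Rightarrow> real) \<Rightarrow> bool" where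
  "weak_entropy_solution T \<phi>x \<phi>y u0 uW uS u \<longleftrightarrow>
     BV (space_time T) u \<and>
     (\<exists>\<gamma>W \<gamma>S. is_trace_W T u \<gamma>W \<and> is_trace_S T u \<gamma>S \<and>
        (\<forall>\<kappa> \<psi>. C2_on (test_domain T) \<psi> \<and> compact_support_in (test_domain T) \<psi> \<and>
               (\<forall>p\<in>test_domain T. 0 \<le> \<psi> p)
           \<longrightarrow> 0 \<le> entropy_functional T \<phi>x \<phi>y u0 uW uS u \<gamma>W \<gamma>S \<kappa> \<psi>))"

section \<open>The lattice Boltzmann scheme\<close>

datatype vel = Rest | XP | XM | YP | YM

lemma UNIV_vel: "(UNIV :: vel set) = {Rest, XP, XM, YP, YM}"
  using vel.exhaust by auto

instance vel :: finite
  by standard (simp add: UNIV_vel)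

fun opposite :: "vel \<Rightarrow> vel" where
  "opposite Rest = Rest"
| "opposite XP = XM"
| "opposite XM = XP"
| "opposite YP = YM"
| "opposite YM = YP"

fun feq ::
    "real \<Rightarrow> (real \<Rightarrow> real) \<Rightarrow> (real \<Rightarrow> real) \<Rightarrow> real \<Rightarrow> real \<Rightarrow> vel \<Rightarrow> real \<Rightarrow> real" where
  "feq lam \<phi>x \<phi>y Lx Ly Rest u = (1 - 2 * Lx - 2 * Ly) * u"
| "feq lam \<phi>x \<phi>y Lx Ly XP u = Lx * u + 1 / (2 * lam) * \<phi>x u"
| "feq lam \<phi>x \<phi>y Lx Ly XM u = Lx * u - 1 / (2 * lam) * \<phi>x u"
| "feq lam \<phi>x \<phi>y Lx Ly YP u = Ly * u + 1 / (2 * lam) * \<phi>y u"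
| "feq lam \<phi>x \<phi>y Lx Ly YM u = Ly * u - 1 / (2 * lam) * \<phi>y u"

text \<open>Below, \<open>E\<close> is the family of equilibria and \<open>g\<close> the distribution functions of one cell.\<close>

definition relax :: "(vel \<Rightarrow> real \<Rightarrow> real) \<Rightarrow> real \<Rightarrow> real \<Rightarrow> (vel \<Rightarrow> real) \<Rightarrow> vel \<Rightarrow> real" where
  "relax E \<omega>s \<omega>a g i =
     (let u = (\<Sum>k\<in>UNIV. g k) in
      if i = Rest then (1 - \<omega>s) * g Rest + \<omega>s * E Rest u
      else (1 - (\<omega>s + \<omega>a) / 2) * g i + (\<omega>s + \<omega>a) / 2 * E i u
           + (\<omega>s - \<omega>a) / 2 * (E (opposite i) u - g (opposite i)))"

definition cell :: "real \<Rightarrow> nat \<times> nat \<Rightarrow> (real \<times> real) set" where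
  "cell dx j = {real (fst j) * dx <..< (real (fst j) + 1) * dx}
               \<times> {real (snd j) * dx <..< (real (snd j) + 1) * dx}"

definition initial_average :: "real \<Rightarrow> (real \<times> real \<Rightarrow> real) \<Rightarrow> nat \<times> nat \<Rightarrow> real" where
  "initial_average dx u0 j = 1 / dx\<^sup>2 * (LINT x|lebesgue_on (cell dx j). u0 x)"

definition boundary_average ::
    "real \<Rightarrow> real \<Rightarrow> (real \<times> real \<Rightarrow> real) \<Rightarrow> nat \<Rightarrow> nat \<Rightarrow> real" where
  "boundary_average dt dx ub n j = 1 / (dt * dx) *
     (LINT z|lebesgue_on ({real n * dt <..< (real n + 1) * dt}
                          \<times> {real j * dx <..< (real j + 1) * dx}). ub z)"

text \<open>\<open>transport gW gS f\<close> shifts the post-collision values \<open>f\<close>; the ghost values left of and below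
  the grid are \<open>gW\<close> and \<open>gS\<close>.\<close>

fun transport ::
    "(nat \<Rightarrow> real) \<Rightarrow> (nat \<Rightarrow> real) \<Rightarrow> (vel \<Rightarrow> nat \<times> nat \<Rightarrow> real) \<Rightarrow> vel \<Rightarrow> nat \<times> nat \<Rightarrow> real" where
  "transport gW gS f Rest (jx, jy) = f Rest (jx, jy)"
| "transport gW gS f XP (jx, jy) = (if jx = 0 then gW jy else f XP (jx - 1, jy))"
| "transport gW gS f XM (jx, jy) = f XM (jx + 1, jy)"
| "transport gW gS f YP (jx, jy) = (if jy = 0 then gS jx else f YP (jx, jy - 1))"
| "transport gW gS f YM (jx, jy) = f YM (jx, jy + 1)"

primrec lbm ::
    "(vel \<Rightarrow> real \<Rightarrow> real) \<Rightarrow> real \<Rightarrow> real \<Rightarrow> (real \<times> real \<Rightarrow> real) \<Rightarrow> (real \<times> real \<Rightarrow> real) \<Rightarrow>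
     (real \<times> real \<Rightarrow> real) \<Rightarrow> real \<Rightarrow> real \<Rightarrow> nat \<Rightarrow> vel \<Rightarrow> nat \<times> nat \<Rightarrow> real" where
  "lbm E \<omega>s \<omega>a u0 uW uS dt dx 0 = (\<lambda>i j. E i (initial_average dx u0 j))"
| "lbm E \<omega>s \<omega>a u0 uW uS dt dx (Suc n) =
     transport (\<lambda>jy. E XP (boundary_average dt dx uW n jy))
       (\<lambda>jx. E YP (boundary_average dt dx uS n jx))
       (\<lambda>i j. relax E \<omega>s \<omega>a (\<lambda>k. lbm E \<omega>s \<omega>a u0 uW uS dt dx n k j) i)"

definition reconstruct ::
    "nat \<Rightarrow> real \<Rightarrow> real \<Rightarrow> (nat \<Rightarrow> nat \<times> nat \<Rightarrow> real) \<Rightarrow> real \<times> real \<times> real \<Rightarrow> real" where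
  "reconstruct N dt dx g = (\<lambda>(t, x).
     \<Sum>n<N. \<Sum>\<^sub>\<infinity>j\<in>UNIV. g n j * indicator (cell dx j) x
                        * indicator {real n * dt ..< (real n + 1) * dt} t)"

definition f_rec ::
    "(vel \<Rightarrow> real \<Rightarrow> real) \<Rightarrow> real \<Rightarrow> real \<Rightarrow> (real \<times> real \<Rightarrow> real) \<Rightarrow> (real \<times> real \<Rightarrow> real) \<Rightarrow>
     (real \<times> real \<Rightarrow> real) \<Rightarrow> nat \<Rightarrow> real \<Rightarrow> real \<Rightarrow> vel \<Rightarrow> real \<times> real \<times> real \<Rightarrow> real" where
  "f_rec E \<omega>s \<omega>a u0 uW uS N dt dx i =
     reconstruct N dt dx (\<lambda>n j. lbm E \<omega>s \<omega>a u0 uW uS dt dx n i j)"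

definition u_rec ::
    "(vel \<Rightarrow> real \<Rightarrow> real) \<Rightarrow> real \<Rightarrow> real \<Rightarrow> (real \<times> real \<Rightarrow> real) \<Rightarrow> (real \<times> real \<Rightarrow> real) \<Rightarrow>
     (real \<times> real \<Rightarrow> real) \<Rightarrow> nat \<Rightarrow> real \<Rightarrow> real \<Rightarrow> real \<times> real \<times> real \<Rightarrow> real" where
  "u_rec E \<omega>s \<omega>a u0 uW uS N dt dx =
     reconstruct N dt dx (\<lambda>n j. \<Sum>i\<in>UNIV. lbm E \<omega>s \<omega>a u0 uW uS dt dx n i j)"

section \<open>Norms and the monotonicity condition\<close>

definition LinfL1_norm :: "real \<Rightarrow> (real \<times> real \<times> real \<Rightarrow> real) \<Rightarrow> ennreal" where
  "LinfL1_norm T g = esssup (lebesgue_on {0<..<T})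
     (\<lambda>t. \<integral>\<^sup>+ x. ennreal \<bar>g (t, x)\<bar> \<partial>lebesgue_on quarter)"

text \<open>The same norm for vector-valued functions, with the \<open>l\<^sup>1\<close>-norm over the index set.\<close>

definition LinfL1_norm_vec :: "real \<Rightarrow> (vel \<Rightarrow> real \<times> real \<times> real \<Rightarrow> real) \<Rightarrow> ennreal" where
  "LinfL1_norm_vec T g = LinfL1_norm T (\<lambda>p. \<Sum>i\<in>UNIV. \<bar>g i p\<bar>)"

definition u_inf ::
    "real \<Rightarrow> (real \<times> real \<Rightarrow> real) \<Rightarrow> (real \<times> real \<Rightarrow> real) \<Rightarrow> (real \<times> real \<Rightarrow> real) \<Rightarrow> real" where
  "u_inf T u0 uW uS =
     enn2real (max (Linf_norm quarter u0) (max (Linf_norm (face T) uW) (Linf_norm (face T) uS)))"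

text \<open>For a \<open>C\<^sup>1\<close> flux the supremum is attained.\<close>

definition max_speed :: "(real \<Rightarrow> real) \<Rightarrow> real \<Rightarrow> real" where
  "max_speed \<phi> U = (SUP u\<in>{-U..U}. \<bar>deriv \<phi> u\<bar>)"

definition monotonicity_condition ::
    "real \<Rightarrow> (real \<Rightarrow> real) \<Rightarrow> (real \<Rightarrow> real) \<Rightarrow> real \<Rightarrow> real \<Rightarrow> real \<Rightarrow> real \<Rightarrow> real \<Rightarrow> bool" where
  "monotonicity_condition lam \<phi>x \<phi>y Lx Ly \<omega>s \<omega>a U \<longleftrightarrow>
     \<omega>s * (1 - 2 * Lx - 2 * Ly) \<ge> max 0 (\<omega>s - 1) \<and>
     \<omega>a / 2 * (max_speed \<phi>x U / lam)
       \<le> \<omega>s * Lx + 1 / 2 * Min {2 - \<omega>s - \<omega>a, 0, \<omega>a - \<omega>s} \<and>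
     \<omega>a / 2 * (max_speed \<phi>y U / lam)
       \<le> \<omega>s * Ly + 1 / 2 * Min {2 - \<omega>s - \<omega>a, 0, \<omega>a - \<omega>s}"

end

theory Submission
 imports Defs
begin

text \<open>
 Under the monotonicity condition the relaxation is monotone on the box \<open>K\<close>, conserves the sum and
 fixes the equilibria. Hence it contracts the \<open>l\<^sup>1\<close> distance in every cell, which makes the box
 invariant, bounds the discrete total variation in space and time by that of the averaged data,
 and gives, for the kinetic Kruzhkov entropies \<open>\<bar>f i - E i kp\<bar>\<close>, a discrete entropy inequality with
 boundary terms. Summation by parts against sampled test functions shows that the limit has bounded
 variation, so that its slices near \<open>x = 0\<close> converge to a trace, and turns the discrete entropy
 inequality into the continuous one.

 The boundary term needs only a weak limit. If \<open>S = sgn (uW - kp)\<close> and \<open>h\<close> is the outgoing value of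
 velocity \<open>x-\<close>, then \<open>- \<bar>h - E XM kp\<bar> \<le> - S * (h - E XM kp)\<close>, which is linear in \<open>h\<close>. The numerical
 fluxes through the boundary converge weakly to the flux of the trace, because of the conservation
 law tested with functions that concentrate at \<open>x = 0\<close>.
\<close>

text \<open>The obstacle is the first column of cells. Its measure tends to 0, so convergence in
  \<open>L1\<close> says nothing about the values that leave through \<open>x = 0\<close>, and the
  trace of the limit cannot be read off from them. The discrete inequality is therefore stated for
  any family of 1-Lipschitz functions whose sum does not grow under relaxation, with its boundary
  sums untouched. The identity and its negative both qualify and together give an equality, the
  conservation law.

  The grid is infinite, so sums run over finite blocks of cells. One time step draws on one further
  row and column, and all bounds are independent of the block size. The two boundary data need not
  agree at the origin; this costs at most \<open>2 * U\<close> of variation per step, hence, after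
  scaling by the cell size, a multiple of the final time.

  The core estimates are made for the direction \<open>x\<close>. Reflection in the diagonal maps
  the scheme, the data and the limit to objects of the same kind, which gives the direction
  \<open>y\<close>.\<close>

type_synonym R2 = "real \<times> real"
type_synonym R3 = "real \<times> real \<times> real"

abbreviation (input) Bor :: "('a::topological_space \<Rightarrow> 'b::topological_space) set"
 where "Bor \<equiv> borel_measurable borel"
abbreviation (input) ind :: "'a set \<Rightarrow> 'a \<Rightarrow> 'b::zero_neq_one" where "ind \<equiv> indicator"
abbreviation (input) integ :: "('a::euclidean_space \<Rightarrow> 'b::{banach,second_countable_topology}) \<Rightarrow> bool"
 where "integ \<equiv> integrable lborel"
abbreviation (input) nnI :: "('a::euclidean_space \<Rightarrow> ennreal) \<Rightarrow> ennreal" (binder "NN " 10)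
 where "nnI f \<equiv> integral\<^sup>N lborel f"
abbreviation (input) seq_limit ("(_) ----> (_)" [60, 60] 60) where "X ----> L \<equiv> (X \<longlongrightarrow> L) sequentially"

section \<open>Index sums and the relaxation in one cell\<close>

lemma sum_vel: "(SUM i:(UNIV::vel set). h i) = h Rest + h XP + h XM + h YP + (h YM :: 'a::comm_monoid_add)"
 by (simp add: UNIV_vel add.assoc)

lemma sum_lessThan_shift_down:
 fixes a :: "nat => real"
 assumes "c \<ge> 0" "!!k. a k \<ge> 0"
 shows "(SUM k<J. if k = 0 then c else a (k - 1)) <= c + (SUM k<J. a k)"
proof (cases J)
 case 0
 thus ?thesis using assms by simp
next
 case (Suc m)
 hence "(SUM k<J. if k = 0 then c else a (k - 1)) = c + (SUM k<m. a k)"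
  by (simp add: sum.lessThan_Suc_shift del: sum.lessThan_Suc)
 also have "... <= c + (SUM k<J. a k)" using Suc assms by simp
 finally show ?thesis .
qed

lemma sum_lessThan_shift_up:
 fixes a :: "nat => real"
 assumes "!!k. a k \<ge> 0"
 shows "(SUM k<J. a (Suc k)) <= (SUM k<Suc J. a k)"
 using assms[of 0] by (simp add: sum.lessThan_Suc_shift del: sum.lessThan_Suc)

lemma sum_lessThan_if_zero:
 fixes c :: real and J :: nat
 assumes "c \<ge> 0"
 shows "(SUM k<J. if k = 0 then c else 0) <= c"
 by (cases J) (simp_all add: assms sum.lessThan_Suc_shift del: sum.lessThan_Suc)

lemma sum_add_if_zero:
 fixes P :: "nat => nat => real"
 shows "(SUM k<J. SUM l<L. P k l + (if k = 0 then Q l else 0))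
  = (SUM k<J. SUM l<L. P k l) + (SUM k<J. if k = 0 then (SUM l<L. Q l) else 0)"
 unfolding sum.distrib by (intro arg_cong2[of _ _ _ _ "(+)"] refl sum.cong) auto

lemma sum_swap3:
 "(SUM i:A. SUM j:B. SUM k:C. g i j k) = (SUM j:B. SUM k:C. SUM i:A. (g i j k :: 'a::comm_monoid_add))"
 by (subst sum.swap) (intro sum.cong refl sum.swap)

text \<open>Monotonicity is required only between the equilibria of \<open>- U\<close> and
  \<open>U\<close>, because the monotonicity condition controls the derivatives of the fluxes on
  \<open>[-U, U]\<close> only.\<close>

locale relaxation =
 fixes E :: "vel => real => real" and R :: "(vel => real) => vel => real" and U :: real
 assumes U_nonneg: "0 <= U"
  and E_zero: "E i 0 = 0"
  and E_sum: "(SUM i:UNIV. E i u) = u"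
  and E_mono: "- U <= u ==> u <= v ==> v <= U ==> E i u <= E i v"
  and R_sum: "(SUM i:UNIV. R g i) = (SUM i:UNIV. g i)"
  and R_eq: "R (%i. E i u) = (%i. E i u)"
  and R_mono: "(!!i. E i (- U) <= g i) ==> (!!i. g i <= h i) ==> (!!i. h i <= E i U)
   ==> R g i <= R h i"
begin

definition admissible :: "(vel => real) => bool" where
 "admissible g \<longleftrightarrow> (ALL i. E i (- U) <= g i & g i <= E i U)"

lemma admissible_E: "\<bar>u\<bar> <= U ==> admissible (%i. E i u)"
 unfolding admissible_def using E_mono[of "- U" u] E_mono[of u U] by (auto simp: abs_le_iff)

text \<open>The two corners of the box are equilibria, hence fixed points of \<open>R\<close>, and
  monotonicity traps \<open>R g\<close> between them.\<close>

lemma admissible_R: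
 assumes "admissible g" shows "admissible (R g)"
proof -
 have "R (%i. E i (- U)) i <= R g i" "R g i <= R (%i. E i U) i" for i
  using assms E_mono[of "- U" U] U_nonneg
  by (intro R_mono; auto simp: admissible_def intro: order_trans)+
 thus ?thesis by (simp add: admissible_def R_eq)
qed

lemma admissible_abs_sum:
 assumes "admissible g" shows "\<bar>SUM i:UNIV. g i\<bar> <= U"
proof -
 have "(SUM i:UNIV. E i (- U)) <= (SUM i:UNIV. g i)" "(SUM i:UNIV. g i) <= (SUM i:UNIV. E i U)"
  using assms by (auto simp: admissible_def intro!: sum_mono)
 thus ?thesis by (simp add: E_sum abs_le_iff)
qed

definition bnd :: real where
 "bnd = (SUM i:UNIV. \<bar>E i U\<bar> + \<bar>E i (- U)\<bar>)"

lemma admissible_abs_le: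
 assumes "admissible g" shows "\<bar>g i\<bar> <= bnd"
proof -
 have "\<bar>g i\<bar> <= \<bar>E i U\<bar> + \<bar>E i (- U)\<bar>"
  using assms[unfolded admissible_def, rule_format, of i] by linarith
 also have "... <= bnd"
  unfolding bnd_def by (rule member_le_sum) auto
 finally show ?thesis .
qed

text \<open>The argument of Crandall and Tartar: both images lie between those of the pointwise
  minimum and maximum, and conservation turns the sum of \<open>R ?M i - R ?m i\<close> into that of
  \<open>?M i - ?m i\<close>.\<close>

lemma contraction:
 assumes g: "admissible g" and h: "admissible h"
 shows "(SUM i:UNIV. \<bar>R g i - R h i\<bar>) <= (SUM i:UNIV. \<bar>g i - h i\<bar>)"
proof -
 let ?M = "%i. max (g i) (h i)" and ?m = "%i. min (g i) (h i)"
 have K: "E i (- U) <= g i" "g i <= E i U" "E i (- U) <= h i" "h i <= E i U" for i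
  using g h by (auto simp: admissible_def)
 have "R ?m i <= R g i" "R ?m i <= R h i" "R g i <= R ?M i" "R h i <= R ?M i" for i
  using K by (auto intro!: R_mono simp: le_max_iff_disj min_le_iff_disj)
 hence "(SUM i:UNIV. \<bar>R g i - R h i\<bar>) <= (SUM i:UNIV. R ?M i - R ?m i)"
  by (intro sum_mono) (smt (verit))
 also have "... = (SUM i:UNIV. ?M i - ?m i)"
  by (simp add: sum_subtractf R_sum)
 also have "... = (SUM i:UNIV. \<bar>g i - h i\<bar>)"
  by (intro sum.cong) auto
 finally show ?thesis .
qed

text \<open>All equilibria increase together on \<open>[-U, U]\<close>, so the differences share one
  sign and their sum collapses by \<open>E_sum\<close>.\<close>

lemma E_dist:
 assumes "\<bar>u\<bar> <= U" "\<bar>v\<bar> <= U"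
 shows "(SUM i:UNIV. \<bar>E i u - E i v\<bar>) = \<bar>u - v\<bar>"
 using assms
proof (induction u v rule: linorder_wlog)
 case (le u v)
 hence "(SUM i:UNIV. \<bar>E i u - E i v\<bar>) = (SUM i:UNIV. E i v - E i u)"
  using E_mono[of u v] by (intro sum.cong) (auto simp: abs_le_iff)
 thus ?case using le by (simp add: sum_subtractf E_sum)
qed (simp add: abs_minus_commute)

lemma E_dist_le:
 assumes "\<bar>u\<bar> <= U" "\<bar>v\<bar> <= U"
 shows "\<bar>E i u - E i v\<bar> <= \<bar>u - v\<bar>"
 unfolding E_dist[OF assms, symmetric] by (rule member_le_sum) auto

lemma E_abs_sum: "\<bar>u\<bar> <= U ==> (SUM i:UNIV. \<bar>E i u\<bar>) = \<bar>u\<bar>"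
 using E_dist[of u 0] U_nonneg by (simp add: E_zero)

lemma R_abs_sum:
 assumes "admissible g" shows "(SUM i:UNIV. \<bar>R g i\<bar>) <= (SUM i:UNIV. \<bar>g i\<bar>)"
 using contraction[OF assms admissible_E[of 0]] U_nonneg R_eq[of 0] by (simp add: E_zero)

end

section \<open>The scheme on the quarter plane and its variation\<close>

fun vswap :: "vel => vel" where
 "vswap Rest = Rest"
| "vswap XP = YP"
| "vswap XM = YM"
| "vswap YP = XP"
| "vswap YM = XM"

lemma vswap_vswap [simp]: "vswap (vswap i) = i"
 by (cases i) auto

lemma sum_vswap: "(SUM i:UNIV. h (vswap i)) = (SUM i:UNIV. h i :: real)"
 by (simp add: sum_vel)

text \<open>The averages \<open>A\<close>, \<open>W\<close>, \<open>S\<close> are arbitrary bounded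
  families here; their bounded variation enters only with \<open>bounded_scheme\<close>.\<close>

locale scheme = relaxation +
 fixes A :: "nat \<times> nat => real" and W S :: "nat => nat => real"
  and f :: "nat => vel => nat \<times> nat => real"
 assumes A_bound: "\<bar>A j\<bar> <= U" and W_bound: "\<bar>W n k\<bar> <= U" and S_bound: "\<bar>S n k\<bar> <= U"
  and f_0: "f 0 i j = E i (A j)"
  and f_Suc: "f (Suc n) = transport (%k. E XP (W n k)) (%k. E YP (S n k))
   (%i j. R (%k. f n k j) i)"
begin

definition post :: "nat => vel => nat \<times> nat => real" where
 "post n i j = R (%k. f n k j) i"

definition mass :: "nat => nat \<times> nat => real" where
 "mass n j = (SUM i:UNIV. f n i j)"

lemma f_Suc': "f (Suc n) = transport (%k. E XP (W n k)) (%k. E YP (S n k)) (post n)"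
 by (simp add: f_Suc post_def[abs_def])

lemma admissible_f: "admissible (%i. f n i j)"
proof (induction n arbitrary: j)
 case 0
 thus ?case by (simp add: f_0 admissible_E A_bound)
next
 case (Suc n)
 have post: "E i (- U) <= post n i j" "post n i j <= E i U" for i j
  using admissible_R[OF Suc.IH[of j]] by (auto simp: admissible_def post_def)
 have gh: "E i (- U) <= E i (W n k)" "E i (W n k) <= E i U"
   "E i (- U) <= E i (S n k)" "E i (S n k) <= E i U" for i k
  using admissible_E[OF W_bound[of n k]] admissible_E[OF S_bound[of n k]]
  by (auto simp: admissible_def)
 obtain jx jy where j: "j = (jx, jy)" by fastforce
 show ?case unfolding admissible_def
 proof
  fix i show "E i (- U) <= f (Suc n) i j & f (Suc n) i j <= E i U"
   by (cases i) (simp_all add: j f_Suc' post gh)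
 qed
qed

lemma admissible_post: "admissible (%i. post n i j)"
 unfolding post_def using admissible_R[OF admissible_f, of n j] by simp

lemma post_sum: "(SUM i:UNIV. post n i j) = mass n j"
 by (simp add: post_def mass_def R_sum)

lemma mass_bound: "\<bar>mass n j\<bar> <= U"
 unfolding mass_def by (rule admissible_abs_sum[OF admissible_f])

text \<open>Column 0 is a ghost column at equilibrium with the western datum: it is a fixed point of the
  relaxation, and its outgoing contribution compensates the one entering through the boundary.\<close>

definition ext :: "nat => vel => nat => nat => real" where
 "ext n i jx jy = (case jx of 0 => E i (W n jy) | Suc k => f n i (k, jy))"

definition ext_post :: "nat => vel => nat => nat => real" where
 "ext_post n i jx jy = R (%k. ext n k jx jy) i"

text \<open>The term \<open>jx = 0\<close> is the jump between the ghost column and the first cells,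
  so a mismatch with the western datum counts as variation.\<close>

definition tv_x :: "nat => nat => real" where
 "tv_x n J = (SUM jx<J. SUM jy<J. SUM i:UNIV. \<bar>ext n i (Suc jx) jy - ext n i jx jy\<bar>)"

definition tv_x_post :: "nat => nat => real" where
 "tv_x_post n J = (SUM jx<J. SUM jy<J. SUM i:UNIV. \<bar>ext_post n i (Suc jx) jy - ext_post n i jx jy\<bar>)"

text \<open>The price of one step: the ghost column changes in time, the vertical velocities see the
  variation of both data along the boundary, and \<open>2 * U\<close> pays for the corner
  cell.\<close>

definition tv_err :: "nat => nat => real" where
 "tv_err n J = (SUM k<J. \<bar>W (Suc n) k - W n k\<bar>) + (SUM k<J. \<bar>W n (Suc k) - W n k\<bar>)
   + (SUM k<J. \<bar>S n (Suc k) - S n k\<bar>) + 2 * U"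

lemma ext_simps [simp]: "ext n i 0 jy = E i (W n jy)" "ext n i (Suc k) jy = f n i (k, jy)"
 by (simp_all add: ext_def)

lemma ext_post_simps [simp]:
 "ext_post n i 0 jy = E i (W n jy)" "ext_post n i (Suc k) jy = post n i (k, jy)"
 by (simp_all add: ext_post_def post_def R_eq)

lemma admissible_ext: "admissible (%i. ext n i jx jy)"
 by (cases jx) (simp_all add: admissible_f admissible_E W_bound)

lemma tv_x_post_le: "tv_x_post n J <= tv_x n J"
 unfolding tv_x_def tv_x_post_def ext_post_def
 by (intro sum_mono contraction admissible_ext)


text \<open>Transport shifts the jumps of each velocity by one cell, so away from the boundary it
  only renumbers them. The block grows to \<open>Suc J\<close> because \<open>XM\<close> and
  \<open>YM\<close> bring in values from one column or row outside it.\<close>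

lemma tv_x_step: "tv_x (Suc n) J <= tv_x_post n (Suc J) + tv_err n J"
proof -
 define a where "a i jx jy = \<bar>ext_post n i (Suc jx) jy - ext_post n i jx jy\<bar>" for i jx jy
 define w where "w i k = \<bar>E i (W (Suc n) k) - E i (W n k)\<bar>" for i k
 define z where "z i k = \<bar>E i (W n (Suc k)) - E i (W n k)\<bar>" for i k
 define s where "s i k = \<bar>E i (S n (Suc k)) - E i (S n k)\<bar>" for i k
 define c where "c i jx jy = \<bar>ext (Suc n) i (Suc jx) jy - ext (Suc n) i jx jy\<bar>" for i jx jy
 define AJ where "AJ i = (SUM jx<Suc J. SUM jy<Suc J. a i jx jy)" for i
 have nn: "a i jx jy \<ge> 0" "w i k \<ge> 0" "z i k \<ge> 0" "s i k \<ge> 0" for i jx jy k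
  by (auto simp: a_def w_def z_def s_def)
 have sub: "(SUM jx<m. SUM jy<l. a i jx jy) <= AJ i" if "m <= Suc J" "l <= Suc J" for i m l
  unfolding AJ_def using that nn
  by (intro order_trans[OF sum_mono[OF sum_mono2] sum_mono2] sum_nonneg) auto
 have XP: "(SUM jx<J. SUM jy<J. c XP jx jy) <= AJ XP + (SUM k<J. w XP k)"
 proof -
  have "c XP jx jy = (if jx = 0 then w XP jy else a XP (jx - 1) jy)" for jx jy
  proof (cases jx)
   case (Suc k)
   thus ?thesis by (cases k) (auto simp: c_def a_def f_Suc')
  qed (auto simp: c_def w_def f_Suc' abs_minus_commute)
  hence "(SUM jx<J. SUM jy<J. c XP jx jy)
   = (SUM jx<J. if jx = 0 then (SUM jy<J. w XP jy) else (SUM jy<J. a XP (jx - 1) jy))"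
   by (intro sum.cong) auto
  also have "... <= (SUM jy<J. w XP jy) + (SUM jx<J. SUM jy<J. a XP jx jy)"
   by (rule sum_lessThan_shift_down) (auto intro!: sum_nonneg nn)
  finally show ?thesis using sub[of J J XP] by simp
 qed
 \<comment> \<open>The new first jump is composed of the old jumps \<open>a XM 0\<close> and
   \<open>a XM 1\<close> and a change of the datum. The shifted sum starts at \<open>a XM 1\<close>
   and leaves \<open>a XM 0\<close> free to pay for this.\<close>
 have XM: "(SUM jx<J. SUM jy<J. c XM jx jy) <= AJ XM + (SUM k<J. w XM k)"
 proof -
  have "c XM jx jy <= a XM (Suc jx) jy + (if jx = 0 then w XM jy + a XM 0 jy else 0)" for jx jy
   by (cases jx) (auto simp: c_def w_def a_def f_Suc')
  hence "(SUM jx<J. SUM jy<J. c XM jx jy)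
   <= (SUM jx<J. SUM jy<J. a XM (Suc jx) jy + (if jx = 0 then w XM jy + a XM 0 jy else 0))"
   by (intro sum_mono)
  also have "... = (SUM jx<J. SUM jy<J. a XM (Suc jx) jy)
    + (SUM jx<J. if jx = 0 then (SUM jy<J. w XM jy + a XM 0 jy) else 0)"
   by (rule sum_add_if_zero)
  also have "(SUM jx<J. if jx = 0 then (SUM jy<J. w XM jy + a XM 0 jy) else 0)
    <= (SUM jy<J. w XM jy + a XM 0 jy)"
   by (rule sum_lessThan_if_zero) (auto intro!: sum_nonneg nn add_nonneg_nonneg)
  also have "(SUM jx<J. SUM jy<J. a XM (Suc jx) jy) + (SUM jy<J. w XM jy + a XM 0 jy)
    = (SUM jx<Suc J. SUM jy<J. a XM jx jy) + (SUM jy<J. w XM jy)"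
   by (simp add: sum.lessThan_Suc_shift sum.distrib del: sum.lessThan_Suc)
  finally show ?thesis using sub[of "Suc J" J XM] by simp
 qed
 have R0: "(SUM jx<J. SUM jy<J. c Rest jx jy) <= AJ Rest + (SUM k<J. w Rest k)"
 proof -
  have "c Rest jx jy <= a Rest jx jy + (if jx = 0 then w Rest jy else 0)" for jx jy
   by (cases jx) (auto simp: c_def w_def a_def f_Suc')
  hence "(SUM jx<J. SUM jy<J. c Rest jx jy)
   <= (SUM jx<J. SUM jy<J. a Rest jx jy + (if jx = 0 then w Rest jy else 0))"
   by (intro sum_mono)
  also have "... = (SUM jx<J. SUM jy<J. a Rest jx jy)
    + (SUM jx<J. if jx = 0 then (SUM jy<J. w Rest jy) else 0)"
   by (rule sum_add_if_zero)
  also have "(SUM jx<J. if jx = 0 then (SUM jy<J. w Rest jy) else 0) <= (SUM jy<J. w Rest jy)"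
   by (rule sum_lessThan_if_zero) (auto intro!: sum_nonneg nn)
  finally show ?thesis using sub[of J J Rest] by simp
 qed
 \<comment> \<open>The ghost column does not move vertically, so the interior value coming from row
   \<open>jy + 1\<close> meets the ghost value of row \<open>jy\<close>; \<open>z\<close> is the
   price.\<close>
 have YM: "(SUM jx<J. SUM jy<J. c YM jx jy) <= AJ YM + (SUM k<J. w YM k) + (SUM k<J. z YM k)"
 proof -
  have "c YM jx jy <= a YM jx (Suc jy) + (if jx = 0 then w YM jy + z YM jy else 0)" for jx jy
   by (cases jx) (auto simp: c_def w_def a_def z_def f_Suc')
  hence "(SUM jx<J. SUM jy<J. c YM jx jy)
   <= (SUM jx<J. SUM jy<J. a YM jx (Suc jy) + (if jx = 0 then w YM jy + z YM jy else 0))"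
   by (intro sum_mono)
  also have "... = (SUM jx<J. SUM jy<J. a YM jx (Suc jy))
    + (SUM jx<J. if jx = 0 then (SUM jy<J. w YM jy + z YM jy) else 0)"
   by (rule sum_add_if_zero)
  also have "(SUM jx<J. if jx = 0 then (SUM jy<J. w YM jy + z YM jy) else 0)
    <= (SUM jy<J. w YM jy + z YM jy)"
   by (rule sum_lessThan_if_zero) (auto intro!: sum_nonneg nn add_nonneg_nonneg)
  also have "(SUM jx<J. SUM jy<J. a YM jx (Suc jy)) <= (SUM jx<J. SUM jy<Suc J. a YM jx jy)"
   by (intro sum_mono sum_lessThan_shift_up nn)
  finally show ?thesis using sub[of J "Suc J" YM] by (simp add: sum.distrib)
 qed
 have YP: "(SUM jx<J. SUM jy<J. c YP jx jy)
   <= AJ YP + (SUM k<J. w YP k) + (SUM k<J. z YP k) + (2 * U + (SUM k<J. s YP k))"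
 proof -
  \<comment> \<open>In the corner cell the entering southern value faces the western ghost value,
    and nothing relates the two data there.\<close>
  have corner: "\<bar>E YP (S n 0) - E YP (W (Suc n) 0)\<bar> <= 2 * U"
   using E_dist_le[OF S_bound W_bound, of YP n 0 "Suc n" 0] S_bound[of n 0] W_bound[of "Suc n" 0]
   by linarith
  have "c YP jx jy <= (if jy = 0 then (if jx = 0 then 2 * U else s YP (jx - 1))
    else a YP jx (jy - 1) + (if jx = 0 then w YP jy + z YP (jy - 1) else 0))" for jx jy
   using corner
   by (cases jx; cases jy) (auto simp: c_def w_def a_def z_def s_def f_Suc')
  also have "... jx jy = (if jy = 0 then (if jx = 0 then 2 * U else s YP (jx - 1)) else a YP jx (jy - 1))
    + (if jx = 0 then (if jy = 0 then 0 else w YP jy + z YP (jy - 1)) else 0)" for jx jy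
   by simp
  finally have "(SUM jx<J. SUM jy<J. c YP jx jy)
   <= (SUM jx<J. SUM jy<J. (if jy = 0 then (if jx = 0 then 2 * U else s YP (jx - 1)) else a YP jx (jy - 1))
    + (if jx = 0 then (if jy = 0 then 0 else w YP jy + z YP (jy - 1)) else 0))"
   by (intro sum_mono)
  also have "... = (SUM jx<J. SUM jy<J. if jy = 0 then (if jx = 0 then 2 * U else s YP (jx - 1)) else a YP jx (jy - 1))
    + (SUM jx<J. if jx = 0 then (SUM jy<J. if jy = 0 then 0 else w YP jy + z YP (jy - 1)) else 0)"
   by (rule sum_add_if_zero)
  also have "(SUM jx<J. if jx = 0 then (SUM jy<J. if jy = 0 then 0 else w YP jy + z YP (jy - 1)) else 0)
    <= (SUM jy<J. if jy = 0 then 0 else w YP jy + z YP (jy - 1))"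
   by (rule sum_lessThan_if_zero) (auto intro!: sum_nonneg nn add_nonneg_nonneg)
  also have "(SUM jy<J. if jy = 0 then 0 else w YP jy + z YP (jy - 1))
    <= (SUM jy<J. w YP jy + (if jy = 0 then 0 else z YP (jy - 1)))"
   by (intro sum_mono) (auto simp: nn)
  also have "... <= (SUM jy<J. w YP jy) + (SUM jy<J. z YP jy)"
   using sum_lessThan_shift_down[of 0 "z YP" J] nn by (simp add: sum.distrib)
  also have "(SUM jx<J. SUM jy<J. if jy = 0 then (if jx = 0 then 2 * U else s YP (jx - 1)) else a YP jx (jy - 1))
    <= (SUM jx<J. (if jx = 0 then 2 * U else s YP (jx - 1)) + (SUM jy<J. a YP jx jy))"
   using U_nonneg nn by (intro sum_mono sum_lessThan_shift_down) auto
  also have "... <= (2 * U + (SUM k<J. s YP k)) + (SUM jx<J. SUM jy<J. a YP jx jy)"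
   unfolding sum.distrib using U_nonneg nn by (intro add_right_mono sum_lessThan_shift_down) auto
  finally show ?thesis using sub[of J J YP] by simp
 qed
 have AJsum: "(SUM i:UNIV. AJ i) = tv_x_post n (Suc J)"
  unfolding AJ_def tv_x_post_def a_def by (rule sum_swap3)
 have wsum: "(SUM i:UNIV. SUM k<J. w i k) = (SUM k<J. \<bar>W (Suc n) k - W n k\<bar>)"
  unfolding w_def by (subst sum.swap) (simp add: E_dist W_bound)
 have "(SUM k<J. z YP k) + (SUM k<J. z YM k) <= (SUM i:UNIV. SUM k<J. z i k)"
  using nn by (simp add: sum_vel sum_nonneg)
 also have "... = (SUM k<J. \<bar>W n (Suc k) - W n k\<bar>)"
  unfolding z_def by (subst sum.swap) (simp add: E_dist W_bound)
 finally have zsum: "(SUM k<J. z YP k) + (SUM k<J. z YM k) <= (SUM k<J. \<bar>W n (Suc k) - W n k\<bar>)" .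
 have ssum: "(SUM k<J. s YP k) <= (SUM k<J. \<bar>S n (Suc k) - S n k\<bar>)"
  unfolding s_def by (intro sum_mono E_dist_le S_bound)
 have "tv_x (Suc n) J = (SUM i:UNIV. SUM jx<J. SUM jy<J. c i jx jy)"
  unfolding tv_x_def c_def by (rule sum_swap3[symmetric])
 also have "... <= (SUM i:UNIV. AJ i) + (SUM i:UNIV. SUM k<J. w i k)
   + ((SUM k<J. z YP k) + (SUM k<J. z YM k)) + (2 * U + (SUM k<J. s YP k))"
  using XP XM R0 YM YP by (simp add: sum_vel)
 also have "... <= tv_x_post n (Suc J) + tv_err n J"
  unfolding AJsum wsum tv_err_def using zsum ssum by simp
 finally show ?thesis .
qed


lemma tv_err_mono: "J <= J' ==> tv_err n J <= tv_err n J'"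
 unfolding tv_err_def by (intro add_mono sum_mono2) auto

text \<open>Going back one step enlarges the block by one row and one column, hence
  \<open>J + n\<close> at time 0.\<close>

lemma tv_x_iterate: "tv_x n J <= tv_x 0 (J + n) + (SUM m<n. tv_err m (J + n))"
proof (induction n arbitrary: J)
 case (Suc n)
 have "tv_x (Suc n) J <= tv_x n (Suc J) + tv_err n J"
  using tv_x_step[of n J] tv_x_post_le[of n "Suc J"] by linarith
 also have "... <= tv_x 0 (J + Suc n) + (SUM m<n. tv_err m (J + Suc n)) + tv_err n (J + Suc n)"
  using Suc[of "Suc J"] tv_err_mono[of J "J + Suc n" n] by simp
 finally show ?case by simp
qed simp

lemma mass_x_var_le_tv_x:
 "(SUM jx<J. SUM jy<J. \<bar>mass n (Suc jx, jy) - mass n (jx, jy)\<bar>) <= tv_x n (Suc J)"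
proof -
 have "(SUM jx<J. SUM jy<J. \<bar>mass n (Suc jx, jy) - mass n (jx, jy)\<bar>)
   <= (SUM jx<J. SUM jy<J. SUM i:UNIV. \<bar>ext n i (Suc (Suc jx)) jy - ext n i (Suc jx) jy\<bar>)"
  unfolding mass_def sum_subtractf[symmetric] ext_simps by (intro sum_mono sum_abs)
 also have "... <= (SUM jx<J. SUM jy<Suc J. SUM i:UNIV. \<bar>ext n i (Suc (Suc jx)) jy - ext n i (Suc jx) jy\<bar>)"
  by (intro sum_mono sum_mono2) (auto intro: sum_nonneg)
 also have "... <= tv_x n (Suc J)"
  unfolding tv_x_def by (rule sum_lessThan_shift_up) (intro sum_nonneg abs_ge_zero)
 finally show ?thesis .
qed

definition ext_y_post :: "nat => vel => nat => nat => real" where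
 "ext_y_post n i jx jy = (case jy of 0 => E i (S n jx) | Suc k => post n i (jx, k))"

definition tv_y_post :: "nat => nat => real" where
 "tv_y_post n J = (SUM jx<J. SUM jy<J. SUM i:UNIV. \<bar>ext_y_post n i jx (Suc jy) - ext_y_post n i jx jy\<bar>)"

text \<open>Relaxation conserves the mass, so its change is a sum of transport differences. With
  equilibrium ghost values the first row and column obey the same formula.\<close>

lemma mass_Suc:
 "mass (Suc n) (jx, jy) - mass n (jx, jy)
  = (ext_post n XP jx jy - ext_post n XP (Suc jx) jy)
  + (ext_post n XM (Suc (Suc jx)) jy - ext_post n XM (Suc jx) jy)
  + (ext_y_post n YP jx jy - ext_y_post n YP jx (Suc jy))
  + (ext_y_post n YM jx (Suc (Suc jy)) - ext_y_post n YM jx (Suc jy))"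
proof -
 have "mass n (jx, jy) = (SUM i:UNIV. post n i (jx, jy))" by (simp add: post_sum)
 moreover have "mass (Suc n) (jx, jy) = (SUM i:UNIV. f (Suc n) i (jx, jy))" by (simp add: mass_def)
 ultimately show ?thesis
  by (cases jx; cases jy) (simp_all add: sum_vel f_Suc' ext_y_post_def)
qed

lemma mass_t_var:
 "(SUM jx<J. SUM jy<J. \<bar>mass (Suc n) (jx, jy) - mass n (jx, jy)\<bar>)
  <= tv_x_post n (Suc J) + tv_y_post n (Suc J)"
proof -
 define a where "a i jx jy = \<bar>ext_post n i (Suc jx) jy - ext_post n i jx jy\<bar>" for i jx jy
 define b where "b i jx jy = \<bar>ext_y_post n i jx (Suc jy) - ext_y_post n i jx jy\<bar>" for i jx jy
 have nn: "a i jx jy \<ge> 0" "b i jx jy \<ge> 0" for i jx jy by (auto simp: a_def b_def)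
 have sub: "(SUM jx<m. SUM jy<l. a i jx jy) <= (SUM jx<Suc J. SUM jy<Suc J. a i jx jy)"
   "(SUM jx<m. SUM jy<l. b i jx jy) <= (SUM jx<Suc J. SUM jy<Suc J. b i jx jy)"
  if "m <= Suc J" "l <= Suc J" for i m l
  using that nn by (intro order_trans[OF sum_mono[OF sum_mono2] sum_mono2] sum_nonneg; auto)+
 have "(SUM jx<J. SUM jy<J. \<bar>mass (Suc n) (jx, jy) - mass n (jx, jy)\<bar>)
   <= (SUM jx<J. SUM jy<J. a XP jx jy + a XM (Suc jx) jy + (b YP jx jy + b YM jx (Suc jy)))"
  unfolding mass_Suc a_def b_def by (intro sum_mono) linarith
 also have "... = (SUM jx<J. SUM jy<J. a XP jx jy) + (SUM jx<J. SUM jy<J. a XM (Suc jx) jy)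
   + ((SUM jx<J. SUM jy<J. b YP jx jy) + (SUM jx<J. SUM jy<J. b YM jx (Suc jy)))"
  by (simp add: sum.distrib)
 also have "... <= (SUM i:{XP, XM}. SUM jx<Suc J. SUM jy<Suc J. a i jx jy)
   + (SUM i:{YP, YM}. SUM jx<Suc J. SUM jy<Suc J. b i jx jy)"
 proof -
  have "(SUM jx<J. SUM jy<J. a XM (Suc jx) jy) <= (SUM jx<Suc J. SUM jy<J. a XM jx jy)"
   by (rule sum_lessThan_shift_up) (auto intro!: sum_nonneg nn)
  moreover have "(SUM jx<J. SUM jy<J. b YM jx (Suc jy)) <= (SUM jx<J. SUM jy<Suc J. b YM jx jy)"
   by (intro sum_mono sum_lessThan_shift_up nn)
  ultimately show ?thesis
   using sub(1)[of J J XP] sub(1)[of "Suc J" J XM] sub(2)[of J J YP] sub(2)[of J "Suc J" YM]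
   by (simp del: sum.lessThan_Suc)
 qed
 also have "... <= (SUM i:UNIV. SUM jx<Suc J. SUM jy<Suc J. a i jx jy)
   + (SUM i:UNIV. SUM jx<Suc J. SUM jy<Suc J. b i jx jy)"
  by (intro add_mono sum_mono2) (auto intro!: sum_nonneg nn simp del: sum.lessThan_Suc)
 also have "... = tv_x_post n (Suc J) + tv_y_post n (Suc J)"
  unfolding tv_x_post_def tv_y_post_def a_def b_def by (subst (1 2) sum_swap3) (rule refl)
 finally show ?thesis .
qed

text \<open>Uniform bounds on these sums will give the integrability of the limit over the unbounded
  domain.\<close>

definition l1 :: "nat => nat => real" where
 "l1 n J = (SUM jx<J. SUM jy<J. SUM i:UNIV. \<bar>f n i (jx, jy)\<bar>)"

lemma l1_step: "l1 (Suc n) J <= l1 n (Suc J) + (SUM k<J. \<bar>W n k\<bar>) + (SUM k<J. \<bar>S n k\<bar>)"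
proof -
 define a where "a i jx jy = \<bar>post n i (jx, jy)\<bar>" for i jx jy
 have nn: "a i jx jy \<ge> 0" for i jx jy by (auto simp: a_def)
 have sub: "(SUM jx<m. SUM jy<l. a i jx jy) <= (SUM jx<Suc J. SUM jy<Suc J. a i jx jy)"
  if "m <= Suc J" "l <= Suc J" for i m l
  using that nn by (intro order_trans[OF sum_mono[OF sum_mono2] sum_mono2] sum_nonneg) auto
 have E_le: "\<bar>E i (W n k)\<bar> <= \<bar>W n k\<bar>" "\<bar>E i (S n k)\<bar> <= \<bar>S n k\<bar>" for i k
  using E_dist_le[OF W_bound, of 0 i n k] E_dist_le[OF S_bound, of 0 i n k] U_nonneg
  by (simp_all add: E_zero)
 have XP: "(SUM jx<J. SUM jy<J. \<bar>f (Suc n) XP (jx, jy)\<bar>)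
   <= (SUM jx<Suc J. SUM jy<Suc J. a XP jx jy) + (SUM k<J. \<bar>W n k\<bar>)"
 proof -
  have "(SUM jx<J. SUM jy<J. \<bar>f (Suc n) XP (jx, jy)\<bar>)
    = (SUM jx<J. if jx = 0 then (SUM jy<J. \<bar>E XP (W n jy)\<bar>) else (SUM jy<J. a XP (jx - 1) jy))"
   by (intro sum.cong) (auto simp: f_Suc' a_def)
  also have "... <= (SUM jy<J. \<bar>E XP (W n jy)\<bar>) + (SUM jx<J. SUM jy<J. a XP jx jy)"
   by (rule sum_lessThan_shift_down) (auto intro!: sum_nonneg nn)
  also have "(SUM jy<J. \<bar>E XP (W n jy)\<bar>) <= (SUM k<J. \<bar>W n k\<bar>)"
   by (intro sum_mono E_le)
  finally show ?thesis using sub[of J J XP] by simp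
 qed
 have YP: "(SUM jx<J. SUM jy<J. \<bar>f (Suc n) YP (jx, jy)\<bar>)
   <= (SUM jx<Suc J. SUM jy<Suc J. a YP jx jy) + (SUM k<J. \<bar>S n k\<bar>)"
 proof -
  have "(SUM jx<J. SUM jy<J. \<bar>f (Suc n) YP (jx, jy)\<bar>)
    = (SUM jx<J. SUM jy<J. if jy = 0 then \<bar>E YP (S n jx)\<bar> else a YP jx (jy - 1))"
   by (intro sum.cong) (auto simp: f_Suc' a_def)
  also have "... <= (SUM jx<J. \<bar>E YP (S n jx)\<bar> + (SUM jy<J. a YP jx jy))"
   by (intro sum_mono sum_lessThan_shift_down nn) auto
  also have "... <= (SUM jx<J. \<bar>S n jx\<bar> + (SUM jy<J. a YP jx jy))"
   by (intro sum_mono add_right_mono E_le)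
  finally show ?thesis using sub[of J J YP] by (simp add: sum.distrib)
 qed
 have XM: "(SUM jx<J. SUM jy<J. \<bar>f (Suc n) XM (jx, jy)\<bar>) <= (SUM jx<Suc J. SUM jy<Suc J. a XM jx jy)"
  using sum_lessThan_shift_up[of "%jx. SUM jy<J. a XM jx jy" J] sub[of "Suc J" J XM] nn
  by (simp add: f_Suc' a_def sum_nonneg)
 have "(SUM jx<J. SUM jy<J. a YM jx (Suc jy)) <= (SUM jx<J. SUM jy<Suc J. a YM jx jy)"
  by (intro sum_mono sum_lessThan_shift_up nn)
 hence YM: "(SUM jx<J. SUM jy<J. \<bar>f (Suc n) YM (jx, jy)\<bar>) <= (SUM jx<Suc J. SUM jy<Suc J. a YM jx jy)"
  using sub[of J "Suc J" YM] by (simp add: f_Suc' a_def del: sum.lessThan_Suc)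
 have R0: "(SUM jx<J. SUM jy<J. \<bar>f (Suc n) Rest (jx, jy)\<bar>) <= (SUM jx<Suc J. SUM jy<Suc J. a Rest jx jy)"
  using sub[of J J Rest] by (simp add: f_Suc' a_def)
 have "l1 (Suc n) J = (SUM i:UNIV. SUM jx<J. SUM jy<J. \<bar>f (Suc n) i (jx, jy)\<bar>)"
  unfolding l1_def by (rule sum_swap3[symmetric])
 also have "... <= (SUM i:UNIV. SUM jx<Suc J. SUM jy<Suc J. a i jx jy)
   + (SUM k<J. \<bar>W n k\<bar>) + (SUM k<J. \<bar>S n k\<bar>)"
  using XP XM R0 YM YP unfolding sum_vel by linarith
 also have "(SUM i:UNIV. SUM jx<Suc J. SUM jy<Suc J. a i jx jy)
   = (SUM jx<Suc J. SUM jy<Suc J. SUM i:UNIV. a i jx jy)" by (rule sum_swap3)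
 also have "... <= l1 n (Suc J)"
  unfolding a_def l1_def post_def by (intro sum_mono R_abs_sum admissible_f)
 finally show ?thesis by simp
qed

lemma l1_iterate:
 "l1 n J <= l1 0 (J + n) + (SUM m<n. (SUM k<J + n. \<bar>W m k\<bar>) + (SUM k<J + n. \<bar>S m k\<bar>))"
proof (induction n arbitrary: J)
 case (Suc n)
 have "(SUM k<J. \<bar>W n k\<bar>) <= (SUM k<J + Suc n. \<bar>W n k\<bar>)" "(SUM k<J. \<bar>S n k\<bar>) <= (SUM k<J + Suc n. \<bar>S n k\<bar>)"
  by (intro sum_mono2; auto)+
 thus ?case
  using l1_step[of n J] Suc[of "Suc J"] by (simp del: sum.lessThan_Suc add: sum.lessThan_Suc[of _ n])
qed simp

lemma mass_abs_le_l1: "(SUM jx<J. SUM jy<J. \<bar>mass n (jx, jy)\<bar>) <= l1 n J"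
 unfolding l1_def mass_def by (intro sum_mono sum_abs)

text \<open>Reflection in the diagonal exchanges the velocities by \<open>vswap\<close>, the two
  coordinates, and the roles of \<open>W\<close> and \<open>S\<close>. Every estimate in
  \<open>x\<close> thereby yields one in \<open>y\<close>.\<close>

lemma swapped:
 "scheme (%i. E (vswap i)) (%g i. R (%k. g (vswap k)) (vswap i)) U (%j. A (prod.swap j)) S W
   (%n i j. f n (vswap i) (prod.swap j))"
proof
 show "(%i. R (%k. E (vswap (vswap k)) u) (vswap i)) = (%i. E (vswap i) u)" for u
  by (simp add: R_eq)
 show "(%i j. f (Suc n) (vswap i) (prod.swap j)) =
   transport (%k. E (vswap XP) (S n k)) (%k. E (vswap YP) (W n k))
    (%i j. R (%k. f n (vswap (vswap k)) (prod.swap j)) (vswap i))" for n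
 proof (intro ext)
  fix i and j :: "nat \<times> nat"
  obtain jx jy where "j = (jx, jy)" by fastforce
  thus "f (Suc n) (vswap i) (prod.swap j) =
   transport (%k. E (vswap XP) (S n k)) (%k. E (vswap YP) (W n k))
    (%i j. R (%k. f n (vswap (vswap k)) (prod.swap j)) (vswap i)) i j"
   by (cases i) (simp_all add: f_Suc)
 qed
 show "(SUM i:UNIV. E (vswap i) u) = u" for u
  using sum_vswap[of "%i. E i u"] by (simp add: E_sum)
 show "(SUM i:UNIV. R (%k. g (vswap k)) (vswap i)) = (SUM i:UNIV. g i)" for g
  using sum_vswap[of "R (%k. g (vswap k))"] by (simp add: R_sum sum_vswap)
 show "R (%k. g (vswap k)) (vswap i) <= R (%k. h (vswap k)) (vswap i)"
  if "!!i. E (vswap i) (- U) <= g i" "!!i. g i <= h i" "!!i. h i <= E (vswap i) U" for g h i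
 proof (rule R_mono)
  show "E k (- U) <= g (vswap k)" "g (vswap k) <= h (vswap k)" "h (vswap k) <= E k U" for k
   using that(1)[of "vswap k"] that(2)[of "vswap k"] that(3)[of "vswap k"] by simp_all
 qed
qed (auto simp: U_nonneg E_zero E_mono A_bound W_bound S_bound f_0)

end

text \<open>The factor \<open>h\<close> is the scaling of a total variation: an area
  \<open>h\<^sup>2\<close> times a difference quotient. The time variations stop at
  \<open>N - 1\<close>, since the averages of step \<open>N\<close> would lie beyond the final
  time.\<close>

locale bounded_scheme = scheme +
 fixes h M :: real and N :: nat
 assumes h_pos: "0 < h" and hN: "h * real N <= M"
  and A_var_x: "h * (SUM jx<J. SUM jy<J. \<bar>A (Suc jx, jy) - A (jx, jy)\<bar>) <= M"
  and A_var_y: "h * (SUM jx<J. SUM jy<J. \<bar>A (jx, Suc jy) - A (jx, jy)\<bar>) <= M"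
  and A_west: "h * (SUM k<J. \<bar>A (0, k)\<bar>) <= M"
  and A_south: "h * (SUM k<J. \<bar>A (k, 0)\<bar>) <= M"
  and W_start: "h * (SUM k<J. \<bar>W 0 k\<bar>) <= M"
  and S_start: "h * (SUM k<J. \<bar>S 0 k\<bar>) <= M"
  and W_var_t: "h * (SUM n<N - 1. SUM k<J. \<bar>W (Suc n) k - W n k\<bar>) <= M"
  and S_var_t: "h * (SUM n<N - 1. SUM k<J. \<bar>S (Suc n) k - S n k\<bar>) <= M"
  and W_var: "h * (SUM n<N. SUM k<J. \<bar>W n (Suc k) - W n k\<bar>) <= M"
  and S_var: "h * (SUM n<N. SUM k<J. \<bar>S n (Suc k) - S n k\<bar>) <= M"
  and A_l1: "h\<^sup>2 * (SUM jx<J. SUM jy<J. \<bar>A (jx, jy)\<bar>) <= M"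
  and W_l1: "h\<^sup>2 * (SUM n<N. SUM k<J. \<bar>W n k\<bar>) <= M"
  and S_l1: "h\<^sup>2 * (SUM n<N. SUM k<J. \<bar>S n k\<bar>) <= M"
begin

lemma bounded_swapped:
 "bounded_scheme (%i. E (vswap i)) (%g i. R (%k. g (vswap k)) (vswap i)) U (%j. A (prod.swap j)) S W
   (%n i j. f n (vswap i) (prod.swap j)) h M N"
proof -
 interpret sw: scheme "%i. E (vswap i)" "%g i. R (%k. g (vswap k)) (vswap i)" U
  "%j. A (prod.swap j)" S W "%n i j. f n (vswap i) (prod.swap j)"
  by (rule swapped)
 show ?thesis
 proof
  show "h * (SUM jx<J. SUM jy<J. \<bar>A (prod.swap (Suc jx, jy)) - A (prod.swap (jx, jy))\<bar>) <= M" for J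
   using A_var_y[of J] by (subst sum.swap) simp
  show "h * (SUM jx<J. SUM jy<J. \<bar>A (prod.swap (jx, Suc jy)) - A (prod.swap (jx, jy))\<bar>) <= M" for J
   using A_var_x[of J] by (subst sum.swap) simp
  show "h\<^sup>2 * (SUM jx<J. SUM jy<J. \<bar>A (prod.swap (jx, jy))\<bar>) <= M" for J
   using A_l1[of J] by (subst sum.swap) simp
 qed (simp_all only: prod.swap_def fst_conv snd_conv prod.simps h_pos hN A_west A_south W_start
   S_start W_var_t S_var_t W_var S_var W_l1 S_l1)
qed

text \<open>\<open>3 * M\<close> bounds the initial variation including the ghost column, another
  \<open>3 * M\<close> the variation of the boundary data, and \<open>2 * U * M\<close> the corner
  over all steps, by \<open>hN\<close>.\<close>

definition tv_bound :: real where "tv_bound = (6 + 2 * U) * M"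

lemma tv_x_bound:
 assumes "n < N" shows "h * tv_x n J <= tv_bound"
proof -
 have A0: "h * tv_x 0 J' <= 3 * M" for J'
 proof -
  have "tv_x 0 J' = (SUM jx<J'. SUM jy<J'. \<bar>(case jx of 0 => A (0, jy) - W 0 jy
    | Suc k => A (Suc k, jy) - A (k, jy))\<bar>)"
   unfolding tv_x_def
   by (intro sum.cong refl) (auto simp: f_0 E_dist A_bound W_bound split: nat.split)
  also have "... <= (SUM jx<J'. if jx = 0 then (SUM jy<J'. \<bar>A (0, jy)\<bar> + \<bar>W 0 jy\<bar>)
    else (SUM jy<J'. \<bar>A (Suc (jx - 1), jy) - A (jx - 1, jy)\<bar>))"
   by (intro sum_mono) (auto split: nat.split intro!: sum_mono)
  also have "... <= (SUM jy<J'. \<bar>A (0, jy)\<bar> + \<bar>W 0 jy\<bar>)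
    + (SUM jx<J'. SUM jy<J'. \<bar>A (Suc jx, jy) - A (jx, jy)\<bar>)"
   by (rule sum_lessThan_shift_down) (auto intro!: sum_nonneg)
  finally have "h * tv_x 0 J' <= h * ((SUM jy<J'. \<bar>A (0, jy)\<bar> + \<bar>W 0 jy\<bar>)
    + (SUM jx<J'. SUM jy<J'. \<bar>A (Suc jx, jy) - A (jx, jy)\<bar>))"
   using h_pos by simp
  also have "... <= 3 * M"
   using A_west[of J'] W_start[of J'] A_var_x[of J']
   by (simp add: sum.distrib distrib_left)
  finally show ?thesis .
 qed
 have err: "h * (SUM m<n. tv_err m J') <= 3 * M + 2 * U * M" for J'
 proof -
  have "h * (SUM m<n. SUM k<J'. \<bar>W (Suc m) k - W m k\<bar>) <= h * (SUM m<N - 1. SUM k<J'. \<bar>W (Suc m) k - W m k\<bar>)"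
    "h * (SUM m<n. SUM k<J'. \<bar>W m (Suc k) - W m k\<bar>) <= h * (SUM m<N. SUM k<J'. \<bar>W m (Suc k) - W m k\<bar>)"
    "h * (SUM m<n. SUM k<J'. \<bar>S m (Suc k) - S m k\<bar>) <= h * (SUM m<N. SUM k<J'. \<bar>S m (Suc k) - S m k\<bar>)"
   using h_pos assms by (intro mult_left_mono sum_mono2 sum_nonneg; auto)+
  moreover have "h * (real n * (2 * U)) <= M * (2 * U)"
  proof -
   have "h * real n <= h * real N" using assms h_pos by simp
   hence "h * real n <= M" using hN by linarith
   hence "(h * real n) * (2 * U) <= M * (2 * U)"
    using U_nonneg by (intro mult_right_mono) auto
   thus ?thesis by (simp add: mult.assoc)
  qed
  ultimately show ?thesis
   using W_var_t[of J'] W_var[of J'] S_var[of J']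
   unfolding tv_err_def sum.distrib distrib_left by (simp add: mult_ac)
 qed
 have "h * tv_x n J <= h * (tv_x 0 (J + n) + (SUM m<n. tv_err m (J + n)))"
  using h_pos tv_x_iterate by simp
 also have "... <= tv_bound"
  using A0[of "J + n"] err[of "J + n"] by (simp add: tv_bound_def distrib_left distrib_right)
 finally show ?thesis .
qed

lemma mass_x_var:
 assumes "n < N"
 shows "h * (SUM jx<J. SUM jy<J. \<bar>mass n (Suc jx, jy) - mass n (jx, jy)\<bar>) <= tv_bound"
 using mult_left_mono[OF mass_x_var_le_tv_x[of n J], of h] tv_x_bound[OF assms, of "Suc J"] h_pos
 by linarith

lemma swapped_tv_bound:
 "bounded_scheme.tv_bound U M = tv_bound"
 unfolding bounded_scheme.tv_bound_def[OF bounded_swapped] tv_bound_def by (rule refl)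

lemma swapped_mass:
 "scheme.mass (%n i j. f n (vswap i) (prod.swap j)) n j = mass n (prod.swap j)"
 unfolding scheme.mass_def[OF swapped] mass_def by (rule sum_vswap[of "%i. f n i (prod.swap j)"])

lemma tv_y_post_bound:
 assumes "n < N" shows "h * tv_y_post n J <= tv_bound"
proof -
 interpret sw: bounded_scheme "%i. E (vswap i)" "%g i. R (%k. g (vswap k)) (vswap i)" U
  "%j. A (prod.swap j)" S W "%n i j. f n (vswap i) (prod.swap j)" h M N
  by (rule bounded_swapped)
 have "sw.ext_post n i jy jx = ext_y_post n (vswap i) jx jy" for i jx jy
  by (cases jy) (simp_all add: ext_y_post_def sw.post_def post_def)
 hence "(SUM i:UNIV. \<bar>ext_y_post n i jx (Suc jy) - ext_y_post n i jx jy\<bar>)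
   = (SUM i:UNIV. \<bar>sw.ext_post n i (Suc jy) jx - sw.ext_post n i jy jx\<bar>)" for jx jy
  using sum_vswap[of "%i. \<bar>ext_y_post n i jx (Suc jy) - ext_y_post n i jx jy\<bar>"]
  by (simp del: sw.ext_post_simps)
 hence "tv_y_post n J = sw.tv_x_post n J"
  unfolding tv_y_post_def sw.tv_x_post_def by (subst sum.swap) simp
 hence "h * tv_y_post n J <= h * sw.tv_x n J"
  using sw.tv_x_post_le[of n J] h_pos by simp
 also have "... <= tv_bound" using sw.tv_x_bound[OF assms, of J] swapped_tv_bound by simp
 finally show ?thesis .
qed

lemma mass_t_var_bound:
 assumes "n < N"
 shows "h * (SUM jx<J. SUM jy<J. \<bar>mass (Suc n) (jx, jy) - mass n (jx, jy)\<bar>) <= 2 * tv_bound"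
proof -
 have "h * (SUM jx<J. SUM jy<J. \<bar>mass (Suc n) (jx, jy) - mass n (jx, jy)\<bar>)
   <= h * (tv_x n (Suc J) + tv_y_post n (Suc J))"
  using h_pos mass_t_var[of n J] tv_x_post_le[of n "Suc J"] by (intro mult_left_mono) auto
 thus ?thesis
  using tv_x_bound[OF assms, of "Suc J"] tv_y_post_bound[OF assms, of "Suc J"]
  by (simp add: distrib_left)
qed

lemma mass_l1_bound:
 assumes "n < N" shows "h\<^sup>2 * (SUM jx<J. SUM jy<J. \<bar>mass n (jx, jy)\<bar>) <= 3 * M"
proof -
 let ?L = "%J. SUM m<n. (SUM k<J. \<bar>W m k\<bar>) + (SUM k<J. \<bar>S m k\<bar>)"
 have "h\<^sup>2 * (SUM jx<J. SUM jy<J. \<bar>mass n (jx, jy)\<bar>) <= h\<^sup>2 * (l1 0 (J + n) + ?L (J + n))"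
  using mass_abs_le_l1[of n J] l1_iterate[of n J] by (intro mult_left_mono) auto
 also have "... <= 3 * M"
 proof -
  have "h\<^sup>2 * (SUM m<n. SUM k<J + n. \<bar>W m k\<bar>) <= h\<^sup>2 * (SUM m<N. SUM k<J + n. \<bar>W m k\<bar>)"
    "h\<^sup>2 * (SUM m<n. SUM k<J + n. \<bar>S m k\<bar>) <= h\<^sup>2 * (SUM m<N. SUM k<J + n. \<bar>S m k\<bar>)"
   using assms by (intro mult_left_mono sum_mono2 sum_nonneg; auto)+
  moreover have "l1 0 J' = (SUM jx<J'. SUM jy<J'. \<bar>A (jx, jy)\<bar>)" for J'
   unfolding l1_def by (simp add: f_0 E_abs_sum A_bound)
  ultimately show ?thesis
   using A_l1[of "J + n"] W_l1[of "J + n"] S_l1[of "J + n"]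
   unfolding distrib_left sum.distrib by (simp add: distrib_left)
 qed
 finally show ?thesis .
qed

end

text \<open>Moving the shift from the distribution functions to the weights leaves, at the boundary,
  the entering ghost value minus the value that leaves. Since \<open>jx - 1\<close> is truncated at
  0, the weight difference of \<open>XM\<close> vanishes in the first column, and likewise that of
  \<open>YM\<close> in the first row.\<close>

lemma transport_sum_weights:
 fixes bs :: "vel => nat \<times> nat => real" and gW gS :: "nat => real" and ps :: "nat => nat => real"
 assumes supp: "!!jx jy. Suc jx \<ge> J \<or> Suc jy \<ge> J ==> ps jx jy = 0"
 defines "b' \<equiv> transport gW gS bs"
 shows "(SUM jx<J. SUM jy<J. (SUM i:UNIV. b' i (jx, jy)) * ps jx jy) =
  (SUM jx<J. SUM jy<J. (SUM i:UNIV. bs i (jx, jy)) * ps jx jy)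
  + (SUM jx<J. SUM jy<J. bs XP (jx, jy) * (ps (Suc jx) jy - ps jx jy))
  + (SUM jx<J. SUM jy<J. bs XM (jx, jy) * (ps (jx - 1) jy - ps jx jy))
  + (SUM jx<J. SUM jy<J. bs YP (jx, jy) * (ps jx (Suc jy) - ps jx jy))
  + (SUM jx<J. SUM jy<J. bs YM (jx, jy) * (ps jx (jy - 1) - ps jx jy))
  + (SUM k<J. (gW k - bs XM (0, k)) * ps 0 k) + (SUM k<J. (gS k - bs YM (k, 0)) * ps k 0)"
proof (cases J)
 case (Suc m)
 have P: "(SUM k<J. (if k = 0 then g else d (k - 1)) * p k) = (SUM k<J. d k * p (Suc k)) + g * p 0"
  if "p m = 0" "p (Suc m) = 0" for d p :: "nat => real" and g
  unfolding Suc using that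
  by (subst sum.lessThan_Suc_shift) (simp add: sum.lessThan_Suc[of _ m])
 have Mn: "(SUM k<J. d (Suc k) * p k) = (SUM k<J. d k * p (k - 1)) - d 0 * p 0"
  if "p m = 0" for d p :: "nat => real"
 proof -
  have "(SUM k<J. d k * p (k - 1)) = d 0 * p 0 + (SUM k<m. d (Suc k) * p k)"
   unfolding Suc by (subst sum.lessThan_Suc_shift) simp
  thus ?thesis unfolding Suc using that by simp
 qed
 have s: "ps m jy = 0" "ps (Suc m) jy = 0" "ps jx m = 0" "ps jx (Suc m) = 0" for jx jy
  using supp Suc by auto
 have XP: "(SUM jx<J. SUM jy<J. b' XP (jx, jy) * ps jx jy)
   = (SUM jx<J. SUM jy<J. bs XP (jx, jy) * ps (Suc jx) jy) + (SUM k<J. gW k * ps 0 k)"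
 proof -
  have "(SUM jx<J. SUM jy<J. b' XP (jx, jy) * ps jx jy)
    = (SUM jy<J. SUM jx<J. (if jx = 0 then gW jy else bs XP (jx - 1, jy)) * ps jx jy)"
   by (subst sum.swap) (simp add: b'_def)
  also have "... = (SUM jy<J. (SUM jx<J. bs XP (jx, jy) * ps (Suc jx) jy) + gW jy * ps 0 jy)"
   by (intro sum.cong refl P s)
  also have "... = (SUM jy<J. SUM jx<J. bs XP (jx, jy) * ps (Suc jx) jy) + (SUM k<J. gW k * ps 0 k)"
   by (rule sum.distrib)
  finally show ?thesis by (subst (2) sum.swap) simp
 qed
 have YP: "(SUM jx<J. SUM jy<J. b' YP (jx, jy) * ps jx jy)
   = (SUM jx<J. SUM jy<J. bs YP (jx, jy) * ps jx (Suc jy)) + (SUM k<J. gS k * ps k 0)"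
  unfolding b'_def sum.distrib[symmetric] transport.simps
  by (intro sum.cong refl) (rule P[where d = "%k. bs YP (_, k)"]; rule s)
 have XM: "(SUM jx<J. SUM jy<J. b' XM (jx, jy) * ps jx jy)
   = (SUM jx<J. SUM jy<J. bs XM (jx, jy) * ps (jx - 1) jy) - (SUM k<J. bs XM (0, k) * ps 0 k)"
 proof -
  have "(SUM jx<J. SUM jy<J. b' XM (jx, jy) * ps jx jy)
    = (SUM jy<J. SUM jx<J. bs XM (Suc jx, jy) * ps jx jy)"
   by (subst sum.swap) (simp add: b'_def)
  also have "... = (SUM jy<J. (SUM jx<J. bs XM (jx, jy) * ps (jx - 1) jy) - bs XM (0, jy) * ps 0 jy)"
   by (intro sum.cong refl Mn s)
  also have "... = (SUM jy<J. SUM jx<J. bs XM (jx, jy) * ps (jx - 1) jy) - (SUM k<J. bs XM (0, k) * ps 0 k)"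
   by (rule sum_subtractf)
  finally show ?thesis by (subst (2) sum.swap) simp
 qed
 have YM: "(SUM jx<J. SUM jy<J. b' YM (jx, jy) * ps jx jy)
   = (SUM jx<J. SUM jy<J. bs YM (jx, jy) * ps jx (jy - 1)) - (SUM k<J. bs YM (k, 0) * ps k 0)"
  unfolding b'_def sum_subtractf[symmetric] transport.simps Suc_eq_plus1[symmetric]
  by (intro sum.cong refl) (rule Mn[where d = "%k. bs YM (_, k)"]; rule s)
 have R0: "(SUM jx<J. SUM jy<J. b' Rest (jx, jy) * ps jx jy)
   = (SUM jx<J. SUM jy<J. bs Rest (jx, jy) * ps jx jy)"
  by (simp add: b'_def)
 show ?thesis
  unfolding sum_vel distrib_right sum.distrib XP XM YP YM R0
  by (simp only: right_diff_distrib left_diff_distrib sum_subtractf)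
qed simp

section \<open>Smooth cutoffs\<close>

definition sqpos :: "real => real" where "sqpos z = (max 0 z)\<^sup>2"

lemma sqpos_nonneg: "0 <= sqpos z" by (simp add: sqpos_def)

lemma sqpos_simps: "z <= 0 ==> sqpos z = 0" "0 <= z ==> sqpos z = z\<^sup>2"
 by (auto simp: sqpos_def max_def)

lemma DERIV_sqpos [derivative_intros]:
 assumes "(g has_real_derivative g') (at x)"
 shows "((%x. sqpos (g x)) has_real_derivative 2 * max 0 (g x) * g') (at x)"
proof -
 have "(sqpos has_real_derivative 2 * max 0 z) (at z)" for z
 proof -
  consider "z < 0" | "z = 0" | "z > 0" by linarith
  thus ?thesis
  proof cases
   case 1
   have "((%z. 0) has_real_derivative 0) (at z)" by simp
   thus ?thesis
    using 1 by (subst (asm) DERIV_cong_ev[where g = sqpos and y = z, OF refl _ refl])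
    (auto simp: sqpos_simps intro!: eventually_mono[OF eventually_nhds_in_open[of "{..<0}" z]])
  next
   case 2
   have "((%h. sqpos h / h) \<longlongrightarrow> 0) (at 0)"
   proof (rule Lim_null_comparison)
    show "\<forall>\<^sub>F h in at 0. norm (sqpos h / h) <= \<bar>h\<bar>"
    by (rule always_eventually) (auto simp: sqpos_def max_def power2_eq_square)
    show "((%h. \<bar>h\<bar>) \<longlongrightarrow> 0) (at (0::real))" by (auto intro!: tendsto_eq_intros)
   qed
   thus ?thesis using 2 by (simp add: has_field_derivative_iff sqpos_simps)
  next
   case 3
   have "((%z. z\<^sup>2) has_real_derivative 2 * z) (at z)" by (auto intro!: derivative_eq_intros)
   thus ?thesis
    using 3 by (subst (asm) DERIV_cong_ev[where g = sqpos and y = z, OF refl _ refl])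
    (auto simp: sqpos_simps intro!: eventually_mono[OF eventually_nhds_in_open[of "{0<..}" z]])
  qed
 qed
 from DERIV_chain2[OF this assms] show ?thesis by simp
qed

lemma continuous_on_sqpos [continuous_intros]:
 "continuous_on S g ==> continuous_on S (%x. sqpos (g x))"
 unfolding sqpos_def by (intro continuous_intros)

text \<open>Nesting two truncated squares gives a \<open>C1\<close> step: the inner one flattens it
  at 1, the outer one at 0.\<close>

definition step01 :: "real => real" where "step01 z = sqpos (1 - sqpos (1 - z))"
definition step01' :: "real => real" where "step01' z = 4 * max 0 (1 - sqpos (1 - z)) * max 0 (1 - z)"

lemma DERIV_step01 [derivative_intros]:
 assumes "(g has_real_derivative g') (at x)"
 shows "((%x. step01 (g x)) has_real_derivative step01' (g x) * g') (at x)"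
 unfolding step01_def step01'_def
 by (rule derivative_eq_intros assms refl)+ simp

lemma step01_props:
 "z <= 0 ==> step01 z = 0" "1 <= z ==> step01 z = 1" "0 <= step01 z" "step01 z <= 1"
proof -
 show "z <= 0 ==> step01 z = 0"
  using one_le_power[of "1 - z" 2] by (simp add: step01_def sqpos_def)
 show "1 <= z ==> step01 z = 1" by (simp add: step01_def sqpos_def)
 show "0 <= step01 z" by (simp add: step01_def sqpos_nonneg)
 have "0 <= max 0 (1 - sqpos (1 - z))" "max 0 (1 - sqpos (1 - z)) <= 1" by (auto simp: sqpos_nonneg)
 thus "step01 z <= 1" unfolding step01_def sqpos_def[of "1 - sqpos _"] by (simp add: power_le_one)
qed

lemma continuous_on_step01' [continuous_intros]:
 "continuous_on S g ==> continuous_on S (%x. step01' (g x))"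
 unfolding step01'_def by (intro continuous_intros)

lemma continuous_on_step01 [continuous_intros]:
 "continuous_on S g ==> continuous_on S (%x. step01 (g x))"
 unfolding step01_def by (intro continuous_intros)

text \<open>The shift by \<open>- 1\<close> keeps the support inside
  \<open>[a + 1 / k, b - 1 / k]\<close>, compactly inside the open interval. As \<open>k\<close>
  grows, the bump tends to the indicator of \<open>{a<..<b}\<close>.\<close>

definition bump :: "real => real => real => real => real" where
 "bump k a b x = step01 (k * (x - a) - 1) * step01 (k * (b - x) - 1)"
definition bump' :: "real => real => real => real => real" where
 "bump' k a b x = k * step01' (k * (x - a) - 1) * step01 (k * (b - x) - 1)
   - k * step01 (k * (x - a) - 1) * step01' (k * (b - x) - 1)"

lemma DERIV_bump: "(bump k a b has_real_derivative bump' k a b x) (at x)"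
 unfolding bump_def[abs_def] bump'_def
 by (rule derivative_eq_intros refl)+ (simp add: algebra_simps)

lemma continuous_on_bump [continuous_intros]:
 "continuous_on S g ==> continuous_on S (%x. bump k a b (g x))"
 "continuous_on S g ==> continuous_on S (%x. bump' k a b (g x))"
 unfolding bump_def bump'_def by (intro continuous_intros; assumption)+

lemma bump_bounds: "0 <= bump k a b x" "bump k a b x <= 1"
 unfolding bump_def using step01_props(3,4) by (auto intro!: mult_le_one mult_nonneg_nonneg)

lemma bump_eq_0:
 assumes "k > 0" "x <= a + 1 / k \<or> b - 1 / k <= x" shows "bump k a b x = 0"
proof -
 have "k * (x - a) - 1 <= 0 \<or> k * (b - x) - 1 <= 0"
  using assms by (auto simp: field_simps)
 thus ?thesis by (auto simp: bump_def step01_props(1))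
qed

lemma bump_tendsto:
 assumes "!!n. kp n > 0" "filterlim kp at_top sequentially"
 shows "(%n. bump (kp n) a b x) ----> ind {a<..<b} x"
proof (cases "a < x & x < b")
 case True
 have "\<forall>\<^sub>F n in sequentially. kp n \<ge> 2 / (x - a) & kp n \<ge> 2 / (b - x)"
  using assms(2) by (simp add: filterlim_at_top eventually_conj)
 hence "\<forall>\<^sub>F n in sequentially. bump (kp n) a b x = 1"
 proof eventually_elim
  case (elim n)
  hence "kp n * (x - a) \<ge> 2" "kp n * (b - x) \<ge> 2" using True by (auto simp: field_simps)
  thus ?case by (simp add: bump_def step01_props(2))
 qed
 thus ?thesis using True by (auto intro: tendsto_eventually)
next
 case False
 have "1 / kp n > 0" for n using assms(1) by simp
 with False have "bump (kp n) a b x = 0" for n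
  by (intro bump_eq_0 assms) (smt (verit, best) assms(1) divide_pos_pos)
 thus ?thesis using False by simp
qed

text \<open>A \<open>C\<^sup>1\<close> approximation \<open>ramp k h\<close> of \<open>x \<mapsto> min (max 0 x) h\<close>.\<close>

definition clampk :: "real => real => real" where
 "clampk k x = k * (max 0 x - max 0 (x - 1 / k))"
definition ramp0 :: "real => real => real" where
 "ramp0 k x = k / 2 * (sqpos x - sqpos (x - 1 / k))"
definition ramp :: "real => real => real => real" where
 "ramp k h x = ramp0 k (x - 1 / k) - ramp0 k (x - h + 2 / k)"
definition ramp' :: "real => real => real => real" where
 "ramp' k h x = clampk k (x - 1 / k) - clampk k (x - h + 2 / k)"

lemma clampk_cases:
 assumes "k > 0"
 shows "clampk k x = (if x <= 0 then 0 else if x <= 1 / k then k * x else 1)"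
proof (cases "x <= 0")
 case True
 hence "x - 1 / k <= 0" using divide_pos_pos[of 1 k] assms by linarith
 thus ?thesis using True by (simp add: clampk_def)
next
 case False
 thus ?thesis using assms by (auto simp: clampk_def max_def field_simps)
qed

lemma clampk_bounds: "k > 0 ==> 0 <= clampk k x" "k > 0 ==> clampk k x <= 1"
 by (auto simp: clampk_cases field_simps)

lemma clampk_mono:
 assumes "k > 0" "x <= y" shows "clampk k x <= clampk k y"
proof -
 have "clampk k z = min 1 (max 0 (k * z))" for z
  using assms(1) zero_less_mult_iff[of k z] by (auto simp: clampk_cases field_simps)
 moreover have "k * x <= k * y" using assms by simp
 ultimately show ?thesis by auto
qed

lemma DERIV_ramp: "(ramp k h has_real_derivative ramp' k h x) (at x)"
 unfolding ramp_def[abs_def] ramp0_def ramp'_def clampk_def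
 by (rule derivative_eq_intros refl)+ (simp add: algebra_simps)

lemma continuous_on_ramp [continuous_intros]:
 "continuous_on S g ==> continuous_on S (%x. ramp k h (g x))"
 "continuous_on S g ==> continuous_on S (%x. ramp' k h (g x))"
 unfolding ramp_def ramp'_def ramp0_def clampk_def by (intro continuous_intros; assumption)+

lemma ramp'_bounds:
 assumes "k > 0" "4 / k <= h"
 shows "0 <= ramp' k h x" "ramp' k h x <= 1"
proof -
 have "x - h + 2 / k <= x - 1 / k"
  using assms by (simp add: field_simps)
 from clampk_mono[OF assms(1) this] show "0 <= ramp' k h x" by (simp add: ramp'_def)
 show "ramp' k h x <= 1"
  using clampk_bounds[OF assms(1), of "x - 1 / k"] clampk_bounds[OF assms(1), of "x - h + 2 / k"]
  by (simp add: ramp'_def)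
qed

lemma ramp'_tendsto:
 assumes "!!n. kp n > 0" "filterlim kp at_top sequentially" "h > 0"
 shows "(%n. ramp' (kp n) h x) ----> ind {0<..<h} x"
proof (cases "0 < x & x < h")
 case True
 have "\<forall>\<^sub>F n in sequentially. kp n \<ge> 3 / x & kp n \<ge> 3 / (h - x)"
  using assms(2) by (simp add: filterlim_at_top eventually_conj)
 hence "\<forall>\<^sub>F n in sequentially. ramp' (kp n) h x = 1"
 proof eventually_elim
  case (elim n)
  hence "2 / kp n < x" "x - h + 2 / kp n <= 0" 
   using True assms(1)[of n] by (auto simp: field_simps)
  moreover have "2 / kp n = 1 / kp n + 1 / kp n" "1 / kp n > 0" using assms(1)[of n] by auto
  ultimately have "\<not> x - 1 / kp n <= 1 / kp n" "\<not> x - 1 / kp n <= 0" "x - h + 2 / kp n <= 0"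
   by linarith+
  thus ?case using assms(1)[of n] unfolding ramp'_def clampk_cases[OF assms(1)] by simp
 qed
 thus ?thesis using True by (auto intro: tendsto_eventually)
next
 case False
 have "\<forall>\<^sub>F n in sequentially. kp n \<ge> 4 / h"
  using assms(2) by (simp add: filterlim_at_top eventually_conj)
 hence "\<forall>\<^sub>F n in sequentially. ramp' (kp n) h x = 0"
 proof eventually_elim
  case (elim n)
  have k: "kp n > 0" "4 / kp n <= h" using elim assms(1)[of n] assms(3) by (auto simp: field_simps)
  show ?case
  proof (cases "x <= 0")
   case True
   have "2 / kp n <= 4 / kp n" "1 / kp n > 0" using k by (auto simp: field_simps)
   hence "x - 1 / kp n <= 0" "x - h + 2 / kp n <= 0" using True k by linarith+
   thus ?thesis unfolding ramp'_def clampk_cases[OF k(1)] by simp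
  next
   case F: False
   hence x: "x \<ge> h" using False by auto
   have "2 / kp n = 1 / kp n + 1 / kp n" "4 / kp n = 2 / kp n + 2 / kp n" "1 / kp n > 0"
    using k by (auto simp: field_simps)
   hence "\<not> x - 1 / kp n <= 1 / kp n" "\<not> x - h + 2 / kp n <= 1 / kp n"
    "\<not> x - 1 / kp n <= 0" "\<not> x - h + 2 / kp n <= 0"
    using x k by linarith+
   thus ?thesis unfolding ramp'_def clampk_cases[OF k(1)] by simp
  qed
 qed
 thus ?thesis using False by (auto intro: tendsto_eventually)
qed

lemma ramp_eq_0:
 assumes "k > 0" "4 / k <= h" "x <= 1 / k" shows "ramp k h x = 0"
proof -
 have "2 / k = 1 / k + 1 / k" "4 / k = 2 / k + 2 / k" "1 / k > 0"
  using assms by (auto simp: field_simps)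
 hence "x - 1 / k <= 0" "x - 1 / k - 1 / k <= 0" "x - h + 2 / k <= 0" "x - h + 2 / k - 1 / k <= 0"
  using assms by linarith+
 thus ?thesis by (simp only: ramp_def ramp0_def sqpos_simps)
qed

text \<open>Beyond its smoothed corner each \<open>ramp0\<close> has slope 1, so the difference of
  the two translates is the distance \<open>h - 3 / k\<close> of the translations.\<close>

lemma ramp_const:
 assumes "k > 0" "4 / k <= h" "h - 1 / k <= x" shows "ramp k h x = h - 3 / k"
proof -
 have "ramp0 k z = z - 1 / (2 * k)" if "1 / k <= z" for z
 proof -
  have "0 <= z" "0 <= z - 1 / k" using that divide_pos_pos[of 1 k] assms(1) by linarith+
  hence "ramp0 k z = k / 2 * (z\<^sup>2 - (z - 1 / k)\<^sup>2)" by (simp add: ramp0_def sqpos_simps(2))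
  also have "... = z - 1 / (2 * k)" using assms(1) by (simp add: power2_eq_square field_simps)
  finally show ?thesis .
 qed
 moreover have e: "2 / k = 1 / k + 1 / k" "3 / k = 2 / k + 1 / k" "4 / k = 2 / k + 2 / k" "1 / k > 0"
  using assms by (auto simp: field_simps)
 moreover have "1 / k <= x - 1 / k" "1 / k <= x - h + 2 / k"
  using assms e by linarith+
 ultimately show ?thesis unfolding ramp_def by simp
qed

lemma ramp_mono:
 assumes "k > 0" "4 / k <= h" "x <= y" shows "ramp k h x <= ramp k h y"
 using DERIV_nonneg_imp_nondecreasing[OF assms(3)] DERIV_ramp ramp'_bounds(1)[OF assms(1,2)] by blast

lemma ramp_bounds:
 assumes "k > 0" "4 / k <= h" shows "0 <= ramp k h x" "ramp k h x <= h"
proof -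
 have "ramp k h (min x 0) = 0" using assms by (intro ramp_eq_0) (auto intro: order_trans[of _ 0])
 thus "0 <= ramp k h x" using ramp_mono[OF assms, of "min x 0" x] by simp
 have "h - 1 / k <= max x h" using divide_pos_pos[of 1 k] assms by linarith
 hence "ramp k h (max x h) = h - 3 / k" using assms by (intro ramp_const)
 moreover have "3 / k > 0" using assms by simp
 ultimately show "ramp k h x <= h" using ramp_mono[OF assms, of x "max x h"] by linarith
qed

section \<open>Discrete variation of BV data\<close>

definition C1_test :: "(R2) set => (R2 => real) => (R2 => real) =>
  (R2 => real) => bool" where
 "C1_test K ps ps1 ps2 \<longleftrightarrow> compact K & (ALL p. p \<notin> K --> ps p = 0) & (ALL p. \<bar>ps p\<bar> <= 1) &
   continuous_on UNIV ps1 & continuous_on UNIV ps2 &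
   (ALL p. (ps has_derivative (%v. fst v * ps1 p + snd v * ps2 p)) (at p))"

lemma Basis_real2: "(Basis :: (R2) set) = {(1, 0), (0, 1)}"
 by (auto simp: Basis_prod_def)

text \<open>Multiplying \<open>ps\<close> by \<open>(1, 0)\<close>, \<open>(-1, 0)\<close>,
  \<open>(0, 1)\<close> and \<open>(0, -1)\<close> gives test fields that isolate each partial
  derivative with either sign.\<close>

lemma BV_C1_test:
 fixes u :: "R2 => real"
 assumes "BV Om u" "open Om"
 obtains M where "!!K ps ps1 ps2. C1_test K ps ps1 ps2 ==> K \<subseteq> Om ==>
   \<bar>LINT p|lebesgue_on Om. u p * ps1 p\<bar> <= M & \<bar>LINT p|lebesgue_on Om. u p * ps2 p\<bar> <= M"
proof -
 from assms(1) obtain M where M: "!!\<Phi>. C1_on Om \<Phi> ==> compact_support_in Om \<Phi> ==>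
   (!!p. p : Om ==> norm (\<Phi> p) <= 1) ==> (LINT p|lebesgue_on Om. u p * divergence Om \<Phi> p) <= M"
  unfolding BV_def by blast
 have *: "(LINT p|lebesgue_on Om. u p * (fst w * ps1 p + snd w * ps2 p)) <= M"
  if T: "C1_test K ps ps1 ps2" "K \<subseteq> Om" and w: "norm w <= 1" for K ps ps1 ps2 and w :: "R2"
 proof -
  let ?\<Phi> = "%p. ps p *\<^sub>R w"
  have d: "(ps has_derivative (%v. fst v * ps1 p + snd v * ps2 p)) (at p)" for p
   using T unfolding C1_test_def by blast
  have D: "(?\<Phi> has_derivative (%v. (fst v * ps1 p + snd v * ps2 p) *\<^sub>R w)) (at p within Om)" for p
   using has_derivative_at_withinI[OF has_derivative_scaleR_left[OF d]] by blast
  have P: "partial Om b ?\<Phi> p = (fst b * ps1 p + snd b * ps2 p) *\<^sub>R w" if "p : Om" for b p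
   unfolding partial_def using frechet_derivative_at[symmetric, OF has_derivative_scaleR_left[OF d, of w p]]
    at_within_open[OF that assms(2)] by simp
  have "C1_on Om ?\<Phi>"
   unfolding C1_on_def
  proof (intro conjI ballI)
   show "?\<Phi> differentiable at p within Om" for p using D[of p] unfolding differentiable_def by blast
   have "continuous_on Om ps1" "continuous_on Om ps2"
    using T by (auto simp: C1_test_def intro: continuous_on_subset)
   hence "continuous_on Om (%p. (fst b * ps1 p + snd b * ps2 p) *\<^sub>R w)" for b :: "R2"
    by (intro continuous_intros)
   thus "continuous_on Om (partial Om b ?\<Phi>)" for b
    using P by (simp cong: continuous_on_cong)
  qed
  moreover have "compact_support_in Om ?\<Phi>"
   unfolding compact_support_in_def using T by (auto simp: C1_test_def intro!: exI[of _ K])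
  moreover have "norm (?\<Phi> p) <= 1" for p
  proof -
   have "\<bar>ps p\<bar> <= 1" using T unfolding C1_test_def by blast
   thus ?thesis using w by (auto intro!: mult_le_one)
  qed
  ultimately have "(LINT p|lebesgue_on Om. u p * divergence Om ?\<Phi> p) <= M" by (rule M)
  moreover have "divergence Om ?\<Phi> p = fst w * ps1 p + snd w * ps2 p" if "p : Om" for p
   unfolding divergence_def Basis_real2 using P[OF that] by (simp add: inner_prod_def)
  hence "(LINT p|lebesgue_on Om. u p * divergence Om ?\<Phi> p)
    = (LINT p|lebesgue_on Om. u p * (fst w * ps1 p + snd w * ps2 p))"
   by (intro Bochner_Integration.integral_cong) auto
  ultimately show ?thesis by simp
 qed
 show ?thesis
 proof (rule that[of M])
  fix K ps ps1 ps2 assume T: "C1_test K ps ps1 ps2" "K \<subseteq> Om"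
  show "\<bar>LINT p|lebesgue_on Om. u p * ps1 p\<bar> <= M & \<bar>LINT p|lebesgue_on Om. u p * ps2 p\<bar> <= M"
   using *[OF T, of "(1, 0)"] *[OF T, of "(-1, 0)"] *[OF T, of "(0, 1)"] *[OF T, of "(0, -1)"]
   by (auto simp: norm_prod_def abs_le_iff)
 qed
qed

lemma borel_measurable_fst' [measurable (raw)]:
 fixes f :: "'c => 'a::second_countable_topology \<times> 'b::second_countable_topology"
 shows "f : borel_measurable M ==> (%x. fst (f x)) : borel_measurable M"
proof -
 have "(fst :: 'a \<times> 'b => _) : Bor"
  by (intro borel_measurable_continuous_onI continuous_on_fst continuous_on_id)
 thus "f : borel_measurable M ==> (%x. fst (f x)) : borel_measurable M"
  using measurable_compose by blast
qed

lemma borel_measurable_snd' [measurable (raw)]: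
 fixes f :: "'c => 'a::second_countable_topology \<times> 'b::second_countable_topology"
 shows "f : borel_measurable M ==> (%x. snd (f x)) : borel_measurable M"
proof -
 have "(snd :: 'a \<times> 'b => _) : Bor"
  by (intro borel_measurable_continuous_onI continuous_on_snd continuous_on_id)
 thus "f : borel_measurable M ==> (%x. snd (f x)) : borel_measurable M"
  using measurable_compose by blast
qed

text \<open>This bounds the mass of the distributional derivative in the first variable. The second
  variable is reached by swapping the coordinates.\<close>

definition var_bound :: "(R2) set => (R2 => real) => real => bool" where
 "var_bound Om u M \<longleftrightarrow> (\<forall>K ps ps1 ps2. C1_test K ps ps1 ps2 & K \<subseteq> Om
   --> \<bar>LBINT p. u p * ps1 p\<bar> <= M)"

text \<open>Written with translates of fixed indicators, which are the limits of the translates of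
  \<open>ramp'\<close> and \<open>bump\<close>.\<close>

definition cell_int :: "(R2 => real) => real => real => nat => nat => real" where
 "cell_int u h1 h2 i j = (LBINT p. u p *
   (ind {0<..<h1} (fst p - real i * h1) * ind {0<..<h2} (snd p - real j * h2)))"

lemma sum_bump_le_1:
 assumes "k > 0" "h > 0"
 shows "(SUM j<l. bump k 0 h (y - real j * h)) <= (if y < real l * h then 1 else 0)"
proof (induction l)
 case 0
 thus ?case by simp
next
 case (Suc l)
 have e: "1 / k > 0" using assms by simp
 consider "y < real l * h" | "real l * h <= y" "y < real (Suc l) * h" | "real (Suc l) * h <= y"
  by linarith
 thus ?case
 proof cases
  case 1
  have "y - real l * h <= 0 + 1 / k" using 1 e by linarith
  hence "bump k 0 h (y - real l * h) = 0" by (intro bump_eq_0 assms disjI1)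
  thus ?thesis using Suc 1 assms by (auto simp: distrib_right)
 next
  case 2
  thus ?thesis using Suc bump_bounds(2)[of k 0 h "y - real l * h"] by simp
 next
  case 3
  have "real (Suc l) * h = real l * h + h" by (simp add: distrib_right)
  hence "h - 1 / k <= y - real l * h" using 3 e by linarith
  hence "bump k 0 h (y - real l * h) = 0" by (intro bump_eq_0 assms disjI2)
  moreover have "\<not> y < real l * h" using 3 assms by (simp add: distrib_right)
  ultimately show ?thesis using Suc 3 by auto
 qed
qed

lemma has_derivative_prod_fst_snd:
 assumes "(a has_real_derivative a') (at (fst p))" "(b has_real_derivative b') (at (snd p))"
 shows "((%p. a (fst p) * b (snd p)) has_derivative
   (%v. fst v * (a' * b (snd p)) + snd v * (a (fst p) * b'))) (at p)"
proof -
 have "((%p. a (fst p)) has_derivative (%v. a' * fst v)) (at p)"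
  using has_derivative_compose[OF has_derivative_fst[OF has_derivative_ident], of a "(*) a'" p UNIV] assms(1)
  by (simp add: has_field_derivative_def)
 moreover have "((%p. b (snd p)) has_derivative (%v. b' * snd v)) (at p)"
  using has_derivative_compose[OF has_derivative_snd[OF has_derivative_ident], of b "(*) b'" p UNIV] assms(2)
  by (simp add: has_field_derivative_def)
 ultimately show ?thesis
  by (rule has_derivative_eq_rhs[OF has_derivative_mult]) (auto simp: algebra_simps)
qed

lemma DERIV_translate:
 "(f has_real_derivative f') (at (x - c)) ==> ((%x. f (x - c)) has_real_derivative f') (at x)"
proof -
 have "((%x. x - c) has_real_derivative 1) (at x)" by (auto intro!: derivative_eq_intros)
 thus "(f has_real_derivative f') (at (x - c)) ==> ((%x. f (x - c)) has_real_derivative f') (at x)"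
  using DERIV_chain2[of f f' "%x. x - c" x 1] by simp
qed

text \<open>The sum of the jumps is the integral of \<open>u\<close> against the
  \<open>x\<close>-derivative of one test function: on each pair of neighbouring cells a hat, the
  difference of two translated ramps, carries the sign of the jump. The hats have height at most
  \<open>h1\<close>, whence the factor on the right.\<close>

lemma discrete_var:
 assumes var: "var_bound Om u M" and u: "integ u" and h: "h1 > 0" "h2 > 0"
  and sub: "{0<..<real (Suc m) * h1} \<times> {0<..<real l * h2} \<subseteq> Om"
 shows "(SUM i<m. SUM j<l. \<bar>cell_int u h1 h2 (Suc i) j - cell_int u h1 h2 i j\<bar>) <= h1 * M"
proof -
 define s where "s i j = sgn (cell_int u h1 h2 i j - cell_int u h1 h2 (Suc i) j)" for i j
 \<comment> \<open>The summand \<open>4 / h1\<close> ensures \<open>4 / kp n <= h1\<close>, which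
   leaves room for both smoothed corners of the ramp.\<close>
 define kp where "kp n = real n + 1 + 4 / h1" for n
 have kpos: "kp n > 0" for n unfolding kp_def using h by (simp add: add_pos_pos)
 have k4: "4 / kp n <= h1" for n
  using h kpos[of n] unfolding kp_def by (simp add: field_simps)
 have klim: "filterlim kp at_top sequentially"
  unfolding kp_def using filterlim_tendsto_add_at_top[OF tendsto_const[of "1 + 4 / h1"] filterlim_real_sequentially]
  by (simp add: add_ac)
 define a where "a n i x = ramp (kp n) h1 (x - real i * h1) - ramp (kp n) h1 (x - real (Suc i) * h1)" for n i x
 define a' where "a' n i x = ramp' (kp n) h1 (x - real i * h1) - ramp' (kp n) h1 (x - real (Suc i) * h1)" for n i x
 define b where "b n j y = bump (kp n) 0 h2 (y - real j * h2)" for n j y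
 define b' where "b' n j y = bump' (kp n) 0 h2 (y - real j * h2)" for n j y
 have da: "(a n i has_real_derivative a' n i x) (at x)" for n i x
  unfolding a_def[abs_def] a'_def
  by (intro DERIV_diff DERIV_translate DERIV_ramp)
 have db: "(b n j has_real_derivative b' n j y) (at y)" for n j y
  unfolding b_def[abs_def] b'_def
  by (intro DERIV_translate DERIV_bump)
 have a_nonneg: "0 <= a n i x" for n i x
  unfolding a_def using ramp_mono[OF kpos k4] h by (simp add: algebra_simps)
 \<comment> \<open>Neighbouring hats overlap, but their sum telescopes to the difference of two
   ramps, so after division by \<open>h1\<close> the test function stays within
   \<open>[-1, 1]\<close>.\<close>
 have a_sum: "(SUM i<m. a n i x) <= h1" for n x
  unfolding a_def sum_lessThan_telescope'[where f = "%i. ramp (kp n) h1 (x - real i * h1)"]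
  using ramp_bounds[OF kpos k4, of n x] 
   ramp_bounds[OF kpos k4, of n "x - real m * h1"] by simp
 have b_nonneg: "0 <= b n j y" for n j y by (simp add: b_def bump_bounds)
 have b_sum: "(SUM j<l. b n j y) <= 1" for n y
  unfolding b_def using sum_bump_le_1[OF kpos h(2), of n y l] by (auto split: if_splits)
 define ps where "ps n p = (1 / h1) * (SUM i<m. SUM j<l. s i j * (a n i (fst p) * b n j (snd p)))" for n p
 define ps1 where "ps1 n p = (1 / h1) * (SUM i<m. SUM j<l. s i j * (a' n i (fst p) * b n j (snd p)))" for n p
 define ps2 where "ps2 n p = (1 / h1) * (SUM i<m. SUM j<l. s i j * (a n i (fst p) * b' n j (snd p)))" for n p
 define K where "K n = cbox (1 / kp n, 1 / kp n) (real (Suc m) * h1 - 1 / kp n, real l * h2 - 1 / kp n)" for n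
 have s1: "\<bar>s i j\<bar> <= 1" for i j by (simp add: s_def sgn_if)
 have test: "C1_test (K n) (ps n) (ps1 n) (ps2 n)" for n
  unfolding C1_test_def
 proof (intro conjI allI impI)
  show "compact (K n)" by (simp add: K_def)
  have e: "1 / kp n > 0" using kpos[of n] by simp
  fix p
  show "ps n p = 0" if "p \<notin> K n"
  proof -
   obtain x y where p: "p = (x, y)" by fastforce
   from that consider "x < 1 / kp n" | "real (Suc m) * h1 - 1 / kp n < x" | "y < 1 / kp n"
    | "real l * h2 - 1 / kp n < y" unfolding K_def p by (auto simp: cbox_Pair_eq not_le)
   hence "a n i x * b n j y = 0" if "i < m" "j < l" for i j
   proof cases
    case 1
    have "0 <= real i * h1" "0 <= real (Suc i) * h1" using h by auto
    hence "x - real i * h1 <= 1 / kp n" "x - real (Suc i) * h1 <= 1 / kp n" using 1 by linarith+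
    hence "a n i x = 0" unfolding a_def by (simp only: ramp_eq_0[OF kpos k4] diff_self)
    thus ?thesis by simp
   next
    case 2
    have "(real (Suc i) + 1) * h1 <= real (Suc m) * h1" using that h by (intro mult_right_mono) auto
    hence "real (Suc i) * h1 + h1 <= real (Suc m) * h1" by (simp add: distrib_right)
    moreover have "real i * h1 <= real (Suc i) * h1" using h by simp
    ultimately have "h1 - 1 / kp n <= x - real i * h1" "h1 - 1 / kp n <= x - real (Suc i) * h1"
    using 2 by linarith+
    hence "a n i x = 0" unfolding a_def by (simp only: ramp_const[OF kpos k4] diff_self)
    thus ?thesis by simp
   next
    case 3
    have "0 <= real j * h2" using h by auto
    hence "b n j y = 0" unfolding b_def using 3 by (intro bump_eq_0 kpos) auto
    thus ?thesis by simp
   next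
    case 4
    have "real (Suc j) * h2 <= real l * h2" using that h by (intro mult_right_mono) auto
    hence "b n j y = 0" unfolding b_def using 4 by (intro bump_eq_0 kpos) (auto simp: distrib_right)
    thus ?thesis by simp
   qed
   hence "(SUM i<m. SUM j<l. s i j * (a n i x * b n j y)) = 0"
    by (intro sum.neutral ballI) simp
   thus ?thesis by (simp add: ps_def p)
  qed
  have "\<bar>SUM i<m. SUM j<l. s i j * (a n i (fst p) * b n j (snd p))\<bar>
    <= (SUM i<m. SUM j<l. a n i (fst p) * b n j (snd p))"
  proof (intro order_trans[OF sum_abs] sum_mono)
   fix i j
   have "\<bar>s i j\<bar> * (a n i (fst p) * b n j (snd p)) <= 1 * (a n i (fst p) * b n j (snd p))"
    by (intro mult_right_mono s1 mult_nonneg_nonneg a_nonneg b_nonneg)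
   thus "\<bar>s i j * (a n i (fst p) * b n j (snd p))\<bar> <= a n i (fst p) * b n j (snd p)"
    by (simp add: abs_mult a_nonneg b_nonneg)
  qed
  also have "... = (SUM i<m. a n i (fst p)) * (SUM j<l. b n j (snd p))" by (simp add: sum_product)
  also have "... <= h1 * 1"
   using h by (intro mult_mono a_sum b_sum sum_nonneg b_nonneg) auto
  finally show "\<bar>ps n p\<bar> <= 1" using h by (simp add: ps_def abs_mult)
  show "continuous_on UNIV (ps1 n)" "continuous_on UNIV (ps2 n)"
   unfolding ps1_def ps2_def a_def b_def a'_def b'_def by (intro continuous_intros)+
  have "((%p. (1 / h1) * (SUM i<m. SUM j<l. s i j * (a n i (fst p) * b n j (snd p)))) has_derivative
   (%v. (1 / h1) * (SUM i<m. SUM j<l. s i j * (fst v * (a' n i (fst p) * b n j (snd p))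
    + snd v * (a n i (fst p) * b' n j (snd p)))))) (at p)"
   by (intro has_derivative_mult_right has_derivative_sum has_derivative_prod_fst_snd da db)
  thus "(ps n has_derivative (%v. fst v * ps1 n p + snd v * ps2 n p)) (at p)"
   unfolding ps_def[abs_def] ps1_def ps2_def
   by (rule has_derivative_eq_rhs)
    (simp add: sum_distrib_left sum.distrib distrib_left mult_ac)
 qed
 have KO: "K n \<subseteq> Om" for n
 proof -
  have e: "1 / kp n > 0" using kpos[of n] by simp
  have "0 < a & a < real (Suc m) * h1 & 0 < b & b < real l * h2" if "(a, b) : K n" for a b
   using that e unfolding K_def
   by (simp only: cbox_interval atLeastAtMost_iff Pair_le) linarith
  hence "K n \<subseteq> {0<..<real (Suc m) * h1} \<times> {0<..<real l * h2}"
   by (auto simp del: of_nat_Suc)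
  thus ?thesis using sub by simp
 qed
 have bound: "\<bar>LBINT p. u p * ps1 n p\<bar> <= M" for n
  using var test KO unfolding var_bound_def by blast
 define g where "g p = (1 / h1) * (SUM i<m. SUM j<l. s i j *
   ((ind {0<..<h1} (fst p - real i * h1) - ind {0<..<h1} (fst p - real (Suc i) * h1))
   * ind {0<..<h2} (snd p - real j * h2)))" for p :: "R2"
 \<comment> \<open>The smoothing is removed by dominated convergence; the slopes 1 and -1 of the
   hats leave the difference of two cell integrals.\<close>
 have lim: "(%n. LBINT p. u p * ps1 n p) ----> (LBINT p. u p * g p)"
 proof (rule integral_dominated_convergence[where w = "%p. \<bar>u p\<bar> * ((1 / h1) * (SUM i<m. SUM j<l. 1))"])
  have [measurable]: "u : borel_measurable lborel" using u by auto
  have [measurable]: "g : borel_measurable lborel" unfolding g_def by measurable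
  have [measurable]: "ps1 n : borel_measurable lborel" for n
   using test[of n] unfolding C1_test_def by (auto intro: borel_measurable_continuous_onI)
  show "(%p. u p * g p) : borel_measurable lborel" "(%p. u p * ps1 n p) : borel_measurable lborel" for n
   by measurable
  show "integ (%p. \<bar>u p\<bar> * ((1 / h1) * (SUM i<m. SUM j<l. 1)))" using u by auto
  show "AE p in lborel. (%n. u p * ps1 n p) ----> u p * g p"
   unfolding ps1_def g_def a'_def b_def
   using ramp'_tendsto[OF kpos klim h(1)]
   by (intro AE_I2 tendsto_intros ramp'_tendsto[OF kpos klim h(1)] bump_tendsto[OF kpos klim])
  show "AE p in lborel. norm (u p * ps1 n p) <= \<bar>u p\<bar> * ((1 / h1) * (SUM i<m. SUM j<l. 1))" for n
  proof (rule AE_I2)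
   fix p
   have "\<bar>s i j * (a' n i (fst p) * b n j (snd p))\<bar> <= 1 * (1 * 1)" for i j
   proof -
    have "\<bar>a' n i (fst p)\<bar> <= 1" unfolding a'_def
    using ramp'_bounds[OF kpos k4, of n "fst p - real i * h1"]
    ramp'_bounds[OF kpos k4, of n "fst p - real (Suc i) * h1"] by linarith
    moreover have "\<bar>b n j (snd p)\<bar> <= 1" unfolding b_def using bump_bounds by simp
    ultimately show ?thesis unfolding abs_mult using s1 by (intro mult_mono) auto
   qed
   hence "\<bar>SUM i<m. SUM j<l. s i j * (a' n i (fst p) * b n j (snd p))\<bar> <= (SUM i<m. SUM j<l. 1)"
    by (intro order_trans[OF sum_abs] sum_mono) (auto intro: order_trans[OF sum_abs] sum_mono)
   hence "\<bar>ps1 n p\<bar> <= (1 / h1) * (SUM i<m. SUM j<l. 1)"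
    using h unfolding ps1_def abs_mult by (intro mult_mono) auto
   thus "norm (u p * ps1 n p) <= \<bar>u p\<bar> * ((1 / h1) * (SUM i<m. SUM j<l. 1))"
    unfolding real_norm_def abs_mult by (intro mult_left_mono) auto
  qed
 qed
 have ci: "integ (%p. u p * (ind {0<..<h1} (fst p - real i * h1)
   * ind {0<..<h2} (snd p - real j * h2)))" for i j
 proof (rule Bochner_Integration.integrable_bound[OF u])
  have [measurable]: "u : borel_measurable lborel" using u by auto
  show "(%p. u p * (ind {0<..<h1} (fst p - real i * h1)
   * ind {0<..<h2} (snd p - real j * h2))) : borel_measurable lborel" by measurable
 qed (auto simp: indicator_def)
 have "(LBINT p. u p * g p) = (1 / h1) * (SUM i<m. SUM j<l. s i j * (cell_int u h1 h2 i j - cell_int u h1 h2 (Suc i) j))"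
 proof -
  have "(%p. u p * g p) = (%p. (1 / h1) * (SUM i<m. SUM j<l. s i j *
    (u p * (ind {0<..<h1} (fst p - real i * h1) * ind {0<..<h2} (snd p - real j * h2))
   - u p * (ind {0<..<h1} (fst p - real (Suc i) * h1) * ind {0<..<h2} (snd p - real j * h2)))))"
   unfolding g_def by (intro ext) (simp add: sum_distrib_left algebra_simps)
  thus ?thesis
   unfolding cell_int_def using ci by (simp add: Bochner_Integration.integral_sum del: of_nat_Suc)
 qed
 also have "... = (1 / h1) * (SUM i<m. SUM j<l. \<bar>cell_int u h1 h2 (Suc i) j - cell_int u h1 h2 i j\<bar>)"
  unfolding s_def by (intro arg_cong2[of _ _ _ _ "(*)"] sum.cong refl) (auto simp: sgn_if)
 finally have "(1 / h1) * (SUM i<m. SUM j<l. \<bar>cell_int u h1 h2 (Suc i) j - cell_int u h1 h2 i j\<bar>) <= M"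
  using LIMSEQ_le_const2[OF lim, of M] bound by (auto simp: abs_le_iff)
 thus ?thesis using h by (simp add: field_simps)
qed

lemma sum_indicator_le_1:
 assumes "h > 0"
 shows "(SUM j<l. ind {0<..<h} (y - real j * h)) <= (if y < real l * h then 1 else 0 :: real)"
proof (induction l)
 case (Suc l)
 have "real (Suc l) * h = real l * h + h" by (simp add: distrib_right)
 thus ?case using Suc assms by (auto simp: indicator_def split: if_splits)
qed simp

lemma cell_indicator_measurable [measurable]:
 "(%p. ind {0<..<h1} (fst p - real i * h1) * ind {0<..<h2} (snd p - real j * h2) :: real)
   : borel_measurable (borel :: (R2) measure)"
 by measurable

lemma integrable_cell:
 fixes u :: "R2 => real"
 assumes "integ u"
 shows "integ (%p. u p * (ind {0<..<h1} (fst p - real i * h1)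
  * ind {0<..<h2} (snd p - real j * h2)))"
proof (rule Bochner_Integration.integrable_bound[OF assms])
 have [measurable]: "u : borel_measurable lborel" using assms by auto
 show "(%p. u p * (ind {0<..<h1} (fst p - real i * h1)
  * ind {0<..<h2} (snd p - real j * h2))) : borel_measurable lborel" by measurable
qed (auto simp: indicator_def)

lemma sum_cell_int_le:
 assumes u: "integ u" and h: "h1 > 0" "h2 > 0"
 shows "(SUM i<m. SUM j<l. \<bar>cell_int u h1 h2 i j\<bar>) <= (LBINT p. \<bar>u p\<bar>)"
proof -
 let ?I = "%i j p. ind {0<..<h1} (fst p - real i * h1) * ind {0<..<h2} (snd p - real j * h2)"
 have ua: "integ (%p. \<bar>u p\<bar>)" using u by simp
 have "(SUM i<m. SUM j<l. \<bar>cell_int u h1 h2 i j\<bar>) <= (SUM i<m. SUM j<l. (LBINT p. \<bar>u p\<bar> * ?I i j p))"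
  unfolding cell_int_def
  by (intro sum_mono order_trans[OF integral_abs_bound]) (simp add: abs_mult)
 also have "... = (LBINT p. (SUM i<m. SUM j<l. \<bar>u p\<bar> * ?I i j p))"
  using integrable_cell[OF ua] by (simp add: Bochner_Integration.integral_sum)
 also have "... <= (LBINT p. \<bar>u p\<bar>)"
 proof (rule integral_mono)
  show "integ (%p. SUM i<m. SUM j<l. \<bar>u p\<bar> * ?I i j p)"
   using integrable_cell[OF ua] by simp
  fix p :: "R2"
  have "(SUM i<m. SUM j<l. ?I i j p) = (SUM i<m. ind {0<..<h1} (fst p - real i * h1))
    * (SUM j<l. ind {0<..<h2} (snd p - real j * h2) :: real)"
   by (simp add: sum_product)
  also have "... <= 1 * 1"
   using sum_indicator_le_1[OF h(1), of "fst p" m] sum_indicator_le_1[OF h(2), of "snd p" l]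
   by (intro mult_mono sum_nonneg) (auto split: if_splits)
  finally have "\<bar>u p\<bar> * (SUM i<m. SUM j<l. ?I i j p) <= \<bar>u p\<bar> * 1" by (intro mult_left_mono) auto
  thus "(SUM i<m. SUM j<l. \<bar>u p\<bar> * ?I i j p) <= \<bar>u p\<bar>" by (simp only: sum_distrib_left mult_1_right)
 qed (rule ua)
 finally show ?thesis .
qed

text \<open>Row 0 differs from any other row by at most the variation. Averaging this comparison
  over the \<open>m\<close> rows replaces the norm of a single row by the integral of
  \<open>|u|\<close>.\<close>

lemma first_row_le:
 assumes var: "var_bound Om u M" and u: "integ u" and h: "h1 > 0" "h2 > 0"
  and sub: "{0<..<real m * h1} \<times> {0<..<real l * h2} \<subseteq> Om" and m: "m > 0"
 shows "(SUM j<l. \<bar>cell_int u h1 h2 0 j\<bar>) <= h1 * M + (LBINT p. \<bar>u p\<bar>) / real m"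
proof -
 define c where "c i j = cell_int u h1 h2 i j" for i j
 obtain k where k: "m = Suc k" using m by (cases m) auto
 have V: "(SUM i<k. SUM j<l. \<bar>c (Suc i) j - c i j\<bar>) <= h1 * M"
  unfolding c_def using sub k by (intro discrete_var[OF var u h]) auto
 have "(SUM j<l. \<bar>c 0 j\<bar>) <= (SUM j<l. \<bar>c i j\<bar>) + h1 * M" if "i < m" for i
 proof -
  have "\<bar>c 0 j\<bar> <= \<bar>c i j\<bar> + (SUM i'<k. \<bar>c (Suc i') j - c i' j\<bar>)" for j
  proof -
   have "c i j - c 0 j = (SUM i'<i. c (Suc i') j - c i' j)" by (simp add: sum_lessThan_telescope[of "%i. c i j"])
   also have "\<bar>...\<bar> <= (SUM i'<i. \<bar>c (Suc i') j - c i' j\<bar>)" by (rule sum_abs)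
   also have "... <= (SUM i'<k. \<bar>c (Suc i') j - c i' j\<bar>)" using that k by (intro sum_mono2) auto
   finally show ?thesis by linarith
  qed
  hence "(SUM j<l. \<bar>c 0 j\<bar>) <= (SUM j<l. \<bar>c i j\<bar> + (SUM i'<k. \<bar>c (Suc i') j - c i' j\<bar>))"
   by (intro sum_mono)
  also have "... = (SUM j<l. \<bar>c i j\<bar>) + (SUM i'<k. SUM j<l. \<bar>c (Suc i') j - c i' j\<bar>)"
   by (simp add: sum.distrib sum.swap[of _ "{..<l}" "{..<k}"])
  finally show ?thesis using V by linarith
 qed
 hence "(SUM i<m. SUM j<l. \<bar>c 0 j\<bar>) <= (SUM i<m. (SUM j<l. \<bar>c i j\<bar>) + h1 * M)"
  by (intro sum_mono) auto
 also have "... <= (LBINT p. \<bar>u p\<bar>) + real m * (h1 * M)"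
  using sum_cell_int_le[OF u h, of l m] by (simp add: sum.distrib c_def)
 finally have "real m * (SUM j<l. \<bar>c 0 j\<bar>) <= (LBINT p. \<bar>u p\<bar>) + real m * (h1 * M)" by simp
 thus ?thesis using m unfolding c_def by (simp add: field_simps)
qed

lemma swap_eq_case_prod: "prod.swap = (%(x, y). (y, x))"
 by (auto simp: fun_eq_iff)

lemma borel_measurable_swap [measurable]:
 "prod.swap : borel_measurable (borel :: ('a::second_countable_topology \<times> 'b::second_countable_topology) measure)"
 unfolding prod.swap_def by (intro borel_measurable_continuous_onI continuous_intros)

lemma lborel_swap_integral:
 fixes g :: "R2 => real"
 assumes [measurable]: "g : Bor"
 shows "(LBINT p. g (prod.swap p)) = (LBINT p. g p)"
proof -
 have "distr (lborel \<Otimes>\<^sub>M lborel) (lborel \<Otimes>\<^sub>M lborel) prod.swap = (lborel \<Otimes>\<^sub>M lborel :: (R2) measure)"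
  using lborel_pair.distr_pair_swap[where 'a = real and 'b = real]
  by (simp add: swap_eq_case_prod)
 hence d: "distr lborel borel prod.swap = (lborel :: (R2) measure)"
    using distr_cong[of lborel lborel "borel :: (R2) measure" lborel prod.swap prod.swap]
  by (simp only: lborel_prod sets_lborel)
 have "(LBINT p. g p) = (LINT p|distr lborel borel prod.swap. g p)" by (simp add: d)
 also have "... = (LBINT p. g (prod.swap p))"
  by (rule integral_distr) auto
 finally show ?thesis by simp
qed

lemma lborel_swap_integrable:
 fixes g :: "R2 => real"
 assumes "integ g"
 shows "integ (%p. g (prod.swap p))"
proof -
 have [measurable]: "g : Bor" using assms by auto
 have "distr (lborel \<Otimes>\<^sub>M lborel) (lborel \<Otimes>\<^sub>M lborel) prod.swap = (lborel \<Otimes>\<^sub>M lborel :: (R2) measure)"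
  using lborel_pair.distr_pair_swap[where 'a = real and 'b = real]
  by (simp add: swap_eq_case_prod)
 hence d: "distr lborel borel prod.swap = (lborel :: (R2) measure)"
    using distr_cong[of lborel lborel "borel :: (R2) measure" lborel prod.swap prod.swap]
  by (simp only: lborel_prod sets_lborel)
 show ?thesis
  by (subst integrable_distr_eq[symmetric, of prod.swap lborel borel]) (auto simp: d assms)
qed

lemma cell_int_swap:
 assumes "u : Bor"
 shows "cell_int (%p. u (prod.swap p)) h2 h1 j i = cell_int u h1 h2 i j"
 unfolding cell_int_def using assms
 by (subst lborel_swap_integral[symmetric]) (auto simp: mult_ac)

section \<open>Step functions\<close>

definition ix :: "real => real => nat" where "ix h x = nat \<lfloor>x / h\<rfloor>"

lemma measurable_ix [measurable]: "ix h : measurable borel (count_space UNIV)"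
 unfolding ix_def[abs_def] by measurable

lemma ix_eq_iff:
 assumes "h > 0" "x \<ge> 0"
 shows "ix h x = i \<longleftrightarrow> real i * h <= x & x < real (Suc i) * h"
proof -
 have "x / h \<ge> 0" using assms by simp
 hence "ix h x = i \<longleftrightarrow> \<lfloor>x / h\<rfloor> = int i" unfolding ix_def by (simp add: nat_eq_iff)
 also have "... \<longleftrightarrow> real i <= x / h & x / h < real i + 1" by (simp add: floor_eq_iff)
 also have "... \<longleftrightarrow> real i * h <= x & x < real (Suc i) * h"
  using assms(1) by (simp add: pos_le_divide_eq pos_divide_less_eq add.commute)
 finally show ?thesis .
qed

lemma ix_bounds:
 assumes "h > 0" "x \<ge> 0"
 shows "real (ix h x) * h <= x" "x < real (Suc (ix h x)) * h"
 using ix_eq_iff[OF assms, of "ix h x"] by auto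

lemma ix_less_iff:
 assumes "h > 0" "x \<ge> 0" shows "ix h x < m \<longleftrightarrow> x < real m * h"
proof
 assume "ix h x < m"
 hence "real (Suc (ix h x)) * h <= real m * h" using assms by (intro mult_right_mono) auto
 thus "x < real m * h" using ix_bounds(2)[OF assms] by linarith
next
 assume a: "x < real m * h"
 show "ix h x < m"
 proof (rule ccontr)
  assume "\<not> ix h x < m"
  hence "real m * h <= real (ix h x) * h" using assms by (intro mult_right_mono) auto
  thus False using a ix_bounds(1)[OF assms] by linarith
 qed
qed

lemma step_sum:
 fixes a :: "nat => real"
 assumes "h > 0" "x \<ge> 0" "!!i. i \<ge> m ==> a i = 0"
 shows "a (ix h x) = (SUM i<m. a i * ind {real i * h..<real (Suc i) * h} x)"
proof -
 have "(SUM i<m. a i * ind {real i * h..<real (Suc i) * h} x)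
   = (SUM i<m. if i = ix h x then a i else 0)"
  by (intro sum.cong) (simp_all add: indicator_def ix_eq_iff[OF assms(1,2), symmetric] eq_commute del: of_nat_Suc)
 also have "... = a (ix h x)" using assms(3)[of "ix h x"] by (auto simp: not_less)
 finally show ?thesis by simp
qed

lemma emeasure_lborel_Times:
 fixes A :: "'a::euclidean_space set" and B :: "'b::euclidean_space set"
 assumes "A : sets borel" "B : sets borel"
 shows "emeasure lborel (A \<times> B) = emeasure lborel A * emeasure lborel B"
 using lborel.emeasure_pair_measure_Times[of A lborel B] assms by (simp add: lborel_prod)

lemma borel_Times [measurable (raw)]:
 fixes A :: "'a::second_countable_topology set" and B :: "'b::second_countable_topology set"
 assumes "A : sets borel" "B : sets borel" shows "A \<times> B : sets borel"
 using pair_measureI[OF assms] unfolding borel_prod .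

lemma has_integral_step2:
 fixes A :: "nat => nat => real"
 assumes h: "h1 > 0" "h2 > 0" and A: "!!i j. i \<ge> m \<or> j \<ge> l ==> A i j = 0"
 shows "has_bochner_integral lborel
  (%p. ind ({0..} \<times> {0..}) p * A (ix h1 (fst p)) (ix h2 (snd p)))
  (h1 * h2 * (SUM i<m. SUM j<l. A i j))"
proof -
 let ?Q = "%i j. {real i * h1..<real (Suc i) * h1} \<times> {real j * h2..<real (Suc j) * h2}"
 have eq: "ind ({0..} \<times> {0..}) p * A (ix h1 (fst p)) (ix h2 (snd p))
   = (SUM i<m. SUM j<l. A i j * ind (?Q i j) p)" for p
 proof (cases "p : {0..} \<times> {0..}")
  case True
  hence p: "fst p \<ge> 0" "snd p \<ge> 0" by auto
  have "A (ix h1 (fst p)) (ix h2 (snd p))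
    = (SUM i<m. A i (ix h2 (snd p)) * ind {real i * h1..<real (Suc i) * h1} (fst p))"
   by (rule step_sum[OF h(1) p(1)]) (use A in auto)
  also have "... = (SUM i<m. (SUM j<l. A i j * ind {real j * h2..<real (Suc j) * h2} (snd p))
    * ind {real i * h1..<real (Suc i) * h1} (fst p))"
   by (intro sum.cong refl arg_cong2[of _ _ _ _ "(*)"] step_sum[OF h(2) p(2)]) (use A in auto)
  also have "... = (SUM i<m. SUM j<l. A i j * ind (?Q i j) p)"
   unfolding sum_distrib_right
   by (intro sum.cong refl) (auto simp: indicator_def mem_Times_iff simp del: of_nat_Suc)
  finally show ?thesis using True by simp
 next
  case False
  have "ind (?Q i j) p = (0::real)" for i j
  proof -
   have "0 <= real i * h1" "0 <= real j * h2" using h by auto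
   thus ?thesis using False by (auto simp: indicator_def mem_Times_iff simp del: of_nat_Suc)
  qed
  thus ?thesis using False by simp
 qed
 have int: "has_bochner_integral lborel (ind (?Q i j) :: _ => real) (h1 * h2)" for i j
 proof -
  have "emeasure lborel (?Q i j) = ennreal (h1 * h2)"
   using h by (subst emeasure_lborel_Times) (auto simp: algebra_simps ennreal_mult[symmetric])
  moreover have "?Q i j : sets lborel" by simp
  ultimately have "has_bochner_integral lborel (ind (?Q i j)) (measure lborel (?Q i j))"
   by (intro has_bochner_integral_real_indicator) auto
  moreover have "measure lborel (?Q i j) = h1 * h2"
   using h \<open>emeasure lborel (?Q i j) = ennreal (h1 * h2)\<close> by (simp add: measure_def)
  ultimately show ?thesis by simp
 qed
 have "has_bochner_integral lborel (%p. SUM i<m. SUM j<l. A i j * ind (?Q i j) p)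
   (SUM i<m. SUM j<l. A i j * (h1 * h2))"
  by (intro has_bochner_integral_sum has_bochner_integral_mult_right int)
 thus ?thesis unfolding eq by (simp add: sum_distrib_left mult_ac)
qed

lemma has_integral_step3:
 fixes A :: "nat => nat => nat => real"
 assumes h: "h0 > 0" "h1 > 0" "h2 > 0"
  and A: "!!n i j. n < N ==> i \<ge> m \<or> j \<ge> l ==> A n i j = 0"
 shows "has_bochner_integral lborel
  (%p. ind ({0..<real N * h0} \<times> {0..} \<times> {0..}) p
    * A (ix h0 (fst p)) (ix h1 (fst (snd p))) (ix h2 (snd (snd p))))
  (h0 * h1 * h2 * (SUM n<N. SUM i<m. SUM j<l. A n i j))"
proof -
 let ?I = "%n. {real n * h0..<real (Suc n) * h0}"
 let ?Q = "%i j. {real i * h1..<real (Suc i) * h1} \<times> {real j * h2..<real (Suc j) * h2}"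
 have eq: "ind ({0..<real N * h0} \<times> {0..} \<times> {0..}) p
    * A (ix h0 (fst p)) (ix h1 (fst (snd p))) (ix h2 (snd (snd p)))
   = (SUM n<N. SUM i<m. SUM j<l. A n i j * ind (?I n \<times> ?Q i j) p)" for p
 proof (cases "p : {0..<real N * h0} \<times> {0..} \<times> {0..}")
  case True
  obtain t x y where p: "p = (t, x, y)" by (metis prod.exhaust)
  have txy: "0 <= t" "t < real N * h0" "0 <= x" "0 <= y" using True p by auto
  define B where "B n = (if n < N then A n (ix h1 x) (ix h2 y) else 0)" for n
  have "A (ix h0 t) (ix h1 x) (ix h2 y) = B (ix h0 t)"
   using txy ix_less_iff[OF h(1) txy(1)] by (simp add: B_def)
  also have "... = (SUM n<N. B n * ind (?I n) t)"
   by (rule step_sum[OF h(1) txy(1)]) (auto simp: B_def)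
  also have "... = (SUM n<N. (SUM i<m. SUM j<l. A n i j * ind (?Q i j) (x, y)) * ind (?I n) t)"
  proof (intro sum.cong refl arg_cong2[of _ _ _ _ "(*)"])
   fix n assume n: "n : {..<N}"
   have "B n = A n (ix h1 x) (ix h2 y)" using n by (simp add: B_def)
   also have "... = (SUM i<m. A n i (ix h2 y) * ind {real i * h1..<real (Suc i) * h1} x)"
    by (rule step_sum[OF h(2) txy(3)]) (use A n in auto)
   also have "... = (SUM i<m. (SUM j<l. A n i j * ind {real j * h2..<real (Suc j) * h2} y)
    * ind {real i * h1..<real (Suc i) * h1} x)"
    by (intro sum.cong refl arg_cong2[of _ _ _ _ "(*)"] step_sum[OF h(3) txy(4)]) (use A n in auto)
   also have "... = (SUM i<m. SUM j<l. A n i j * ind (?Q i j) (x, y))"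
    unfolding sum_distrib_right
    by (intro sum.cong refl) (auto simp: indicator_def mem_Times_iff simp del: of_nat_Suc)
   finally show "B n = (SUM i<m. SUM j<l. A n i j * ind (?Q i j) (x, y))" .
  qed
  also have "... = (SUM n<N. SUM i<m. SUM j<l. A n i j * ind (?I n \<times> ?Q i j) p)"
   unfolding sum_distrib_right p
   by (intro sum.cong refl) (auto simp: indicator_def mem_Times_iff simp del: of_nat_Suc)
  finally show ?thesis using True p by simp
 next
  case False
  have "ind (?I n \<times> ?Q i j) p = (0::real)" if "n < N" for n i j
  proof -
   have "0 <= real i * h1" "0 <= real j * h2" "0 <= real n * h0" "real (Suc n) * h0 <= real N * h0"
    using h that by (auto intro!: mult_right_mono simp del: of_nat_Suc)
   thus ?thesis using False
    by (auto simp: indicator_def mem_Times_iff simp del: of_nat_Suc)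
  qed
  thus ?thesis using False by simp
 qed
 have int: "has_bochner_integral lborel (ind (?I n \<times> ?Q i j) :: _ => real) (h0 * h1 * h2)" for n i j
 proof -
  have e: "emeasure lborel (?I n \<times> ?Q i j) = ennreal (h0 * h1 * h2)"
   using h by (subst emeasure_lborel_Times, simp, simp, subst emeasure_lborel_Times)
    (auto simp: algebra_simps ennreal_mult[symmetric])
  have "?I n \<times> ?Q i j : sets lborel" by simp
  hence "has_bochner_integral lborel (ind (?I n \<times> ?Q i j)) (measure lborel (?I n \<times> ?Q i j))"
   using e by (intro has_bochner_integral_real_indicator) auto
  moreover have "measure lborel (?I n \<times> ?Q i j) = h0 * h1 * h2"
   using h e by (simp add: measure_def)
  ultimately show ?thesis by simp
 qed
 have "has_bochner_integral lborel (%p. SUM n<N. SUM i<m. SUM j<l. A n i j * ind (?I n \<times> ?Q i j) p)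
   (SUM n<N. SUM i<m. SUM j<l. A n i j * (h0 * h1 * h2))"
  by (intro has_bochner_integral_sum has_bochner_integral_mult_right int)
 thus ?thesis unfolding eq by (simp add: sum_distrib_left mult_ac)
qed

text \<open>The bounded factor converges in \<open>L1\<close> on \<open>B\<close>, the weight almost
  everywhere. The difference splits into \<open>(a p - \<alpha>) * d p\<close>, small in
  \<open>L1\<close>, and \<open>\<alpha> * d p\<close>, which is dominated.\<close>

lemma tendsto_integral_prod:
 fixes a d :: "nat => 'a => real" and \<alpha> \<delta> :: "'a => real"
 assumes [measurable]: "!!p. a p : borel_measurable M" "!!p. d p : borel_measurable M"
   "\<alpha> : borel_measurable M" "\<delta> : borel_measurable M" "B : sets M"
  and B: "emeasure M B < \<infinity>"
  and d: "!!p x. x : space M ==> \<bar>d p x\<bar> <= C * ind B x"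
  and lim: "AE x in M. (%p. d p x) ----> \<delta> x"
  and bd: "!!x. \<bar>\<alpha> x\<bar> <= C'" "!!p x. \<bar>a p x\<bar> <= C'"
  and L1: "(%p. \<integral>\<^sup>+ x. ennreal (ind B x * \<bar>a p x - \<alpha> x\<bar>) \<partial>M) ----> 0"
 shows "(%p. LINT x|M. a p x * d p x) ----> (LINT x|M. \<alpha> x * \<delta> x)"
proof -
 have iB: "integrable M (%x. ind B x * c :: real)" for c
  using B by auto
 have C0: "0 <= C" if "x : space M" "x : B" for x using d[OF that(1), of 0] that by auto
 have ad: "integrable M (%x. a p x * d q x)" "integrable M (%x. \<alpha> x * d q x)" for p q
 proof -
  have "norm (a p x * d q x) <= norm (ind B x * (C' * C))"
    "norm (\<alpha> x * d q x) <= norm (ind B x * (C' * C))" if "x : space M" for x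
  proof -
   have *: "\<bar>r\<bar> * \<bar>d q x\<bar> <= C' * (C * ind B x)" if "\<bar>r\<bar> <= C'" for r
    using that d[OF \<open>x \<in> space M\<close>, of q] by (intro mult_mono) auto
   have "C' * (C * ind B x) <= norm (ind B x * (C' * C))" by (auto simp: indicator_def)
   thus "norm (a p x * d q x) <= norm (ind B x * (C' * C))"
    "norm (\<alpha> x * d q x) <= norm (ind B x * (C' * C))"
    using *[OF bd(2)[of p x]] *[OF bd(1)[of x]] by (auto simp: abs_mult)
  qed
  note le = this
  show "integrable M (%x. a p x * d q x)"
   by (rule Bochner_Integration.integrable_bound[OF iB[of "C' * C"]], measurable, rule AE_I2, rule le(1))
  show "integrable M (%x. \<alpha> x * d q x)"
   by (rule Bochner_Integration.integrable_bound[OF iB[of "C' * C"]], measurable, rule AE_I2, rule le(2))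
 qed
 have "(%p. LINT x|M. \<alpha> x * d p x) ----> (LINT x|M. \<alpha> x * \<delta> x)"
 proof (rule integral_dominated_convergence[where w = "%x. ind B x * (C' * C)"])
  show "AE x in M. (%p. \<alpha> x * d p x) ----> \<alpha> x * \<delta> x"
   using lim by eventually_elim (intro tendsto_intros)
  show "AE x in M. norm (\<alpha> x * d p x) <= ind B x * (C' * C)" for p
  proof (rule AE_I2)
   fix x assume x: "x : space M"
   have "\<bar>\<alpha> x\<bar> * \<bar>d p x\<bar> <= C' * (C * ind B x)"
    using bd(1)[of x] d[OF x, of p] by (intro mult_mono) auto
   thus "norm (\<alpha> x * d p x) <= ind B x * (C' * C)" by (simp add: abs_mult mult_ac)
  qed
  show "integrable M (%x. ind B x * (C' * C))" by (rule iB)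
 qed measurable
 moreover have "(%p. LINT x|M. (a p x - \<alpha> x) * d p x) ----> 0"
 proof (rule Lim_null_comparison)
  have "(%p. C * enn2real (\<integral>\<^sup>+ x. ennreal (ind B x * \<bar>a p x - \<alpha> x\<bar>) \<partial>M)) ----> C * enn2real 0"
   by (intro tendsto_mult tendsto_const tendsto_enn2real) (simp_all add: L1)
  thus "(%p. C * enn2real (\<integral>\<^sup>+ x. ennreal (ind B x * \<bar>a p x - \<alpha> x\<bar>) \<partial>M)) ----> 0" by simp
  show "\<forall>\<^sub>F p in sequentially. norm (LINT x|M. (a p x - \<alpha> x) * d p x)
    <= C * enn2real (\<integral>\<^sup>+ x. ennreal (ind B x * \<bar>a p x - \<alpha> x\<bar>) \<partial>M)"
  proof (rule always_eventually, rule allI)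
   fix p
   have iBa: "integrable M (%x. ind B x * \<bar>a p x - \<alpha> x\<bar>)"
   proof (rule Bochner_Integration.integrable_bound[OF iB[of "2 * C'"]])
    have "\<bar>a p x - \<alpha> x\<bar> <= \<bar>2 * C'\<bar>" for x using bd(1)[of x] bd(2)[of p x] by linarith
    thus "AE x in M. norm (ind B x * \<bar>a p x - \<alpha> x\<bar>) <= norm (ind B x * (2 * C'))"
    by (intro AE_I2) (simp add: indicator_def)
   qed measurable
   have "norm (LINT x|M. (a p x - \<alpha> x) * d p x) <= (LINT x|M. norm ((a p x - \<alpha> x) * d p x))"
    by (rule integral_norm_bound)
   also have "... <= (LINT x|M. C * (ind B x * \<bar>a p x - \<alpha> x\<bar>))"
   proof (rule integral_mono)
    show "integrable M (%x. norm ((a p x - \<alpha> x) * d p x))"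
    using ad(1)[of p p] ad(2)[of p] by (auto simp: left_diff_distrib)
    show "integrable M (%x. C * (ind B x * \<bar>a p x - \<alpha> x\<bar>))" using iBa by simp
    show "norm ((a p x - \<alpha> x) * d p x) <= C * (ind B x * \<bar>a p x - \<alpha> x\<bar>)" if "x : space M" for x
    using mult_left_mono[OF d[OF that, of p], of "\<bar>a p x - \<alpha> x\<bar>"] by (simp add: abs_mult mult_ac)
   qed
   also have "... = C * (LINT x|M. ind B x * \<bar>a p x - \<alpha> x\<bar>)" by simp
   also have "(LINT x|M. ind B x * \<bar>a p x - \<alpha> x\<bar>)
    = enn2real (\<integral>\<^sup>+ x. ennreal (ind B x * \<bar>a p x - \<alpha> x\<bar>) \<partial>M)"
    by (rule integral_eq_nn_integral) auto
   finally show "norm (LINT x|M. (a p x - \<alpha> x) * d p x)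
    <= C * enn2real (\<integral>\<^sup>+ x. ennreal (ind B x * \<bar>a p x - \<alpha> x\<bar>) \<partial>M)" .
  qed
 qed
 ultimately have "(%p. (LINT x|M. \<alpha> x * d p x) + (LINT x|M. (a p x - \<alpha> x) * d p x))
   ----> (LINT x|M. \<alpha> x * \<delta> x) + 0" by (rule tendsto_add)
 thus ?thesis using ad by (simp add: left_diff_distrib)
qed

text \<open>\<open>measurable_on\<close> supplies continuous functions that converge almost
  everywhere; truncating them at \<open>U\<close> provides the domination.\<close>

lemma bounded_measurable_approx_continuous:
 fixes w :: "R2 => real"
 assumes [measurable]: "w : Bor" and w: "!!z. \<bar>w z\<bar> <= U"
  and B: "B : sets borel" "emeasure lborel B < \<infinity>" and e: "e > 0"
 obtains g where "continuous_on UNIV g" "!!z. \<bar>g z\<bar> <= U" "(LBINT z. ind B z * \<bar>w z - g z\<bar>) < e"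
proof -
 note [measurable] = B(1)
 have U: "0 <= U" using w[of 0] by simp
 have "w : borel_measurable (lebesgue_on UNIV)"
  by (simp add: measurable_completion lebesgue_on_UNIV_eq)
 hence "w measurable_on UNIV"
  using measurable_on_iff_borel_measurable[of UNIV w] by simp
 then obtain N g where N: "negligible N" and g: "!!n. continuous_on UNIV (g n)"
  and lim: "!!z. z \<notin> N ==> (%n. g n z) ----> w z"
  unfolding measurable_on_def by auto
 define h where "h n z = max (- U) (min U (g n z))" for n z
 have h: "continuous_on UNIV (h n)" for n unfolding h_def by (intro continuous_intros g)
 hence [measurable]: "h n : Bor" for n by (rule borel_measurable_continuous_onI)
 have hU: "\<bar>h n z\<bar> <= U" for n z using U by (auto simp: h_def)
 have hlim: "(%n. h n z) ----> w z" if "z \<notin> N" for z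
 proof -
  have "(%n. h n z) ----> max (- U) (min U (w z))"
   unfolding h_def by (intro tendsto_intros lim that)
  thus ?thesis using w[of z] by (simp add: abs_le_iff)
 qed
 have "AE z in lebesgue. z \<notin> N"
  using N AE_not_in[of N lebesgue] by (simp add: negligible_iff_null_sets)
 hence AE: "AE z in lborel. z \<notin> N" by (simp add: AE_completion_iff)
 have "(%n. LBINT z. ind B z * \<bar>w z - h n z\<bar>) ----> (LINT (z::real\<times>real)|lborel. 0)"
 proof (rule integral_dominated_convergence[where w = "%z. ind B z * (2 * U)"])
  show "integ (%z. ind B z * (2 * U))" using B by simp
  show "AE z in lborel. (%n. ind B z * \<bar>w z - h n z\<bar>) ----> 0"
   using AE
  proof eventually_elim
   case (elim z)
   have "(%n. ind B z * \<bar>w z - h n z\<bar>) ----> ind B z * \<bar>w z - w z\<bar>"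
    by (intro tendsto_intros hlim elim)
   thus ?case by simp
  qed
  show "AE z in lborel. norm (ind B z * \<bar>w z - h n z\<bar>) <= ind B z * (2 * U)" for n
  proof (rule AE_I2)
   fix z have "\<bar>w z - h n z\<bar> <= 2 * U" using w[of z] hU[of n z] by linarith
   thus "norm (ind B z * \<bar>w z - h n z\<bar>) <= ind B z * (2 * U)"
    by (simp add: indicator_def)
  qed
 qed auto
 hence "\<forall>\<^sub>F n in sequentially. (LBINT z. ind B z * \<bar>w z - h n z\<bar>) < e"
  using e by (auto dest: order_tendstoD(2))
 then obtain n where "(LBINT z. ind B z * \<bar>w z - h n z\<bar>) < e"
  by (auto simp: eventually_sequentially)
 thus ?thesis using that h hU by blast
qed

lemma cell_int_const:
 assumes "h1 > 0" "h2 > 0"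
 shows "integ (%p :: R2. ind {0<..<h1} (fst p - real i * h1) * ind {0<..<h2} (snd p - real j * h2) :: real)"
  "(LBINT p. ind {0<..<h1} (fst p - real i * h1) * ind {0<..<h2} (snd p - real j * h2)) = h1 * h2"
proof -
 let ?Q = "{real i * h1<..<real (Suc i) * h1} \<times> {real j * h2<..<real (Suc j) * h2}"
 have eq: "ind {0<..<h1} (fst p - real i * h1) * ind {0<..<h2} (snd p - real j * h2)
   = (ind ?Q p :: real)" for p
  by (auto simp: indicator_def mem_Times_iff algebra_simps)
 have e: "emeasure lborel ?Q = ennreal (h1 * h2)"
  using assms by (subst emeasure_lborel_Times) (auto simp: algebra_simps ennreal_mult[symmetric])
 have Q: "?Q : sets lborel" by simp
 show "integ (%p :: R2. ind {0<..<h1} (fst p - real i * h1) * ind {0<..<h2} (snd p - real j * h2) :: real)"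
  unfolding eq using e Q by (intro integrable_real_indicator) auto
 show "(LBINT p. ind {0<..<h1} (fst p - real i * h1) * ind {0<..<h2} (snd p - real j * h2)) = h1 * h2"
  unfolding eq using e Q assms by (simp add: measure_def)
qed

lemma integrable_bounded_cell:
 fixes w :: "R2 => real"
 assumes [measurable]: "w : Bor" and w: "!!z. \<bar>w z\<bar> <= U" and h: "h1 > 0" "h2 > 0"
 shows "integ (%p. w p * (ind {0<..<h1} (fst p - real i * h1) * ind {0<..<h2} (snd p - real j * h2)))"
proof (rule Bochner_Integration.integrable_bound[OF integrable_mult_right[OF cell_int_const(1)[OF h], of U]])
 show "AE p in lborel. norm (w p * (ind {0<..<h1} (fst p - real i * h1) * ind {0<..<h2} (snd p - real j * h2)))
   <= norm (U * (ind {0<..<h1} (fst p - real i * h1) * ind {0<..<h2} (snd p - real j * h2)))"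
 proof (rule AE_I2)
  fix p have "\<bar>w p\<bar> <= \<bar>U\<bar>" using w[of p] by linarith
  thus "norm (w p * (ind {0<..<h1} (fst p - real i * h1) * ind {0<..<h2} (snd p - real j * h2)))
   <= norm (U * (ind {0<..<h1} (fst p - real i * h1) * ind {0<..<h2} (snd p - real j * h2)))"
   by (simp add: indicator_def)
 qed
qed measurable

lemma cell_int_bound:
 fixes w :: "R2 => real"
 assumes [measurable]: "w : Bor" and w: "!!z. \<bar>w z\<bar> <= U" and h: "h1 > 0" "h2 > 0"
 shows "\<bar>cell_int w h1 h2 i j\<bar> <= U * (h1 * h2)"
proof -
 let ?I = "%p :: R2. ind {0<..<h1} (fst p - real i * h1) * ind {0<..<h2} (snd p - real j * h2) :: real"
 have "\<bar>cell_int w h1 h2 i j\<bar> <= (LBINT p. \<bar>w p * ?I p\<bar>)"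
  unfolding cell_int_def by (rule integral_abs_bound)
 also have "... <= (LBINT p. U * ?I p)"
 proof (rule integral_mono)
  show "integ (%p. \<bar>w p * ?I p\<bar>)"
   by (intro integrable_abs integrable_bounded_cell[OF _ w h]) measurable
  show "integ (%p. U * ?I p)" using cell_int_const(1)[OF h] by simp
  show "\<bar>w p * ?I p\<bar> <= U * ?I p" for p using w[of p] by (simp add: indicator_def)
 qed
 also have "... = U * (h1 * h2)" using cell_int_const(2)[OF h] by simp
 finally show ?thesis .
qed

text \<open>For a continuous function this is uniform continuity. Averaging does not increase the
  \<open>L1\<close> norm, so bounded measurable functions follow by density.\<close>

lemma cell_average_tendsto:
 fixes w :: "R2 => real" and h k :: "nat => real"
 assumes [measurable]: "w : Bor" and w: "!!z. \<bar>w z\<bar> <= U"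
  and hk: "!!p. h p > 0" "!!p. k p > 0" "h ----> 0" "k ----> 0" and ab: "0 <= a" "0 <= b"
 defines "avg \<equiv> %p i j. cell_int w (h p) (k p) i j / (h p * k p)"
 shows "(%p. LBINT z. ind ({0..a} \<times> {0..b}) z
   * \<bar>avg p (ix (h p) (fst z)) (ix (k p) (snd z)) - w z\<bar>) ----> 0"
proof (rule tendstoI)
 fix e0 :: real assume e0: "e0 > 0"
 \<comment> \<open>The budget consists of two \<open>L1\<close> errors of the approximation by
   \<open>g\<close>, one averaged and one not, and a uniform error over \<open>?B'\<close>. This
   larger box contains every cell that meets \<open>?B\<close>, as such cells stick out by less than
   1.\<close>
 define e where "e = e0 / (2 + (a + 1) * (b + 1))"
 have den: "2 + (a + 1) * (b + 1) > 0" using ab by (simp add: add_pos_nonneg)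
 have e: "e > 0" using e0 den by (simp add: e_def)
 let ?B = "{0..a} \<times> {0..b}" and ?B' = "{0..a+1} \<times> {0..b+1}"
 have eB': "emeasure lborel ?B' = ennreal ((a + 1) * (b + 1))"
  using ab by (simp add: emeasure_lborel_Times ennreal_mult)
 have B': "?B' : sets borel" "emeasure lborel ?B' < \<infinity>"
  unfolding eB' by auto
 note [measurable] = B'(1)
 obtain g where g: "continuous_on UNIV g" "!!z. \<bar>g z\<bar> <= U" "(LBINT z. ind ?B' z * \<bar>w z - g z\<bar>) < e"
  using bounded_measurable_approx_continuous[OF assms(1) w B' e] by blast
 have [measurable]: "g : Bor" by (rule borel_measurable_continuous_onI[OF g(1)])
 have "uniformly_continuous_on ?B' g"
  by (intro compact_uniformly_continuous continuous_on_subset[OF g(1)] compact_Times) auto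
 then obtain d where d: "d > 0" "!!z z'. z : ?B' ==> z' : ?B' ==> dist z' z < d ==> dist (g z') (g z) < e"
  using e unfolding uniformly_continuous_on_def by blast
 define d' where "d' = min 1 (d / 2)"
 have d': "d' > 0" using d by (simp add: d'_def)
 have ev: "\<forall>\<^sub>F p in sequentially. h p < d' & k p < d'"
  using order_tendstoD(2)[OF hk(3) d'] order_tendstoD(2)[OF hk(4) d'] by eventually_elim auto
 show "\<forall>\<^sub>F p in sequentially. dist (LBINT z. ind ?B z
   * \<bar>avg p (ix (h p) (fst z)) (ix (k p) (snd z)) - w z\<bar>) 0 < e0"
  using ev
 proof eventually_elim
  case (elim p)
  define H K where "H = h p" and "K = k p"
  have HK: "H > 0" "K > 0" "H < 1" "K < 1" "H < d / 2" "K < d / 2"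
   using elim hk by (auto simp: H_def K_def d'_def)
  define m l where "m = Suc (ix H a)" and "l = Suc (ix K b)"
  have ml: "real m * H <= a + 1" "real l * K <= b + 1" "a < real m * H" "b < real l * K"
   using ix_bounds[of H a] ix_bounds[of K b] HK ab unfolding m_def l_def
   by (auto simp: distrib_right)
  let ?I = "%i j p. ind {0<..<H} (fst p - real i * H) * ind {0<..<K} (snd p - real j * K) :: real"
  define r where "r z = ind ?B' z * (w z - g z)" for z
  have rint: "integ r"
  proof (rule Bochner_Integration.integrable_bound)
   show "integ (%z. ind ?B' z * (2 * U))" using B' by simp
   have "\<bar>w z - g z\<bar> <= \<bar>2 * U\<bar>" for z using w[of z] g(2)[of z] by linarith
   thus "AE z in lborel. norm (r z) <= norm (ind ?B' z * (2 * U))"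
    by (intro AE_I2) (simp add: r_def indicator_def)
  qed (unfold r_def, measurable)
  have rl: "(LBINT z. \<bar>r z\<bar>) < e" using g(3) by (simp add: r_def abs_mult)
  define D where "D i j = (if i < m & j < l then \<bar>cell_int r H K i j\<bar> / (H * K) else 0)" for i j
  have hb: "has_bochner_integral lborel (%z. ind ({0..} \<times> {0..}) z * D (ix H (fst z)) (ix K (snd z)))
    (H * K * (SUM i<m. SUM j<l. D i j))"
   by (rule has_integral_step2) (auto simp: HK D_def)
  have "H * K * (SUM i<m. SUM j<l. D i j) = (SUM i<m. SUM j<l. \<bar>cell_int r H K i j\<bar>)"
   using HK by (simp add: sum_distrib_left D_def)
  also have "... <= (LBINT z. \<bar>r z\<bar>)" by (rule sum_cell_int_le[OF rint HK(1,2)])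
  finally have Dl: "(LBINT z. ind ({0..} \<times> {0..}) z * D (ix H (fst z)) (ix K (snd z))) <= e"
   using hb rl by (simp add: has_bochner_integral_integral_eq)
  have pw: "ind ?B z * \<bar>avg p (ix H (fst z)) (ix K (snd z)) - w z\<bar>
    <= ind ({0..} \<times> {0..}) z * D (ix H (fst z)) (ix K (snd z))
    + ind ?B' z * e + \<bar>r z\<bar>" for z
  proof (cases "z : ?B")
   case True
   obtain x y where z: "z = (x, y)" by fastforce
   have xy: "0 <= x" "x <= a" "0 <= y" "y <= b" using True z by auto
   define i j where "i = ix H x" and "j = ix K y"
   have im: "i < m" "j < l" using ix_less_iff[of H x m] ix_less_iff[of K y l] xy HK ml by (auto simp: i_def j_def)
   have ixy: "real i * H <= x" "x < real (Suc i) * H" "real j * K <= y" "y < real (Suc j) * K"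
    using ix_bounds[of H x] ix_bounds[of K y] xy HK by (auto simp: i_def j_def)
   have cellB: "q : ?B'" "dist q z < d" if "?I i j q ~= 0" for q
   proof -
    have q: "real i * H < fst q" "fst q < real i * H + H" "real j * K < snd q" "snd q < real j * K + K"
    using that by (auto simp: indicator_def split: if_splits)
    have "real (Suc i) * H <= real m * H" "real (Suc j) * K <= real l * K"
    using im HK by (auto intro!: mult_right_mono)
    moreover have "real (Suc i) * H = real i * H + H" "real (Suc j) * K = real j * K + K"
    by (auto simp: distrib_right)
    moreover have "0 <= real i * H" "0 <= real j * K" using HK by (auto intro!: mult_nonneg_nonneg)
    ultimately have "0 <= fst q" "fst q <= a + 1" "0 <= snd q" "snd q <= b + 1"
    using q ml by linarith+
    thus "q : ?B'" by (simp add: mem_Times_iff)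
    have "real (Suc i) * H = real i * H + H" "real (Suc j) * K = real j * K + K"
    by (auto simp: distrib_right)
    hence "\<bar>fst q - x\<bar> < d / 2" "\<bar>snd q - y\<bar> < d / 2" using q ixy HK by linarith+
    thus "dist q z < d"
    using sqrt_sum_squares_le_sum_abs[of "dist (fst q) x" "dist (snd q) y"]
    by (simp add: z dist_prod_def dist_real_def)
   qed
   have zB': "z : ?B'" using True by auto
   have ci: "cell_int w H K i j = cell_int r H K i j + cell_int g H K i j"
   proof -
    have "cell_int w H K i j = (LBINT q. r q * ?I i j q + g q * ?I i j q)"
    unfolding cell_int_def
    proof (intro Bochner_Integration.integral_cong refl)
    fix q show "w q * ?I i j q = r q * ?I i j q + g q * ?I i j q"
    using cellB(1)[of q] by (cases "?I i j q = 0") (auto simp: r_def left_diff_distrib)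
    qed
    also have "... = cell_int r H K i j + cell_int g H K i j"
    unfolding cell_int_def
    by (intro Bochner_Integration.integral_add integrable_cell[OF rint] integrable_bounded_cell[OF _ g(2) HK(1,2)]) measurable
    finally show ?thesis .
   qed
   have "\<bar>cell_int g H K i j - g z * (H * K)\<bar> <= e * (H * K)"
   proof -
    have eq: "cell_int g H K i j - g z * (H * K) = (LBINT q. (g q - g z) * ?I i j q)"
    unfolding cell_int_def cell_int_const(2)[OF HK(1,2), symmetric, of i j] left_diff_distrib
    using cell_int_const(1)[OF HK(1,2), of i j]
    by (subst Bochner_Integration.integral_diff) (auto intro!: integrable_bounded_cell[OF _ g(2) HK(1,2)])
    have "\<bar>cell_int g H K i j - g z * (H * K)\<bar> <= (LBINT q. \<bar>(g q - g z) * ?I i j q\<bar>)"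
    unfolding eq by (rule integral_abs_bound)
    also have "... <= (LBINT q. e * ?I i j q)"
    proof (rule integral_mono)
    have "\<bar>g q - g z\<bar> <= 2 * U" for q using g(2)[of q] g(2)[of z] by linarith
    thus "integ (%q. \<bar>(g q - g z) * ?I i j q\<bar>)"
    by (intro integrable_abs integrable_bounded_cell[OF _ _ HK(1,2), of _ "2 * U"]) measurable
    show "integ (%q. e * ?I i j q)" using cell_int_const(1)[OF HK(1,2)] by simp
    fix q show "\<bar>(g q - g z) * ?I i j q\<bar> <= e * ?I i j q"
    proof (cases "?I i j q = 0")
    case False
    hence "\<bar>g q - g z\<bar> < e" using d(2)[OF zB' cellB(1) cellB(2)] by (simp add: dist_real_def)
    thus ?thesis by (simp add: abs_mult mult_right_mono)
    next
    case True
    thus ?thesis by (simp only: mult_zero_right abs_zero order_refl)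
    qed
    qed
    also have "... = e * (H * K)" using cell_int_const(2)[OF HK(1,2)] by simp
    finally show ?thesis .
   qed
   hence "\<bar>cell_int g H K i j / (H * K) - g z\<bar> <= e"
    using HK by (simp add: field_simps abs_le_iff)
   moreover have "avg p i j = cell_int r H K i j / (H * K) + cell_int g H K i j / (H * K)"
    unfolding avg_def using ci by (simp add: add_divide_distrib H_def K_def)
   moreover have "D i j = \<bar>cell_int r H K i j / (H * K)\<bar>"
    using im HK by (simp add: D_def abs_divide abs_mult)
   moreover have "r z = w z - g z" using zB' by (simp add: r_def)
   ultimately have "\<bar>avg p i j - w z\<bar> <= D i j + e + \<bar>r z\<bar>" by linarith
   thus ?thesis using True zB' xy by (simp add: z i_def j_def)
  next
   case False
   have "D i j \<ge> 0" for i j using HK by (simp add: D_def)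
   thus ?thesis using False e by (simp add: add_nonneg_nonneg)
  qed
  have i1: "integ (%z. ind ({0..} \<times> {0..}) z * D (ix H (fst z)) (ix K (snd z)))"
   using hb by (rule integrable.intros)
  have i2: "integ (%z. ind ?B' z * e)" using B' by simp
  have v: "(LBINT z. ind ?B' z * e) = (a + 1) * (b + 1) * e"
   using ab by (simp add: measure_def eB' del: ennreal_1 ennreal_plus)
  have "(LBINT z. ind ?B z * \<bar>avg p (ix H (fst z)) (ix K (snd z)) - w z\<bar>)
   <= (LBINT z. ind ({0..} \<times> {0..}) z * D (ix H (fst z)) (ix K (snd z))
    + ind ?B' z * e + \<bar>r z\<bar>)"
  proof (rule integral_mono_AE')
   show "integ (%z. ind ({0..} \<times> {0..}) z * D (ix H (fst z)) (ix K (snd z))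
    + ind ?B' z * e + \<bar>r z\<bar>)"
    by (intro Bochner_Integration.integrable_add integrable_abs i1 i2 rint)
   show "AE z in lborel. ind ?B z * \<bar>avg p (ix H (fst z)) (ix K (snd z)) - w z\<bar>
    <= ind ({0..} \<times> {0..}) z * D (ix H (fst z)) (ix K (snd z)) + ind ?B' z * e + \<bar>r z\<bar>"
    by (intro AE_I2 pw)
   have "D i j \<ge> 0" for i j using HK by (simp add: D_def)
   thus "AE z in lborel. 0 <= ind ({0..} \<times> {0..}) z * D (ix H (fst z)) (ix K (snd z))
    + ind ?B' z * e + \<bar>r z\<bar>"
    using e by (intro AE_I2 add_nonneg_nonneg mult_nonneg_nonneg) auto
  qed
  also have "... = (LBINT z. ind ({0..} \<times> {0..}) z * D (ix H (fst z)) (ix K (snd z)))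
    + (LBINT z. ind ?B' z * e) + (LBINT z. \<bar>r z\<bar>)"
   using i1 i2 rint by simp
  also have "... < e + (a + 1) * (b + 1) * e + e" using Dl v rl by linarith
  also have "... = e * (2 + (a + 1) * (b + 1))" by (simp add: algebra_simps)
  also have "... = e0" using den by (simp add: e_def)
  finally have "(LBINT z. ind ?B z * \<bar>avg p (ix H (fst z)) (ix K (snd z)) - w z\<bar>) < e0" .
  moreover have "0 <= (LBINT z. ind ?B z * \<bar>avg p (ix H (fst z)) (ix K (snd z)) - w z\<bar>)"
   by (intro integral_nonneg_AE AE_I2) simp
  ultimately show ?case by (simp add: H_def K_def dist_real_def)
 qed
qed

section \<open>Sampled test functions\<close>

text \<open>Only values and derivatives at positive coordinates matter; near \<open>t = T\<close> and for large
 \<open>x\<close> or \<open>y\<close> a test function vanishes.\<close>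

definition test_fun :: "real => (real => real => real => real) => (real => real => real => real) =>
  (real => real => real => real) => (real => real => real => real) => real => real => real => bool" where
 "test_fun T ps pst psx psy T' R C \<longleftrightarrow> 0 < T' & T' < T & 0 < R & 0 <= C &
   (ALL t>0. ALL x>0. ALL y>0.
    ((%s. ps s x y) has_real_derivative pst t x y) (at t) &
    ((%s. ps t s y) has_real_derivative psx t x y) (at x) &
    ((%s. ps t x s) has_real_derivative psy t x y) (at y) &
    \<bar>pst t x y\<bar> <= C & \<bar>psx t x y\<bar> <= C & \<bar>psy t x y\<bar> <= C) &
   (ALL f:{pst, psx, psy}. continuous_on ({0<..} \<times> {0<..} \<times> {0<..}) (%(t, x, y). f t x y)) &
   (\<forall>t\<ge>0. \<forall>x\<ge>0. \<forall>y\<ge>0. \<bar>ps t x y\<bar> <= C & (T' <= t \<or> R <= x \<or> R <= y --> ps t x y = 0)) &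
   continuous_on ({0..} \<times> {0..} \<times> {0..}) (%(t, x, y). ps t x y)"

text \<open>Sampling at cell centres keeps all points at positive coordinates, where
  \<open>test_fun\<close> provides derivatives.\<close>

definition sample :: "(real => real => real => real) => real => real => nat => nat => nat => real" where
 "sample ps k h n i j = ps ((real n + 1/2) * k) ((real i + 1/2) * h) ((real j + 1/2) * h)"

lemma forward_quotient:
 fixes f f' :: "real => real"
 assumes "h > 0" "!!s. s > 0 ==> (f has_real_derivative f' s) (at s)"
 obtains z where "(real i + 1/2) * h <= z" "z <= (real i + 3/2) * h"
  "f ((real (Suc i) + 1/2) * h) - f ((real i + 1/2) * h) = h * f' z"
proof -
 have "(real i + 1/2) * h < (real (Suc i) + 1/2) * h" using assms(1) by (intro mult_strict_right_mono) auto
 moreover have "0 < (real i + 1/2) * h" using assms(1) by (intro mult_pos_pos) auto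
 ultimately obtain z where z: "(real i + 1/2) * h < z" "z < (real (Suc i) + 1/2) * h"
  "f ((real (Suc i) + 1/2) * h) - f ((real i + 1/2) * h) = ((real (Suc i) + 1/2) * h - (real i + 1/2) * h) * f' z"
  using MVT2[of "(real i + 1/2) * h" "(real (Suc i) + 1/2) * h" f f'] assms(2) by force
 show ?thesis
 proof (rule that[of z])
  show "f ((real (Suc i) + 1/2) * h) - f ((real i + 1/2) * h) = h * f' z"
   unfolding z(3) by (simp add: algebra_simps)
 qed (use z in \<open>auto simp: algebra_simps\<close>)
qed

text \<open>The slack of a few cells covers cell centres, intermediate points of the mean value
  theorem and neighbouring cells at once.\<close>

lemma ix_mid_tendsto:
 assumes "!!p. h p > 0" "h ----> 0" "x \<ge> 0"
  and "!!p. (real (ix (h p) x) - 2) * h p <= z p" "!!p. z p <= (real (ix (h p) x) + 3) * h p"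
 shows "z ----> x"
proof (rule Lim_transform_bound[THEN LIM_zero_cancel])
 show "\<forall>\<^sub>F p in sequentially. norm (z p - x) <= norm (4 * h p)"
 proof (rule always_eventually, rule allI)
  fix p
  have "real (ix (h p) x) * h p <= x" "x < real (ix (h p) x) * h p + h p"
   using ix_bounds[OF assms(1,3), of p] by (auto simp: distrib_right)
  thus "norm (z p - x) <= norm (4 * h p)"
   using assms(1)[of p] assms(4,5)[of p] by (auto simp: distrib_right left_diff_distrib)
 qed
 show "(%p. 4 * h p) ----> 0" using tendsto_mult[OF tendsto_const assms(2), of 4] by simp
qed

lemma ix_eventually_pos:
 assumes "!!p. h p > 0" "h ----> 0" "x > 0"
 shows "\<forall>\<^sub>F p in sequentially. ix (h p) x \<ge> 1"
 using order_tendstoD(2)[OF assms(2,3)]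
proof eventually_elim
 case (elim p)
 hence "\<not> ix (h p) x < 1" using ix_less_iff[OF assms(1), of x p 1] assms(3) by simp
 thus ?case by simp
qed

locale sampled =
 fixes T :: real and ps pst psx psy :: "real => real => real => real" and T' R C :: real
  and k h :: "nat => real"
 assumes tf: "test_fun T ps pst psx psy T' R C"
  and k: "!!p. k p > 0" "k ----> 0" and h: "!!p. h p > 0" "h ----> 0"
begin

abbreviation sm where "sm p \<equiv> sample ps (k p) (h p)"

lemma half_pos: "0 < (real i + 1/2) * h p" "0 < (real i + 1/2) * k p"
 using h k by (auto intro!: mult_pos_pos)

lemma deriv_facts:
 assumes "t > 0" "x > 0" "y > 0"
 shows "((%s. ps s x y) has_real_derivative pst t x y) (at t)"
  "((%s. ps t s y) has_real_derivative psx t x y) (at x)"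
  "((%s. ps t x s) has_real_derivative psy t x y) (at y)"
  "\<bar>pst t x y\<bar> <= C" "\<bar>psx t x y\<bar> <= C" "\<bar>psy t x y\<bar> <= C"
proof -
 have "ALL t>0. ALL x>0. ALL y>0.
    ((%s. ps s x y) has_real_derivative pst t x y) (at t) &
    ((%s. ps t s y) has_real_derivative psx t x y) (at x) &
    ((%s. ps t x s) has_real_derivative psy t x y) (at y) &
    \<bar>pst t x y\<bar> <= C & \<bar>psx t x y\<bar> <= C & \<bar>psy t x y\<bar> <= C"
  using tf unfolding test_fun_def by (elim conjE)
 from this[rule_format, OF assms] show "((%s. ps s x y) has_real_derivative pst t x y) (at t)"
  "((%s. ps t s y) has_real_derivative psx t x y) (at x)"
  "((%s. ps t x s) has_real_derivative psy t x y) (at y)"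
  "\<bar>pst t x y\<bar> <= C" "\<bar>psx t x y\<bar> <= C" "\<bar>psy t x y\<bar> <= C"
  by simp_all
qed

lemma psi_facts:
 assumes "t \<ge> 0" "x \<ge> 0" "y \<ge> 0"
 shows "\<bar>ps t x y\<bar> <= C" "T' <= t \<or> R <= x \<or> R <= y ==> ps t x y = 0"
proof -
 have "\<forall>t\<ge>0. \<forall>x\<ge>0. \<forall>y\<ge>0. \<bar>ps t x y\<bar> <= C & (T' <= t \<or> R <= x \<or> R <= y --> ps t x y = 0)"
  using tf unfolding test_fun_def by (elim conjE)
 from this[rule_format, OF assms] show "\<bar>ps t x y\<bar> <= C" "T' <= t \<or> R <= x \<or> R <= y ==> ps t x y = 0"
  by simp_all
qed

lemma C_nonneg: "0 <= C" and T'_bounds: "0 < T'" "T' < T" and R_pos: "0 < R"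
 using tf unfolding test_fun_def by - (elim conjE, assumption)+

lemma derivs_tendsto:
 assumes "t > 0" "x > 0" "y > 0" "a ----> t" "b ----> x" "c ----> y" "f : {pst, psx, psy}"
 shows "(%p. f (a p) (b p) (c p)) ----> f t x y"
proof -
 let ?S = "{0<..} \<times> {0<..} \<times> {0<..} :: (R3) set"
 have "continuous_on ?S (%(t, x, y). f t x y)" using tf assms(7) unfolding test_fun_def by blast
 moreover have "open ?S" by (intro open_Times) auto
 ultimately have "isCont (%(t, x, y). f t x y) (t, x, y)"
  using assms(1-3) by (subst (asm) continuous_on_eq_continuous_at) auto
 hence "(%p. (%(t, x, y). f t x y) (a p, b p, c p)) ----> (%(t, x, y). f t x y) (t, x, y)"
  by (rule isCont_tendsto_compose) (intro tendsto_Pair assms)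
 thus ?thesis by simp
qed

lemma psi_tendsto:
 assumes "t \<ge> 0" "x \<ge> 0" "y \<ge> 0" "a ----> t" "b ----> x" "c ----> y"
  "!!p. a p \<ge> 0" "!!p. b p \<ge> 0" "!!p. c p \<ge> 0"
 shows "(%p. ps (a p) (b p) (c p)) ----> ps t x y"
proof -
 let ?S = "{0..} \<times> {0..} \<times> {0..} :: (R3) set"
 have "continuous_on ?S (%(t, x, y). ps t x y)" using tf unfolding test_fun_def by blast
 hence "(%p. (%(t, x, y). ps t x y) (a p, b p, c p)) ----> (%(t, x, y). ps t x y) (t, x, y)"
  by (rule continuous_on_tendsto_compose) (use assms in \<open>auto intro!: tendsto_Pair always_eventually\<close>)
 thus ?thesis by simp
qed

lemma sm_bound: "\<bar>sm p n i j\<bar> <= C"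
 unfolding sample_def by (intro psi_facts(1)) (use half_pos in \<open>auto intro: less_imp_le\<close>)

lemma sm_zero:
 assumes "T' <= (real n + 1/2) * k p \<or> R <= (real i + 1/2) * h p \<or> R <= (real j + 1/2) * h p"
 shows "sm p n i j = 0"
 unfolding sample_def using assms half_pos by (intro psi_facts(2)) (auto intro: less_imp_le)

definition Dt where "Dt p n i j = (sm p (Suc n) i j - sm p n i j) / k p"
definition Dxp where "Dxp p n i j = (sm p n (Suc i) j - sm p n i j) / h p"
definition Dxm where "Dxm p n i j = (sm p n (i - 1) j - sm p n i j) / h p"
definition Dyp where "Dyp p n i j = (sm p n i (Suc j) - sm p n i j) / h p"
definition Dym where "Dym p n i j = (sm p n i (j - 1) - sm p n i j) / h p"

lemma Dt_mid: "EX z. (real n + 1/2) * k p <= z & z <= (real n + 3/2) * k p &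
  Dt p n i j = pst z ((real i + 1/2) * h p) ((real j + 1/2) * h p)"
proof -
 obtain z where z: "(real n + 1/2) * k p <= z" "z <= (real n + 3/2) * k p"
  "ps ((real (Suc n) + 1/2) * k p) ((real i + 1/2) * h p) ((real j + 1/2) * h p)
   - ps ((real n + 1/2) * k p) ((real i + 1/2) * h p) ((real j + 1/2) * h p)
   = k p * pst z ((real i + 1/2) * h p) ((real j + 1/2) * h p)"
  by (rule forward_quotient[where f = "%s. ps s ((real i + 1/2) * h p) ((real j + 1/2) * h p)"
    and f' = "%s. pst s ((real i + 1/2) * h p) ((real j + 1/2) * h p)" and i = n and h = "k p"])
   (use deriv_facts(1) half_pos k in auto)
 show ?thesis
  using z k(1)[of p] by (intro exI[of _ z]) (simp add: Dt_def sample_def field_simps)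
qed

lemma Dxp_mid: "EX z. (real i + 1/2) * h p <= z & z <= (real i + 3/2) * h p &
  Dxp p n i j = psx ((real n + 1/2) * k p) z ((real j + 1/2) * h p)"
proof -
 obtain z where z: "(real i + 1/2) * h p <= z" "z <= (real i + 3/2) * h p"
  "ps ((real n + 1/2) * k p) ((real (Suc i) + 1/2) * h p) ((real j + 1/2) * h p)
   - ps ((real n + 1/2) * k p) ((real i + 1/2) * h p) ((real j + 1/2) * h p)
   = h p * psx ((real n + 1/2) * k p) z ((real j + 1/2) * h p)"
  by (rule forward_quotient[where f = "%s. ps ((real n + 1/2) * k p) s ((real j + 1/2) * h p)"
    and f' = "%s. psx ((real n + 1/2) * k p) s ((real j + 1/2) * h p)" and i = i and h = "h p"])
   (use deriv_facts(2) half_pos h in auto)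
 show ?thesis
  using z h(1)[of p] by (intro exI[of _ z]) (simp add: Dxp_def sample_def field_simps)
qed

lemma Dyp_mid: "EX z. (real j + 1/2) * h p <= z & z <= (real j + 3/2) * h p &
  Dyp p n i j = psy ((real n + 1/2) * k p) ((real i + 1/2) * h p) z"
proof -
 obtain z where z: "(real j + 1/2) * h p <= z" "z <= (real j + 3/2) * h p"
  "ps ((real n + 1/2) * k p) ((real i + 1/2) * h p) ((real (Suc j) + 1/2) * h p)
   - ps ((real n + 1/2) * k p) ((real i + 1/2) * h p) ((real j + 1/2) * h p)
   = h p * psy ((real n + 1/2) * k p) ((real i + 1/2) * h p) z"
  by (rule forward_quotient[where f = "%s. ps ((real n + 1/2) * k p) ((real i + 1/2) * h p) s"
    and f' = "%s. psy ((real n + 1/2) * k p) ((real i + 1/2) * h p) s" and i = j and h = "h p"])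
   (use deriv_facts(3) half_pos h in auto)
 show ?thesis
  using z h(1)[of p] by (intro exI[of _ z]) (simp add: Dyp_def sample_def field_simps)
qed

text \<open>By truncated subtraction the backward quotient vanishes in the first cell; any fixed
  \<open>x > 0\<close> eventually lies outside that cell.\<close>

lemma Dxm_eq: "Dxm p n (Suc i) j = - Dxp p n i j" "Dxm p n 0 j = 0"
 by (simp_all add: Dxm_def Dxp_def minus_divide_left)
lemma Dym_eq: "Dym p n i (Suc j) = - Dyp p n i j" "Dym p n i 0 = 0"
 by (simp_all add: Dym_def Dyp_def minus_divide_left)

lemma D_bounds: "\<bar>Dt p n i j\<bar> <= C" "\<bar>Dxp p n i j\<bar> <= C" "\<bar>Dyp p n i j\<bar> <= C"
proof -
 show "\<bar>Dt p n i j\<bar> <= C"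
  using Dt_mid[of n p i j] half_pos(2)[of n p] by (auto intro!: deriv_facts(4) half_pos)
 show "\<bar>Dxp p n i j\<bar> <= C"
  using Dxp_mid[of i p n j] half_pos(1)[of i p] by (auto intro!: deriv_facts(5) half_pos)
 show "\<bar>Dyp p n i j\<bar> <= C"
  using Dyp_mid[of j p n i] half_pos(1)[of j p] by (auto intro!: deriv_facts(6) half_pos)
qed

lemma Dm_bounds: "\<bar>Dxm p n i j\<bar> <= C" "\<bar>Dym p n i j\<bar> <= C"
 using D_bounds C_nonneg by (cases i; simp add: Dxm_eq) (cases j; simp add: Dym_eq D_bounds C_nonneg)

lemma mid_tendsto:
 assumes "x \<ge> 0"
 shows "(%p. (real (ix (h p) x) + 1/2) * h p) ----> x" "(%p. (real (ix (k p) x) + 1/2) * k p) ----> x"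
  "(%p. (real (Suc (ix (k p) x)) + 1/2) * k p) ----> x"
proof -
 have *: "(real (ix c x) - 2) * c <= (real (ix c x) + 1/2) * c" "(real (ix c x) + 1/2) * c <= (real (ix c x) + 3) * c"
  "(real (ix c x) - 2) * c <= (real (Suc (ix c x)) + 1/2) * c" "(real (Suc (ix c x)) + 1/2) * c <= (real (ix c x) + 3) * c"
  if "c > 0" for c :: real
  using that by (auto intro!: mult_right_mono)
 show "(%p. (real (ix (h p) x) + 1/2) * h p) ----> x"
  by (rule ix_mid_tendsto[OF h assms]) (intro * h)+
 show "(%p. (real (ix (k p) x) + 1/2) * k p) ----> x"
  by (rule ix_mid_tendsto[OF k assms]) (intro * k)+
 show "(%p. (real (Suc (ix (k p) x)) + 1/2) * k p) ----> x"
  by (rule ix_mid_tendsto[OF k assms]) (intro * k)+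
qed

lemma D_tendsto:
 assumes txy: "t > 0" "x > 0" "y > 0"
 shows "(%p. Dt p (ix (k p) t) (ix (h p) x) (ix (h p) y)) ----> pst t x y"
  and "(%p. Dxp p (Suc (ix (k p) t)) (ix (h p) x) (ix (h p) y)) ----> psx t x y"
  and "(%p. Dxm p (Suc (ix (k p) t)) (ix (h p) x) (ix (h p) y)) ----> - psx t x y"
  and "(%p. Dyp p (Suc (ix (k p) t)) (ix (h p) x) (ix (h p) y)) ----> psy t x y"
  and "(%p. Dym p (Suc (ix (k p) t)) (ix (h p) x) (ix (h p) y)) ----> - psy t x y"
proof -
 have nn: "t \<ge> 0" "x \<ge> 0" "y \<ge> 0" using txy by auto
 have "ALL p. EX w. ((real (ix (k p) t) + 1/2) * k p <= w) & (w <= (real (ix (k p) t) + 3/2) * k p) & (Dt p (ix (k p) t) (ix (h p) x) (ix (h p) y)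
   = pst w ((real (ix (h p) x) + 1/2) * h p) ((real (ix (h p) y) + 1/2) * h p))" by (intro allI Dt_mid)
  hence "EX z. ALL p. ((real (ix (k p) t) + 1/2) * k p <= (z p)) & ((z p) <= (real (ix (k p) t) + 3/2) * k p) & (Dt p (ix (k p) t) (ix (h p) x) (ix (h p) y)
   = pst (z p) ((real (ix (h p) x) + 1/2) * h p) ((real (ix (h p) y) + 1/2) * h p))" by (rule choice)
  then obtain z where z0: "ALL p. ((real (ix (k p) t) + 1/2) * k p <= (z p)) & ((z p) <= (real (ix (k p) t) + 3/2) * k p) & (Dt p (ix (k p) t) (ix (h p) x) (ix (h p) y)
   = pst (z p) ((real (ix (h p) x) + 1/2) * h p) ((real (ix (h p) y) + 1/2) * h p))" ..
  have z: "(real (ix (k p) t) + 1/2) * k p <= z p"  "z p <= (real (ix (k p) t) + 3/2) * k p"  "Dt p (ix (k p) t) (ix (h p) x) (ix (h p) y)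
   = pst (z p) ((real (ix (h p) x) + 1/2) * h p) ((real (ix (h p) y) + 1/2) * h p)" for p
   using z0[rule_format, of p] by simp_all
 have "z ----> t"
 proof (rule ix_mid_tendsto[OF k nn(1)])
  fix p
  have "(real (ix (k p) t) - 2) * k p <= (real (ix (k p) t) + 1/2) * k p"
    "(real (ix (k p) t) + 3/2) * k p <= (real (ix (k p) t) + 3) * k p"
   using k(1)[of p] by (auto intro!: mult_right_mono)
  thus "(real (ix (k p) t) - 2) * k p <= z p" "z p <= (real (ix (k p) t) + 3) * k p"
   using z(1,2)[of p] by linarith+
 qed
 thus "(%p. Dt p (ix (k p) t) (ix (h p) x) (ix (h p) y)) ----> pst t x y"
  unfolding z(3) using derivs_tendsto[OF txy _ mid_tendsto(1)[OF nn(2)] mid_tendsto(1)[OF nn(3)], of z pst] by simp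
 \<comment> \<open>Letting the index \<open>I\<close> lag by at most one cell serves the forward
   quotient and, through \<open>Dxm_eq\<close>, the backward one.\<close>
 have gx: "(%p. Dxp p (Suc (ix (k p) t)) (I p) (ix (h p) y)) ----> psx t x y"
  if I: "!!p. ix (h p) x - 1 <= I p" "!!p. I p <= ix (h p) x" for I
 proof -
  have "ALL p. EX w. ((real (I p) + 1/2) * h p <= w) & (w <= (real (I p) + 3/2) * h p) & (Dxp p (Suc (ix (k p) t)) (I p) (ix (h p) y)
    = psx ((real (Suc (ix (k p) t)) + 1/2) * k p) w ((real (ix (h p) y) + 1/2) * h p))" by (intro allI Dxp_mid)
  hence "EX z. ALL p. ((real (I p) + 1/2) * h p <= (z p)) & ((z p) <= (real (I p) + 3/2) * h p) & (Dxp p (Suc (ix (k p) t)) (I p) (ix (h p) y)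
    = psx ((real (Suc (ix (k p) t)) + 1/2) * k p) (z p) ((real (ix (h p) y) + 1/2) * h p))" by (rule choice)
  then obtain z where z0: "ALL p. ((real (I p) + 1/2) * h p <= (z p)) & ((z p) <= (real (I p) + 3/2) * h p) & (Dxp p (Suc (ix (k p) t)) (I p) (ix (h p) y)
    = psx ((real (Suc (ix (k p) t)) + 1/2) * k p) (z p) ((real (ix (h p) y) + 1/2) * h p))" ..
  have z: "(real (I p) + 1/2) * h p <= z p"  "z p <= (real (I p) + 3/2) * h p"  "Dxp p (Suc (ix (k p) t)) (I p) (ix (h p) y)
    = psx ((real (Suc (ix (k p) t)) + 1/2) * k p) (z p) ((real (ix (h p) y) + 1/2) * h p)" for p
   using z0[rule_format, of p] by simp_all
  have "z ----> x"
  proof (rule ix_mid_tendsto[OF h nn(2)])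
   fix p
   have "(real (ix (h p) x) - 2) * h p <= (real (I p) + 1/2) * h p"
    "(real (I p) + 3/2) * h p <= (real (ix (h p) x) + 3) * h p"
    using h(1)[of p] I[of p] by (auto intro!: mult_right_mono)
   thus "(real (ix (h p) x) - 2) * h p <= z p" "z p <= (real (ix (h p) x) + 3) * h p"
    using z(1,2)[of p] by linarith+
  qed
  thus ?thesis
   unfolding z(3) using derivs_tendsto[OF txy mid_tendsto(3)[OF nn(1)] _ mid_tendsto(1)[OF nn(3)], of z psx] by simp
 qed
 show "(%p. Dxp p (Suc (ix (k p) t)) (ix (h p) x) (ix (h p) y)) ----> psx t x y"
  by (rule gx) auto
 have ev: "\<forall>\<^sub>F p in sequentially. - Dxp p (Suc (ix (k p) t)) (ix (h p) x - 1) (ix (h p) y)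
   = Dxm p (Suc (ix (k p) t)) (ix (h p) x) (ix (h p) y)"
  using ix_eventually_pos[OF h txy(2)]
 proof eventually_elim
  case (elim p)
  then obtain m where "ix (h p) x = Suc m" by (cases "ix (h p) x") auto
  thus ?case by (simp add: Dxm_eq)
 qed
 have "(%p. - Dxp p (Suc (ix (k p) t)) (ix (h p) x - 1) (ix (h p) y)) ----> - psx t x y"
  by (intro tendsto_minus gx) auto
 thus "(%p. Dxm p (Suc (ix (k p) t)) (ix (h p) x) (ix (h p) y)) ----> - psx t x y"
  using ev by (rule Lim_transform_eventually)
 have gy: "(%p. Dyp p (Suc (ix (k p) t)) (ix (h p) x) (I p)) ----> psy t x y"
  if I: "!!p. ix (h p) y - 1 <= I p" "!!p. I p <= ix (h p) y" for I
 proof -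
  have "ALL p. EX w. ((real (I p) + 1/2) * h p <= w) & (w <= (real (I p) + 3/2) * h p) & (Dyp p (Suc (ix (k p) t)) (ix (h p) x) (I p)
    = psy ((real (Suc (ix (k p) t)) + 1/2) * k p) ((real (ix (h p) x) + 1/2) * h p) w)" by (intro allI Dyp_mid)
  hence "EX z. ALL p. ((real (I p) + 1/2) * h p <= (z p)) & ((z p) <= (real (I p) + 3/2) * h p) & (Dyp p (Suc (ix (k p) t)) (ix (h p) x) (I p)
    = psy ((real (Suc (ix (k p) t)) + 1/2) * k p) ((real (ix (h p) x) + 1/2) * h p) (z p))" by (rule choice)
  then obtain z where z0: "ALL p. ((real (I p) + 1/2) * h p <= (z p)) & ((z p) <= (real (I p) + 3/2) * h p) & (Dyp p (Suc (ix (k p) t)) (ix (h p) x) (I p)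
    = psy ((real (Suc (ix (k p) t)) + 1/2) * k p) ((real (ix (h p) x) + 1/2) * h p) (z p))" ..
  have z: "(real (I p) + 1/2) * h p <= z p"  "z p <= (real (I p) + 3/2) * h p"  "Dyp p (Suc (ix (k p) t)) (ix (h p) x) (I p)
    = psy ((real (Suc (ix (k p) t)) + 1/2) * k p) ((real (ix (h p) x) + 1/2) * h p) (z p)" for p
   using z0[rule_format, of p] by simp_all
  have "z ----> y"
  proof (rule ix_mid_tendsto[OF h nn(3)])
   fix p
   have "(real (ix (h p) y) - 2) * h p <= (real (I p) + 1/2) * h p"
    "(real (I p) + 3/2) * h p <= (real (ix (h p) y) + 3) * h p"
    using h(1)[of p] I[of p] by (auto intro!: mult_right_mono)
   thus "(real (ix (h p) y) - 2) * h p <= z p" "z p <= (real (ix (h p) y) + 3) * h p"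
    using z(1,2)[of p] by linarith+
  qed
  thus ?thesis
   unfolding z(3) using derivs_tendsto[OF txy mid_tendsto(3)[OF nn(1)] mid_tendsto(1)[OF nn(2)], of z psy] by simp
 qed
 show "(%p. Dyp p (Suc (ix (k p) t)) (ix (h p) x) (ix (h p) y)) ----> psy t x y"
  by (rule gy) auto
 have ev: "\<forall>\<^sub>F p in sequentially. - Dyp p (Suc (ix (k p) t)) (ix (h p) x) (ix (h p) y - 1)
   = Dym p (Suc (ix (k p) t)) (ix (h p) x) (ix (h p) y)"
  using ix_eventually_pos[OF h txy(3)]
 proof eventually_elim
  case (elim p)
  then obtain m where "ix (h p) y = Suc m" by (cases "ix (h p) y") auto
  thus ?case by (simp add: Dym_eq)
 qed
 have "(%p. - Dyp p (Suc (ix (k p) t)) (ix (h p) x) (ix (h p) y - 1)) ----> - psy t x y"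
  by (intro tendsto_minus gy) auto
 thus "(%p. Dym p (Suc (ix (k p) t)) (ix (h p) x) (ix (h p) y)) ----> - psy t x y"
  using ev by (rule Lim_transform_eventually)
qed

end

section \<open>Passage to the limit\<close>

lemma measurable_step3:
 fixes a :: "nat => nat => nat => real"
 shows "(%z :: R3. a (ix h0 (fst z)) (ix h1 (fst (snd z))) (ix h2 (snd (snd z)))) : Bor"
proof -
 have 0: "(%z :: R3. ix h0 (fst z)) : measurable borel (count_space UNIV)" by measurable
 have 1: "(%z :: R3. ix h1 (fst (snd z))) : measurable borel (count_space UNIV)" by measurable
 have 2: "(%z :: R3. ix h2 (snd (snd z))) : measurable borel (count_space UNIV)" by measurable
 have "(%z :: R3. a n i (ix h2 (snd (snd z)))) : Bor" for n i
  by (rule measurable_compose_countable[OF _ 2]) simp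
 hence "(%z :: R3. a n (ix h1 (fst (snd z))) (ix h2 (snd (snd z)))) : Bor" for n
  by (rule measurable_compose_countable[OF _ 1])
 thus ?thesis by (rule measurable_compose_countable[OF _ 0])
qed

lemma measurable_step2:
 fixes a :: "nat => nat => real"
 shows "(%z :: R2. a (ix h0 (fst z)) (ix h1 (snd z))) : Bor"
proof -
 have 0: "(%z :: R2. ix h0 (fst z)) : measurable borel (count_space UNIV)" by measurable
 have 1: "(%z :: R2. ix h1 (snd z)) : measurable borel (count_space UNIV)" by measurable
 have "(%z :: R2. a n (ix h1 (snd z))) : Bor" for n
  by (rule measurable_compose_countable[OF _ 1]) simp
 thus ?thesis by (rule measurable_compose_countable[OF _ 0])
qed

lemma AE_inner_neq:
 fixes b :: "'a::euclidean_space"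
 assumes "b : Basis" shows "AE z in lborel. z \<bullet> b ~= c"
proof -
 have "{z. z \<bullet> b = c} : null_sets lebesgue"
  using negligible_standard_hyperplane[OF assms, of c] by (simp add: negligible_iff_null_sets)
 hence "AE z in lebesgue. z \<notin> {z. z \<bullet> b = c}" by (rule AE_not_in)
 thus ?thesis by (simp add: AE_completion_iff)
qed

lemma AE_space_time: "AE z in lborel. z : {0..<T} \<times> {0..} \<times> {0..} \<longleftrightarrow> z : space_time T"
proof -
 have b: "(1, 0, 0) : (Basis :: (R3) set)" "(0, 1, 0) : (Basis :: (R3) set)"
  "(0, 0, 1) : (Basis :: (R3) set)" by (auto simp: Basis_prod_def zero_prod_def)
 show ?thesis
  using AE_inner_neq[OF b(1), of 0] AE_inner_neq[OF b(2), of 0] AE_inner_neq[OF b(3), of 0]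
  by eventually_elim (auto simp: space_time_def quarter_def inner_prod_def)
qed

lemma AE_pos2: "AE z :: R2 in lborel. fst z ~= 0 & snd z ~= 0"
proof -
 have b: "(1, 0) : (Basis :: (R2) set)" "(0, 1) : (Basis :: (R2) set)"
  by (auto simp: Basis_prod_def)
 show ?thesis
  using AE_inner_neq[OF b(1), of 0] AE_inner_neq[OF b(2), of 0]
  by eventually_elim (auto simp: inner_prod_def)
qed

lemma open_space_time: "open (space_time T)" and open_face: "open (face T)" and open_quarter: "open quarter"
 unfolding space_time_def face_def quarter_def by (auto intro!: open_Times)

lemma borel_domains [measurable]:
 "space_time T : sets borel" "face T : sets borel" "quarter : sets borel"
 using open_space_time open_face open_quarter by auto

lemma cell_average_tendsto_nn:
 fixes w :: "R2 => real" and h k :: "nat => real"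
 assumes [measurable]: "w : Bor" and w: "!!z. \<bar>w z\<bar> <= U"
  and hk: "!!p. h p > 0" "!!p. k p > 0" "h ----> 0" "k ----> 0" and ab: "0 <= a" "0 <= b"
 shows "(%p. NN z. ennreal (ind ({0..a} \<times> {0..b}) z
   * \<bar>cell_int w (h p) (k p) (ix (h p) (fst z)) (ix (k p) (snd z)) / (h p * k p) - w z\<bar>)) ----> 0"
proof -
 let ?B = "{0..a} \<times> {0..b}"
 have [measurable]: "?B : sets borel" by measurable
 have B: "emeasure lborel ?B < \<infinity>"
  by (intro emeasure_bounded_finite bounded_Times bounded_closed_interval)
 let ?F = "%p z. ind ?B z * \<bar>cell_int w (h p) (k p) (ix (h p) (fst z)) (ix (k p) (snd z)) / (h p * k p) - w z\<bar>"
 have "(NN z. ennreal (?F p z)) = ennreal (LBINT z. ?F p z)" for p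
 proof (rule nn_integral_eq_integral)
  have [measurable]: "(%z. cell_int w (h p) (k p) (ix (h p) (fst z)) (ix (k p) (snd z))) : Bor"
   by (rule measurable_step2)
  show "integ (?F p)"
  proof (rule Bochner_Integration.integrable_bound)
   show "integ (%z. ind ?B z * (2 * U))" using B by simp
   have "\<bar>cell_int w (h p) (k p) i j / (h p * k p) - w z\<bar> <= \<bar>2 * U\<bar>" for i j z
   proof -
    have "\<bar>cell_int w (h p) (k p) i j / (h p * k p)\<bar> <= U"
    using cell_int_bound[OF assms(1) w hk(1)[of p] hk(2)[of p], of i j] hk(1)[of p] hk(2)[of p]
    by (simp add: abs_divide abs_mult pos_divide_le_eq)
    thus ?thesis using w[of z] by linarith
   qed
   thus "AE z in lborel. norm (?F p z) <= norm (ind ?B z * (2 * U))"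
    by (intro AE_I2) (auto simp: indicator_def)
  qed measurable
 qed auto
 moreover have "(%p. ennreal (LBINT z. ?F p z)) ----> ennreal 0"
  by (rule tendsto_ennrealI[OF cell_average_tendsto[OF assms(1) w hk ab]])
 ultimately show ?thesis by simp
qed

lemma sum_eq_integral2:
 fixes a :: "nat => nat => real"
 assumes h: "h1 > 0" "h2 > 0" and a: "!!i j. i \<ge> m \<or> j \<ge> l ==> a i j = 0"
 shows "integ (%z. ind quarter z * a (ix h1 (fst z)) (ix h2 (snd z)))"
  "h1 * h2 * (SUM i<m. SUM j<l. a i j) = (LBINT z. ind quarter z * a (ix h1 (fst z)) (ix h2 (snd z)))"
proof -
 have hb: "has_bochner_integral lborel (%z. ind ({0..} \<times> {0..}) z * a (ix h1 (fst z)) (ix h2 (snd z)))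
  (h1 * h2 * (SUM i<m. SUM j<l. a i j))"
  by (rule has_integral_step2[OF h a])
 have ae: "AE z in lborel. ind ({0..} \<times> {0..}) z * a (ix h1 (fst z)) (ix h2 (snd z))
   = ind quarter z * a (ix h1 (fst z)) (ix h2 (snd z))"
  using AE_pos2 by eventually_elim (auto simp: indicator_def quarter_def)
 have [measurable]: "(%z. a (ix h1 (fst z)) (ix h2 (snd z))) : Bor"
  by (rule measurable_step2)
 have [measurable]: "{0::real..} \<times> {0::real..} : sets borel" by measurable
 have "has_bochner_integral lborel (%z. ind quarter z * a (ix h1 (fst z)) (ix h2 (snd z)))
  (h1 * h2 * (SUM i<m. SUM j<l. a i j))"
  by (rule iffD1[OF has_bochner_integral_cong_AE[OF _ _ ae] hb]) measurable
 thus "integ (%z. ind quarter z * a (ix h1 (fst z)) (ix h2 (snd z)))"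
  "h1 * h2 * (SUM i<m. SUM j<l. a i j) = (LBINT z. ind quarter z * a (ix h1 (fst z)) (ix h2 (snd z)))"
  by (auto simp: has_bochner_integral_iff)
qed

text \<open>The bound \<open>M\<close> does not depend on \<open>p\<close>. The data and the limit
  are Borel and bounded everywhere, and the convergence is kept in the weaker form of
  \<open>L1\<close> in space-time.\<close>

locale lbm_limit =
 fixes E :: "vel => real => real" and R :: "(vel => real) => vel => real" and U M lam T :: real
  and \<phi>x \<phi>y :: "real => real"
  and A :: "nat => nat \<times> nat => real" and W S :: "nat => nat => nat => real"
  and f :: "nat => nat => vel => nat \<times> nat => real"
  and dt dx :: "nat => real" and N :: "nat => nat"
  and u0 uW uS :: "R2 => real" and v :: "R3 => real"
 assumes scheme: "bounded_scheme E R U (A p) (W p) (S p) (f p) (dx p) M (N p)"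
  and lam_pos: "0 < lam" and T_pos: "0 < T" and dx_lim: "dx ----> 0"
  and dt_eq: "dx p = lam * dt p" and N_eq: "real (N p) * dt p = T"
  and flux_x: "lam * (E XP u - E XM u) = \<phi>x u" and flux_y: "lam * (E YP u - E YM u) = \<phi>y u"
  and E_borel: "!!k. E k : Bor"
  and data_borel: "u0 : Bor" "uW : Bor" "uS : Bor"
  and data_bound: "!!z. \<bar>u0 z\<bar> <= U" "!!z. \<bar>uW z\<bar> <= U" "!!z. \<bar>uS z\<bar> <= U"
  and A_eq: "A p (i, j) = cell_int u0 (dx p) (dx p) i j / (dx p * dx p)"
  and W_eq: "W p n j = cell_int uW (dt p) (dx p) n j / (dt p * dx p)"
  and S_eq: "S p n j = cell_int uS (dt p) (dx p) n j / (dt p * dx p)"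
  and v_borel: "v : Bor" and v_bound: "!!z. \<bar>v z\<bar> <= U"
  and f_lim: "(%p. NN z. ennreal (ind (space_time T) z *
    (SUM i:UNIV. \<bar>f p (ix (dt p) (fst z)) i (ix (dx p) (fst (snd z)), ix (dx p) (snd (snd z))) - E i (v z)\<bar>))) ----> 0"
begin

sublocale sc: bounded_scheme E R U "A p" "W p" "S p" "f p" "dx p" M "N p" for p
 by (rule scheme)

lemmas borels [measurable] = E_borel data_borel v_borel

lemma dx_pos: "0 < dx p" by (rule sc.h_pos)
lemma dt_pos: "0 < dt p" using dx_pos[of p] dt_eq[of p] lam_pos by (simp add: zero_less_mult_iff)
lemma dt_lim: "dt ----> 0"
proof -
 have "(%p. dx p / lam) ----> 0 / lam" using lam_pos by (intro tendsto_intros dx_lim) auto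
 thus ?thesis using lam_pos by (simp add: dt_eq)
qed
lemma N_pos: "N p > 0" using N_eq[of p] T_pos by (cases "N p") auto

definition dx_max :: real where "dx_max = (SUP p. dx p)"
lemma dx_le_max: "dx p <= dx_max" and dx_max_pos: "0 < dx_max"
proof -
 have "Bseq dx" using dx_lim by (intro convergent_imp_Bseq) (auto simp: convergent_def)
 thus *: "dx p <= dx_max" for p
  unfolding dx_max_def by (intro cSUP_upper) (auto simp: Bseq_eq_bounded dest: bounded_imp_bdd_above)
 show "0 < dx_max" using *[of 0] dx_pos[of 0] by simp
qed

definition st :: "nat => (nat => nat => nat => real) => R3 => real" where
 "st p a z = a (ix (dt p) (fst z)) (ix (dx p) (fst (snd z))) (ix (dx p) (snd (snd z)))"

lemma st_borel [measurable]: "st p a : Bor"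
 unfolding st_def[abs_def] by (rule measurable_step3)

abbreviation post where "post \<equiv> sc.post"
abbreviation mass where "mass \<equiv> sc.mass"

text \<open>One null sequence controls everything: the values after relaxation and the masses are no
  farther from their limits than the distribution functions.\<close>

definition err :: "nat => R3 => real" where
 "err p z = (SUM i:UNIV. \<bar>st p (%n jx jy. f p n i (jx, jy)) z - E i (v z)\<bar>)"

lemma err_borel [measurable]: "err p : Bor"
 unfolding err_def[abs_def] by measurable
lemma err_nonneg: "0 <= err p z" unfolding err_def by (auto intro: sum_nonneg)

lemma err_lim: "(%p. NN z. ennreal (ind (space_time T) z * err p z)) ----> 0"
 using f_lim unfolding err_def st_def .

lemma f_err: "(SUM i:UNIV. \<bar>st p (%n jx jy. f p n i (jx, jy)) z - E i (v z)\<bar>) <= err p z"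
 unfolding err_def by simp

text \<open>\<open>R\<close> contracts and fixes the equilibrium of \<open>v z\<close>, so
  relaxation does not increase the distance to it.\<close>

lemma post_err: "(SUM i:UNIV. \<bar>st p (%n jx jy. post p n i (jx, jy)) z - E i (v z)\<bar>) <= err p z"
proof -
 have "(SUM i:UNIV. \<bar>R (%k. f p n k j) i - R (%k. E k (v z)) i\<bar>) <= (SUM i:UNIV. \<bar>f p n i j - E i (v z)\<bar>)" for n j
  by (intro sc.contraction sc.admissible_f sc.admissible_E v_bound)
 thus ?thesis unfolding err_def st_def sc.post_def by (simp add: sc.R_eq)
qed

lemma mass_err: "\<bar>st p (%n jx jy. mass p n (jx, jy)) z - v z\<bar> <= err p z"
proof -
 have "st p (%n jx jy. mass p n (jx, jy)) z - v z
   = (SUM i:UNIV. st p (%n jx jy. f p n i (jx, jy)) z - E i (v z))"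
  unfolding st_def sc.mass_def sum_subtractf sc.E_sum by (rule refl)
 thus ?thesis unfolding err_def by simp
qed

lemma L1_of_err:
 assumes "!!p z. \<bar>a p z - \<alpha> z\<bar> <= c * err p z" "0 <= c"
 shows "(%p. NN z. ennreal (ind B z * \<bar>ind (space_time T) z * a p z - ind (space_time T) z * \<alpha> z\<bar>)) ----> 0"
proof (rule tendsto_sandwich[OF _ _ tendsto_const])
 let ?I = "%p. NN z. ennreal (ind (space_time T) z * err p z)"
 have "(%p. ennreal c * ?I p) ----> ennreal c * 0"
  by (intro tendsto_mult_ennreal tendsto_const err_lim) auto
 thus "(%p. ennreal c * ?I p) ----> 0" by simp
 have "(NN z. ennreal (ind B z * \<bar>ind (space_time T) z * a p z - ind (space_time T) z * \<alpha> z\<bar>))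
   <= ennreal c * ?I p" for p
 proof -
  have "(NN z. ennreal (ind B z * \<bar>ind (space_time T) z * a p z - ind (space_time T) z * \<alpha> z\<bar>))
    <= (NN z. ennreal c * ennreal (ind (space_time T) z * err p z))"
  proof (rule nn_integral_mono)
   fix z
   have "ind B z * \<bar>ind (space_time T) z * a p z - ind (space_time T) z * \<alpha> z\<bar>
    <= c * (ind (space_time T) z * err p z)"
    using assms(1)[of p z] assms(2) err_nonneg[of p z] by (auto simp: indicator_def)
   thus "ennreal (ind B z * \<bar>ind (space_time T) z * a p z - ind (space_time T) z * \<alpha> z\<bar>)
    <= ennreal c * ennreal (ind (space_time T) z * err p z)"
    using assms(2) err_nonneg[of p z] by (simp add: ennreal_mult[symmetric] ennreal_leI)
  qed
  thus ?thesis by (simp add: nn_integral_cmult)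
 qed
 thus "\<forall>\<^sub>F p in sequentially. (NN z. ennreal (ind B z * \<bar>ind (space_time T) z * a p z - ind (space_time T) z * \<alpha> z\<bar>))
   <= ennreal c * ?I p" by simp
qed auto

lemma sum_eq_integral3:
 assumes "!!n i j. n < N p ==> i \<ge> m \<or> j \<ge> m ==> a n i j = 0"
 shows "integ (%z. ind (space_time T) z * st p a z)"
  "dt p * dx p * dx p * (SUM n<N p. SUM i<m. SUM j<m. a n i j) = (LBINT z. ind (space_time T) z * st p a z)"
proof -
 have hb: "has_bochner_integral lborel (%z. ind ({0..<real (N p) * dt p} \<times> {0..} \<times> {0..}) z * st p a z)
  (dt p * dx p * dx p * (SUM n<N p. SUM i<m. SUM j<m. a n i j))"
  unfolding st_def by (rule has_integral_step3) (use assms dt_pos dx_pos in auto)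
 have ae: "AE z in lborel. ind ({0..<real (N p) * dt p} \<times> {0..} \<times> {0..}) z * st p a z
   = ind (space_time T) z * st p a z"
  using AE_space_time[of T] by eventually_elim (auto simp: indicator_def N_eq)
 have "{0..<real (N p) * dt p} \<times> {0::real..} \<times> {0::real..} : sets borel" by measurable
 note [measurable] = this
 have "has_bochner_integral lborel (%z. ind (space_time T) z * st p a z)
  (dt p * dx p * dx p * (SUM n<N p. SUM i<m. SUM j<m. a n i j))"
  by (rule iffD1[OF has_bochner_integral_cong_AE[OF _ _ ae] hb]) measurable
 thus "integ (%z. ind (space_time T) z * st p a z)"
  "dt p * dx p * dx p * (SUM n<N p. SUM i<m. SUM j<m. a n i j) = (LBINT z. ind (space_time T) z * st p a z)"
  by (auto simp: has_bochner_integral_iff)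
qed

end

locale lbm_test = lbm_limit + sampled T ps pst psx psy T' Rad C dt dx
 for ps pst psx psy T' Rad C
begin

text \<open>From index \<open>Jmax p - 1\<close> on, even the centre of the preceding cell lies
  beyond \<open>Rad\<close>, so forward and backward differences of the samples all vanish.\<close>

definition Jmax :: "nat => nat" where "Jmax p = ix (dx p) Rad + 4"

lemma Jmax_zero:
 assumes "Suc i \<ge> Jmax p" shows "Rad <= (real i - 1/2) * dx p"
proof -
 have "Rad < real (Suc (ix (dx p) Rad)) * dx p" using ix_bounds(2)[OF dx_pos] R_pos by simp
 also have "... <= (real i - 1/2) * dx p"
  using assms dx_pos[of p] by (intro mult_right_mono) (auto simp: Jmax_def)
 finally show ?thesis by simp
qed

lemma sm_zero':
 assumes "Rad <= (real i - 1/2) * dx p \<or> Rad <= (real j - 1/2) * dx p"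
 shows "sm p n i j = 0" "sm p n (Suc i) j = 0" "sm p n i (Suc j) = 0" "sm p n (i - 1) j = 0" "sm p n i (j - 1) = 0"
proof -
 have pos: "(real i - 1/2) * dx p < 0" if "i = 0" for i
  using dx_pos[of p] that by simp
 have *: "(real i - 1/2) * dx p <= (real i + 1/2) * dx p" "(real i - 1/2) * dx p <= (real (Suc i) + 1/2) * dx p"
   "i ~= 0 ==> (real i - 1/2) * dx p = (real (i - 1) + 1/2) * dx p" for i
  using dx_pos[of p] by (auto intro!: mult_right_mono)
 show "sm p n i j = 0" "sm p n (Suc i) j = 0" "sm p n i (Suc j) = 0"
  by (rule sm_zero; use assms *(1,2)[of i] *(1,2)[of j] in linarith)+
 show "sm p n (i - 1) j = 0"
  using pos[of i] pos[of j] *(1,3)[of i] *(1,3)[of j] R_pos assms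
  by (intro sm_zero) (smt (verit))
 show "sm p n i (j - 1) = 0"
  using pos[of i] pos[of j] *(1,3)[of i] *(1,3)[of j] R_pos assms
  by (intro sm_zero) (smt (verit))
qed

lemma D_zero:
 assumes "Rad <= (real i - 1/2) * dx p \<or> Rad <= (real j - 1/2) * dx p"
 shows "Dt p n i j = 0" "Dxp p n i j = 0" "Dxm p n i j = 0" "Dyp p n i j = 0" "Dym p n i j = 0"
 using sm_zero'[OF assms] by (simp_all add: Dt_def Dxp_def Dxm_def Dyp_def Dym_def)

text \<open>The margin \<open>2 * dx_max\<close> absorbs cells that stick out of the support and the
  reach of the backward differences.\<close>

definition box3 :: "(R3) set" where
 "box3 = {0..T} \<times> {0..Rad + 2 * dx_max} \<times> {0..Rad + 2 * dx_max}"

lemma box3: "box3 : sets borel" "emeasure lborel box3 < \<infinity>"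
proof -
 show "box3 : sets borel" unfolding box3_def by measurable
 have "bounded box3" unfolding box3_def by (intro bounded_Times bounded_closed_interval)
 thus "emeasure lborel box3 < \<infinity>" by (rule emeasure_bounded_finite)
qed

text \<open>The sum is an integral of a product of two step functions, to which
  \<open>tendsto_integral_prod\<close> applies. The factor \<open>c\<close> carries the sign with
  which backward quotients converge.\<close>

lemma weighted_sum_tendsto:
 assumes D0: "!!p n i j. Rad <= (real i - 1/2) * dx p \<or> Rad <= (real j - 1/2) * dx p ==> D p n i j = 0"
  and Db: "!!p n i j. \<bar>D p n i j\<bar> <= C"
  and Dl: "!!t x y. t > 0 ==> x > 0 ==> y > 0 ==>
    (%p. D p (ix (dt p) t) (ix (dx p) x) (ix (dx p) y)) ----> c * \<delta> t x y"
  and \<delta>: "\<delta> : {pst, psx, psy}"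
  and a: "!!p n i j. \<bar>a p n i j\<bar> <= C'" and \<alpha>: "!!z. \<bar>\<alpha> z\<bar> <= C'" and [measurable]: "\<alpha> : Bor"
  and lim: "!!p z. \<bar>st p (a p) z - \<alpha> z\<bar> <= K * err p z" "0 <= K"
 shows "(%p. dt p * dx p * dx p * (SUM n<N p. SUM i<Jmax p. SUM j<Jmax p. a p n i j * D p n i j))
   ----> (LBINT z. ind (space_time T) z * (\<alpha> z * (c * (case z of (t, x, y) => \<delta> t x y))))"
  and "integ (%z. ind (space_time T) z * (\<alpha> z * (c * (case z of (t, x, y) => \<delta> t x y))))"
proof -
 let ?ST = "ind (space_time T) :: _ => real"
 let ?\<delta> = "%z. ?ST z * (c * (case z of (t, x, y) => \<delta> t x y))"
 have eq: "dt p * dx p * dx p * (SUM n<N p. SUM i<Jmax p. SUM j<Jmax p. a p n i j * D p n i j)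
   = (LBINT z. (?ST z * st p (a p) z) * (?ST z * st p (D p) z))" for p
 proof -
  have "D p n i j = 0" if "i \<ge> Jmax p \<or> j \<ge> Jmax p" for n i j
   using that Jmax_zero[of p i] Jmax_zero[of p j] by (intro D0) auto
  hence "dt p * dx p * dx p * (SUM n<N p. SUM i<Jmax p. SUM j<Jmax p. a p n i j * D p n i j)
   = (LBINT z. ?ST z * st p (%n i j. a p n i j * D p n i j) z)"
   by (intro sum_eq_integral3) auto
  also have "... = (LBINT z. (?ST z * st p (a p) z) * (?ST z * st p (D p) z))"
   by (intro Bochner_Integration.integral_cong) (auto simp: st_def indicator_def)
  finally show ?thesis .
 qed
 have S0: "space_time T \<subseteq> {0<..} \<times> {0<..} \<times> {0<..}" unfolding space_time_def quarter_def by auto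
 have "continuous_on ({0<..} \<times> {0<..} \<times> {0<..}) (%(t, x, y). \<delta> t x y)"
  using tf \<delta> unfolding test_fun_def by blast
 hence cd: "continuous_on (space_time T) (%(t, x, y). \<delta> t x y)" using S0 by (rule continuous_on_subset)
 have [measurable]: "(%z. ?ST z * (case z of (t, x, y) => \<delta> t x y)) : Bor"
  using borel_measurable_continuous_on_indicator[OF _ cd] by simp
 have "?\<delta> = (%z. c * (?ST z * (case z of (t, x, y) => \<delta> t x y)))" by (auto simp: fun_eq_iff)
 hence [measurable]: "?\<delta> : Bor" by simp
  have Dbox: "\<bar>?ST z * st p (D p) z\<bar> <= C * ind box3 z" for p z
  proof (cases "z : space_time T")
   case True
   obtain t x y where z: "z = (t, x, y)" by (metis prod.exhaust)
   have txy: "0 < t" "t < T" "0 < x" "0 < y" using True z by (auto simp: space_time_def quarter_def)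
   have far: "Rad <= (real (ix (dx p) s) - 1/2) * dx p" if "Rad + 2 * dx_max < s" "0 < s" for s
   proof -
    have "s < real (ix (dx p) s) * dx p + dx p"
    using ix_bounds(2)[OF dx_pos, of s p] that by (simp add: distrib_right)
    thus ?thesis using that dx_le_max[of p] dx_pos[of p] by (simp add: left_diff_distrib)
   qed
   show ?thesis
   proof (cases "z : box3")
    case False
    hence "Rad + 2 * dx_max < x \<or> Rad + 2 * dx_max < y" using txy by (auto simp: z box3_def)
    hence "st p (D p) z = 0" unfolding st_def z using far txy by (auto intro!: D0)
    thus ?thesis using C_nonneg by simp
   qed (use Db C_nonneg in \<open>auto simp: st_def indicator_def\<close>)
  qed (use C_nonneg in auto)
  have Dlim: "(%p. ?ST z * st p (D p) z) ----> ?\<delta> z" for z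
  proof -
   obtain t x y where z: "z = (t, x, y)" by (metis prod.exhaust)
   show "(%p. ?ST z * st p (D p) z) ----> ?\<delta> z"
   proof (cases "z : space_time T")
    case True
    hence txy: "0 < t" "t < T" "0 < x" "0 < y" using z by (auto simp: space_time_def quarter_def)
    show ?thesis using tendsto_mult[OF tendsto_const Dl[OF txy(1,3,4)], of "?ST z"] by (simp add: z st_def)
   qed simp
  qed
  have dbox: "\<bar>?\<delta> z\<bar> <= C * ind box3 z" for z
   using LIMSEQ_le_const2[OF tendsto_rabs[OF Dlim[of z]], of "C * ind box3 z"] Dbox by blast
  have C'0: "0 <= C'" using \<alpha>[of 0] by simp
  have fin: "(LBINT z. (?ST z * \<alpha> z) * ?\<delta> z)
   = (LBINT z. ?ST z * (\<alpha> z * (c * (case z of (t, x, y) => \<delta> t x y))))"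
  by (intro Bochner_Integration.integral_cong) (auto simp: indicator_def)
  show "integ (%z. ?ST z * (\<alpha> z * (c * (case z of (t, x, y) => \<delta> t x y))))"
  proof (rule Bochner_Integration.integrable_bound)
   show "integ (%z. ind box3 z * (C' * C))"
    using box3 by simp
   have "(%z. ?ST z * (\<alpha> z * (c * (case z of (t, x, y) => \<delta> t x y)))) = (%z. \<alpha> z * ?\<delta> z)"
    by (auto simp: fun_eq_iff)
   thus "(%z. ?ST z * (\<alpha> z * (c * (case z of (t, x, y) => \<delta> t x y)))) : borel_measurable lborel"
    by simp
   show "AE z in lborel. norm (?ST z * (\<alpha> z * (c * (case z of (t, x, y) => \<delta> t x y)))) <= norm (ind box3 z * (C' * C))"
   proof (rule AE_I2)
    fix z
    have "norm (?ST z * (\<alpha> z * (c * (case z of (t, x, y) => \<delta> t x y)))) = \<bar>\<alpha> z\<bar> * \<bar>?\<delta> z\<bar>"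
    by (simp add: abs_mult mult_ac)
    also have "... <= C' * (C * ind box3 z)" by (intro mult_mono \<alpha> dbox C'0) auto
    also have "... <= norm (ind box3 z * (C' * C))" by (auto simp: indicator_def)
    finally show "norm (?ST z * (\<alpha> z * (c * (case z of (t, x, y) => \<delta> t x y)))) <= norm (ind box3 z * (C' * C))" .
   qed
  qed
 have "(%p. LBINT z. (?ST z * st p (a p) z) * (?ST z * st p (D p) z))
   ----> (LBINT z. (?ST z * \<alpha> z) * ?\<delta> z)"
 proof (rule tendsto_integral_prod[where B = box3 and C = C and C' = C'])
  show "box3 : sets lborel" "emeasure lborel box3 < \<infinity>" using box3 by auto
  show "\<bar>?ST z * st p (D p) z\<bar> <= C * ind box3 z" for p z by (rule Dbox)
  show "AE z in lborel. (%p. ?ST z * st p (D p) z) ----> ?\<delta> z" by (intro AE_I2 Dlim)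
  show "\<bar>?ST z * \<alpha> z\<bar> <= C'" "\<bar>?ST z * st p (a p) z\<bar> <= C'" for z p
   using \<alpha> a C'0 by (auto simp: indicator_def st_def)
  show "(%p. NN z. ennreal (ind box3 z * \<bar>?ST z * st p (a p) z - ?ST z * \<alpha> z\<bar>)) ----> 0"
   by (rule L1_of_err[OF lim])
 qed measurable
 thus "(%p. dt p * dx p * dx p * (SUM n<N p. SUM i<Jmax p. SUM j<Jmax p. a p n i j * D p n i j))
   ----> (LBINT z. ind (space_time T) z * (\<alpha> z * (c * (case z of (t, x, y) => \<delta> t x y))))"
  unfolding eq fin .
qed

end

context lbm_test
begin

text \<open>Entropy entering minus entropy leaving through the western edge. The factor
  \<open>(dx p)\<^sup>2\<close> is \<open>lam\<close> times the measure \<open>dt p * dx p\<close>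
  of a boundary cell.\<close>

definition bw :: "(vel => real => real) => nat => real" where
 "bw bet p = (dx p)\<^sup>2 * (SUM n<N p. SUM k<Jmax p. (bet XP (E XP (W p n k)) - bet XM (post p n XM (0, k))) * sm p (Suc n) 0 k)"

definition bs :: "(vel => real => real) => nat => real" where
 "bs bet p = (dx p)\<^sup>2 * (SUM n<N p. SUM k<Jmax p. (bet YP (E YP (S p n k)) - bet YM (post p n YM (k, 0))) * sm p (Suc n) k 0)"

abbreviation (input) at3 :: "(real => real => real => real) => R3 => real" where
 "at3 g z \<equiv> (case z of (t, x, y) => g t x y)"

text \<open>The density of the limiting weak form: \<open>lam\<close> times the difference of
  opposite velocities is the flux that belongs to \<open>bet\<close>. For the identity it is
  \<open>\<phi>x (v z)\<close> or \<open>\<phi>y (v z)\<close>.\<close>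

definition interior :: "(vel => real => real) => R3 => real" where
 "interior bet z = (SUM k:UNIV. bet k (E k (v z))) * at3 pst z
   + lam * ((bet XP (E XP (v z)) - bet XM (E XM (v z))) * at3 psx z
    + (bet YP (E YP (v z)) - bet YM (E YM (v z))) * at3 psy z)"

text \<open>Relaxation lowers the weighted sum because the weights are nonnegative, transport is
  summed by parts, and the resulting inequality telescopes in time.\<close>

lemma discrete_entropy:
 assumes psi: "!!t x y. 0 <= t ==> 0 <= x ==> 0 <= y ==> 0 <= ps t x y"
  and diss: "!!g. relaxation.admissible E U g ==> (SUM k:UNIV. bet k (R g k)) <= (SUM k:UNIV. bet k (g k))"
 shows "0 <= dx p * dx p * (SUM i<Jmax p. SUM j<Jmax p. (SUM k:UNIV. bet k (E k (A p (i, j)))) * sm p 0 i j)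
   + dt p * dx p * dx p * (SUM n<N p. SUM i<Jmax p. SUM j<Jmax p. (SUM k:UNIV. bet k (f p n k (i, j))) * Dt p n i j)
   + lam * (dt p * dx p * dx p * (SUM n<N p. SUM i<Jmax p. SUM j<Jmax p. bet XP (post p n XP (i, j)) * Dxp p (Suc n) i j)
    + dt p * dx p * dx p * (SUM n<N p. SUM i<Jmax p. SUM j<Jmax p. bet XM (post p n XM (i, j)) * Dxm p (Suc n) i j)
    + dt p * dx p * dx p * (SUM n<N p. SUM i<Jmax p. SUM j<Jmax p. bet YP (post p n YP (i, j)) * Dyp p (Suc n) i j)
    + dt p * dx p * dx p * (SUM n<N p. SUM i<Jmax p. SUM j<Jmax p. bet YM (post p n YM (i, j)) * Dym p (Suc n) i j))
   + bw bet p + bs bet p"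
proof -
 define J where "J = Jmax p"
 define b where "b n i j = (SUM k:UNIV. bet k (f p n k (i, j)))" for n i j
 define I where "I n = (SUM i<J. SUM j<J. b n i j * sm p n i j)" for n
 define Qt where "Qt n = (SUM i<J. SUM j<J. b n i j * (sm p (Suc n) i j - sm p n i j))" for n
 define Q1 where "Q1 n = (SUM i<J. SUM j<J. bet XP (post p n XP (i, j)) * (sm p (Suc n) (Suc i) j - sm p (Suc n) i j))" for n
 define Q2 where "Q2 n = (SUM i<J. SUM j<J. bet XM (post p n XM (i, j)) * (sm p (Suc n) (i - 1) j - sm p (Suc n) i j))" for n
 define Q3 where "Q3 n = (SUM i<J. SUM j<J. bet YP (post p n YP (i, j)) * (sm p (Suc n) i (Suc j) - sm p (Suc n) i j))" for n
 define Q4 where "Q4 n = (SUM i<J. SUM j<J. bet YM (post p n YM (i, j)) * (sm p (Suc n) i (j - 1) - sm p (Suc n) i j))" for n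
 define B1 where "B1 n = (SUM k<J. (bet XP (E XP (W p n k)) - bet XM (post p n XM (0, k))) * sm p (Suc n) 0 k)" for n
 define B2 where "B2 n = (SUM k<J. (bet YP (E YP (S p n k)) - bet YM (post p n YM (k, 0))) * sm p (Suc n) k 0)" for n
 have sm0: "0 <= sm p n i j" for n i j
  unfolding sample_def using half_pos by (intro psi) (auto intro: less_imp_le)
 have step: "I (Suc n) <= I n + (Qt n + Q1 n + Q2 n + Q3 n + Q4 n + B1 n + B2 n)" for n
 proof -
  let ?bs = "%k j. bet k (post p n k j)"
  let ?T = "transport (%k. bet XP (E XP (W p n k))) (%k. bet YP (E YP (S p n k))) ?bs"
  have T: "?T k (i, j) = bet k (f p (Suc n) k (i, j))" for k i j
   unfolding sc.f_Suc' by (cases k; simp)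
  have "I (Suc n) = (SUM i<J. SUM j<J. (SUM k:UNIV. ?T k (i, j)) * sm p (Suc n) i j)"
   unfolding I_def b_def T by (rule refl)
  moreover have "(SUM i<J. SUM j<J. (SUM k:UNIV. ?T k (i, j)) * sm p (Suc n) i j)
    = (SUM i<J. SUM j<J. (SUM k:UNIV. ?bs k (i, j)) * sm p (Suc n) i j)
    + Q1 n + Q2 n + Q3 n + Q4 n + B1 n + B2 n"
   unfolding Q1_def Q2_def Q3_def Q4_def B1_def B2_def
   by (rule transport_sum_weights) (use Jmax_zero J_def sm_zero' in blast)
  moreover have "(SUM i<J. SUM j<J. (SUM k:UNIV. ?bs k (i, j)) * sm p (Suc n) i j)
    <= (SUM i<J. SUM j<J. b n i j * sm p (Suc n) i j)"
   unfolding b_def sc.post_def by (intro sum_mono mult_right_mono diss sc.admissible_f sm0)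
  moreover have "(SUM i<J. SUM j<J. b n i j * sm p (Suc n) i j) = I n + Qt n"
   unfolding I_def Qt_def by (simp add: sum.distrib[symmetric] algebra_simps)
  ultimately show ?thesis by linarith
 qed
 have tel: "I m <= I 0 + (SUM n<m. Qt n + Q1 n + Q2 n + Q3 n + Q4 n + B1 n + B2 n)" for m
 proof (induction m)
  case (Suc m)
  thus ?case using step[of m] by simp
 qed simp
 \<comment> \<open>The test function has vanished before the final time, so the telescoped sum ends
   with zero.\<close>
 have "T' <= (real (N p) + 1/2) * dt p"
  using T'_bounds N_eq[of p] dt_pos[of p] by (simp add: distrib_right)
 hence "I (N p) = 0" unfolding I_def by (simp add: sm_zero)
 hence "0 <= I 0 + (SUM n<N p. Qt n + Q1 n + Q2 n + Q3 n + Q4 n + B1 n + B2 n)"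
  using tel[of "N p"] by simp
 hence "0 <= dx p * dx p * (I 0 + (SUM n<N p. Qt n + Q1 n + Q2 n + Q3 n + Q4 n + B1 n + B2 n))"
  using dx_pos[of p] by (intro mult_nonneg_nonneg) auto
 moreover have "dx p * dx p * (I 0 + (SUM n<N p. Qt n + Q1 n + Q2 n + Q3 n + Q4 n + B1 n + B2 n)) = dx p * dx p * I 0 + dx p * dx p * (SUM n<N p. Qt n) + dx p * dx p * (SUM n<N p. Q1 n)
   + dx p * dx p * (SUM n<N p. Q2 n) + dx p * dx p * (SUM n<N p. Q3 n) + dx p * dx p * (SUM n<N p. Q4 n)
   + dx p * dx p * (SUM n<N p. B1 n) + dx p * dx p * (SUM n<N p. B2 n)"
  by (simp add: sum.distrib distrib_left)
 moreover have "dx p * dx p * (SUM n<N p. Qt n)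
   = dt p * dx p * dx p * (SUM n<N p. SUM i<J. SUM j<J. b n i j * Dt p n i j)"
 proof -
  have "sm p (Suc n) i j - sm p n i j = dt p * Dt p n i j" for n i j
   using dt_pos[of p] by (simp add: Dt_def)
  thus ?thesis unfolding Qt_def sum_distrib_left by (simp add: mult_ac)
 qed
 moreover have "dx p * dx p * (SUM n<N p. Q1 n) = lam * (dt p * dx p * dx p
   * (SUM n<N p. SUM i<J. SUM j<J. bet XP (post p n XP (i, j)) * Dxp p (Suc n) i j))"
 proof -
  have "sm p (Suc n) (Suc i) j - sm p (Suc n) i j = dx p * Dxp p (Suc n) i j" for n i j
   using dx_pos[of p] by (simp add: Dxp_def)
  thus ?thesis unfolding Q1_def sum_distrib_left by (simp add: dt_eq mult_ac)
 qed
 moreover have "dx p * dx p * (SUM n<N p. Q2 n) = lam * (dt p * dx p * dx p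
   * (SUM n<N p. SUM i<J. SUM j<J. bet XM (post p n XM (i, j)) * Dxm p (Suc n) i j))"
 proof -
  have "sm p (Suc n) (i - 1) j - sm p (Suc n) i j = dx p * Dxm p (Suc n) i j" for n i j
   using dx_pos[of p] by (simp add: Dxm_def)
  thus ?thesis unfolding Q2_def sum_distrib_left by (simp add: dt_eq mult_ac)
 qed
 moreover have "dx p * dx p * (SUM n<N p. Q3 n) = lam * (dt p * dx p * dx p
   * (SUM n<N p. SUM i<J. SUM j<J. bet YP (post p n YP (i, j)) * Dyp p (Suc n) i j))"
 proof -
  have "sm p (Suc n) i (Suc j) - sm p (Suc n) i j = dx p * Dyp p (Suc n) i j" for n i j
   using dx_pos[of p] by (simp add: Dyp_def)
  thus ?thesis unfolding Q3_def sum_distrib_left by (simp add: dt_eq mult_ac)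
 qed
 moreover have "dx p * dx p * (SUM n<N p. Q4 n) = lam * (dt p * dx p * dx p
   * (SUM n<N p. SUM i<J. SUM j<J. bet YM (post p n YM (i, j)) * Dym p (Suc n) i j))"
 proof -
  have "sm p (Suc n) i (j - 1) - sm p (Suc n) i j = dx p * Dym p (Suc n) i j" for n i j
   using dx_pos[of p] by (simp add: Dym_def)
  thus ?thesis unfolding Q4_def sum_distrib_left by (simp add: dt_eq mult_ac)
 qed
 ultimately show ?thesis
  unfolding bw_def bs_def I_def B1_def B2_def J_def b_def sc.f_0
  by (simp only: distrib_left power2_eq_square)
qed

definition box2 :: "(R2) set" where
 "box2 = {0..Rad + 2 * dx_max} \<times> {0..Rad + 2 * dx_max}"

lemma box2: "box2 : sets borel" "emeasure lborel box2 < \<infinity>"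
proof -
 show "box2 : sets borel" unfolding box2_def by measurable
 have "bounded box2" unfolding box2_def by (intro bounded_Times bounded_closed_interval)
 thus "emeasure lborel box2 < \<infinity>" by (rule emeasure_bounded_finite)
qed

lemma sm_far:
 assumes "Rad + 2 * dx_max < s" shows "sm p n (ix (dx p) s) j = 0" "sm p n i (ix (dx p) s) = 0"
proof -
 have "0 <= s" using assms dx_max_pos R_pos by linarith
 hence "s < real (ix (dx p) s) * dx p + dx p"
  using ix_bounds(2)[OF dx_pos, of s p] by (simp add: distrib_right)
 hence "Rad <= (real (ix (dx p) s) + 1/2) * dx p"
  using assms dx_le_max[of p] dx_pos[of p] by (simp add: distrib_right)
 thus "sm p n (ix (dx p) s) j = 0" "sm p n i (ix (dx p) s) = 0"
  by (auto intro!: sm_zero)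
qed

text \<open>By \<open>E_dist\<close> the sum over velocities is 1-Lipschitz in the datum, so
  convergence of the cell averages of \<open>u0\<close> suffices.\<close>

lemma initial_tendsto:
 assumes lip: "!!k a b. \<bar>bet k a - bet k b\<bar> <= \<bar>a - b\<bar>"
 shows "(%p. dx p * dx p * (SUM i<Jmax p. SUM j<Jmax p. (SUM k:UNIV. bet k (E k (A p (i, j)))) * sm p 0 i j))
   ----> (LBINT z. ind quarter z * ((SUM k:UNIV. bet k (E k (u0 z))) * ps 0 (fst z) (snd z)))"
proof -
 define c where "c u = (SUM k:UNIV. bet k (E k u))" for u
 have clip: "\<bar>c u - c w\<bar> <= \<bar>u - w\<bar>" if "\<bar>u\<bar> <= U" "\<bar>w\<bar> <= U" for u w
 proof -
  have "\<bar>c u - c w\<bar> <= (SUM k:UNIV. \<bar>bet k (E k u) - bet k (E k w)\<bar>)"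
   unfolding c_def sum_subtractf[symmetric] by (rule sum_abs)
  also have "... <= (SUM k:UNIV. \<bar>E k u - E k w\<bar>)" by (intro sum_mono lip)
  also have "... = \<bar>u - w\<bar>" by (rule sc.E_dist[OF that])
  finally show ?thesis .
 qed
 have cb: "\<bar>c u\<bar> <= \<bar>c 0\<bar> + U" if "\<bar>u\<bar> <= U" for u
  using clip[OF that, of 0] that sc.U_nonneg by simp
 have "continuous_on UNIV (bet k)" for k
  unfolding continuous_on_iff dist_real_def using lip by (meson le_less_trans)
 hence [measurable]: "bet k : Bor" for k by (rule borel_measurable_continuous_onI)
 have [measurable]: "(%z. c (u0 z)) : Bor" unfolding c_def by measurable
 let ?Q = "ind quarter :: _ => real"
 let ?a = "%p z. c (A p (ix (dx p) (fst z), ix (dx p) (snd z)))"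
 let ?s = "%p z. sm p 0 (ix (dx p) (fst z)) (ix (dx p) (snd z))"
 have eq: "dx p * dx p * (SUM i<Jmax p. SUM j<Jmax p. (SUM k:UNIV. bet k (E k (A p (i, j)))) * sm p 0 i j)
   = (LBINT z. (?Q z * ?a p z) * (?Q z * ?s p z))" for p
 proof -
  have "dx p * dx p * (SUM i<Jmax p. SUM j<Jmax p. c (A p (i, j)) * sm p 0 i j)
   = (LBINT z. ?Q z * (c (A p (ix (dx p) (fst z), ix (dx p) (snd z))) * sm p 0 (ix (dx p) (fst z)) (ix (dx p) (snd z))))"
  proof (rule sum_eq_integral2(2)[OF dx_pos dx_pos])
   fix i j assume "Jmax p <= i \<or> Jmax p <= j"
   hence "Rad <= (real i - 1/2) * dx p \<or> Rad <= (real j - 1/2) * dx p"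
    using Jmax_zero[of p i] Jmax_zero[of p j] by auto
   thus "c (A p (i, j)) * sm p 0 i j = 0" by (simp add: sm_zero')
  qed
  also have "... = (LBINT z. (?Q z * ?a p z) * (?Q z * ?s p z))"
   by (intro Bochner_Integration.integral_cong) (auto simp: indicator_def)
  finally show ?thesis by (simp add: c_def)
 qed
 have cont: "continuous_on quarter (%z. ps 0 (fst z) (snd z))"
 proof -
  have c3: "continuous_on ({0..} \<times> {0..} \<times> {0..}) (%(t, x, y). ps t x y)" using tf unfolding test_fun_def by blast
  have "continuous_on quarter (%z. (%(t, x, y). ps t x y) (0, fst z, snd z))"
   by (rule continuous_on_compose2[OF c3]) (auto intro!: continuous_intros simp: quarter_def)
  thus ?thesis by (simp add: case_prod_beta')
 qed
 have [measurable]: "(%z. ?Q z * ps 0 (fst z) (snd z)) : Bor"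
  using borel_measurable_continuous_on_indicator[OF _ cont] by simp
 have [measurable]: "?a p : Bor" "?s p : Bor" for p
  by (rule measurable_step2)+
 have "(%p. LBINT z. (?Q z * ?a p z) * (?Q z * ?s p z))
   ----> (LBINT z. (?Q z * c (u0 z)) * (?Q z * ps 0 (fst z) (snd z)))"
 proof (rule tendsto_integral_prod[where B = box2 and C = C and C' = "\<bar>c 0\<bar> + U"])
  show "box2 : sets lborel" "emeasure lborel box2 < \<infinity>" using box2 by auto
  show "\<bar>?Q z * ?s p z\<bar> <= C * ind box2 z" for p z
  proof (cases "z : quarter & z \<notin> box2")
   case True
   hence "Rad + 2 * dx_max < fst z \<or> Rad + 2 * dx_max < snd z"
    by (auto simp: box2_def quarter_def mem_Times_iff)
   hence "?s p z = 0" using sm_far by auto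
   thus ?thesis using C_nonneg by simp
  qed (use sm_bound C_nonneg in \<open>auto simp: indicator_def\<close>)
  show "AE z in lborel. (%p. ?Q z * ?s p z) ----> ?Q z * ps 0 (fst z) (snd z)"
  proof (rule AE_I2)
   fix z :: "R2"
   show "(%p. ?Q z * ?s p z) ----> ?Q z * ps 0 (fst z) (snd z)"
   proof (cases "z : quarter")
    case True
    hence z: "0 <= fst z" "0 <= snd z" by (auto simp: quarter_def)
    have "(%p. (real 0 + 1/2) * dt p) ----> (real 0 + 1/2) * 0" by (intro tendsto_intros dt_lim)
    hence "(%p. (real 0 + 1/2) * dt p) ----> 0" by simp
    thus ?thesis
    unfolding sample_def using z half_pos
    by (intro tendsto_mult tendsto_const psi_tendsto mid_tendsto) (auto intro: less_imp_le dt_pos)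
   qed simp
  qed
  show "\<bar>?Q z * c (u0 z)\<bar> <= \<bar>c 0\<bar> + U" "\<bar>?Q z * ?a p z\<bar> <= \<bar>c 0\<bar> + U" for z p
   using cb[OF data_bound(1)] cb[OF sc.A_bound] sc.U_nonneg by (auto simp: indicator_def)
  have "(NN z. ennreal (ind box2 z * \<bar>?Q z * ?a p z - ?Q z * c (u0 z)\<bar>))
    <= (NN z. ennreal (ind ({0..Rad + 2 * dx_max} \<times> {0..Rad + 2 * dx_max}) z
    * \<bar>cell_int u0 (dx p) (dx p) (ix (dx p) (fst z)) (ix (dx p) (snd z)) / (dx p * dx p) - u0 z\<bar>))" for p
  proof (intro nn_integral_mono ennreal_leI)
   fix z
   have "\<bar>?a p z - c (u0 z)\<bar> <= \<bar>A p (ix (dx p) (fst z), ix (dx p) (snd z)) - u0 z\<bar>"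
    by (intro clip sc.A_bound data_bound)
   thus "ind box2 z * \<bar>?Q z * ?a p z - ?Q z * c (u0 z)\<bar>
    <= ind ({0..Rad + 2 * dx_max} \<times> {0..Rad + 2 * dx_max}) z
    * \<bar>cell_int u0 (dx p) (dx p) (ix (dx p) (fst z)) (ix (dx p) (snd z)) / (dx p * dx p) - u0 z\<bar>"
    by (auto simp: A_eq box2_def indicator_def)
  qed
  thus "(%p. NN z. ennreal (ind box2 z * \<bar>?Q z * ?a p z - ?Q z * c (u0 z)\<bar>)) ----> 0"
   using R_pos dx_max_pos
   by (intro tendsto_sandwich[OF _ _ tendsto_const cell_average_tendsto_nn[where w = u0 and h = dx and k = dx and U = U
    and a = "Rad + 2 * dx_max" and b = "Rad + 2 * dx_max"]])
    (auto intro!: always_eventually data_bound dx_pos dx_lim)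
 qed measurable
 moreover have "(LBINT z. (?Q z * c (u0 z)) * (?Q z * ps 0 (fst z) (snd z)))
   = (LBINT z. ?Q z * (c (u0 z) * ps 0 (fst z) (snd z)))"
  by (intro Bochner_Integration.integral_cong) (auto simp: indicator_def)
 ultimately show ?thesis unfolding eq c_def by simp
qed

text \<open>The boundary sums stay as they are, since \<open>L1\<close> convergence says nothing
  about them. The result is applied to the identity, to its negative and to the kinetic
  entropies.\<close>

lemma core:
 assumes psi: "!!t x y. 0 <= t ==> 0 <= x ==> 0 <= y ==> 0 <= ps t x y"
  and lip: "!!k a b. \<bar>bet k a - bet k b\<bar> <= \<bar>a - b\<bar>"
  and diss: "!!g. relaxation.admissible E U g ==> (SUM k:UNIV. bet k (R g k)) <= (SUM k:UNIV. bet k (g k))"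
 obtains c where "c ----> (LBINT z. ind (space_time T) z * interior bet z)
   + (LBINT z. ind quarter z * ((SUM k:UNIV. bet k (E k (u0 z))) * ps 0 (fst z) (snd z)))"
  "!!p. 0 <= c p + bw bet p + bs bet p"
  "integ (%z. ind (space_time T) z * interior bet z)"
proof -
 let ?ST = "ind (space_time T) :: _ => real"
 let ?b = "relaxation.bnd E U"
 let ?C' = "SUM k:UNIV. \<bar>bet k 0\<bar> + ?b"
 have "continuous_on UNIV (bet k)" for k
  unfolding continuous_on_iff dist_real_def using lip by (meson le_less_trans)
 hence [measurable]: "bet k : Bor" for k by (rule borel_measurable_continuous_onI)
 have b1: "\<bar>bet k a\<bar> <= \<bar>bet k 0\<bar> + ?b" if "\<bar>a\<bar> <= ?b" for k a
  using lip[of k a 0] that by simp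
 have bb: "0 <= ?b" using sc.admissible_abs_le[OF sc.admissible_f, of 0 0 XP "(0,0)"] by simp
 have b2: "\<bar>SUM k:UNIV. bet k (a k)\<bar> <= ?C'" if "!!k. \<bar>a k\<bar> <= ?b" for a
  by (intro order_trans[OF sum_abs] sum_mono b1 that)
 have b3: "\<bar>bet k a\<bar> <= ?C'" if "\<bar>a\<bar> <= ?b" for k a
  using b1[OF that, of k] member_le_sum[of k UNIV "%k. \<bar>bet k 0\<bar> + ?b"] bb by simp
 have fb: "\<bar>f p n k j\<bar> <= ?b" "\<bar>post p n k j\<bar> <= ?b" "\<bar>E k (v z)\<bar> <= ?b" for p n k j z
  using sc.admissible_abs_le[OF sc.admissible_f] sc.admissible_abs_le[OF sc.admissible_post]
   sc.admissible_abs_le[OF sc.admissible_E[OF v_bound]] by blast+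
 have e1: "\<bar>st p (%n i j. SUM k:UNIV. bet k (f p n k (i, j))) z - (SUM k:UNIV. bet k (E k (v z)))\<bar> <= 1 * err p z" for p z
 proof -
  have "\<bar>st p (%n i j. SUM k:UNIV. bet k (f p n k (i, j))) z - (SUM k:UNIV. bet k (E k (v z)))\<bar>
    <= (SUM k:UNIV. \<bar>bet k (st p (%n i j. f p n k (i, j)) z) - bet k (E k (v z))\<bar>)"
   unfolding st_def sum_subtractf[symmetric] by (rule sum_abs)
  also have "... <= (SUM k:UNIV. \<bar>st p (%n i j. f p n k (i, j)) z - E k (v z)\<bar>)" by (intro sum_mono lip)
  finally show ?thesis using f_err[of p z] by simp
 qed
 have e2: "\<bar>st p (%n i j. bet k (post p n k (i, j))) z - bet k (E k (v z))\<bar> <= 1 * err p z" for p z k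
 proof -
  have "\<bar>st p (%n i j. bet k (post p n k (i, j))) z - bet k (E k (v z))\<bar>
    <= \<bar>st p (%n i j. post p n k (i, j)) z - E k (v z)\<bar>" unfolding st_def by (rule lip)
  also have "... <= (SUM k:UNIV. \<bar>st p (%n i j. post p n k (i, j)) z - E k (v z)\<bar>)"
   by (rule member_le_sum) auto
  finally show ?thesis using post_err[of p z] by simp
 qed
 note wst = weighted_sum_tendsto[where K = 1 and C' = ?C']
 let ?It = "%z. ?ST z * ((SUM k:UNIV. bet k (E k (v z))) * (1 * at3 pst z))"
 let ?Ixp = "%z. ?ST z * (bet XP (E XP (v z)) * (1 * at3 psx z))"
 let ?Ixm = "%z. ?ST z * (bet XM (E XM (v z)) * (- 1 * at3 psx z))"
 let ?Iyp = "%z. ?ST z * (bet YP (E YP (v z)) * (1 * at3 psy z))"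
 let ?Iym = "%z. ?ST z * (bet YM (E YM (v z)) * (- 1 * at3 psy z))"
 let ?s = "%a p. dt p * dx p * dx p * (SUM n<N p. SUM i<Jmax p. SUM j<Jmax p. a p n i j)"
 have Lt: "?s (%p n i j. (SUM k:UNIV. bet k (f p n k (i, j))) * Dt p n i j) ----> (LBINT z. ?It z)"
  and It: "integ ?It"
  by (rule wst[where D = "Dt" and \<delta> = pst and c = "1" and a = "%p n i j. SUM k:UNIV. bet k (f p n k (i, j))" and \<alpha> = "%z. SUM k:UNIV. bet k (E k (v z))"],
    rule D_zero(1), assumption, rule D_bounds(1), simp only: mult_1, rule D_tendsto(1), assumption+, simp,
    rule b2, rule fb, rule b2, rule fb, measurable, rule e1, simp)+
 have Lxp: "?s (%p n i j. bet XP (post p n XP (i, j)) * Dxp p (Suc n) i j) ----> (LBINT z. ?Ixp z)"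
  and Ixp: "integ ?Ixp"
  by (rule wst[where D = "%p n. Dxp p (Suc n)" and \<delta> = psx and c = "1" and a = "%p n i j. bet XP (post p n XP (i, j))" and \<alpha> = "%z. bet XP (E XP (v z))"],
    rule D_zero(2), assumption, rule D_bounds(2), simp only: mult_1, rule D_tendsto(2), assumption+, simp,
    rule b3, rule fb, rule b3, rule fb, measurable, rule e2, simp)+
 have Lxm: "?s (%p n i j. bet XM (post p n XM (i, j)) * Dxm p (Suc n) i j) ----> (LBINT z. ?Ixm z)"
  and Ixm: "integ ?Ixm"
  by (rule wst[where D = "%p n. Dxm p (Suc n)" and \<delta> = psx and c = "- 1" and a = "%p n i j. bet XM (post p n XM (i, j))" and \<alpha> = "%z. bet XM (E XM (v z))"],
    rule D_zero(3), assumption, rule Dm_bounds(1), simp only: mult_minus1, rule D_tendsto(3), assumption+, simp,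
    rule b3, rule fb, rule b3, rule fb, measurable, rule e2, simp)+
 have Lyp: "?s (%p n i j. bet YP (post p n YP (i, j)) * Dyp p (Suc n) i j) ----> (LBINT z. ?Iyp z)"
  and Iyp: "integ ?Iyp"
  by (rule wst[where D = "%p n. Dyp p (Suc n)" and \<delta> = psy and c = "1" and a = "%p n i j. bet YP (post p n YP (i, j))" and \<alpha> = "%z. bet YP (E YP (v z))"],
    rule D_zero(4), assumption, rule D_bounds(3), simp only: mult_1, rule D_tendsto(4), assumption+, simp,
    rule b3, rule fb, rule b3, rule fb, measurable, rule e2, simp)+
 have Lym: "?s (%p n i j. bet YM (post p n YM (i, j)) * Dym p (Suc n) i j) ----> (LBINT z. ?Iym z)"
  and Iym: "integ ?Iym"
  by (rule wst[where D = "%p n. Dym p (Suc n)" and \<delta> = psy and c = "- 1" and a = "%p n i j. bet YM (post p n YM (i, j))" and \<alpha> = "%z. bet YM (E YM (v z))"],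
    rule D_zero(5), assumption, rule Dm_bounds(2), simp only: mult_minus1, rule D_tendsto(5), assumption+, simp,
    rule b3, rule fb, rule b3, rule fb, measurable, rule e2, simp)+
 have int_eq: "?ST z * interior bet z = ?It z + lam * (?Ixp z + ?Ixm z + ?Iyp z + ?Iym z)" for z
  unfolding interior_def by (simp add: algebra_simps)
 have Int: "(LBINT z. ?ST z * interior bet z) = (LBINT z. ?It z)
   + lam * ((LBINT z. ?Ixp z) + (LBINT z. ?Ixm z) + (LBINT z. ?Iyp z) + (LBINT z. ?Iym z))"
  unfolding int_eq using It Ixp Ixm Iyp Iym by simp
 show ?thesis
 proof (rule that)
  show "(%p. ?s (%p n i j. (SUM k:UNIV. bet k (f p n k (i, j))) * Dt p n i j) p
    + lam * (?s (%p n i j. bet XP (post p n XP (i, j)) * Dxp p (Suc n) i j) p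
    + ?s (%p n i j. bet XM (post p n XM (i, j)) * Dxm p (Suc n) i j) p
    + ?s (%p n i j. bet YP (post p n YP (i, j)) * Dyp p (Suc n) i j) p
    + ?s (%p n i j. bet YM (post p n YM (i, j)) * Dym p (Suc n) i j) p)
    + dx p * dx p * (SUM i<Jmax p. SUM j<Jmax p. (SUM k:UNIV. bet k (E k (A p (i, j)))) * sm p 0 i j))
   ----> (LBINT z. ?ST z * interior bet z)
   + (LBINT z. ind quarter z * ((SUM k:UNIV. bet k (E k (u0 z))) * ps 0 (fst z) (snd z)))"
   unfolding Int by (intro tendsto_add tendsto_mult tendsto_const Lt Lxp Lxm Lyp Lym initial_tendsto lip)
  show "0 <= ?s (%p n i j. (SUM k:UNIV. bet k (f p n k (i, j))) * Dt p n i j) p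
    + lam * (?s (%p n i j. bet XP (post p n XP (i, j)) * Dxp p (Suc n) i j) p
    + ?s (%p n i j. bet XM (post p n XM (i, j)) * Dxm p (Suc n) i j) p
    + ?s (%p n i j. bet YP (post p n YP (i, j)) * Dyp p (Suc n) i j) p
    + ?s (%p n i j. bet YM (post p n YM (i, j)) * Dym p (Suc n) i j) p)
    + dx p * dx p * (SUM i<Jmax p. SUM j<Jmax p. (SUM k:UNIV. bet k (E k (A p (i, j)))) * sm p 0 i j)
    + bw bet p + bs bet p" for p
   using discrete_entropy[OF psi diss, of p] by (simp add: add_ac)
  show "integ (%z. ?ST z * interior bet z)"
   unfolding int_eq using It Ixp Ixm Iyp Iym by simp
 qed
qed

end

section \<open>Bounded variation and integrability of the limit\<close>

lemma (in bounded_scheme) mass_y_var: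
 assumes "n < N"
 shows "h * (SUM jx<J. SUM jy<J. \<bar>mass n (jx, Suc jy) - mass n (jx, jy)\<bar>) <= tv_bound"
proof -
 interpret sw: bounded_scheme "%i. E (vswap i)" "%g i. R (%k. g (vswap k)) (vswap i)" U
  "%j. A (prod.swap j)" S W "%n i j. f n (vswap i) (prod.swap j)" h M N
  by (rule bounded_swapped)
 have "sw.mass n (jy, jx) = mass n (jx, jy)" for jx jy
  using swapped_mass[of n "(jy, jx)"] by simp
 thus ?thesis
  using sw.mass_x_var[OF assms, of J] swapped_tv_bound by (subst sum.swap) simp
qed

text \<open>Since \<open>s\<close> vanishes at both ends, Abel summation leaves no boundary
  terms.\<close>

lemma abel_summation_bound:
 fixes m s :: "nat => real"
 assumes "s 0 = 0" "s J = 0" "!!i. \<bar>s i\<bar> <= 1"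
 shows "\<bar>SUM i<J. m i * (s (Suc i) - s i)\<bar> <= (SUM i<J. \<bar>m (Suc i) - m i\<bar>)"
proof -
 have "(SUM i<K. m i * (s (Suc i) - s i)) = m K * s K - m 0 * s 0 - (SUM i<K. (m (Suc i) - m i) * s (Suc i))" for K
  by (induction K) (simp_all add: algebra_simps)
 hence "\<bar>SUM i<J. m i * (s (Suc i) - s i)\<bar> = \<bar>SUM i<J. (m (Suc i) - m i) * s (Suc i)\<bar>"
  using assms by simp
 also have "... <= (SUM i<J. \<bar>(m (Suc i) - m i) * s (Suc i)\<bar>)" by (rule sum_abs)
 also have "... <= (SUM i<J. \<bar>m (Suc i) - m i\<bar>)"
  using assms(3) by (intro sum_mono) (simp add: abs_mult mult_left_le)
 finally show ?thesis .
qed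

context lbm_limit
begin

lemma tv_bound_eq: "sc.tv_bound = (6 + 2 * U) * M"
 by (simp add: sc.tv_bound_def)

lemma tv_nonneg: "0 <= (6 + 2 * U) * M"
proof -
 have "0 <= dx 0 * real (N 0)" using dx_pos[of 0] by simp
 hence "0 <= M" using sc.hN[of 0] by linarith
 thus ?thesis using sc.U_nonneg by simp
qed

lemma mass_tv_sum:
 "dt p * dx p * (SUM n<N p. SUM i<J. SUM j<J. \<bar>mass p n (Suc i, j) - mass p n (i, j)\<bar>) <= T * ((6 + 2 * U) * M)"
 "dt p * dx p * (SUM n<N p. SUM i<J. SUM j<J. \<bar>mass p n (i, Suc j) - mass p n (i, j)\<bar>) <= T * ((6 + 2 * U) * M)"
 "dx p * dx p * (SUM n<N p. SUM i<J. SUM j<J. \<bar>mass p (Suc n) (i, j) - mass p n (i, j)\<bar>) <= 2 * lam * T * ((6 + 2 * U) * M)"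
proof -
 have *: "dt p * (SUM n<N p. dx p * F n) <= T * c" if "!!n. n < N p ==> dx p * F n <= c" for F c
 proof -
  have "(SUM n<N p. dx p * F n) <= real (N p) * c" using sum_bounded_above[of "{..<N p}" "%n. dx p * F n" c] that by simp
  hence "dt p * (SUM n<N p. dx p * F n) <= dt p * (real (N p) * c)" using dt_pos[of p] by simp
  also have "... = (real (N p) * dt p) * c" by simp
  finally show ?thesis by (simp only: N_eq)
 qed
 show "dt p * dx p * (SUM n<N p. SUM i<J. SUM j<J. \<bar>mass p n (Suc i, j) - mass p n (i, j)\<bar>) <= T * ((6 + 2 * U) * M)"
  using *[OF sc.mass_x_var[of _ p J]] unfolding tv_bound_eq sum_distrib_left[symmetric] by (simp add: mult.assoc)
 show "dt p * dx p * (SUM n<N p. SUM i<J. SUM j<J. \<bar>mass p n (i, Suc j) - mass p n (i, j)\<bar>) <= T * ((6 + 2 * U) * M)"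
  using *[OF sc.mass_y_var[of _ p J]] unfolding tv_bound_eq sum_distrib_left[symmetric] by (simp add: mult.assoc)
 have "dt p * (dx p * (SUM n<N p. SUM i<J. SUM j<J. \<bar>mass p (Suc n) (i, j) - mass p n (i, j)\<bar>)) <= T * (2 * ((6 + 2 * U) * M))"
  using *[OF sc.mass_t_var_bound[of _ p J]] unfolding tv_bound_eq sum_distrib_left[symmetric] .
 hence "lam * (dt p * (dx p * (SUM n<N p. SUM i<J. SUM j<J. \<bar>mass p (Suc n) (i, j) - mass p n (i, j)\<bar>))) <= lam * (T * (2 * ((6 + 2 * U) * M)))"
  using lam_pos by simp
 moreover have "lam * (dt p * (dx p * X)) = dx p * dx p * X" for X by (simp add: dt_eq mult_ac)
 ultimately show "dx p * dx p * (SUM n<N p. SUM i<J. SUM j<J. \<bar>mass p (Suc n) (i, j) - mass p n (i, j)\<bar>) <= 2 * lam * T * ((6 + 2 * U) * M)"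
  by (simp add: mult_ac)
qed

text \<open>The masses are bounded in \<open>L1\<close> on finite blocks, uniformly in the block;
  monotone convergence over growing boxes then covers the whole domain.\<close>

lemma v_integrable: "integ (%z. ind (space_time T) z * v z)"
proof -
 let ?ST = "ind (space_time T) :: _ => real"
 let ?B = "%k::nat. ind (UNIV \<times> {..<real k} \<times> {..<real k}) :: _ => real"
 have [measurable]: "(UNIV::real set) \<times> {..<real k} \<times> {..<real k} : sets borel" for k by measurable
 have box: "(NN z. ennreal (?B k z * (?ST z * \<bar>v z\<bar>))) <= ennreal (T * (3 * M))" for k
 proof (rule LIMSEQ_le_const)
  show "(%p. ennreal (T * (3 * M)) + (NN z. ennreal (?ST z * err p z))) ----> ennreal (T * (3 * M))"
   using tendsto_add[OF tendsto_const err_lim] by simp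
  have "(NN z. ennreal (?B k z * (?ST z * \<bar>v z\<bar>)))
    <= ennreal (T * (3 * M)) + (NN z. ennreal (?ST z * err p z))" for p
  proof -
   define J where "J = Suc (ix (dx p) (real k))"
   define m where "m n i j = (if i < J & j < J then \<bar>mass p n (i, j)\<bar> else 0)" for n i j
   have J: "ix (dx p) x < J" if "0 <= x" "x < real k" for x
    using that ix_less_iff[OF dx_pos that(1), of p J] ix_bounds(2)[OF dx_pos, of "real k" p]
    unfolding J_def by (simp del: of_nat_Suc)
   have "(NN z. ennreal (?B k z * (?ST z * \<bar>v z\<bar>)))
    <= (NN z. ennreal (?ST z * st p m z) + ennreal (?ST z * err p z))"
   proof (rule nn_integral_mono)
    fix z
    have m0: "0 <= st p m z" by (simp add: st_def m_def)
    have "?B k z * (?ST z * \<bar>v z\<bar>) <= ?ST z * st p m z + ?ST z * err p z"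
    proof (cases "z : space_time T & fst (snd z) < real k & snd (snd z) < real k")
    case True
    hence "st p m z = \<bar>st p (%n i j. mass p n (i, j)) z\<bar>"
    using J by (auto simp: st_def m_def space_time_def quarter_def)
    thus ?thesis using True mass_err[of p z] by (simp add: indicator_def mem_Times_iff)
    next
    case False
    thus ?thesis using m0 err_nonneg[of p z] by (auto simp: indicator_def mem_Times_iff)
    qed
    hence "ennreal (?B k z * (?ST z * \<bar>v z\<bar>)) <= ennreal (?ST z * st p m z + ?ST z * err p z)"
    by (rule ennreal_leI)
    thus "ennreal (?B k z * (?ST z * \<bar>v z\<bar>)) <= ennreal (?ST z * st p m z) + ennreal (?ST z * err p z)"
    using m0 err_nonneg[of p z] by simp
   qed
   also have "... = (NN z. ennreal (?ST z * st p m z)) + (NN z. ennreal (?ST z * err p z))"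
    by (rule nn_integral_add) measurable
   also have "(NN z. ennreal (?ST z * st p m z)) = ennreal (LBINT z. ?ST z * st p m z)"
   proof (rule nn_integral_eq_integral)
    show "integ (%z. ?ST z * st p m z)"
    by (rule sum_eq_integral3(1)[where m = J]) (auto simp: m_def)
   qed (auto simp: m_def st_def)
   also have "(LBINT z. ?ST z * st p m z) = dt p * dx p * dx p * (SUM n<N p. SUM i<J. SUM j<J. m n i j)"
    by (rule sum_eq_integral3(2)[symmetric]) (auto simp: m_def)
   also have "... <= T * (3 * M)"
   proof -
    have "(SUM n<N p. (dx p)\<^sup>2 * (SUM i<J. SUM j<J. m n i j)) <= real (N p) * (3 * M)"
    using sum_bounded_above[of "{..<N p}" "%n. (dx p)\<^sup>2 * (SUM i<J. SUM j<J. m n i j)" "3 * M"]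
    sc.mass_l1_bound[of _ p J] by (simp add: m_def)
    hence "dt p * (SUM n<N p. (dx p)\<^sup>2 * (SUM i<J. SUM j<J. m n i j)) <= dt p * (real (N p) * (3 * M))"
    using dt_pos[of p] by simp
    also have "... = (real (N p) * dt p) * (3 * M)" by simp
    finally show ?thesis
    unfolding N_eq sum_distrib_left[symmetric] by (simp add: power2_eq_square mult.assoc)
   qed
   finally show ?thesis by (simp add: add_right_mono ennreal_leI)
  qed
  thus "EX N. \<forall>p\<ge>N. (NN z. ennreal (?B k z * (?ST z * \<bar>v z\<bar>)))
    <= ennreal (T * (3 * M)) + (NN z. ennreal (?ST z * err p z))" by blast
 qed
 have sup: "(SUP k. ennreal (?B k z * (?ST z * \<bar>v z\<bar>))) = ennreal (?ST z * \<bar>v z\<bar>)" for z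
 proof (rule antisym)
  obtain k :: nat where "max (fst (snd z)) (snd (snd z)) < real k" using reals_Archimedean2 by blast
  hence e: "?B k z * (?ST z * \<bar>v z\<bar>) = ?ST z * \<bar>v z\<bar>" by (simp add: indicator_def mem_Times_iff)
  have "ennreal (?B k z * (?ST z * \<bar>v z\<bar>)) <= (SUP k. ennreal (?B k z * (?ST z * \<bar>v z\<bar>)))"
   by (rule SUP_upper) simp
  thus "ennreal (?ST z * \<bar>v z\<bar>) <= (SUP k. ennreal (?B k z * (?ST z * \<bar>v z\<bar>)))"
   unfolding e .
 qed (auto intro!: SUP_least ennreal_leI simp: indicator_def)
 have "(NN z. (SUP k. ennreal (?B k z * (?ST z * \<bar>v z\<bar>))))
   = (SUP k. NN z. ennreal (?B k z * (?ST z * \<bar>v z\<bar>)))"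
 proof (rule nn_integral_monotone_convergence_SUP)
  show "incseq (%k z. ennreal (?B k z * (?ST z * \<bar>v z\<bar>)))"
   by (auto simp: incseq_def le_fun_def indicator_def intro!: ennreal_leI)
 qed measurable
 also have "... <= ennreal (T * (3 * M))" by (intro SUP_least box)
 finally have le: "(NN z. ennreal (?ST z * \<bar>v z\<bar>)) <= ennreal (T * (3 * M))"
  unfolding sup .
 show ?thesis
 proof (rule integrableI_bounded)
  have "ennreal (norm (?ST z * v z)) = ennreal (?ST z * \<bar>v z\<bar>)" for z by (simp add: abs_mult)
  hence "(NN z. ennreal (norm (?ST z * v z))) <= ennreal (T * (3 * M))"
   using le by simp
  thus "(NN z. ennreal (norm (?ST z * v z))) < \<infinity>"
   by (rule le_less_trans) simp
 qed measurable
qed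

end

context lbm_test
begin

text \<open>This is lower semicontinuity of the variation. The test function vanishes near the
  faces, so once the grid is finer than \<open>r\<close>, Abel summation moves the difference
  quotients to the masses without boundary terms.\<close>

lemma variation_bounds:
 assumes supp: "0 < r" "!!t x y. t <= r \<or> x <= r \<or> y <= r ==> ps t x y = 0" and le1: "!!t x y. \<bar>ps t x y\<bar> <= 1"
 shows "\<bar>LBINT z. ind (space_time T) z * (v z * (case z of (t, x, y) => psx t x y))\<bar> <= T * ((6 + 2 * U) * M)"
  "\<bar>LBINT z. ind (space_time T) z * (v z * (case z of (t, x, y) => psy t x y))\<bar> <= T * ((6 + 2 * U) * M)"
  "\<bar>LBINT z. ind (space_time T) z * (v z * (case z of (t, x, y) => pst t x y))\<bar> <= 2 * lam * T * ((6 + 2 * U) * M)"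
  "integ (%z. ind (space_time T) z * (v z * (case z of (t, x, y) => psx t x y)))"
  "integ (%z. ind (space_time T) z * (v z * (case z of (t, x, y) => psy t x y)))"
  "integ (%z. ind (space_time T) z * (v z * (case z of (t, x, y) => pst t x y)))"
proof -
 note wst = weighted_sum_tendsto[where K = 1 and C' = U and c = 1 and a = "%p n i j. mass p n (i, j)" and \<alpha> = v]
 have e: "\<bar>st p (%n i j. mass p n (i, j)) z - v z\<bar> <= 1 * err p z" for p z using mass_err[of p z] by simp
 have J0: "sm p n (Jmax p) j = 0" "sm p n i (Jmax p) = 0" for p n i j
  using Jmax_zero[of p "Jmax p"] by (auto intro!: sm_zero')
 have le1': "\<bar>sm p n i j\<bar> <= 1" for p n i j unfolding sample_def by (rule le1)
 have ev: "\<forall>\<^sub>F p in sequentially. dx p < r & dt p < r"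
  using order_tendstoD(2)[OF dx_lim supp(1)] order_tendstoD(2)[OF dt_lim supp(1)] by eventually_elim auto
 have Lx: "(%p. dt p * dx p * dx p * (SUM n<N p. SUM i<Jmax p. SUM j<Jmax p. mass p n (i, j) * Dxp p (Suc n) i j))
   ----> (LBINT z. ind (space_time T) z * (v z * (1 * (case z of (t, x, y) => psx t x y))))"
  and Ix: "integ (%z. ind (space_time T) z * (v z * (1 * (case z of (t, x, y) => psx t x y))))"
  by (rule wst[where D = "%p n. Dxp p (Suc n)" and \<delta> = psx], rule D_zero(2), assumption, rule D_bounds(2),
    simp only: mult_1, rule D_tendsto(2), assumption+, simp, rule sc.mass_bound, rule v_bound, measurable, rule e, simp)+
 have Ly: "(%p. dt p * dx p * dx p * (SUM n<N p. SUM i<Jmax p. SUM j<Jmax p. mass p n (i, j) * Dyp p (Suc n) i j))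
   ----> (LBINT z. ind (space_time T) z * (v z * (1 * (case z of (t, x, y) => psy t x y))))"
  and Iy: "integ (%z. ind (space_time T) z * (v z * (1 * (case z of (t, x, y) => psy t x y))))"
  by (rule wst[where D = "%p n. Dyp p (Suc n)" and \<delta> = psy], rule D_zero(4), assumption, rule D_bounds(3),
    simp only: mult_1, rule D_tendsto(4), assumption+, simp, rule sc.mass_bound, rule v_bound, measurable, rule e, simp)+
 have Lt: "(%p. dt p * dx p * dx p * (SUM n<N p. SUM i<Jmax p. SUM j<Jmax p. mass p n (i, j) * Dt p n i j))
   ----> (LBINT z. ind (space_time T) z * (v z * (1 * (case z of (t, x, y) => pst t x y))))"
  and It: "integ (%z. ind (space_time T) z * (v z * (1 * (case z of (t, x, y) => pst t x y))))"
  by (rule wst[where D = Dt and \<delta> = pst], rule D_zero(1), assumption, rule D_bounds(1),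
    simp only: mult_1, rule D_tendsto(1), assumption+, simp, rule sc.mass_bound, rule v_bound, measurable, rule e, simp)+
 have bx: "\<forall>\<^sub>F p in sequentially. \<bar>dt p * dx p * dx p * (SUM n<N p. SUM i<Jmax p. SUM j<Jmax p. mass p n (i, j) * Dxp p (Suc n) i j)\<bar>
   <= T * ((6 + 2 * U) * M)"
  using ev
 proof eventually_elim
  case (elim p)
  let ?J = "Jmax p"
  have s0: "sm p n 0 j = 0" for n j
   unfolding sample_def using elim dx_pos[of p] by (intro supp(2)) auto
  have "dt p * dx p * dx p * (SUM n<N p. SUM i<?J. SUM j<?J. mass p n (i, j) * Dxp p (Suc n) i j)
    = dt p * dx p * (SUM n<N p. SUM j<?J. SUM i<?J. mass p n (i, j) * (sm p (Suc n) (Suc i) j - sm p (Suc n) i j))"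
  proof -
   have "sm p (Suc n) (Suc i) j - sm p (Suc n) i j = dx p * Dxp p (Suc n) i j" for n i j
    using dx_pos[of p] by (simp add: Dxp_def)
   thus ?thesis by (subst (2) sum.swap) (simp add: sum_distrib_left mult_ac)
  qed
  moreover have "\<bar>SUM n<N p. SUM j<?J. SUM i<?J. mass p n (i, j) * (sm p (Suc n) (Suc i) j - sm p (Suc n) i j)\<bar>
    <= (SUM n<N p. SUM j<?J. SUM i<?J. \<bar>mass p n (Suc i, j) - mass p n (i, j)\<bar>)"
   by (intro order_trans[OF sum_abs] sum_mono abel_summation_bound s0 J0 le1')
  ultimately have "\<bar>dt p * dx p * dx p * (SUM n<N p. SUM i<?J. SUM j<?J. mass p n (i, j) * Dxp p (Suc n) i j)\<bar>
    <= dt p * dx p * (SUM n<N p. SUM j<?J. SUM i<?J. \<bar>mass p n (Suc i, j) - mass p n (i, j)\<bar>)"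
   using dt_pos[of p] dx_pos[of p] by (simp add: abs_mult mult_left_mono)
  moreover have "(SUM n<N p. SUM j<?J. SUM i<?J. \<bar>mass p n (Suc i, j) - mass p n (i, j)\<bar>)
    = (SUM n<N p. SUM i<?J. SUM j<?J. \<bar>mass p n (Suc i, j) - mass p n (i, j)\<bar>)"
   by (intro sum.cong refl sum.swap)
  ultimately show ?case using mass_tv_sum(1)[of p ?J] by simp
 qed
 have byy: "\<forall>\<^sub>F p in sequentially. \<bar>dt p * dx p * dx p * (SUM n<N p. SUM i<Jmax p. SUM j<Jmax p. mass p n (i, j) * Dyp p (Suc n) i j)\<bar>
   <= T * ((6 + 2 * U) * M)"
  using ev
 proof eventually_elim
  case (elim p)
  let ?J = "Jmax p"
  have s0: "sm p n i 0 = 0" for n i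
   unfolding sample_def using elim dx_pos[of p] by (intro supp(2)) auto
  have "dt p * dx p * dx p * (SUM n<N p. SUM i<?J. SUM j<?J. mass p n (i, j) * Dyp p (Suc n) i j)
    = dt p * dx p * (SUM n<N p. SUM i<?J. SUM j<?J. mass p n (i, j) * (sm p (Suc n) i (Suc j) - sm p (Suc n) i j))"
  proof -
   have "sm p (Suc n) i (Suc j) - sm p (Suc n) i j = dx p * Dyp p (Suc n) i j" for n i j
    using dx_pos[of p] by (simp add: Dyp_def)
   thus ?thesis by (simp add: sum_distrib_left mult_ac)
  qed
  moreover have "\<bar>SUM n<N p. SUM i<?J. SUM j<?J. mass p n (i, j) * (sm p (Suc n) i (Suc j) - sm p (Suc n) i j)\<bar>
    <= (SUM n<N p. SUM i<?J. SUM j<?J. \<bar>mass p n (i, Suc j) - mass p n (i, j)\<bar>)"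
   by (intro order_trans[OF sum_abs] sum_mono abel_summation_bound s0 J0 le1')
  ultimately have "\<bar>dt p * dx p * dx p * (SUM n<N p. SUM i<?J. SUM j<?J. mass p n (i, j) * Dyp p (Suc n) i j)\<bar>
    <= dt p * dx p * (SUM n<N p. SUM i<?J. SUM j<?J. \<bar>mass p n (i, Suc j) - mass p n (i, j)\<bar>)"
   using dt_pos[of p] dx_pos[of p] by (simp add: abs_mult mult_left_mono)
  also have "... <= T * ((6 + 2 * U) * M)" by (rule mass_tv_sum(2))
  finally show ?case .
 qed
 have bt: "\<forall>\<^sub>F p in sequentially. \<bar>dt p * dx p * dx p * (SUM n<N p. SUM i<Jmax p. SUM j<Jmax p. mass p n (i, j) * Dt p n i j)\<bar>
   <= 2 * lam * T * ((6 + 2 * U) * M)"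
  using ev
 proof eventually_elim
  case (elim p)
  let ?J = "Jmax p"
  have s0: "sm p 0 i j = 0" for i j
   unfolding sample_def using elim dt_pos[of p] by (intro supp(2)) auto
  have "T' <= (real (N p) + 1/2) * dt p"
   using T'_bounds N_eq[of p] dt_pos[of p] by (simp add: distrib_right)
  hence sN: "sm p (N p) i j = 0" for i j by (intro sm_zero) simp
  have sw: "(SUM n<N p. SUM i<?J. SUM j<?J. F n i j) = (SUM i<?J. SUM j<?J. SUM n<N p. F n i j :: real)" for F
   by (rule sum_swap3)
  have "dt p * dx p * dx p * (SUM n<N p. SUM i<?J. SUM j<?J. mass p n (i, j) * Dt p n i j)
    = dx p * dx p * (SUM i<?J. SUM j<?J. SUM n<N p. mass p n (i, j) * (sm p (Suc n) i j - sm p n i j))"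
  proof -
   have "sm p (Suc n) i j - sm p n i j = dt p * Dt p n i j" for n i j
    using dt_pos[of p] by (simp add: Dt_def)
   thus ?thesis unfolding sw by (simp add: sum_distrib_left mult_ac)
  qed
  moreover have "\<bar>SUM i<?J. SUM j<?J. SUM n<N p. mass p n (i, j) * (sm p (Suc n) i j - sm p n i j)\<bar>
    <= (SUM i<?J. SUM j<?J. SUM n<N p. \<bar>mass p (Suc n) (i, j) - mass p n (i, j)\<bar>)"
   by (intro order_trans[OF sum_abs] sum_mono abel_summation_bound s0 sN le1')
  ultimately have "\<bar>dt p * dx p * dx p * (SUM n<N p. SUM i<?J. SUM j<?J. mass p n (i, j) * Dt p n i j)\<bar>
    <= dx p * dx p * (SUM i<?J. SUM j<?J. SUM n<N p. \<bar>mass p (Suc n) (i, j) - mass p n (i, j)\<bar>)"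
   using dx_pos[of p] by (simp add: abs_mult mult_left_mono)
  also have "... <= 2 * lam * T * ((6 + 2 * U) * M)" using mass_tv_sum(3)[of p ?J] unfolding sw .
  finally show ?case .
 qed
 have fin: "\<bar>l\<bar> <= c" if "X ----> l" "\<forall>\<^sub>F p in sequentially. \<bar>X p\<bar> <= c" for X :: "nat => real" and l c
  using tendsto_upperbound[OF tendsto_rabs[OF that(1)] that(2)] by simp
 show "\<bar>LBINT z. ind (space_time T) z * (v z * (case z of (t, x, y) => psx t x y))\<bar> <= T * ((6 + 2 * U) * M)"
  using fin[OF Lx bx] by simp
 show "\<bar>LBINT z. ind (space_time T) z * (v z * (case z of (t, x, y) => psy t x y))\<bar> <= T * ((6 + 2 * U) * M)"
  using fin[OF Ly byy] by simp
 show "\<bar>LBINT z. ind (space_time T) z * (v z * (case z of (t, x, y) => pst t x y))\<bar> <= 2 * lam * T * ((6 + 2 * U) * M)"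
  using fin[OF Lt bt] by simp
 show "integ (%z. ind (space_time T) z * (v z * (case z of (t, x, y) => psx t x y)))"
  "integ (%z. ind (space_time T) z * (v z * (case z of (t, x, y) => psy t x y)))"
  "integ (%z. ind (space_time T) z * (v z * (case z of (t, x, y) => pst t x y)))"
  using Ix Iy It by simp_all
qed

end

section \<open>Existence of the trace on \<open>x = 0\<close>\<close>

lemma nn_integral_lborel_reorder:
 fixes g :: "R3 => ennreal"
 assumes [measurable]: "g : Bor"
 shows "(NN z. g z) = (NN x. (NN q. g (fst q, x, snd q)))"
proof -
 have "(NN z. g z) = (NN t. (NN q. g (t, q)))"
  by (subst lborel_prod[symmetric], subst lborel.nn_integral_fst[symmetric]) (simp_all add: lborel_prod borel_prod)
 also have "... = (NN t. (NN x. (NN y. g (t, x, y))))"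
 proof (rule nn_integral_cong)
  fix t :: real
  show "(NN q. g (t, q)) = (NN x. (NN y. g (t, x, y)))"
   by (subst lborel_prod[symmetric], subst lborel.nn_integral_fst[symmetric]) (simp_all add: lborel_prod borel_prod)
 qed
 also have "... = (NN x. (NN t. (NN y. g (t, x, y))))"
  by (rule lborel_pair.Fubini') (simp add: case_prod_beta')
 also have "... = (NN x. (NN q. g (fst q, x, snd q)))"
 proof (rule nn_integral_cong)
  fix x :: real
  have "(\<integral>\<^sup>+ q. g (fst q, x, snd q) \<partial>(lborel \<Otimes>\<^sub>M lborel)) = (NN t. (NN y. g (t, x, y)))"
   by (subst lborel.nn_integral_fst[symmetric]) (simp_all add: borel_prod)
  thus "(NN t. (NN y. g (t, x, y))) = (NN q. g (fst q, x, snd q))"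
   by (simp add: lborel_prod)
 qed
 finally show ?thesis .
qed

lemma AE_lborel_ex_small:
 assumes "AE x in lborel. 0 < x --> P x" "(0::real) < d"
 obtains x where "0 < x" "x < d" "P x"
proof -
 have "EX x. 0 < x & x < d & P x"
 proof (rule ccontr)
  assume n: "\<not> ?thesis"
  have "AE x in lborel. x \<notin> {0<..<d}"
   using assms(1) by eventually_elim (use n in auto)
  hence "emeasure lborel {0<..<d} = 0"
   by (subst (asm) AE_iff_measurable[of "{0<..<d}"]) auto
  thus False using assms(2) by simp
 qed
 thus ?thesis using that by blast
qed

context lbm_limit
begin

definition slice_dist :: "real => real => ennreal" where
 "slice_dist a b = (NN q. ennreal (ind (face T) q * \<bar>v (fst q, a, snd q) - v (fst q, b, snd q)\<bar>))"

definition slice_err :: "nat => real => ennreal" where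
 "slice_err p x = (NN q. ennreal (ind (face T) q * err p (fst q, x, snd q)))"

lemma slice_measurable [measurable]: "(%q. v (fst q, x, snd q)) : Bor"
 "(%q. err p (fst q, x, snd q)) : Bor"
 by measurable

lemma slice_err_integral:
 "(NN x. ind {0<..} x * slice_err p x) = (NN z. ennreal (ind (space_time T) z * err p z))"
proof -
 have "(NN z. ennreal (ind (space_time T) z * err p z))
   = (NN x. (NN q. ennreal (ind (space_time T) (fst q, x, snd q) * err p (fst q, x, snd q))))"
  by (rule nn_integral_lborel_reorder) measurable
 also have "... = (NN x. ind {0<..} x * slice_err p x)"
  unfolding slice_err_def
  by (intro nn_integral_cong)
   (auto simp: indicator_def space_time_def face_def quarter_def mem_Times_iff intro!: nn_integral_cong)
 finally show ?thesis by simp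
qed

text \<open>Along a subsequence with errors at most \<open>(1/2)^k\<close> the slice errors are
  summable for almost every \<open>x\<close>, hence tend to 0 there.\<close>

lemma good_slices:
 obtains r :: "nat => nat" where
  "AE x in lborel. 0 < x --> (%k. slice_err (r k) x) ----> 0"
proof -
 let ?I = "%p. NN x. ind {0<..} x * slice_err p x"
 have [measurable]: "slice_err p : Bor" for p
  unfolding slice_err_def by measurable
 have lim: "?I ----> 0" unfolding slice_err_integral by (rule err_lim)
 have "EX p. ?I p <= ennreal ((1/2)^k)" for k
 proof -
  have "\<forall>\<^sub>F p in sequentially. ?I p < ennreal ((1/2)^k)"
   by (rule order_tendstoD(2)[OF lim]) simp
  thus ?thesis by (auto simp: eventually_sequentially intro: less_imp_le)
 qed
 then obtain r where r: "!!k. ?I (r k) <= ennreal ((1/2)^k)" by metis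
 have "(NN x. (\<Sum>k. ind {0<..} x * slice_err (r k) x)) = (\<Sum>k. ?I (r k))"
  by (rule nn_integral_suminf) measurable
 also have "... <= (\<Sum>k. ennreal ((1/2)^k))" by (intro suminf_le r) auto
 also have "... = ennreal (\<Sum>k. (1/2)^k)" by (rule suminf_ennreal2) (auto intro: summable_geometric)
 also have "... < \<infinity>" by simp
 finally have "AE x in lborel. (\<Sum>k. ind {0<..} x * slice_err (r k) x) ~= \<infinity>"
  by (intro nn_integral_noteq_infinite) auto
 hence "AE x in lborel. 0 < x --> (%k. slice_err (r k) x) ----> 0"
 proof eventually_elim
  case (elim x)
  show ?case
  proof
   assume "0 < x"
   hence fin: "(\<Sum>k. slice_err (r k) x) ~= \<infinity>" using elim by simp
   hence "slice_err (r k) x ~= \<infinity>" for k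
    using ennreal_suminf_lessD[of "%k. slice_err (r k) x" \<infinity> k] by (auto simp: less_top)
   hence e: "slice_err (r k) x = ennreal (enn2real (slice_err (r k) x))" for k
    by (simp add: less_top)
   have "summable (%k. enn2real (slice_err (r k) x))"
    using fin by (subst (asm) e, intro summable_suminf_not_top) auto
   hence "(%k. enn2real (slice_err (r k) x)) ----> 0" by (rule summable_LIMSEQ_zero)
   hence "(%k. ennreal (enn2real (slice_err (r k) x))) ----> ennreal 0" by (rule tendsto_ennrealI)
   thus "(%k. slice_err (r k) x) ----> 0" by (subst e) simp
  qed
 qed
 thus ?thesis by (rule that)
qed

text \<open>Along a decreasing sequence of abscissae the jumps between consecutive slices use
  disjoint ranges of columns, so together they are at most the total variation in
  \<open>x\<close>.\<close>

lemma discrete_slice_variation: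
 assumes s: "!!i. 0 < s i" "!!i. s (Suc i) <= s i"
 shows "(SUM i<m. NN q. ennreal (ind (face T) q * ind {..<Y} (snd q)
    * \<bar>st p (%n i j. mass p n (i, j)) (fst q, s i, snd q) - st p (%n i j. mass p n (i, j)) (fst q, s (Suc i), snd q)\<bar>))
  <= ennreal (T * ((6 + 2 * U) * M))"
proof -
 \<comment> \<open>Large enough for the rows below \<open>Y\<close> and for the columns before the
   first slice.\<close>
 define J where "J = max (Suc (ix (dx p) Y)) (ix (dx p) (s 0))"
 define c where "c k n j = (if n < N p & j < J then \<bar>mass p n (Suc k, j) - mass p n (k, j)\<bar> else 0)" for k n j
 define C where "C k q = ind quarter q * c k (ix (dt p) (fst q)) (ix (dx p) (snd q))" for k and q :: "R2"
 define K where "K i = ix (dx p) (s i)" for i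
 have [measurable]: "C k : Bor" for k
  unfolding C_def[abs_def] by (intro borel_measurable_times borel_measurable_indicator measurable_step2) measurable
 have C0: "0 <= C k q" for k q by (simp add: C_def c_def)
 have K: "K (Suc i) <= K i" for i
  unfolding K_def ix_def using s(2)[of i] dx_pos[of p] by (intro nat_mono floor_mono divide_right_mono) auto
 have Ci: "(NN q. ennreal (C k q)) = ennreal (dt p * dx p * (SUM n<N p. SUM j<J. c k n j))" for k
 proof -
  have "c k n j = 0" if "N p <= n \<or> J <= j" for n j using that by (auto simp: c_def)
  note c = sum_eq_integral2[where a = "c k", OF dt_pos[of p] dx_pos[of p] this]
  have "(NN q. ennreal (C k q))
    = ennreal (LBINT q. ind quarter q * c k (ix (dt p) (fst q)) (ix (dx p) (snd q)))"
   unfolding C_def by (rule nn_integral_eq_integral[OF c(1)]) (auto simp: c_def)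
  thus ?thesis using c(2) by simp
 qed
 have le: "(NN q. ennreal (ind (face T) q * ind {..<Y} (snd q)
    * \<bar>st p (%n i j. mass p n (i, j)) (fst q, s i, snd q) - st p (%n i j. mass p n (i, j)) (fst q, s (Suc i), snd q)\<bar>))
   <= (SUM k:{K (Suc i)..<K i}. ennreal (dt p * dx p * (SUM n<N p. SUM j<J. c k n j)))" for i
 proof -
  have "ind (face T) q * ind {..<Y} (snd q)
    * \<bar>st p (%n i j. mass p n (i, j)) (fst q, s i, snd q) - st p (%n i j. mass p n (i, j)) (fst q, s (Suc i), snd q)\<bar>
    <= (SUM k:{K (Suc i)..<K i}. C k q)" for q
  proof (cases "q : face T & snd q < Y")
   case True
   define n j where "n = ix (dt p) (fst q)" and "j = ix (dx p) (snd q)"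
   have q: "0 < fst q" "fst q < T" "0 < snd q" "snd q < Y" using True by (auto simp: face_def)
   have n: "n < N p" using ix_less_iff[OF dt_pos, of "fst q" p "N p"] q by (simp add: n_def N_eq)
   have "j < Suc (ix (dx p) Y)"
    using ix_less_iff[OF dx_pos, of "snd q" p "Suc (ix (dx p) Y)"] ix_bounds(2)[OF dx_pos, of Y p] q
    by (simp add: j_def del: of_nat_Suc)
   hence j: "j < J" by (simp add: J_def)
   have "\<bar>mass p n (K i, j) - mass p n (K (Suc i), j)\<bar> = \<bar>SUM k:{K (Suc i)..<K i}. mass p n (Suc k, j) - mass p n (k, j)\<bar>"
    using sum_Suc_diff'[OF K[of i], of "%k. mass p n (k, j)"] by simp
   also have "... <= (SUM k:{K (Suc i)..<K i}. \<bar>mass p n (Suc k, j) - mass p n (k, j)\<bar>)" by (rule sum_abs)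
   also have "... = (SUM k:{K (Suc i)..<K i}. C k q)"
    using n j q by (intro sum.cong) (auto simp: C_def c_def n_def j_def quarter_def mem_Times_iff)
   finally show ?thesis using True by (simp add: st_def K_def n_def j_def)
  next
   case False
   have "0 <= (SUM k:{K (Suc i)..<K i}. C k q)" by (intro sum_nonneg C0)
   thus ?thesis using False by auto
  qed
  hence "(NN q. ennreal (ind (face T) q * ind {..<Y} (snd q)
    * \<bar>st p (%n i j. mass p n (i, j)) (fst q, s i, snd q) - st p (%n i j. mass p n (i, j)) (fst q, s (Suc i), snd q)\<bar>))
    <= (NN q. ennreal (SUM k:{K (Suc i)..<K i}. C k q))"
   by (intro nn_integral_mono ennreal_leI)
  also have "... = (NN q. (SUM k:{K (Suc i)..<K i}. ennreal (C k q)))"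
   by (intro nn_integral_cong sum_ennreal[symmetric] C0)
  also have "... = (SUM k:{K (Suc i)..<K i}. NN q. ennreal (C k q))"
   by (rule nn_integral_sum) measurable
  finally show ?thesis unfolding Ci .
 qed
 have tel: "(SUM i<m. SUM k:{K (Suc i)..<K i}. g k) <= (SUM k:{K m..<K 0}. g k)" for g :: "nat => ennreal" and m
 proof (induction m)
  case (Suc m)
  have Km: "K m <= K 0" using lift_Suc_antimono_le[of K 0 m] K by simp
  have "(SUM k:{K (Suc m)..<K 0}. g k) = (SUM k:{K (Suc m)..<K m}. g k) + (SUM k:{K m..<K 0}. g k)"
   using K[of m] Km by (simp add: sum.atLeastLessThan_concat)
  thus ?case using Suc by (simp add: add.commute add_left_mono)
 qed simp
 let ?g = "%k. dt p * dx p * (SUM n<N p. SUM j<J. c k n j)"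
 have g0: "0 <= ?g k" for k using dt_pos[of p] dx_pos[of p] by (auto intro!: mult_nonneg_nonneg sum_nonneg simp: c_def)
 have "(SUM i<m. NN q. ennreal (ind (face T) q * ind {..<Y} (snd q)
    * \<bar>st p (%n i j. mass p n (i, j)) (fst q, s i, snd q) - st p (%n i j. mass p n (i, j)) (fst q, s (Suc i), snd q)\<bar>))
   <= (SUM k:{K m..<K 0}. ennreal (?g k))"
  by (rule order_trans[OF sum_mono[OF le] tel])
 also have "... = ennreal (SUM k:{K m..<K 0}. ?g k)" by (rule sum_ennreal) (rule g0)
 also have "(SUM k:{K m..<K 0}. ?g k) <= (SUM k<J. ?g k)"
  by (intro sum_mono2 g0) (auto simp: K_def J_def)
 also have "... = dt p * dx p * (SUM n<N p. SUM k<J. SUM j<J. \<bar>mass p n (Suc k, j) - mass p n (k, j)\<bar>)"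
  unfolding sum_distrib_left[symmetric] by (subst sum.swap) (simp add: c_def)
 also have "... <= T * ((6 + 2 * U) * M)" by (rule mass_tv_sum(1))
 finally show ?thesis by (simp add: ennreal_leI)
qed

end

context lbm_limit
begin

lemma slice_dist_sym: "slice_dist a b = slice_dist b a"
 unfolding slice_dist_def by (simp add: abs_minus_commute)

text \<open>The discrete bound lives on finite blocks, hence the cutoff \<open>Y\<close>; it is
  removed by monotone convergence after the passage to the limit.\<close>

lemma slice_variation:
 assumes s: "!!i. 0 < s i" "!!i. s (Suc i) <= s i"
  and good: "!!i. (%k. slice_err (r k) (s i)) ----> 0"
 shows "(SUM i<m. slice_dist (s i) (s (Suc i))) <= ennreal (T * ((6 + 2 * U) * M))"
proof -
 let ?C = "ennreal (T * ((6 + 2 * U) * M))"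
 let ?F = "ind (face T) :: R2 => real"
 define D where "D Y i = (NN q. ennreal (?F q * ind {..<Y} (snd q)
   * \<bar>v (fst q, s i, snd q) - v (fst q, s (Suc i), snd q)\<bar>))" for Y :: real and i
 have DY: "(SUM i<m. D Y i) <= ?C" for Y
 proof (rule LIMSEQ_le_const)
  have "(%k. (SUM i<m. slice_err (r k) (s i)) + (SUM i<m. slice_err (r k) (s (Suc i))) + ?C)
    ----> (SUM i<m. 0) + (SUM i<m. 0) + ?C"
   by (intro tendsto_add tendsto_sum tendsto_const good)
  thus "(%k. (SUM i<m. slice_err (r k) (s i)) + (SUM i<m. slice_err (r k) (s (Suc i))) + ?C) ----> ?C"
   by simp
  have "(SUM i<m. D Y i) <= (SUM i<m. slice_err p (s i)) + (SUM i<m. slice_err p (s (Suc i))) + ?C" for p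
  proof -
   let ?m = "st p (%n i j. mass p n (i, j))"
   let ?X = "%i. NN q. ennreal (?F q * ind {..<Y} (snd q)
    * \<bar>?m (fst q, s i, snd q) - ?m (fst q, s (Suc i), snd q)\<bar>)"
   have [measurable]: "(%q. ?m (fst q, x, snd q)) : Bor" for x by measurable
   have "D Y i <= slice_err p (s i) + slice_err p (s (Suc i)) + ?X i" for i
   proof -
    have "D Y i <= (NN q. ennreal (?F q * err p (fst q, s i, snd q)) + ennreal (?F q * err p (fst q, s (Suc i), snd q))
    + ennreal (?F q * ind {..<Y} (snd q) * \<bar>?m (fst q, s i, snd q) - ?m (fst q, s (Suc i), snd q)\<bar>))"
    unfolding D_def
    proof (rule nn_integral_mono)
    fix q :: "R2"
    let ?a = "?F q * err p (fst q, s i, snd q)" and ?b = "?F q * err p (fst q, s (Suc i), snd q)"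
    let ?c = "?F q * ind {..<Y} (snd q) * \<bar>?m (fst q, s i, snd q) - ?m (fst q, s (Suc i), snd q)\<bar>"
    have nn: "0 <= ?a" "0 <= ?b" "0 <= ?c" using err_nonneg by auto
    have "?F q * ind {..<Y} (snd q) * \<bar>v (fst q, s i, snd q) - v (fst q, s (Suc i), snd q)\<bar> <= ?a + ?b + ?c"
    using mass_err[of p "(fst q, s i, snd q)"] mass_err[of p "(fst q, s (Suc i), snd q)"]
    err_nonneg[of p "(fst q, s i, snd q)"] err_nonneg[of p "(fst q, s (Suc i), snd q)"]
    by (auto simp: indicator_def)
    hence "ennreal (?F q * ind {..<Y} (snd q) * \<bar>v (fst q, s i, snd q) - v (fst q, s (Suc i), snd q)\<bar>)
    <= ennreal (?a + ?b + ?c)" by (rule ennreal_leI)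
    also have "... = ennreal ?a + ennreal ?b + ennreal ?c" using nn by simp
    finally show "ennreal (?F q * ind {..<Y} (snd q) * \<bar>v (fst q, s i, snd q) - v (fst q, s (Suc i), snd q)\<bar>)
    <= ennreal ?a + ennreal ?b + ennreal ?c" .
    qed
    also have "... = slice_err p (s i) + slice_err p (s (Suc i)) + ?X i"
    unfolding slice_err_def by (subst nn_integral_add, measurable)+
    finally show ?thesis .
   qed
   hence "(SUM i<m. D Y i) <= (SUM i<m. slice_err p (s i) + slice_err p (s (Suc i)) + ?X i)" by (intro sum_mono)
   also have "... = (SUM i<m. slice_err p (s i)) + (SUM i<m. slice_err p (s (Suc i))) + (SUM i<m. ?X i)"
    by (simp add: sum.distrib)
   also have "... <= (SUM i<m. slice_err p (s i)) + (SUM i<m. slice_err p (s (Suc i))) + ?C"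
    by (intro add_left_mono discrete_slice_variation s)
   finally show ?thesis .
  qed
  thus "EX N. \<forall>k\<ge>N. (SUM i<m. D Y i) <= (SUM i<m. slice_err (r k) (s i)) + (SUM i<m. slice_err (r k) (s (Suc i))) + ?C"
   by blast
 qed
 have "slice_dist (s i) (s (Suc i)) = (SUP k::nat. D (real k) i)" for i
 proof -
  let ?g = "%k q. ennreal (?F q * ind {..<real k} (snd q) * \<bar>v (fst q, s i, snd q) - v (fst q, s (Suc i), snd q)\<bar>)"
  have sup: "(SUP k::nat. ?g k q) = ennreal (?F q * \<bar>v (fst q, s i, snd q) - v (fst q, s (Suc i), snd q)\<bar>)" for q
  proof (rule antisym)
   obtain k :: nat where k: "snd q < real k" using reals_Archimedean2 by blast
   have "?g k q <= (SUP k::nat. ?g k q)" by (rule SUP_upper) simp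
   thus "ennreal (?F q * \<bar>v (fst q, s i, snd q) - v (fst q, s (Suc i), snd q)\<bar>) <= (SUP k::nat. ?g k q)"
    using k by simp
  qed (auto intro!: SUP_least ennreal_leI simp: indicator_def)
  have "(NN q. (SUP k::nat. ?g k q)) = (SUP k::nat. NN q. ?g k q)"
  proof (rule nn_integral_monotone_convergence_SUP)
   show "incseq ?g" by (auto simp: incseq_def le_fun_def indicator_def intro!: ennreal_leI)
  qed measurable
  thus ?thesis unfolding slice_dist_def D_def sup .
 qed
 hence "(SUM i<m. slice_dist (s i) (s (Suc i))) = (SUM i<m. SUP k::nat. D (real k) i)" by simp
 also have "... = (SUP k::nat. SUM i<m. D (real k) i)"
 proof (rule ennreal_SUP_sum[symmetric])
  fix i show "incseq (%k. D (real k) i)"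
   unfolding D_def
   by (auto simp: incseq_def indicator_def intro!: nn_integral_mono ennreal_leI)
 qed
 also have "... <= ?C" by (intro SUP_least DY)
 finally show ?thesis .
qed

text \<open>The map from \<open>x\<close> to its slice has finite variation in \<open>L1\<close>, so
  it has a limit at 0. Only slices in \<open>G\<close> occur in the variation bound, namely those to
  which the numerical slices converge along \<open>r\<close>.\<close>

lemma trace_exists:
 obtains ga where "ga : Bor" "!!q. \<bar>ga q\<bar> <= U"
  "integ (%q. ind (face T) q * ga q)"
  "!!ep. 0 < ep ==> \<exists>\<delta>>0. AE s in lborel. 0 < s & s < \<delta> -->
    (NN q. ennreal (ind (face T) q * \<bar>v (fst q, s, snd q) - ga q\<bar>)) < ennreal ep"
proof -
 obtain r where r: "AE x in lborel. 0 < x --> (%k. slice_err (r k) x) ----> 0" by (rule good_slices)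
 define G where "G s \<longleftrightarrow> 0 < s & (%k. slice_err (r k) s) ----> 0" for s
 have AEG: "AE s in lborel. 0 < s --> G s" using r by eventually_elim (auto simp: G_def)
 let ?C = "ennreal (T * ((6 + 2 * U) * M))"
 let ?F = "ind (face T) :: R2 => real"
 have var: "(SUM i<m. slice_dist (s i) (s (Suc i))) <= ?C" if "!!i. G (s i)" "!!i. s (Suc i) <= s i" for s m
  using that unfolding G_def by (intro slice_variation[where r = r]) auto
 \<comment> \<open>Otherwise there are infinitely many pairs of slices at distance above
   \<open>ep\<close>, each pair to the left of the preceding one; listed in decreasing order they
   contradict the bound on the variation.\<close>
 have cauchy: "\<exists>\<delta>>0. ALL a b. G a & G b & a < \<delta> & b < \<delta> --> slice_dist a b <= ennreal ep" if ep: "0 < ep" for ep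
 proof (rule ccontr)
  assume neg: "\<not> ?thesis"
  have ex: "EX p. G (fst p) & G (snd p) & fst p < \<delta> & snd p <= fst p & ennreal ep < slice_dist (fst p) (snd p)" if "0 < \<delta>" for \<delta>
  proof -
   from neg that obtain a b where ab: "G a" "G b" "a < \<delta>" "b < \<delta>" "ennreal ep < slice_dist a b" by (auto simp: not_le)
   show ?thesis
   proof (cases "b <= a")
    case True thus ?thesis using ab by (intro exI[of _ "(a, b)"]) auto
   next
    case False thus ?thesis using ab slice_dist_sym[of a b] by (intro exI[of _ "(b, a)"]) auto
   qed
  qed
  have "EX f. ALL n. (G (fst (f n)) & G (snd (f n)) & snd (f n) <= fst (f n) & ennreal ep < slice_dist (fst (f n)) (snd (f n)))
    & fst (f (Suc n)) < snd (f n)"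
  proof (rule dependent_nat_choice)
   show "EX p. G (fst p) & G (snd p) & snd p <= fst p & ennreal ep < slice_dist (fst p) (snd p)"
    using ex[of 1] by auto
   show "EX q. (G (fst q) & G (snd q) & snd q <= fst q & ennreal ep < slice_dist (fst q) (snd q)) & fst q < snd p"
    if "G (fst p) & G (snd p) & snd p <= fst p & ennreal ep < slice_dist (fst p) (snd p)" for p and n :: nat
    using ex[of "snd p"] that by (auto simp: G_def)
  qed
  then obtain p where p: "!!n. G (fst (p n))" "!!n. G (snd (p n))" "!!n. snd (p n) <= fst (p n)"
   "!!n. ennreal ep < slice_dist (fst (p n)) (snd (p n))" "!!n. fst (p (Suc n)) < snd (p n)" by blast
  define s where "s i = (if even i then fst (p (i div 2)) else snd (p (i div 2)))" for i
  have sG: "G (s i)" for i by (simp add: s_def p)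
  have sle: "s (Suc i) <= s i" for i
  proof (cases "even i")
   case True
   thus ?thesis by (simp add: s_def p)
  next
   case False
   then obtain l where "i = 2 * l + 1" by (auto elim: oddE)
   thus ?thesis using p(5)[of l] by (simp add: s_def)
  qed
  have low: "of_nat m * ennreal ep <= (SUM i<2 * m. slice_dist (s i) (s (Suc i)))" for m
  proof (induction m)
   case (Suc m)
   have "ennreal ep <= slice_dist (s (2 * m)) (s (Suc (2 * m)))"
    using p(4)[of m] by (simp add: s_def less_imp_le)
   hence "of_nat m * ennreal ep + ennreal ep <= (SUM i<2 * m. slice_dist (s i) (s (Suc i))) + slice_dist (s (2 * m)) (s (Suc (2 * m)))"
    using Suc by (rule add_mono[rotated])
   also have "... <= (SUM i<2 * Suc m. slice_dist (s i) (s (Suc i)))" by simp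
   finally show ?case by (simp add: distrib_right add.commute)
  qed simp
  obtain m :: nat where m: "T * ((6 + 2 * U) * M) / ep < real m" using reals_Archimedean2 by blast
  have "ennreal (real m * ep) = of_nat m * ennreal ep" using ep by (simp add: ennreal_mult ennreal_of_nat_eq_real_of_nat)
  also have "... <= ?C" using order_trans[OF low[of m] var[of s "2 * m", OF sG sle]] .
  finally have "real m * ep <= T * ((6 + 2 * U) * M)"
   using T_pos tv_nonneg by (simp add: ennreal_le_iff)
  thus False using m ep by (simp add: field_simps)
 qed
 \<comment> \<open>Along a decreasing sequence of good slices the distances are summable, so the
   slices also converge pointwise almost everywhere. Their limit becomes the trace.\<close>
 have "EX s. ALL n. (G (s n) & s n < 1 / real (Suc n)) & s (Suc n) <= s n"
 proof (rule dependent_nat_choice)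
  show "EX x. G x & x < 1 / real (Suc 0)" using AE_lborel_ex_small[OF AEG, of 1] by auto
  show "EX y. (G y & y < 1 / real (Suc (Suc n))) & y <= x" if "G x & x < 1 / real (Suc n)" for x n
  proof -
   have "0 < min x (1 / real (Suc (Suc n)))" using that by (simp add: G_def)
   from AE_lborel_ex_small[OF AEG this] obtain y where "G y" "y < min x (1 / real (Suc (Suc n)))" by blast
   thus ?thesis by auto
  qed
 qed
 then obtain s where s: "!!n. G (s n)" "!!n. s n < 1 / real (Suc n)" "!!n. s (Suc n) <= s n" by blast
 have s0: "s ----> 0"
 proof (rule tendsto_sandwich[OF _ _ tendsto_const LIMSEQ_inverse_real_of_nat])
  show "\<forall>\<^sub>F n in sequentially. 0 <= s n"
   using s(1) unfolding G_def by (intro always_eventually allI less_imp_le) blast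
  show "\<forall>\<^sub>F n in sequentially. s n <= inverse (real (Suc n))"
   by (intro always_eventually allI less_imp_le) (simp only: inverse_eq_divide s(2))
 qed
 define g where "g n q = v (fst q, s n, snd q)" for n q
 have [measurable]: "g n : Bor" for n unfolding g_def[abs_def] by measurable
 have gU: "\<bar>g n q\<bar> <= U" for n q by (simp add: g_def v_bound)
 \<comment> \<open>Truncation makes the bound by \<open>U\<close> hold also where the limit fails to
   exist.\<close>
 define ga where "ga q = max (- U) (min U (lim (%n. g n q)))" for q
 have [measurable]: "(%q. lim (%n. g n q)) : Bor"
  by (rule borel_measurable_lim_metric) measurable
 have gam[measurable]: "ga : Bor" unfolding ga_def[abs_def] by measurable
 have gaU: "\<bar>ga q\<bar> <= U" for q using sc.U_nonneg by (auto simp: ga_def)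
 have "(NN q. (\<Sum>n. ennreal (?F q * \<bar>g n q - g (Suc n) q\<bar>))) = (\<Sum>n. slice_dist (s n) (s (Suc n)))"
  unfolding slice_dist_def g_def by (rule nn_integral_suminf) measurable
 also have "... <= ?C"
  unfolding suminf_eq_SUP by (intro SUP_least var s)
 finally have "(NN q. (\<Sum>n. ennreal (?F q * \<bar>g n q - g (Suc n) q\<bar>))) ~= \<infinity>"
  by (auto simp: top_unique)
 hence "AE q in lborel. (\<Sum>n. ennreal (?F q * \<bar>g n q - g (Suc n) q\<bar>)) ~= \<infinity>"
  by (intro nn_integral_noteq_infinite) auto
 hence conv: "AE q in lborel. q : face T --> (%n. g n q) ----> ga q"
 proof eventually_elim
  case (elim q)
  show ?case
  proof
   assume "q : face T"
   hence "(\<Sum>n. ennreal \<bar>g n q - g (Suc n) q\<bar>) ~= \<infinity>" using elim by simp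
   hence "summable (%n. \<bar>g n q - g (Suc n) q\<bar>)" by (intro summable_suminf_not_top) auto
   hence "summable (%n. g n q - g (Suc n) q)" by (rule summable_rabs_cancel)
   hence "convergent (%m. SUM n<m. g n q - g (Suc n) q)" by (simp add: summable_iff_convergent)
   hence "convergent (%m. g 0 q - g m q)"
    using sum_lessThan_telescope'[of "%n. g n q"] by simp
   then obtain L where "(%m. g 0 q - g m q) ----> L" by (auto simp: convergent_def)
   from tendsto_diff[OF tendsto_const[of "g 0 q"] this] have "(%m. g m q) ----> g 0 q - L" by simp
   hence "convergent (%m. g m q)" by (auto simp: convergent_def)
   hence l: "(%n. g n q) ----> lim (%n. g n q)" by (simp add: convergent_LIMSEQ_iff)
   have "\<bar>lim (%n. g n q)\<bar> <= U"
    using LIMSEQ_le_const2[OF tendsto_rabs[OF l], of U] gU by blast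
   thus "(%n. g n q) ----> ga q" using l by (simp add: ga_def abs_le_iff)
  qed
 qed
 \<comment> \<open>Fatou's lemma passes from mutual distances of slices to the distance from their
   limit.\<close>
 have fatou: "\<exists>\<delta>>0. ALL a. G a & a < \<delta> -->
   (NN q. ennreal (?F q * \<bar>v (fst q, a, snd q) - ga q\<bar>)) <= ennreal ep" if ep: "0 < ep" for ep
 proof -
  obtain \<delta> where \<delta>: "\<delta> > 0" "!!a b. G a ==> G b ==> a < \<delta> ==> b < \<delta> ==> slice_dist a b <= ennreal ep"
   using cauchy[OF ep] by blast
  have "(NN q. ennreal (?F q * \<bar>v (fst q, a, snd q) - ga q\<bar>)) <= ennreal ep" if a: "G a" "a < \<delta>" for a
  proof -
   have "(NN q. ennreal (?F q * \<bar>v (fst q, a, snd q) - ga q\<bar>))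
    = (NN q. liminf (%n. ennreal (?F q * \<bar>v (fst q, a, snd q) - g n q\<bar>)))"
   proof (rule nn_integral_cong_AE, use conv in eventually_elim)
    case (elim q)
    have "(%n. ennreal (?F q * \<bar>v (fst q, a, snd q) - g n q\<bar>)) ----> ennreal (?F q * \<bar>v (fst q, a, snd q) - ga q\<bar>)"
    proof (cases "q : face T")
    case True
    thus ?thesis using elim by (intro tendsto_ennrealI tendsto_intros) auto
    qed simp
    thus ?case by (intro lim_imp_Liminf[symmetric]) auto
   qed
   also have "... <= liminf (%n. NN q. ennreal (?F q * \<bar>v (fst q, a, snd q) - g n q\<bar>))"
    by (rule nn_integral_liminf) measurable
   also have "... <= liminf (%n::nat. ennreal ep)"
   proof (rule Liminf_mono)
    have "\<forall>\<^sub>F n in sequentially. s n < \<delta>" using order_tendstoD(2)[OF s0 \<delta>(1)] .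
    thus "\<forall>\<^sub>F n in sequentially. (NN q. ennreal (?F q * \<bar>v (fst q, a, snd q) - g n q\<bar>)) <= ennreal ep"
    proof eventually_elim
    case (elim n)
    thus ?case using \<delta>(2)[OF a(1) s(1)[of n] a(2)] by (simp add: slice_dist_def g_def)
    qed
   qed
   also have "... = ennreal ep" by (simp add: Liminf_const)
   finally show ?thesis .
  qed
  thus ?thesis using \<delta>(1) by blast
 qed
 \<comment> \<open>A single good slice with finite integral, at distance at most 1 from the trace,
   suffices.\<close>
 have int: "integ (%q. ?F q * ga q)"
 proof -
  obtain \<delta> where \<delta>: "\<delta> > 0" "!!a. G a ==> a < \<delta> ==>
    (NN q. ennreal (?F q * \<bar>v (fst q, a, snd q) - ga q\<bar>)) <= ennreal 1"
   using fatou[of 1] by auto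
  let ?V = "%x. NN q. ennreal (?F q * \<bar>v (fst q, x, snd q)\<bar>)"
  have "(NN z. ennreal (ind (space_time T) z * \<bar>v z\<bar>))
    = (NN x. (NN q. ennreal (ind (space_time T) (fst q, x, snd q) * \<bar>v (fst q, x, snd q)\<bar>)))"
   by (rule nn_integral_lborel_reorder) measurable
  also have "... = (NN x. ind {0<..} x * ?V x)"
   by (intro nn_integral_cong)
    (auto simp: indicator_def space_time_def face_def quarter_def mem_Times_iff intro!: nn_integral_cong)
  finally have "(NN x. ind {0<..} x * ?V x) < \<infinity>"
   using v_integrable by (simp add: integrable_iff_bounded abs_mult)
  moreover have [measurable]: "(%x. ?V x) : Bor" by measurable
  ultimately have "AE x in lborel. ind {0<..} x * ?V x ~= \<infinity>"
   by (intro nn_integral_noteq_infinite) auto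
  hence "AE x in lborel. 0 < x --> G x & ?V x ~= \<infinity>"
   using AEG by eventually_elim auto
  from AE_lborel_ex_small[OF this \<delta>(1)] obtain a where a0: "0 < a" "a < \<delta>" "G a & ?V a ~= \<infinity>" .
  hence a: "0 < a" "a < \<delta>" "G a" "?V a ~= \<infinity>" by blast+
  have "(NN q. ennreal (norm (?F q * ga q)))
   <= (NN q. ennreal (?F q * \<bar>v (fst q, a, snd q) - ga q\<bar>) + ennreal (?F q * \<bar>v (fst q, a, snd q)\<bar>))"
  proof (rule nn_integral_mono)
   fix q
   have "\<bar>ga q\<bar> <= \<bar>v (fst q, a, snd q) - ga q\<bar> + \<bar>v (fst q, a, snd q)\<bar>" by linarith
   hence "norm (?F q * ga q) <= ?F q * \<bar>v (fst q, a, snd q) - ga q\<bar> + ?F q * \<bar>v (fst q, a, snd q)\<bar>"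
    by (cases "q : face T") auto
   hence "ennreal (norm (?F q * ga q)) <= ennreal (?F q * \<bar>v (fst q, a, snd q) - ga q\<bar> + ?F q * \<bar>v (fst q, a, snd q)\<bar>)"
    by (rule ennreal_leI)
   thus "ennreal (norm (?F q * ga q)) <= ennreal (?F q * \<bar>v (fst q, a, snd q) - ga q\<bar>) + ennreal (?F q * \<bar>v (fst q, a, snd q)\<bar>)"
    by simp
  qed
  also have "... = (NN q. ennreal (?F q * \<bar>v (fst q, a, snd q) - ga q\<bar>)) + ?V a"
   by (rule nn_integral_add) measurable
  also have "... <= ennreal 1 + ?V a" by (intro add_right_mono \<delta>(2) a)
  also have "... < \<infinity>" using a(4) by (simp add: less_top)
  finally show ?thesis by (intro integrableI_bounded) measurable
 qed
 show ?thesis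
 proof (rule that[OF gam gaU int])
  fix ep :: real assume ep: "0 < ep"
  then obtain \<delta> where \<delta>: "\<delta> > 0" "!!a. G a ==> a < \<delta> ==>
    (NN q. ennreal (?F q * \<bar>v (fst q, a, snd q) - ga q\<bar>)) <= ennreal (ep / 2)"
   using fatou[of "ep / 2"] by auto
  have half: "ennreal (ep / 2) < ennreal ep" using ep by (simp add: ennreal_less_iff)
  have "AE s in lborel. 0 < s & s < \<delta> -->
    (NN q. ennreal (?F q * \<bar>v (fst q, s, snd q) - ga q\<bar>)) < ennreal ep"
   using AEG
  proof eventually_elim
   case (elim s)
   thus ?case using le_less_trans[OF \<delta>(2) half] by blast
  qed
  thus "\<exists>\<delta>>0. AE s in lborel. 0 < s & s < \<delta> -->
    (NN q. ennreal (?F q * \<bar>v (fst q, s, snd q) - ga q\<bar>)) < ennreal ep"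
   using \<delta>(1) by blast
 qed
qed

end

section \<open>Weak limit of the fluxes through the boundary\<close>

lemma integral_lborel_reorder:
 fixes g :: "R3 => real"
 assumes g: "integ g"
 shows "(LBINT z. g z) = (LBINT x. (LBINT q. g (fst q, x, snd q)))"
proof -
 let ?T = "%p :: R3. (fst (snd p), fst p, snd (snd p))"
 have T [measurable]: "?T : Bor"
  by (intro borel_measurable_continuous_onI continuous_intros)
 have [measurable]: "g : Bor" using g by auto
 have "distr lborel borel ?T = (lborel :: (R3) measure)"
 proof (rule measure_eqI)
  fix A :: "(R3) set" assume "A : sets (distr lborel borel ?T)"
  hence [measurable]: "A : sets borel" by simp
  have "emeasure (distr lborel borel ?T) A = (\<integral>\<^sup>+ z. ind A z \<partial>(distr lborel borel ?T))" by simp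
  also have "... = (NN p. ind A (?T p))" by (rule nn_integral_distr) auto
  also have "... = (NN x. (NN q. ind A (fst q, x, snd q)))"
   by (subst lborel_prod[symmetric], subst lborel.nn_integral_fst[symmetric]) (simp_all add: lborel_prod borel_prod)
  also have "... = (NN z. ind A z)" by (rule nn_integral_lborel_reorder[symmetric]) measurable
  finally show "emeasure (distr lborel borel ?T) A = emeasure lborel A" by simp
 qed simp
 note d = this
 have gi: "integ (%p. g (?T p))"
  using g integrable_distr_eq[of ?T lborel borel g] d by simp
 have "(LBINT z. g z) = (LINT z|distr lborel borel ?T. g z)" by (simp add: d)
 also have "... = (LBINT p. g (?T p))" by (rule integral_distr) auto
 also have "... = (LINT p|(lborel \<Otimes>\<^sub>M lborel). g (?T p))" by (simp add: lborel_prod)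
 also have "... = (LBINT x. (LBINT q. g (?T (x, q))))"
  by (rule lborel_pair.integral_fst'[symmetric]) (use gi in \<open>simp add: lborel_prod\<close>)
 finally show ?thesis by simp
qed

lemma step01'_bounds: "0 <= step01' z" "step01' z <= 4"
proof -
 show "0 <= step01' z" by (simp add: step01'_def)
 show "step01' z <= 4"
 proof (cases "z < 0")
  case True
  have "1 <= (1 - z)\<^sup>2" using True by (intro one_le_power) auto
  thus ?thesis using True by (simp add: step01'_def sqpos_simps(2))
 next
  case False
  have "max 0 (1 - sqpos (1 - z)) * max 0 (1 - z) <= 1 * 1"
   using False by (intro mult_mono) (auto simp: sqpos_nonneg)
  thus ?thesis by (simp add: step01'_def)
 qed
qed

lemma bump'_bound: assumes "k > 0" shows "\<bar>bump' k a b x\<bar> <= 8 * k"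
proof -
 have "\<bar>k * step01' (k * (x - a) - 1) * step01 (k * (b - x) - 1)\<bar> <= k * 4 * 1"
    "\<bar>k * step01 (k * (x - a) - 1) * step01' (k * (b - x) - 1)\<bar> <= k * 1 * 4"
  unfolding abs_mult using assms step01'_bounds step01_props(3,4)
  by (intro mult_mono; simp)+
 thus ?thesis unfolding bump'_def by linarith
qed

definition decay :: "real => real => real" where "decay s x = sqpos (1 - x / s)"
text \<open>Minus the derivative of \<open>decay s\<close>. On positive \<open>x\<close> it is a
  probability density that concentrates at 0 as \<open>s\<close> decreases.\<close>

definition decay' :: "real => real => real" where "decay' s x = 2 / s * max 0 (1 - x / s)"

lemma DERIV_decay: assumes "s > 0" shows "(decay s has_real_derivative - decay' s x) (at x)"
 unfolding decay_def[abs_def] decay'_def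
 by (rule derivative_eq_intros refl | use assms in simp)+

lemma continuous_on_decay [continuous_intros]:
 assumes "continuous_on S g"
 shows "continuous_on S (%x. decay s (g x))" "continuous_on S (%x. decay' s (g x))"
 unfolding decay_def decay'_def divide_inverse by (intro continuous_intros assms)+

lemma decay_props:
 assumes "s > 0"
 shows "0 <= decay s x" "0 <= x ==> decay s x <= 1" "s <= x ==> decay s x = 0" "decay s 0 = 1"
  "0 <= decay' s x" "0 <= x ==> decay' s x <= 2 / s" "s <= x ==> decay' s x = 0"
proof -
 show "0 <= decay s x" "decay s 0 = 1" by (simp_all add: decay_def sqpos_nonneg sqpos_def)
 show "0 <= x ==> decay s x <= 1"
  using assms by (auto simp: decay_def sqpos_def max_def intro!: power_le_one)
 show "s <= x ==> decay s x = 0" using assms by (simp add: decay_def sqpos_def)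
 show "0 <= decay' s x" using assms by (simp add: decay'_def)
 show "0 <= x ==> decay' s x <= 2 / s"
 proof -
  assume "0 <= x"
  hence "max 0 (1 - x / s) <= 1" using assms by simp
  hence "2 / s * max 0 (1 - x / s) <= 2 / s * 1" using assms by (intro mult_left_mono) auto
  thus ?thesis by (simp add: decay'_def)
 qed
 show "s <= x ==> decay' s x = 0" using assms by (simp add: decay'_def)
qed

lemma integral_decay':
 assumes "s > 0"
 shows "integ (%x. ind {0<..} x * decay' s x)" "(LBINT x. ind {0<..} x * decay' s x) = 1"
proof -
 have "has_bochner_integral lborel (%x. decay' s x * ind {0..s} x) (- decay s s - (- decay s 0))"
 proof (rule has_bochner_integral_FTC_Icc_real)
  show "((%x. - decay s x) has_real_derivative decay' s x) (at x)" for x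
   using DERIV_minus[OF DERIV_decay[OF assms, of x]] by simp
  have "continuous_on UNIV (%x. decay' s x)" by (intro continuous_intros)
  thus "isCont (decay' s) x" for x by (simp add: continuous_on_eq_continuous_at)
 qed (use assms in auto)
 hence hb: "has_bochner_integral lborel (%x. decay' s x * ind {0..s} x) 1"
  by (simp add: decay_props(3)[OF assms, of s] decay_props(4)[OF assms])
 have [measurable]: "decay' s : Bor"
  by (intro borel_measurable_continuous_onI continuous_intros)
 have ae: "AE x in lborel. decay' s x * ind {0..s} x = ind {0<..} x * decay' s x"
  using AE_lborel_singleton[of 0]
  by eventually_elim (use decay_props(7)[OF assms] in \<open>auto simp: indicator_def not_le\<close>)
 have "has_bochner_integral lborel (%x. ind {0<..} x * decay' s x) 1"
  by (rule iffD1[OF has_bochner_integral_cong_AE[OF _ _ ae] hb]) measurable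
 thus "integ (%x. ind {0<..} x * decay' s x)" "(LBINT x. ind {0<..} x * decay' s x) = 1"
  by (auto simp: has_bochner_integral_iff)
qed

context lbm_limit
begin

text \<open>The numerical flux through \<open>x = 0\<close>, formed from the equilibrium that enters
  and the relaxed value that leaves.\<close>

definition wflux :: "nat => R2 => real" where
 "wflux p q = lam * (E XP (W p (ix (dt p) (fst q)) (ix (dx p) (snd q)))
   - post p (ix (dt p) (fst q)) XM (0, ix (dx p) (snd q)))"

definition fbnd :: real where "fbnd = 2 * lam * relaxation.bnd E U"

lemma bnd_nonneg: "0 <= relaxation.bnd E U"
 using sc.admissible_abs_le[OF sc.admissible_f, of 0 0 XP "(0,0)"] by simp

lemma fbnd_nonneg: "0 <= fbnd" unfolding fbnd_def using lam_pos bnd_nonneg by simp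

lemma wflux_borel [measurable]: "wflux p : Bor"
 unfolding wflux_def[abs_def] by (rule measurable_step2[of "%n k. lam * (E XP (W p n k) - post p n XM (0, k))"])

lemma diff_bound:
 assumes "\<bar>a\<bar> <= relaxation.bnd E U" "\<bar>b\<bar> <= relaxation.bnd E U" shows "\<bar>lam * (a - b)\<bar> <= fbnd"
proof -
 have "lam * \<bar>a - b\<bar> <= lam * (2 * relaxation.bnd E U)" using assms lam_pos by (intro mult_left_mono) auto
 thus ?thesis using lam_pos by (simp add: abs_mult fbnd_def mult_ac)
qed

lemma wflux_bound: "\<bar>wflux p q\<bar> <= fbnd"
 unfolding wflux_def
 by (intro diff_bound sc.admissible_abs_le[OF sc.admissible_E[OF sc.W_bound]] sc.admissible_abs_le[OF sc.admissible_post])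

lemma phi_bounds: assumes "\<bar>u\<bar> <= U" shows "\<bar>\<phi>x u\<bar> <= fbnd" "\<bar>\<phi>y u\<bar> <= fbnd"
 unfolding flux_x[symmetric] flux_y[symmetric]
 by (intro diff_bound sc.admissible_abs_le[OF sc.admissible_E[OF assms]])+

text \<open>A consequence of \<open>E_dist\<close>: the speed of propagation is at most
  \<open>lam\<close>, one cell per step.\<close>

lemma phi_lip: assumes "\<bar>u\<bar> <= U" "\<bar>w\<bar> <= U" shows "\<bar>\<phi>x u - \<phi>x w\<bar> <= lam * \<bar>u - w\<bar>"
proof -
 have "\<bar>(E XP u - E XM u) - (E XP w - E XM w)\<bar> <= \<bar>E XP u - E XP w\<bar> + \<bar>E XM u - E XM w\<bar>" by linarith
 also have "... <= (SUM i:UNIV. \<bar>E i u - E i w\<bar>)" by (simp add: sum_vel)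
 also have "... = \<bar>u - w\<bar>" by (rule sc.E_dist[OF assms])
 finally have "lam * \<bar>(E XP u - E XM u) - (E XP w - E XM w)\<bar> <= lam * \<bar>u - w\<bar>" using lam_pos by simp
 moreover have "\<phi>x u - \<phi>x w = lam * ((E XP u - E XM u) - (E XP w - E XM w))"
  unfolding flux_x[symmetric] by (simp add: algebra_simps)
 ultimately show ?thesis using lam_pos by (simp add: abs_mult)
qed

lemma phi_borel [measurable]: "\<phi>x : Bor" "\<phi>y : Bor"
proof -
 have "(%u. lam * (E XP u - E XM u)) : Bor" "(%u. lam * (E YP u - E YM u)) : Bor"
  by measurable
 thus "\<phi>x : Bor" "\<phi>y : Bor" unfolding flux_x flux_y by simp_all
qed

end

context lbm_test
begin

definition edge :: "nat => R2 => real" where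
 "edge p q = sm p (Suc (ix (dt p) (fst q))) 0 (ix (dx p) (snd q))"

lemma edge_borel [measurable]: "edge p : Bor"
 unfolding edge_def[abs_def] by (rule measurable_step2[of "%n k. sm p (Suc n) 0 k"])

lemma bw_eq_integral:
 "bw bet p = (LBINT q. ind (face T) q * (lam * (bet XP (E XP (W p (ix (dt p) (fst q)) (ix (dx p) (snd q))))
   - bet XM (post p (ix (dt p) (fst q)) XM (0, ix (dx p) (snd q)))) * edge p q))"
proof -
 define a where "a n k = (if n < N p then lam * (bet XP (E XP (W p n k)) - bet XM (post p n XM (0, k))) * sm p (Suc n) 0 k else 0)" for n k
 have a0: "a n k = 0" if "N p <= n \<or> Jmax p <= k" for n k
  using that Jmax_zero[of p k] by (auto simp: a_def intro: sm_zero')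
 have "bw bet p = dt p * dx p * (SUM n<N p. SUM k<Jmax p. a n k)"
  unfolding bw_def a_def sum_distrib_left by (intro sum.cong refl) (simp add: power2_eq_square dt_eq mult_ac)
 also have "... = (LBINT q. ind quarter q * a (ix (dt p) (fst q)) (ix (dx p) (snd q)))"
  by (rule sum_eq_integral2(2)[OF dt_pos dx_pos a0])
 also have "... = (LBINT q. ind (face T) q * (lam * (bet XP (E XP (W p (ix (dt p) (fst q)) (ix (dx p) (snd q))))
   - bet XM (post p (ix (dt p) (fst q)) XM (0, ix (dx p) (snd q)))) * edge p q))"
 proof (intro Bochner_Integration.integral_cong refl)
  fix q :: "R2"
  have "ix (dt p) (fst q) < N p \<longleftrightarrow> fst q < T" if "0 < fst q"
   using ix_less_iff[OF dt_pos, of "fst q" p "N p"] that by (simp add: N_eq)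
  thus "ind quarter q * a (ix (dt p) (fst q)) (ix (dx p) (snd q))
   = ind (face T) q * (lam * (bet XP (E XP (W p (ix (dt p) (fst q)) (ix (dx p) (snd q))))
   - bet XM (post p (ix (dt p) (fst q)) XM (0, ix (dx p) (snd q)))) * edge p q)"
   by (auto simp: indicator_def quarter_def face_def a_def edge_def mem_Times_iff)
 qed
 finally show ?thesis .
qed

definition fbox :: "(R2) set" where "fbox = {0..T} \<times> {0..Rad + 2 * dx_max}"

lemma fbox: "fbox : sets borel" "emeasure lborel fbox < \<infinity>"
proof -
 show "fbox : sets borel" unfolding fbox_def by measurable
 have "bounded fbox" unfolding fbox_def by (intro bounded_Times bounded_closed_interval)
 thus "emeasure lborel fbox < \<infinity>" by (rule emeasure_bounded_finite)
qed

lemma edge_bound: assumes "q : face T" shows "\<bar>edge p q\<bar> <= C * ind fbox q"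
proof (cases "q : fbox")
 case False
 hence "Rad + 2 * dx_max < snd q" using assms by (auto simp: fbox_def face_def mem_Times_iff)
 hence "edge p q = 0" unfolding edge_def by (rule sm_far(2))
 thus ?thesis using C_nonneg by simp
qed (use sm_bound in \<open>simp add: edge_def\<close>)

lemma edge_tendsto:
 assumes "q : face T" shows "(%p. edge p q) ----> ps (fst q) 0 (snd q)"
proof -
 have q: "0 <= fst q" "0 <= snd q" using assms by (auto simp: face_def)
 have "(%p. (real 0 + 1/2) * dx p) ----> (real 0 + 1/2) * 0" by (intro tendsto_intros dx_lim)
 hence h: "(%p. (real 0 + 1/2) * dx p) ----> 0" by simp
 have pos: "0 <= (real i + 1/2) * dx p" "0 <= (real i + 1/2) * dt p" for i p
  using half_pos[of i p] by linarith+
 show ?thesis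
  unfolding edge_def sample_def
  by (rule psi_tendsto[OF q(1) order_refl q(2) mid_tendsto(3)[OF q(1)] h mid_tendsto(1)[OF q(2)]]) (rule pos)+
qed

lemma edge_limit_bound: assumes "q : face T" shows "\<bar>ps (fst q) 0 (snd q)\<bar> <= C * ind fbox q"
 using LIMSEQ_le_const2[OF tendsto_rabs[OF edge_tendsto[OF assms]]] edge_bound[OF assms] by blast

lemma edge_limit_borel [measurable]: "(%q. ind (face T) q * ps (fst q) 0 (snd q)) : Bor"
proof -
 have c3: "continuous_on ({0..} \<times> {0..} \<times> {0..}) (%(t, x, y). ps t x y)" using tf unfolding test_fun_def by blast
 have "continuous_on (face T) (%q. (%(t, x, y). ps t x y) (fst q, 0, snd q))"
  by (rule continuous_on_compose2[OF c3]) (auto intro!: continuous_intros simp: face_def)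
 hence "continuous_on (face T) (%q. ps (fst q) 0 (snd q))" by (simp add: case_prod_beta')
 thus ?thesis using borel_measurable_continuous_on_indicator[of "face T" "%q. ps (fst q) 0 (snd q)"] by simp
qed

lemma edge_L1:
 "(%p. LBINT q. ind (face T) q * \<bar>edge p q - ps (fst q) 0 (snd q)\<bar>) ----> 0"
 "integ (%q. ind (face T) q * \<bar>edge p q - ps (fst q) 0 (snd q)\<bar>)"
 "integ (%q. ind (face T) q * edge p q)"
 "integ (%q. ind (face T) q * ps (fst q) 0 (snd q))"
proof -
 have iB: "integ (%q. ind fbox q * c :: real)" for c using fbox by simp
 have e: "ind (face T) q * \<bar>edge p q - ps (fst q) 0 (snd q)\<bar>
   = ind (face T) q * \<bar>edge p q - ind (face T) q * ps (fst q) 0 (snd q)\<bar>" for p q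
  by (simp add: indicator_def)
 have m: "(%q. ind (face T) q * \<bar>edge p q - ps (fst q) 0 (snd q)\<bar>) : borel_measurable lborel" for p
  unfolding e by measurable
 have b: "norm (ind (face T) q * \<bar>edge p q - ps (fst q) 0 (snd q)\<bar>) <= ind fbox q * (2 * C)" for p q
  using edge_bound[of q p] edge_limit_bound[of q] C_nonneg by (auto simp: indicator_def)
 have "(%p. LBINT q. ind (face T) q * \<bar>edge p q - ps (fst q) 0 (snd q)\<bar>) ----> (LINT (q::real\<times>real)|lborel. 0)"
 proof (rule integral_dominated_convergence[OF _ m iB[of "2 * C"]])
  show "AE q in lborel. (%p. ind (face T) q * \<bar>edge p q - ps (fst q) 0 (snd q)\<bar>) ----> 0"
  proof (rule AE_I2)
   fix q
   show "(%p. ind (face T) q * \<bar>edge p q - ps (fst q) 0 (snd q)\<bar>) ----> 0"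
   proof (cases "q : face T")
    case True
    have "(%p. \<bar>edge p q - ps (fst q) 0 (snd q)\<bar>) ----> \<bar>ps (fst q) 0 (snd q) - ps (fst q) 0 (snd q)\<bar>"
    by (intro tendsto_intros edge_tendsto True)
    thus ?thesis using True by simp
   qed simp
  qed
 qed (use b in auto)
 thus "(%p. LBINT q. ind (face T) q * \<bar>edge p q - ps (fst q) 0 (snd q)\<bar>) ----> 0" by simp
 show "integ (%q. ind (face T) q * \<bar>edge p q - ps (fst q) 0 (snd q)\<bar>)"
 proof (rule Bochner_Integration.integrable_bound[OF iB[of "2 * C"] m])
  show "AE q in lborel. norm (ind (face T) q * \<bar>edge p q - ps (fst q) 0 (snd q)\<bar>) <= norm (ind fbox q * (2 * C))"
   using order_trans[OF b abs_ge_self] by (intro AE_I2) simp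
 qed
 show "integ (%q. ind (face T) q * edge p q)"
 proof (rule Bochner_Integration.integrable_bound[OF iB[of C]])
  show "AE q in lborel. norm (ind (face T) q * edge p q) <= norm (ind fbox q * C)"
  proof (rule AE_I2)
   fix q show "norm (ind (face T) q * edge p q) <= norm (ind fbox q * C)"
    using edge_bound[of q p] C_nonneg by (cases "q : face T"; cases "q : fbox") simp_all
  qed
 qed measurable
 show "integ (%q. ind (face T) q * ps (fst q) 0 (snd q))"
 proof (rule Bochner_Integration.integrable_bound[OF iB[of C]])
  show "AE q in lborel. norm (ind (face T) q * ps (fst q) 0 (snd q)) <= norm (ind fbox q * C)"
  proof (rule AE_I2)
   fix q show "norm (ind (face T) q * ps (fst q) 0 (snd q)) <= norm (ind fbox q * C)"
    using edge_limit_bound[of q] C_nonneg by (cases "q : face T"; cases "q : fbox") simp_all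
  qed
 qed measurable
qed

text \<open>The sampled weights converge in \<open>L1\<close> of the face, so a uniform bound on
  \<open>g p\<close> suffices to exchange them for their limit. This matters because the boundary
  fluxes converge only weakly.\<close>

lemma edge_replace:
 fixes g :: "nat => R2 => real"
 assumes [measurable]: "!!p. g p : Bor" and g: "!!p q. \<bar>g p q\<bar> <= G"
 shows "(%p. (LBINT q. ind (face T) q * (g p q * edge p q))
   - (LBINT q. ind (face T) q * (g p q * ps (fst q) 0 (snd q)))) ----> 0"
  "integ (%q. ind (face T) q * (g p q * edge p q))"
  "integ (%q. ind (face T) q * (g p q * ps (fst q) 0 (snd q)))"
proof -
 let ?F = "ind (face T) :: _ => real"
 have G: "0 <= G" using g[of 0 0] by simp
 have i1: "integ (%q. ?F q * (g p q * edge p q))" for p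
 proof -
  have "integ (%q. g p q * (?F q * edge p q))"
  proof (rule Bochner_Integration.integrable_bound[OF integrable_mult_right[OF edge_L1(3)[of p], of G]])
   show "AE q in lborel. norm (g p q * (?F q * edge p q)) <= norm (G * (?F q * edge p q))"
    using g G by (intro AE_I2) (simp add: abs_mult mult_right_mono)
  qed measurable
  thus ?thesis by (simp add: mult_ac)
 qed
 have i2: "integ (%q. ?F q * (g p q * ps (fst q) 0 (snd q)))" for p
 proof -
  have "integ (%q. g p q * (?F q * ps (fst q) 0 (snd q)))"
  proof (rule Bochner_Integration.integrable_bound[OF integrable_mult_right[OF edge_L1(4), of G]])
   show "AE q in lborel. norm (g p q * (?F q * ps (fst q) 0 (snd q))) <= norm (G * (?F q * ps (fst q) 0 (snd q)))"
    using g G by (intro AE_I2) (simp add: abs_mult mult_right_mono)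
  qed measurable
  thus ?thesis by (simp add: mult_ac)
 qed
 show "integ (%q. ?F q * (g p q * edge p q))" "integ (%q. ?F q * (g p q * ps (fst q) 0 (snd q)))"
  by (rule i1, rule i2)
 show "(%p. (LBINT q. ?F q * (g p q * edge p q)) - (LBINT q. ?F q * (g p q * ps (fst q) 0 (snd q)))) ----> 0"
 proof (rule Lim_null_comparison)
  show "(%p. G * (LBINT q. ?F q * \<bar>edge p q - ps (fst q) 0 (snd q)\<bar>)) ----> 0"
   using tendsto_mult[OF tendsto_const edge_L1(1), of G] by simp
  have "norm ((LBINT q. ?F q * (g p q * edge p q)) - (LBINT q. ?F q * (g p q * ps (fst q) 0 (snd q))))
    <= G * (LBINT q. ?F q * \<bar>edge p q - ps (fst q) 0 (snd q)\<bar>)" for p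
  proof -
   have "norm ((LBINT q. ?F q * (g p q * edge p q)) - (LBINT q. ?F q * (g p q * ps (fst q) 0 (snd q))))
    = norm (LBINT q. ?F q * (g p q * edge p q) - ?F q * (g p q * ps (fst q) 0 (snd q)))"
    using i1 i2 by simp
   also have "... <= (LBINT q. norm (?F q * (g p q * edge p q) - ?F q * (g p q * ps (fst q) 0 (snd q))))"
    by (rule integral_norm_bound)
   also have "... <= (LBINT q. G * (?F q * \<bar>edge p q - ps (fst q) 0 (snd q)\<bar>))"
   proof (rule integral_mono)
    show "integ (%q. norm (?F q * (g p q * edge p q) - ?F q * (g p q * ps (fst q) 0 (snd q))))"
    using i1 i2 by simp
    show "integ (%q. G * (?F q * \<bar>edge p q - ps (fst q) 0 (snd q)\<bar>))" using edge_L1(2) by simp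
    fix q
    have "norm (?F q * (g p q * edge p q) - ?F q * (g p q * ps (fst q) 0 (snd q)))
    = \<bar>g p q\<bar> * (?F q * \<bar>edge p q - ps (fst q) 0 (snd q)\<bar>)"
    by (simp add: indicator_def abs_mult[symmetric] right_diff_distrib)
    thus "norm (?F q * (g p q * edge p q) - ?F q * (g p q * ps (fst q) 0 (snd q)))
    <= G * (?F q * \<bar>edge p q - ps (fst q) 0 (snd q)\<bar>)"
    using g[of p q] by (simp add: mult_right_mono)
   qed
   finally show ?thesis by simp
  qed
  thus "\<forall>\<^sub>F p in sequentially. norm ((LBINT q. ?F q * (g p q * edge p q)) - (LBINT q. ?F q * (g p q * ps (fst q) 0 (snd q))))
    <= G * (LBINT q. ?F q * \<bar>edge p q - ps (fst q) 0 (snd q)\<bar>)" by simp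
 qed
qed

end

context lbm_limit
begin

text \<open>Borel and bounded by \<open>U\<close> everywhere, so that the flux of the trace is
  measurable and bounded without exceptional sets.\<close>

definition is_trace :: "(R2 => real) => bool" where
 "is_trace ga \<longleftrightarrow> ga : Bor & (ALL q. \<bar>ga q\<bar> <= U) &
   integ (%q. ind (face T) q * ga q) &
   (\<forall>ep>0. \<exists>\<delta>>0. AE s in lborel. 0 < s & s < \<delta> -->
    (NN q. ennreal (ind (face T) q * \<bar>v (fst q, s, snd q) - ga q\<bar>)) < ennreal ep)"

text \<open>The maximum with \<open>T / 2\<close> ensures a positive cutoff time even if
  \<open>t2 - 1 / k\<close> is not positive. In the constant, \<open>8 * k\<close> bounds the
  derivative of a bump and \<open>2 / s\<close> that of the decay.\<close>

lemma bump_test_fun: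
 assumes t: "0 <= t1" "t1 < t2" "t2 <= T" and y: "0 <= y1" "y1 < y2" and k: "k > 0" and s: "s > 0"
 shows "test_fun T (%t x y. bump k t1 t2 t * bump k y1 y2 y * decay s x)
   (%t x y. bump' k t1 t2 t * bump k y1 y2 y * decay s x)
   (%t x y. bump k t1 t2 t * bump k y1 y2 y * - decay' s x)
   (%t x y. bump k t1 t2 t * bump' k y1 y2 y * decay s x)
   (max (t2 - 1 / k) (T / 2)) (max s y2) (8 * k + 2 / s + 1)"
 unfolding test_fun_def
proof (intro conjI allI impI ballI)
 have b: "\<bar>bump k a b x\<bar> <= 1" for a b x using bump_bounds by simp
 have m1: "\<bar>p * q * r\<bar> <= c" if "\<bar>p\<bar> * (\<bar>q\<bar> * \<bar>r\<bar>) <= c" for p q r c :: real using that by (simp add: abs_mult mult_ac)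
 have C: "1 <= 8 * k + 2 / s + 1" "8 * k <= 8 * k + 2 / s + 1" "2 / s <= 8 * k + 2 / s + 1" "0 <= 8 * k + 2 / s + 1"
  using k s by auto
 have d1: "\<bar>decay s x\<bar> <= 1" if "0 <= x" for x using decay_props(1,2)[OF s] that by simp
 have d2: "\<bar>- decay' s x\<bar> <= 2 / s" if "0 <= x" for x using decay_props(5,6)[OF s] that by simp
 show "0 < max (t2 - 1 / k) (T / 2)" "max (t2 - 1 / k) (T / 2) < T" "0 < max s y2" "0 <= 8 * k + 2 / s + 1"
  using t T_pos k s C by (auto intro: less_le_trans[of _ t2 T])
 fix t x y :: real
 show "((%s'. bump k t1 t2 s' * bump k y1 y2 y * decay s x) has_real_derivative bump' k t1 t2 t * bump k y1 y2 y * decay s x) (at t)"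
  using DERIV_cmult_right[OF DERIV_cmult_right[OF DERIV_bump]] by blast
 show "((%s'. bump k t1 t2 t * bump k y1 y2 y * decay s s') has_real_derivative bump k t1 t2 t * bump k y1 y2 y * - decay' s x) (at x)"
  by (rule DERIV_cmult[OF DERIV_decay[OF s]])
 show "((%s'. bump k t1 t2 t * bump k y1 y2 s' * decay s x) has_real_derivative bump k t1 t2 t * bump' k y1 y2 y * decay s x) (at y)"
  by (rule DERIV_cmult_right[OF DERIV_cmult[OF DERIV_bump]])
 { assume "0 < t" "0 < x" "0 < y"
  show "\<bar>bump' k t1 t2 t * bump k y1 y2 y * decay s x\<bar> <= 8 * k + 2 / s + 1"
  proof (rule m1)
   have "\<bar>bump' k t1 t2 t\<bar> * (\<bar>bump k y1 y2 y\<bar> * \<bar>decay s x\<bar>) <= (8 * k) * (1 * 1)"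
    using k \<open>0 < x\<close> by (intro mult_mono bump'_bound b d1) auto
   thus "\<bar>bump' k t1 t2 t\<bar> * (\<bar>bump k y1 y2 y\<bar> * \<bar>decay s x\<bar>) <= 8 * k + 2 / s + 1" using C by linarith
  qed
  show "\<bar>bump k t1 t2 t * bump k y1 y2 y * - decay' s x\<bar> <= 8 * k + 2 / s + 1"
  proof (rule m1)
   have "\<bar>bump k t1 t2 t\<bar> * (\<bar>bump k y1 y2 y\<bar> * \<bar>- decay' s x\<bar>) <= 1 * (1 * (2 / s))"
    using \<open>0 < x\<close> by (intro mult_mono b d2) auto
   thus "\<bar>bump k t1 t2 t\<bar> * (\<bar>bump k y1 y2 y\<bar> * \<bar>- decay' s x\<bar>) <= 8 * k + 2 / s + 1" using C by linarith
  qed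
  show "\<bar>bump k t1 t2 t * bump' k y1 y2 y * decay s x\<bar> <= 8 * k + 2 / s + 1"
  proof (rule m1)
   have "\<bar>bump k t1 t2 t\<bar> * (\<bar>bump' k y1 y2 y\<bar> * \<bar>decay s x\<bar>) <= 1 * ((8 * k) * 1)"
    using k \<open>0 < x\<close> by (intro mult_mono bump'_bound b d1) auto
   thus "\<bar>bump k t1 t2 t\<bar> * (\<bar>bump' k y1 y2 y\<bar> * \<bar>decay s x\<bar>) <= 8 * k + 2 / s + 1" using C by linarith
  qed }
 { assume nn: "0 <= t" "0 <= x" "0 <= y"
  show "\<bar>bump k t1 t2 t * bump k y1 y2 y * decay s x\<bar> <= 8 * k + 2 / s + 1"
  proof (rule m1)
   have "\<bar>bump k t1 t2 t\<bar> * (\<bar>bump k y1 y2 y\<bar> * \<bar>decay s x\<bar>) <= 1 * (1 * 1)"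
    using nn by (intro mult_mono b d1) auto
   thus "\<bar>bump k t1 t2 t\<bar> * (\<bar>bump k y1 y2 y\<bar> * \<bar>decay s x\<bar>) <= 8 * k + 2 / s + 1" using C by linarith
  qed
  assume "max (t2 - 1 / k) (T / 2) <= t \<or> max s y2 <= x \<or> max s y2 <= y"
  moreover have "1 / k > 0" using k by simp
  ultimately have "t2 - 1 / k <= t \<or> s <= x \<or> y2 - 1 / k <= y" by linarith
  thus "bump k t1 t2 t * bump k y1 y2 y * decay s x = 0"
   using bump_eq_0[OF k, of t t1 t2] bump_eq_0[OF k, of y y1 y2] decay_props(3)[OF s] by auto }
 have "continuous_on S (%z. bump' k t1 t2 (fst z) * bump k y1 y2 (snd (snd z)) * decay s (fst (snd z)))"
  "continuous_on S (%z. bump k t1 t2 (fst z) * bump k y1 y2 (snd (snd z)) * - decay' s (fst (snd z)))"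
  "continuous_on S (%z. bump k t1 t2 (fst z) * bump' k y1 y2 (snd (snd z)) * decay s (fst (snd z)))"
  "continuous_on S (%z. bump k t1 t2 (fst z) * bump k y1 y2 (snd (snd z)) * decay s (fst (snd z)))"
  for S :: "(R3) set"
  by (intro continuous_intros)+
 hence c: "continuous_on S (%(t, x, y). bump' k t1 t2 t * bump k y1 y2 y * decay s x)"
  "continuous_on S (%(t, x, y). bump k t1 t2 t * bump k y1 y2 y * - decay' s x)"
  "continuous_on S (%(t, x, y). bump k t1 t2 t * bump' k y1 y2 y * decay s x)"
  "continuous_on S (%(t, x, y). bump k t1 t2 t * bump k y1 y2 y * decay s x)"
  for S :: "(R3) set"
  by (simp_all add: case_prod_beta')
 show "continuous_on ({0..} \<times> {0..} \<times> {0..}) (%(t, x, y). bump k t1 t2 t * bump k y1 y2 y * decay s x)"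
  by (rule c)
 show "continuous_on ({0<..} \<times> {0<..} \<times> {0<..}) (%(t, x, y). f t x y)"
  if "f : {%t x y. bump' k t1 t2 t * bump k y1 y2 y * decay s x,
    %t x y. bump k t1 t2 t * bump k y1 y2 y * - decay' s x,
    %t x y. bump k t1 t2 t * bump' k y1 y2 y * decay s x}" for f
  using that c(1-3) by blast
qed

text \<open>The weak limit of the boundary fluxes against a product of bumps: the conservation law is
  tested with the bumps times a function of \<open>x\<close> that decays from 1 to 0 on \<open>[0, s]\<close>, and then
 \<open>s \<rightarrow> 0\<close>.\<close>

lemma bump_flux:
 assumes ga: "is_trace ga" and t: "0 <= t1" "t1 < t2" "t2 <= T" and y: "0 <= y1" "y1 < y2" and k: "k > 0"
 defines "w \<equiv> %q. bump k t1 t2 (fst q) * bump k y1 y2 (snd q)"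
 shows "(%p. LBINT q. ind (face T) q * (wflux p q * w q))
   ----> (LBINT q. ind (face T) q * (\<phi>x (ga q) * w q))"
proof -
 let ?F = "ind (face T) :: _ => real"
 let ?ST = "ind (space_time T) :: _ => real"
 let ?X = "%p. LBINT q. ?F q * (wflux p q * w q)"
 let ?K = "LBINT q. ?F q * (\<phi>x (ga q) * w q)"
 have gam [measurable]: "ga : Bor" and gaU: "!!q. \<bar>ga q\<bar> <= U"
  using ga by (auto simp: is_trace_def)
 have wc: "continuous_on UNIV w" unfolding w_def by (intro continuous_intros)
 hence wm [measurable]: "w : Bor" by (rule borel_measurable_continuous_onI)
 have w01: "0 <= w q" "w q <= 1" for q
  unfolding w_def using bump_bounds by (auto intro!: mult_nonneg_nonneg mult_le_one)
 have e0: "1 / k > 0" using k by simp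
 have w0: "w q = 0" if "fst q <= t1 + 1 / k \<or> snd q <= y1 + 1 / k \<or> y2 <= snd q" for q
 proof -
  have "fst q <= t1 + 1 / k \<or> snd q <= y1 + 1 / k \<or> y2 - 1 / k <= snd q" using that e0 by linarith
  hence "bump k t1 t2 (fst q) = 0 \<or> bump k y1 y2 (snd q) = 0"
   by (elim disjE) (simp_all add: bump_eq_0[OF k])
  thus ?thesis by (auto simp: w_def)
 qed
 have Fw: "integ (%q. ?F q * (a q * w q))"
  if [measurable]: "a : Bor" and a: "!!q. \<bar>a q\<bar> <= c" for a :: "R2 => real" and c
 proof (rule Bochner_Integration.integrable_bound)
  have "emeasure lborel ({0..T} \<times> {0..y2}) < \<infinity>"
   by (intro emeasure_bounded_finite bounded_Times bounded_closed_interval)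
  moreover have "{0..T} \<times> {0..y2} : sets borel" by measurable
  ultimately show "integ (%q. ind ({0..T} \<times> {0..y2}) q * c)" by simp
  show "AE q in lborel. norm (?F q * (a q * w q)) <= norm (ind ({0..T} \<times> {0..y2}) q * c)"
  proof (rule AE_I2)
   fix q
   have "\<bar>a q * w q\<bar> <= c * 1" unfolding abs_mult using a[of q] w01[of q] by (intro mult_mono) auto
   hence *: "\<bar>a q * w q\<bar> <= \<bar>c\<bar>" by simp
   show "norm (?F q * (a q * w q)) <= norm (ind ({0..T} \<times> {0..y2}) q * c)"
   proof (cases "q : face T & snd q < y2")
    case True
    hence "q : {0..T} \<times> {0..y2}" by (auto simp: face_def mem_Times_iff)
    thus ?thesis using True * by simp
   next
    case False
    hence "?F q * (a q * w q) = 0" using w0[of q] by auto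
    thus ?thesis by (simp only: norm_zero norm_ge_zero)
   qed
  qed
 qed measurable
 \<comment> \<open>For the terms without an \<open>x\<close>-derivative: an integrand of size at
   most \<open>(U + fbnd) * (8 * k)\<close> on a box of volume \<open>T * s * y2\<close>.\<close>
 define B where "B = (U + fbnd) * (8 * k) * (T * y2)"
 have B0: "0 <= B" unfolding B_def using sc.U_nonneg fbnd_nonneg k T_pos y by (intro mult_nonneg_nonneg) auto
 have approx: "EX l. ?X ----> l & \<bar>l - ?K\<bar> <= B * s + lam * ep"
  if s: "s > 0" and ep: "ep > 0" and close: "AE x in lborel. 0 < x & x < s -->
    (NN q. ennreal (?F q * \<bar>v (fst q, x, snd q) - ga q\<bar>)) < ennreal ep" for s ep
 proof -
  interpret te: lbm_test E R U M lam T \<phi>x \<phi>y A W S f dt dx N u0 uW uS v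
   "%t x y. bump k t1 t2 t * bump k y1 y2 y * decay s x"
   "%t x y. bump' k t1 t2 t * bump k y1 y2 y * decay s x"
   "%t x y. bump k t1 t2 t * bump k y1 y2 y * - decay' s x"
   "%t x y. bump k t1 t2 t * bump' k y1 y2 y * decay s x"
   "max (t2 - 1 / k) (T / 2)" "max s y2" "8 * k + 2 / s + 1"
   by unfold_locales (use bump_test_fun[OF t y k s] dt_pos dt_lim dx_pos dx_lim in auto)
  let ?id = "%i::vel. %a::real. a" and ?neg = "%i::vel. %a::real. - a"
  have psi0: "0 <= bump k t1 t2 t * bump k y1 y2 y * decay s x" for t x y
   using bump_bounds decay_props(1)[OF s] by (intro mult_nonneg_nonneg) auto
  have init0: "bump k t1 t2 0 = 0" by (rule bump_eq_0[OF k]) (use t e0 in simp)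
  \<comment> \<open>With the identity and its negative the entropy inequality becomes two-sided,
    which fixes the limit of the boundary sums.\<close>
  obtain c where c: "c ----> (LBINT z. ?ST z * te.interior ?id z)"
   "!!p. 0 <= c p + te.bw ?id p + te.bs ?id p" and ci: "integ (%z. ?ST z * te.interior ?id z)"
   using te.core[OF psi0, of ?id] by (auto simp: init0 sc.R_sum)
  obtain c' where c': "c' ----> (LBINT z. ?ST z * te.interior ?neg z)"
   "!!p. 0 <= c' p + te.bw ?neg p + te.bs ?neg p"
  proof (rule te.core[OF psi0, of ?neg])
   show "\<bar>- a - - b\<bar> <= \<bar>a - b\<bar>" for a b :: real by simp
   show "(SUM k:UNIV. - R g k) <= (SUM k:UNIV. - g k)" if "relaxation.admissible E U g" for g
    using sc.R_sum[of g] that by (simp add: sum_negf)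
  qed (use that in \<open>simp add: init0\<close>)
  have bneg: "te.bw ?neg p = - te.bw ?id p" "te.bs ?neg p = - te.bs ?id p" for p
  proof -
   have m: "(- a - - b) * c = - ((a - b) * c)" for a b c :: real by (simp add: algebra_simps)
   show "te.bw ?neg p = - te.bw ?id p" "te.bs ?neg p = - te.bs ?id p"
    unfolding te.bw_def te.bs_def m sum_negf by simp_all
  qed
  have ineg: "te.interior ?neg z = - te.interior ?id z" for z
   unfolding te.interior_def by (simp add: sum_negf algebra_simps)
  let ?L = "LBINT z. ?ST z * te.interior ?id z"
  have c'l: "c' ----> - ?L" using c'(1) unfolding ineg by simp
  have "(%p. te.bw ?id p + te.bs ?id p) ----> - ?L"
  proof (rule tendsto_sandwich[OF _ _ tendsto_minus[OF c(1)] c'l])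
   show "\<forall>\<^sub>F p in sequentially. - c p <= te.bw ?id p + te.bs ?id p"
   proof (rule always_eventually, rule allI)
    fix p show "- c p <= te.bw ?id p + te.bs ?id p" using c(2)[of p] by linarith
   qed
   show "\<forall>\<^sub>F p in sequentially. te.bw ?id p + te.bs ?id p <= c' p"
   proof (rule always_eventually, rule allI)
    fix p show "te.bw ?id p + te.bs ?id p <= c' p" using c'(2)[of p] bneg[of p] by linarith
   qed
  qed
  \<comment> \<open>The bump in \<open>y\<close> vanishes near \<open>y = 0\<close>, so on fine
    grids the southern boundary contributes nothing.\<close>
  moreover have "\<forall>\<^sub>F p in sequentially. te.bw ?id p + te.bs ?id p = te.bw ?id p"
  proof -
   have "\<forall>\<^sub>F p in sequentially. dx p < 1 / k" using order_tendstoD(2)[OF dx_lim e0] .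
   thus ?thesis
   proof eventually_elim
    case (elim p)
    have "(real 0 + 1/2) * dx p <= y1 + 1 / k" using elim dx_pos[of p] y by simp
    hence "bump k y1 y2 ((real 0 + 1/2) * dx p) = 0" by (intro bump_eq_0[OF k]) auto
    thus ?case unfolding te.bs_def sample_def by simp
   qed
  qed
  ultimately have bwl: "te.bw ?id ----> - ?L" by (rule Lim_transform_eventually)
  have bwX: "te.bw ?id p = (LBINT q. ?F q * (wflux p q * te.edge p q))" for p
   unfolding te.bw_eq_integral wflux_def by (simp add: mult.assoc)
  have edge0: "bump k t1 t2 (fst q) * bump k y1 y2 (snd q) * decay s 0 = w q" for q
   using decay_props(4)[OF s] by (simp add: w_def)
  have "(%p. te.bw ?id p - ?X p) ----> 0"
   using te.edge_replace(1)[where g = wflux, OF wflux_borel wflux_bound] unfolding bwX edge0 .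
  from tendsto_diff[OF bwl this] have Xl: "?X ----> - ?L" by simp
  \<comment> \<open>\<open>g1\<close> collects the terms whose integral is of order
    \<open>s\<close>. \<open>g2\<close> carries the density \<open>decay'\<close>, and
    \<open>g3\<close> is \<open>g2\<close> with the trace in place of \<open>v\<close>, so that its
    integral is exactly \<open>?K\<close>.\<close>
  define g1 where "g1 z = ?ST z * (v z * (bump' k t1 t2 (fst z) * bump k y1 y2 (snd (snd z)) * decay s (fst (snd z)))
    + \<phi>y (v z) * (bump k t1 t2 (fst z) * bump' k y1 y2 (snd (snd z)) * decay s (fst (snd z))))" for z
  define g2 where "g2 z = ?ST z * (\<phi>x (v z) * (w (fst z, snd (snd z)) * decay' s (fst (snd z))))" for z
  define g3 where "g3 z = ?ST z * (\<phi>x (ga (fst z, snd (snd z))) * (w (fst z, snd (snd z)) * decay' s (fst (snd z))))" for z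
  have int_eq: "?ST z * te.interior ?id z = g1 z - g2 z" for z
  proof -
   have ie: "te.interior ?id z = v z * (bump' k t1 t2 (fst z) * bump k y1 y2 (snd (snd z)) * decay s (fst (snd z)))
    + (\<phi>x (v z) * (bump k t1 t2 (fst z) * bump k y1 y2 (snd (snd z)) * - decay' s (fst (snd z)))
    + \<phi>y (v z) * (bump k t1 t2 (fst z) * bump' k y1 y2 (snd (snd z)) * decay s (fst (snd z))))"
    unfolding te.interior_def flux_x[symmetric] flux_y[symmetric] sc.E_sum
    by (simp add: case_prod_beta' algebra_simps)
   show ?thesis unfolding ie g1_def g2_def w_def by (simp add: algebra_simps)
  qed
  let ?box = "{0..T} \<times> {0..s} \<times> {0..y2}"
  have box: "?box : sets borel" "emeasure lborel ?box < \<infinity>" "measure lborel ?box = T * s * y2"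
  proof -
   show "?box : sets borel" by measurable
   show "emeasure lborel ?box < \<infinity>" by (intro emeasure_bounded_finite bounded_Times bounded_closed_interval)
   have "emeasure lborel ?box = ennreal (T * (s * y2))"
    using T_pos s y by (simp add: emeasure_lborel_Times ennreal_mult)
   thus "measure lborel ?box = T * s * y2" using T_pos s y by (simp add: measure_def)
  qed
  note [measurable] = box(1)
  have cut: "z : ?box" if "z : space_time T" "fst (snd z) < s" "snd (snd z) < y2" for z
   using that by (auto simp: space_time_def quarter_def mem_Times_iff)
  have [measurable]: "decay s : Bor" "decay' s : Bor"
   "bump k a b : Bor" "bump' k a b : Bor" for a b
   by (intro borel_measurable_continuous_onI continuous_intros)+
  have w3 [measurable]: "(%z :: R3. w (fst z, snd (snd z))) : Bor"
   "(%z :: R3. ga (fst z, snd (snd z))) : Bor"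
  proof -
   have p: "(%z :: R3. (fst z, snd (snd z))) : Bor"
    by (intro borel_measurable_continuous_onI continuous_intros)
   show "(%z :: R3. w (fst z, snd (snd z))) : Bor" by (rule measurable_compose[OF p wm])
   show "(%z :: R3. ga (fst z, snd (snd z))) : Bor" by (rule measurable_compose[OF p gam])
  qed
  have [measurable]: "g1 : Bor" "g2 : Bor" "g3 : Bor"
   unfolding g1_def[abs_def] g2_def[abs_def] g3_def[abs_def] by measurable
  have by0: "bump k y1 y2 r = 0" "bump' k y1 y2 r = 0" if "y2 <= r" for r
  proof -
   have "k * (y2 - r) <= 0" using that k by (intro mult_nonneg_nonpos) auto
   hence z: "k * (y2 - r) - 1 <= 0" by simp
   hence "1 <= sqpos (1 - (k * (y2 - r) - 1))"
    using one_le_power[of "1 - (k * (y2 - r) - 1)" 2] by (simp add: sqpos_def)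
   hence "step01' (k * (y2 - r) - 1) = 0" by (simp add: step01'_def)
   thus "bump k y1 y2 r = 0" "bump' k y1 y2 r = 0"
    unfolding bump_def bump'_def step01_props(1)[OF z] by simp_all
  qed
  have g1b: "\<bar>g1 z\<bar> <= ind ?box z * ((U + fbnd) * (8 * k))" for z
  proof (cases "z : space_time T & fst (snd z) < s & snd (snd z) < y2")
   case True
   have d: "\<bar>decay s (fst (snd z))\<bar> <= 1"
    using decay_props(1,2)[OF s] True by (auto simp: space_time_def quarter_def)
   have b: "\<bar>bump k a b x\<bar> <= 1" for a b x using bump_bounds by simp
   have "\<bar>v z * (bump' k t1 t2 (fst z) * bump k y1 y2 (snd (snd z)) * decay s (fst (snd z)))\<bar> <= U * ((8 * k) * 1 * 1)"
    unfolding abs_mult using k sc.U_nonneg by (intro mult_mono v_bound bump'_bound b d mult_nonneg_nonneg) auto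
   moreover have "\<bar>\<phi>y (v z) * (bump k t1 t2 (fst z) * bump' k y1 y2 (snd (snd z)) * decay s (fst (snd z)))\<bar> <= fbnd * (1 * (8 * k) * 1)"
    unfolding abs_mult using k fbnd_nonneg by (intro mult_mono phi_bounds v_bound bump'_bound b d mult_nonneg_nonneg) auto
   ultimately have "\<bar>v z * (bump' k t1 t2 (fst z) * bump k y1 y2 (snd (snd z)) * decay s (fst (snd z)))
    + \<phi>y (v z) * (bump k t1 t2 (fst z) * bump' k y1 y2 (snd (snd z)) * decay s (fst (snd z)))\<bar> <= (U + fbnd) * (8 * k)"
    by (simp add: distrib_right)
   thus ?thesis using True cut[of z] by (simp add: g1_def)
  next
   case False
   hence "g1 z = 0" using decay_props(3)[OF s, of "fst (snd z)"] by0[of "snd (snd z)"] by (auto simp: g1_def not_less)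
   thus ?thesis using sc.U_nonneg fbnd_nonneg k by simp
  qed
  have iB: "integ (%z. ind ?box z * c :: real)" for c using box by simp
  have g1i: "integ g1"
   by (rule Bochner_Integration.integrable_bound[OF iB[of "(U + fbnd) * (8 * k)"]], measurable, rule AE_I2)
    (use order_trans[OF g1b abs_ge_self] in simp)
  have "\<bar>LBINT z. g1 z\<bar> <= (LBINT z. \<bar>g1 z\<bar>)" by (rule integral_abs_bound)
  also have "... <= (LBINT z. ind ?box z * ((U + fbnd) * (8 * k)))"
   by (rule integral_mono[OF integrable_abs[OF g1i] iB g1b])
  also have "... = B * s" using box by (simp add: B_def)
  finally have G1: "\<bar>LBINT z. g1 z\<bar> <= B * s" .
  have gb: "\<bar>?ST z * (a * (w (fst z, snd (snd z)) * decay' s (fst (snd z))))\<bar> <= ind ?box z * (fbnd * (2 / s))"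
   if "\<bar>a\<bar> <= fbnd" for a z
  proof (cases "z : space_time T & fst (snd z) < s & snd (snd z) < y2")
   case True
   have d: "\<bar>decay' s (fst (snd z))\<bar> <= 2 / s"
    using decay_props(5,6)[OF s] True by (auto simp: space_time_def quarter_def)
   have "\<bar>a * (w (fst z, snd (snd z)) * decay' s (fst (snd z)))\<bar> <= fbnd * (1 * (2 / s))"
    unfolding abs_mult using w01 fbnd_nonneg s by (intro mult_mono that d) auto
   thus ?thesis using True cut[of z] by simp
  next
   case False
   hence "?ST z * (a * (w (fst z, snd (snd z)) * decay' s (fst (snd z)))) = 0"
    using decay_props(7)[OF s, of "fst (snd z)"] w0[of "(fst z, snd (snd z))"] by (auto simp: not_less)
   moreover have "0 <= ind ?box z * (fbnd * (2 / s))" using fbnd_nonneg s by simp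
   ultimately show ?thesis by (simp only: abs_zero)
  qed
  have g2i: "integ g2"
   by (rule Bochner_Integration.integrable_bound[OF iB[of "fbnd * (2 / s)"]], measurable, rule AE_I2, unfold g2_def)
    (use order_trans[OF gb[OF phi_bounds(1)[OF v_bound]] abs_ge_self] in simp)
  have g3i: "integ g3"
   by (rule Bochner_Integration.integrable_bound[OF iB[of "fbnd * (2 / s)"]], measurable, rule AE_I2, unfold g3_def)
    (use order_trans[OF gb[OF phi_bounds(1)[OF gaU]] abs_ge_self] in simp)
  have "(LBINT z. g3 z) = (LBINT x. (LBINT q. g3 (fst q, x, snd q)))"
   by (rule integral_lborel_reorder[OF g3i])
  also have "... = (LBINT x. (ind {0<..} x * decay' s x) * ?K)"
  proof (intro Bochner_Integration.integral_cong refl)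
   fix x
   have "(LBINT q. g3 (fst q, x, snd q)) = (LBINT q. (ind {0<..} x * decay' s x) * (?F q * (\<phi>x (ga q) * w q)))"
    by (intro Bochner_Integration.integral_cong refl)
    (auto simp: g3_def indicator_def space_time_def quarter_def face_def mem_Times_iff)
   thus "(LBINT q. g3 (fst q, x, snd q)) = (ind {0<..} x * decay' s x) * ?K" by simp
  qed
  also have "... = ?K" using integral_decay'[OF s] by simp
  finally have G3: "(LBINT z. g3 z) = ?K" .
  \<comment> \<open>The flux is Lipschitz with constant \<open>lam\<close>, almost every slice with
    \<open>0 < x < s\<close> is within \<open>ep\<close> of the trace, and the density has mass
    1.\<close>
  have "ennreal (LBINT z. \<bar>g2 z - g3 z\<bar>) = (NN z. ennreal \<bar>g2 z - g3 z\<bar>)"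
   using g2i g3i by (intro nn_integral_eq_integral[symmetric]) auto
  also have "... = (NN x. (NN q. ennreal \<bar>g2 (fst q, x, snd q) - g3 (fst q, x, snd q)\<bar>))"
   by (rule nn_integral_lborel_reorder) measurable
  also have "... <= (NN x. ennreal (lam * ep) * ennreal (ind {0<..} x * decay' s x))"
  proof (rule nn_integral_mono_AE, use close in eventually_elim)
   case (elim x)
   show ?case
   proof (cases "0 < x & x < s")
    case True
    have d0: "0 <= lam * decay' s x" using lam_pos decay_props(5)[OF s] by simp
    have "\<bar>g2 (fst q, x, snd q) - g3 (fst q, x, snd q)\<bar> <= (lam * decay' s x) * (?F q * \<bar>v (fst q, x, snd q) - ga q\<bar>)" for q
    proof (cases "q : face T")
    case True
    have "\<bar>g2 (fst q, x, snd q) - g3 (fst q, x, snd q)\<bar> = \<bar>\<phi>x (v (fst q, x, snd q)) - \<phi>x (ga q)\<bar> * (w q * decay' s x)"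
    using True \<open>0 < x \<and> x < s\<close> w01[of q] decay_props(5)[OF s, of x]
    by (simp add: g2_def g3_def space_time_def quarter_def face_def mem_Times_iff abs_mult left_diff_distrib[symmetric])
    also have "... <= (lam * \<bar>v (fst q, x, snd q) - ga q\<bar>) * (1 * decay' s x)"
    using w01[of q] decay_props(5)[OF s, of x] lam_pos
    by (intro mult_mono phi_lip v_bound gaU) auto
    finally show ?thesis using True by (simp add: mult_ac)
    next
    case False
    hence "(fst q, x, snd q) \<notin> space_time T" using \<open>0 < x \<and> x < s\<close>
    by (auto simp: space_time_def quarter_def face_def mem_Times_iff)
    thus ?thesis using False by (simp add: g2_def g3_def)
    qed
    hence "(NN q. ennreal \<bar>g2 (fst q, x, snd q) - g3 (fst q, x, snd q)\<bar>)
    <= (NN q. ennreal (lam * decay' s x) * ennreal (?F q * \<bar>v (fst q, x, snd q) - ga q\<bar>))"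
    using d0 by (intro nn_integral_mono) (simp add: ennreal_mult[symmetric] ennreal_leI)
    also have "... = ennreal (lam * decay' s x) * (NN q. ennreal (?F q * \<bar>v (fst q, x, snd q) - ga q\<bar>))"
    by (rule nn_integral_cmult) measurable
    also have "... <= ennreal (lam * decay' s x) * ennreal ep"
    using elim True by (intro mult_left_mono) auto
    also have "... = ennreal (lam * ep) * ennreal (ind {0<..} x * decay' s x)"
    using True lam_pos ep decay_props(5)[OF s, of x] d0 by (simp add: ennreal_mult[symmetric] mult_ac)
    finally show ?thesis .
   next
    case False
    have "g2 (fst q, x, snd q) = 0" "g3 (fst q, x, snd q) = 0" for q
    using False decay_props(7)[OF s, of x]
    by (auto simp: g2_def g3_def space_time_def quarter_def indicator_def not_less)
    thus ?thesis by simp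
   qed
  qed
  also have "... = ennreal (lam * ep) * (NN x. ennreal (ind {0<..} x * decay' s x))"
   by (rule nn_integral_cmult) measurable
  also have "(NN x. ennreal (ind {0<..} x * decay' s x)) = ennreal 1"
   using nn_integral_eq_integral[OF integral_decay'(1)[OF s]] integral_decay'(2)[OF s] decay_props(5)[OF s] by simp
  finally have "ennreal (LBINT z. \<bar>g2 z - g3 z\<bar>) <= ennreal (lam * ep)" by simp
  hence "(LBINT z. \<bar>g2 z - g3 z\<bar>) <= lam * ep"
   using lam_pos ep by (subst (asm) ennreal_le_iff) auto
  hence G2: "\<bar>(LBINT z. g2 z) - ?K\<bar> <= lam * ep"
   using integral_abs_bound[of lborel "%z. g2 z - g3 z"] g2i g3i by (simp add: G3)
  have "?L = (LBINT z. g1 z) - (LBINT z. g2 z)" unfolding int_eq using g1i g2i by simp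
  hence "\<bar>- ?L - ?K\<bar> <= B * s + lam * ep" using G1 G2 by linarith
  thus ?thesis using Xl by blast
 qed
 have approx2: "EX l. ?X ----> l & \<bar>l - ?K\<bar> <= e" if e: "e > 0" for e
 proof -
  define ep where "ep = e / (2 * lam)"
  have ep: "ep > 0" using e lam_pos by (simp add: ep_def)
  obtain \<delta> where \<delta>: "\<delta> > 0" "AE x in lborel. 0 < x & x < \<delta> -->
    (NN q. ennreal (?F q * \<bar>v (fst q, x, snd q) - ga q\<bar>)) < ennreal ep"
   using ga ep unfolding is_trace_def by blast
  \<comment> \<open>Half of \<open>e\<close> goes to \<open>B * s\<close> and half to
    \<open>lam * ep\<close>; the summand 1 in \<open>B + 1\<close> avoids division by zero.\<close>
  define s where "s = min \<delta> (e / (2 * (B + 1)))"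
  have s: "s > 0" using \<delta>(1) e B0 by (simp add: s_def)
  have "AE x in lborel. 0 < x & x < s -->
    (NN q. ennreal (?F q * \<bar>v (fst q, x, snd q) - ga q\<bar>)) < ennreal ep"
   using \<delta>(2) by eventually_elim (simp add: s_def)
  then obtain l where l: "?X ----> l" "\<bar>l - ?K\<bar> <= B * s + lam * ep" using approx[OF s ep] by blast
  have "B * s <= (B + 1) * (e / (2 * (B + 1)))"
   using B0 s by (intro mult_mono) (auto simp: s_def)
  also have "... = e / 2" using B0 by (simp add: field_simps)
  finally have "B * s + lam * ep <= e" using lam_pos by (simp add: ep_def)
  thus ?thesis using l by (intro exI[of _ l]) linarith
 qed
 \<comment> \<open>The limit of \<open>?X\<close> does not depend on \<open>e\<close>, so its
   distance from \<open>?K\<close> is at most every \<open>e\<close>.\<close>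
 obtain l where l: "?X ----> l" using approx2[of 1] by auto
 have "\<bar>l - ?K\<bar> <= e" if "e > 0" for e
  using approx2[OF that] LIMSEQ_unique[OF l] by blast
 hence "\<bar>l - ?K\<bar> <= 0" by (rule field_le_epsilon[of _ 0, simplified])
 thus ?thesis using l by simp
qed

end

definition weakly :: "(nat => R2 => real) => (R2 => real) => (R2 => real) => bool" where
 "weakly g g' w \<longleftrightarrow> integ w & (%p. LBINT q. g p q * w q) ----> (LBINT q. g' q * w q)"

lemma integrable_bounded_mult:
 fixes a w :: "R2 => real"
 assumes [measurable]: "a : Bor" and a: "!!q. \<bar>a q\<bar> <= G" and w: "integ w"
 shows "integ (%q. a q * w q)"
proof -
 have [measurable]: "w : Bor" using borel_measurable_integrable[OF w] by simp
 have G: "0 <= G" using a[of 0] by simp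
 show ?thesis
 proof (rule Bochner_Integration.integrable_bound[OF integrable_mult_right[OF w, of G]])
  show "AE q in lborel. norm (a q * w q) <= norm (G * w q)"
   using a G by (intro AE_I2) (simp add: abs_mult mult_right_mono)
 qed measurable
qed

lemma weakly_sum:
 assumes [measurable]: "!!p. g p : Bor" "g' : Bor"
  and b: "!!p q. \<bar>g p q\<bar> <= G" "!!q. \<bar>g' q\<bar> <= G"
  and fin: "finite I" and w: "!!i. i : I ==> weakly g g' (w i)"
 shows "weakly g g' (%q. SUM i:I. c i * w i q)"
proof -
 have i: "integ (w i)" if "i : I" for i using w[OF that] by (simp add: weakly_def)
 have "(LBINT q. h q * (SUM i:I. c i * w i q)) = (SUM i:I. c i * (LBINT q. h q * w i q))"
  if [measurable]: "h : Bor" and h: "!!q. \<bar>h q\<bar> <= G" for h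
 proof -
  have "(LBINT q. h q * (SUM i:I. c i * w i q)) = (LBINT q. (SUM i:I. c i * (h q * w i q)))"
   by (simp add: sum_distrib_left mult_ac)
  also have "... = (SUM i:I. (LBINT q. c i * (h q * w i q)))"
   by (intro Bochner_Integration.integral_sum integrable_mult_right integrable_bounded_mult[of h G] h i) simp_all
  finally show ?thesis by simp
 qed
 moreover have "(%p. SUM i:I. c i * (LBINT q. g p q * w i q)) ----> (SUM i:I. c i * (LBINT q. g' q * w i q))"
  using w by (intro tendsto_sum tendsto_mult tendsto_const) (simp add: weakly_def)
 ultimately show ?thesis unfolding weakly_def using b i
  by (auto intro!: Bochner_Integration.integrable_sum integrable_mult_right)
qed

text \<open>The bound \<open>G\<close> is uniform in \<open>p\<close>, hence so is the error made by
  replacing \<open>w'\<close> with \<open>w n\<close>.\<close>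

lemma weakly_limit:
 assumes gm [measurable]: "!!p. g p : Bor" "g' : Bor"
  and b: "!!p q. \<bar>g p q\<bar> <= G" "!!q. \<bar>g' q\<bar> <= G"
  and w: "!!n. weakly g g' (w n)" "integ w'"
  and L: "(%n. LBINT q. \<bar>w n q - w' q\<bar>) ----> 0"
 shows "weakly g g' w'"
 unfolding weakly_def
proof (intro conjI w(2) tendstoI)
 fix e :: real assume e: "e > 0"
 have G: "0 <= G" using b(2)[of 0] by simp
 have wi: "integ (w n)" for n using w(1)[of n] by (simp add: weakly_def)
 have close: "\<bar>(LBINT q. h q * w n q) - (LBINT q. h q * w' q)\<bar> <= G * (LBINT q. \<bar>w n q - w' q\<bar>)"
  if hm: "h : Bor" and h: "!!q. \<bar>h q\<bar> <= G" for h n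
 proof -
  have i: "integ (%q. h q * w n q)" "integ (%q. h q * w' q)"
   using integrable_bounded_mult[OF hm h] wi w(2) by auto
  have d: "integ (%q. \<bar>w n q - w' q\<bar>)" using wi w(2) by auto
  have "\<bar>LBINT q. (h q * w n q - h q * w' q)\<bar> <= (LBINT q. \<bar>h q * w n q - h q * w' q\<bar>)"
   by (rule integral_abs_bound)
  also have "... <= (LBINT q. G * \<bar>w n q - w' q\<bar>)"
  proof (rule integral_mono)
   show "\<bar>h q * w n q - h q * w' q\<bar> <= G * \<bar>w n q - w' q\<bar>" for q
    using h[of q] by (simp add: right_diff_distrib[symmetric] abs_mult mult_right_mono)
  qed (use i d in auto)
  finally show ?thesis using i by simp
 qed
 have "0 < e / (3 * (G + 1))" using e G by simp
 from order_tendstoD(2)[OF L this] obtain n where n: "(LBINT q. \<bar>w n q - w' q\<bar>) < e / (3 * (G + 1))"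
  by (auto dest: eventually_happens)
 have "G * (LBINT q. \<bar>w n q - w' q\<bar>) <= (G + 1) * (e / (3 * (G + 1)))"
  using n G by (intro mult_mono) auto
 also have "... = e / 3" using G by (simp add: field_simps)
 finally have e3: "G * (LBINT q. \<bar>w n q - w' q\<bar>) <= e / 3" .
 have "\<forall>\<^sub>F p in sequentially. dist (LBINT q. g p q * w n q) (LBINT q. g' q * w n q) < e / 3"
  using w(1)[of n] e unfolding weakly_def by (intro tendstoD) auto
 thus "\<forall>\<^sub>F p in sequentially. dist (LBINT q. g p q * w' q) (LBINT q. g' q * w' q) < e"
 proof eventually_elim
  case (elim p)
  show ?case using elim e3 close[OF gm(1) b(1), of p n] close[OF gm(2) b(2), of n] unfolding dist_real_def by linarith
 qed
qed

definition rect :: "real => real => real => real => R2 => real" where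
 "rect a b c d q = ind {a..<b} (fst q) * ind {c..<d} (snd q)"

lemma rect_borel [measurable]: "rect a b c d : Bor"
proof -
 have "(%q :: R2. ind {a..<b} (fst q) * ind {c..<d} (snd q) :: real) : Bor" by measurable
 thus ?thesis by (simp add: rect_def[abs_def])
qed

lemma rect_box: "0 <= rect a b c d q" "rect a b c d q <= ind ({a..b} \<times> {c..d}) q"
 by (auto simp: rect_def indicator_def mem_Times_iff)

lemma integrable_box2: "integ (%q :: R2. ind ({a..b} \<times> {c..d}) q * e :: real)"
proof -
 have "{a..b} \<times> {c..d} : sets borel" by measurable
 moreover have "emeasure lborel ({a..b} \<times> {c..d}) < \<infinity>" by (intro emeasure_bounded_finite bounded_Times bounded_closed_interval)
 ultimately show ?thesis by simp
qed

lemma integrable_dominated_box2: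
 fixes w :: "R2 => real"
 assumes [measurable]: "w : Bor" and w: "!!q. \<bar>w q\<bar> <= ind ({a..b} \<times> {c..d}) q * e"
 shows "integ w"
proof (rule Bochner_Integration.integrable_bound[OF integrable_box2[of a b c d e]])
 show "AE q in lborel. norm (w q) <= norm (ind ({a..b} \<times> {c..d}) q * e)"
  by (rule AE_I2) (use w in \<open>simp add: order_trans[OF _ abs_ge_self]\<close>)
qed measurable

text \<open>Rectangles are half-open so that they tile. The bumps tend to the open rectangles, which
  differ from them by a null set.\<close>

lemma bump_rect_L1:
 assumes "a < b" "c < d"
 shows "(%n. LBINT q. \<bar>bump (real (Suc n)) a b (fst q) * bump (real (Suc n)) c d (snd q) - rect a b c d q\<bar>) ----> 0"
proof -
 let ?B = "%n q. bump (real (Suc n)) a b (fst q) * bump (real (Suc n)) c d (snd q)"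
 have k: "real (Suc n) > 0" for n by simp
 have [measurable]: "bump k a b : Bor" for k a b
  by (intro borel_measurable_continuous_onI continuous_intros)
 have "(%n. LBINT q. \<bar>?B n q - rect a b c d q\<bar>) ----> (LINT q|(lborel :: (R2) measure). 0)"
 proof (rule integral_dominated_convergence[where w = "%q. ind ({a..b} \<times> {c..d}) q * 2"])
  show "integ (%q. ind ({a..b} \<times> {c..d}) q * 2 :: real)" by (rule integrable_box2)
  have f: "filterlim (%n. real (Suc n)) at_top sequentially"
   by (intro filterlim_compose[OF filterlim_real_sequentially filterlim_Suc])
  have e: "AE q :: R2 in lborel. q \<bullet> (1, 0) ~= a" "AE q :: R2 in lborel. q \<bullet> (0, 1) ~= c"
   by (intro AE_inner_neq, simp add: Basis_prod_def)+
  show "AE q in lborel. (%n. \<bar>?B n q - rect a b c d q\<bar>) ----> 0"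
   using e
  proof eventually_elim
   case (elim q)
   hence ne: "fst q ~= a" "snd q ~= c" by (auto simp: inner_prod_def)
   have "(%n. ?B n q) ----> ind {a<..<b} (fst q) * ind {c<..<d} (snd q)"
    by (intro tendsto_mult bump_tendsto f k)
   also have "ind {a<..<b} (fst q) * ind {c<..<d} (snd q) = rect a b c d q"
    using ne by (auto simp: rect_def indicator_def)
   finally show ?case by (intro tendsto_rabs_zero) (simp add: LIM_zero)
  qed
  show "AE q in lborel. norm \<bar>?B n q - rect a b c d q\<bar> <= ind ({a..b} \<times> {c..d}) q * 2" for n
  proof (rule AE_I2)
   fix q
   have b: "0 <= ?B n q" "?B n q <= 1" using bump_bounds by (auto intro!: mult_nonneg_nonneg mult_le_one)
   show "norm \<bar>?B n q - rect a b c d q\<bar> <= ind ({a..b} \<times> {c..d}) q * 2"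
   proof (cases "q : {a..b} \<times> {c..d}")
    case True
    thus ?thesis using b rect_box[of a b c d q] by simp
   next
    case False
    have "0 < 1 / real (Suc n)" by simp
    hence "fst q <= a + 1 / real (Suc n) \<or> b - 1 / real (Suc n) <= fst q \<or> snd q <= c + 1 / real (Suc n) \<or> d - 1 / real (Suc n) <= snd q"
    using False unfolding mem_Times_iff atLeastAtMost_iff by linarith
    hence "?B n q = 0" using bump_eq_0[OF k] by (elim disjE) simp_all
    moreover have "rect a b c d q = 0" using False rect_box[of a b c d q] by simp
    ultimately show ?thesis by (simp only: norm_zero abs_zero diff_self indicator_pos_le mult_nonneg_nonneg zero_le_numeral)
   qed
  qed
 qed measurable
 thus ?thesis by simp
qed

text \<open>Bounded functions with bounded support are \<open>L\<^sup>1\<close> limits of their averages over the cells of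
 finer and finer grids.\<close>

lemma weakly_if_rect:
 fixes w :: "R2 => real"
 assumes gm [measurable]: "!!p. g p : Bor" "g' : Bor"
  and b: "!!p q. \<bar>g p q\<bar> <= G" "!!q. \<bar>g' q\<bar> <= G" and TY: "T > 0" "Y > 0"
  and rc: "!!t1 t2 y1 y2. 0 <= t1 ==> t1 < t2 ==> t2 <= T ==> 0 <= y1 ==> y1 < y2 ==> weakly g g' (rect t1 t2 y1 y2)"
  and wm [measurable]: "w : Bor" and wb: "!!q. \<bar>w q\<bar> <= C"
  and w0: "!!q. q \<notin> {0..<T} \<times> {0..<Y} ==> w q = 0"
 shows "weakly g g' w"
proof -
 define h where "h n = T / real (Suc n)" for n
 define k where "k n = Y / real (Suc n)" for n
 have hk: "h n > 0" "k n > 0" for n using TY by (auto simp: h_def k_def)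
 have hl: "h ----> 0" "k ----> 0" unfolding h_def k_def by (rule LIMSEQ_Suc[OF lim_const_over_n])+
 define avg where "avg n i j = cell_int w (h n) (k n) i j / (h n * k n)" for n i j
 define a where "a n = (%q. SUM i<Suc n. 1 * (SUM j<Suc n. avg n i j * rect (real i * h n) (real (Suc i) * h n) (real j * k n) (real (Suc j) * k n) q))" for n
 have hn: "real (Suc n) * h n = T" "real (Suc n) * k n = Y" for n by (simp_all add: h_def k_def del: of_nat_Suc)
 have rw: "weakly g g' (rect (real i * h n) (real (Suc i) * h n) (real j * k n) (real (Suc j) * k n))" if "i < Suc n" for i j n
 proof (rule rc)
  have "real (Suc i) * h n <= real (Suc n) * h n" using that hk[of n] by (intro mult_right_mono) auto
  thus "real (Suc i) * h n <= T" unfolding hn .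
 qed (use hk[of n] in \<open>auto simp: mult_less_cancel_right\<close>)
 have aw: "weakly g g' (a n)" for n
  unfolding a_def
 proof (rule weakly_sum[OF gm b])
  fix i assume "i : {..<Suc n}"
  thus "weakly g g' (%q. SUM j<Suc n. avg n i j * rect (real i * h n) (real (Suc i) * h n) (real j * k n) (real (Suc j) * k n) q)"
   by (intro weakly_sum[OF gm b] rw) auto
 qed auto
 have a_in: "a n q = avg n (ix (h n) (fst q)) (ix (k n) (snd q))" if q: "q : {0..<T} \<times> {0..<Y}" for n q
 proof -
  have q0: "0 <= fst q" "0 <= snd q" using q by (auto simp: mem_Times_iff)
  define A where "A i j = (if i < Suc n & j < Suc n then avg n i j else 0)" for i j
  have "a n q = (SUM i<Suc n. (SUM j<Suc n. A i j * ind {real j * k n..<real (Suc j) * k n} (snd q)) * ind {real i * h n..<real (Suc i) * h n} (fst q))"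
   unfolding a_def sum_distrib_right
   by (intro sum.cong refl) (auto simp: A_def rect_def mult_ac simp del: of_nat_Suc sum.lessThan_Suc intro!: sum.cong)
  also have "... = (SUM i<Suc n. A i (ix (k n) (snd q)) * ind {real i * h n..<real (Suc i) * h n} (fst q))"
   by (intro sum.cong refl arg_cong2[of _ _ _ _ "(*)"] step_sum[symmetric] hk q0) (auto simp: A_def)
  also have "... = A (ix (h n) (fst q)) (ix (k n) (snd q))"
   by (intro step_sum[symmetric] hk q0) (auto simp: A_def)
  also have "... = avg n (ix (h n) (fst q)) (ix (k n) (snd q))"
   unfolding A_def ix_less_iff[OF hk(1) q0(1)] ix_less_iff[OF hk(2) q0(2)] hn using q by (auto simp: mem_Times_iff)
  finally show ?thesis .
 qed
 have a_out: "a n q = 0" if q: "q \<notin> {0..<T} \<times> {0..<Y}" for n q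
 proof -
  have "rect (real i * h n) (real (Suc i) * h n) (real j * k n) (real (Suc j) * k n) q = 0" if "i < Suc n" "j < Suc n" for i j
  proof -
   have "real (Suc i) * h n <= real (Suc n) * h n" "real (Suc j) * k n <= real (Suc n) * k n"
    using that hk[of n] by (auto intro!: mult_right_mono)
   hence "real (Suc i) * h n <= T" "real (Suc j) * k n <= Y" unfolding hn .
   moreover have "0 <= real i * h n" "0 <= real j * k n" using hk[of n] by auto
   moreover have "fst q < 0 \<or> T <= fst q \<or> snd q < 0 \<or> Y <= snd q" using q by (auto simp: mem_Times_iff)
   ultimately have "fst q \<notin> {real i * h n..<real (Suc i) * h n} \<or> snd q \<notin> {real j * k n..<real (Suc j) * k n}"
    unfolding atLeastLessThan_iff by linarith
   thus ?thesis by (auto simp: rect_def)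
  qed
  thus ?thesis unfolding a_def by (intro sum.neutral) (simp add: sum.neutral del: of_nat_Suc sum.lessThan_Suc)
 qed
 have C0: "0 <= C" using wb[of 0] by simp
 have wi: "integ w"
 proof (rule integrable_dominated_box2[OF wm])
  show "\<bar>w q\<bar> <= ind ({0..T} \<times> {0..Y}) q * C" for q
   using wb[of q] w0[of q] C0 by (cases "q : {0..<T} \<times> {0..<Y}") (auto simp: mem_Times_iff indicator_def)
 qed
 have am [measurable]: "a n : Bor" for n unfolding a_def by measurable
 have ai: "integ (a n)" for n using aw[of n] by (simp add: weakly_def)
 have "\<bar>a n q - w q\<bar> <= ind ({0..T} \<times> {0..Y}) q * \<bar>avg n (ix (h n) (fst q)) (ix (k n) (snd q)) - w q\<bar>" for n q
  using a_in[of q n] a_out[of q n] w0[of q] by (cases "q : {0..<T} \<times> {0..<Y}") (auto simp: mem_Times_iff indicator_def)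
 moreover have "integ (%q. ind ({0..T} \<times> {0..Y}) q * \<bar>avg n (ix (h n) (fst q)) (ix (k n) (snd q)) - w q\<bar>)" for n
 proof (rule integrable_dominated_box2)
  have [measurable]: "(%q. avg n (ix (h n) (fst q)) (ix (k n) (snd q))) : Bor"
   by (rule measurable_step2)
  show "(%q. ind ({0..T} \<times> {0..Y}) q * \<bar>avg n (ix (h n) (fst q)) (ix (k n) (snd q)) - w q\<bar>) : Bor"
   by (intro borel_measurable_times borel_measurable_abs borel_measurable_diff wm measurable_step2 borel_measurable_indicator) measurable
  fix q
  have hkp: "h n * k n > 0" using hk[of n] by simp
  have av: "\<bar>avg n i j\<bar> <= C" for i j
   using cell_int_bound[OF wm wb hk(1)[of n] hk(2)[of n], of i j]
   unfolding avg_def abs_divide abs_of_pos[OF hkp] pos_divide_le_eq[OF hkp] .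
  have "\<bar>avg n (ix (h n) (fst q)) (ix (k n) (snd q)) - w q\<bar> <= 2 * C"
   using wb[of q] av[of "ix (h n) (fst q)" "ix (k n) (snd q)"] by linarith
  thus "\<bar>ind ({0..T} \<times> {0..Y}) q * \<bar>avg n (ix (h n) (fst q)) (ix (k n) (snd q)) - w q\<bar>\<bar> <= ind ({0..T} \<times> {0..Y}) q * (2 * C)"
   by (simp add: indicator_def)
 qed
 ultimately have le: "(LBINT q. \<bar>a n q - w q\<bar>) <= (LBINT q. ind ({0..T} \<times> {0..Y}) q * \<bar>avg n (ix (h n) (fst q)) (ix (k n) (snd q)) - w q\<bar>)" for n
  using ai wi by (intro integral_mono) auto
 have "(%n. LBINT q. \<bar>a n q - w q\<bar>) ----> 0"
 proof (rule tendsto_sandwich[OF _ _ tendsto_const])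
  show "(%n. LBINT q. ind ({0..T} \<times> {0..Y}) q * \<bar>avg n (ix (h n) (fst q)) (ix (k n) (snd q)) - w q\<bar>) ----> 0"
   unfolding avg_def using TY by (intro cell_average_tendsto[OF wm wb hk hl]) auto
 qed (use le in auto)
 from weakly_limit[OF gm b aw wi this] show ?thesis .
qed

context lbm_limit
begin

text \<open>Products of bumps approximate rectangles, and rectangles approximate every bounded
  weight with bounded support. The weight needed later, the sign of \<open>uW - kp\<close> times a
  test function, is of this kind.\<close>

lemma weak_flux:
 assumes ga: "is_trace ga" and [measurable]: "w : Bor" and wb: "!!q. \<bar>w q\<bar> <= C"
  and w0: "!!q. Y <= snd q ==> ind (face T) q * w q = 0" and Y: "0 < Y"
 shows "(%p. LBINT q. ind (face T) q * (wflux p q * w q))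
   ----> (LBINT q. ind (face T) q * (\<phi>x (ga q) * w q))"
proof -
 let ?F = "ind (face T) :: _ => real"
 define g where "g p q = ?F q * wflux p q" for p q
 define g' where "g' q = ?F q * \<phi>x (ga q)" for q
 have gam [measurable]: "ga : Bor" and gaU: "!!q. \<bar>ga q\<bar> <= U"
  using ga by (auto simp: is_trace_def)
 have gm: "g p : Bor" "g' : Bor" for p
  unfolding g_def[abs_def] g'_def[abs_def] by measurable
 have b: "\<bar>g p q\<bar> <= fbnd" "\<bar>g' q\<bar> <= fbnd" for p q
  using wflux_bound[of p q] phi_bounds(1)[OF gaU[of q]] fbnd_nonneg by (auto simp: g_def g'_def indicator_def)
 have "weakly g g' (rect t1 t2 y1 y2)" if t: "0 <= t1" "t1 < t2" "t2 <= T" and y: "0 <= y1" "y1 < y2" for t1 t2 y1 y2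
 proof (rule weakly_limit[OF gm b])
  show "integ (rect t1 t2 y1 y2)"
   by (rule integrable_dominated_box2[of _ t1 t2 y1 y2 1]) (use rect_box in auto)
  show "weakly g g' (%q. bump (real (Suc n)) t1 t2 (fst q) * bump (real (Suc n)) y1 y2 (snd q))" for n
   unfolding weakly_def
  proof
   have k: "0 < real (Suc n)" by simp
   show "integ (%q. bump (real (Suc n)) t1 t2 (fst q) * bump (real (Suc n)) y1 y2 (snd q))"
   proof (rule integrable_dominated_box2[of _ t1 t2 y1 y2 1])
    show "(%q. bump (real (Suc n)) t1 t2 (fst q) * bump (real (Suc n)) y1 y2 (snd q)) : Bor"
    by (intro borel_measurable_continuous_onI continuous_intros)
    fix q :: "R2"
    let ?b = "bump (real (Suc n)) t1 t2 (fst q) * bump (real (Suc n)) y1 y2 (snd q)"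
    have bb: "0 <= ?b" "?b <= 1" using bump_bounds by (auto intro!: mult_nonneg_nonneg mult_le_one)
    show "\<bar>?b\<bar> <= ind ({t1..t2} \<times> {y1..y2}) q * 1"
    proof (cases "q : {t1..t2} \<times> {y1..y2}")
    case False
    have "0 < 1 / real (Suc n)" by simp
    hence "fst q <= t1 + 1 / real (Suc n) \<or> t2 - 1 / real (Suc n) <= fst q \<or> snd q <= y1 + 1 / real (Suc n) \<or> y2 - 1 / real (Suc n) <= snd q"
    using False unfolding mem_Times_iff atLeastAtMost_iff by linarith
    hence "?b = 0" using bump_eq_0[OF k] by (elim disjE) simp_all
    thus ?thesis by (simp only: abs_zero indicator_pos_le mult_1_right)
    qed (use bb in simp)
   qed
   show "(%p. LBINT q. g p q * (bump (real (Suc n)) t1 t2 (fst q) * bump (real (Suc n)) y1 y2 (snd q)))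
    ----> (LBINT q. g' q * (bump (real (Suc n)) t1 t2 (fst q) * bump (real (Suc n)) y1 y2 (snd q)))"
    unfolding g_def g'_def mult.assoc by (rule bump_flux[OF ga t y k])
  qed
 qed (rule bump_rect_L1[OF t(2) y(2)])
 hence "weakly g g' (%q. ?F q * w q)"
 proof (rule weakly_if_rect[OF gm b T_pos Y, where C = C])
  show "(%q. ?F q * w q) : Bor" by measurable
  show "\<bar>?F q * w q\<bar> <= C" for q using wb[of q] by (auto simp: indicator_def)
  show "?F q * w q = 0" if "q \<notin> {0..<T} \<times> {0..<Y}" for q
   using that w0[of q] by (cases "Y <= snd q") (auto simp: face_def mem_Times_iff indicator_def)
 qed
 moreover have "g p q * (?F q * w q) = ?F q * (wflux p q * w q)" "g' q * (?F q * w q) = ?F q * (\<phi>x (ga q) * w q)" for p q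
  by (simp_all add: g_def g'_def indicator_def)
 ultimately show ?thesis unfolding weakly_def by (simp only:)
qed

text \<open>For \<open>\<bar>kp\<bar> \<le> U\<close> these are the kinetic Kruzhkov entropies. Outside, \<open>E i kp\<close> need not be monotone
 in \<open>kp\<close>, but the sign of \<open>u - kp\<close> is constant, so that a linear function suffices.\<close>

definition entr :: "real => vel => real => real" where
 "entr kp i a = (if \<bar>kp\<bar> <= U then \<bar>a - E i kp\<bar> else - sgn kp * (a - E i kp))"

lemma entr_lip: "\<bar>entr kp i a - entr kp i b\<bar> <= \<bar>a - b\<bar>"
 unfolding entr_def by (auto simp: sgn_if)

lemma sgn_diff_far: assumes "\<bar>u\<bar> <= U" "\<not> \<bar>kp\<bar> <= U" shows "sgn (u - kp) = - sgn kp"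
 using assms by (auto simp: sgn_if)

text \<open>For \<open>kp\<close> in \<open>[-U, U]\<close> the monotonicity of \<open>E\<close>
  gives \<open>E i u - E i kp\<close> the sign of \<open>u - kp\<close>; outside, this sign is
  constant and the entropy is already linear.\<close>

lemma entr_E: assumes "\<bar>u\<bar> <= U" shows "entr kp i (E i u) = sgn (u - kp) * (E i u - E i kp)"
proof (cases "\<bar>kp\<bar> <= U")
 case True
 have "E i u <= E i kp" if "u <= kp" using sc.E_mono[of u kp i] that assms True by (simp add: abs_le_iff)
 moreover have "E i kp <= E i u" if "kp <= u" using sc.E_mono[of kp u i] that assms True by (simp add: abs_le_iff)
 ultimately show ?thesis using True by (cases u kp rule: linorder_cases) (auto simp: entr_def sgn_if)
qed (simp add: entr_def sgn_diff_far[OF assms])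

lemma entr_ge: assumes "\<bar>u\<bar> <= U" shows "sgn (u - kp) * (a - E i kp) <= entr kp i a"
proof (cases "\<bar>kp\<bar> <= U")
 case True
 thus ?thesis by (auto simp: entr_def sgn_if)
qed (simp add: entr_def sgn_diff_far[OF assms])

lemma entr_sum: assumes "\<bar>u\<bar> <= U" shows "(SUM k:UNIV. entr kp k (E k u)) = \<bar>u - kp\<bar>"
 by (simp add: entr_E[OF assms] sum_distrib_left[symmetric] sum_subtractf sc.E_sum sgn_mult_self_eq abs_sgn mult.commute)

text \<open>For \<open>kp\<close> in \<open>[-U, U]\<close> the family \<open>E i kp\<close> is an
  admissible fixed point and the contraction applies; otherwise the entropy is affine and its sum is
  conserved.\<close>

lemma entr_diss:
 assumes g: "relaxation.admissible E U g"
 shows "(SUM k:UNIV. entr kp k (R g k)) <= (SUM k:UNIV. entr kp k (g k))"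
proof (cases "\<bar>kp\<bar> <= U")
 case True
 have "(SUM k:UNIV. \<bar>R g k - R (%i. E i kp) k\<bar>) <= (SUM k:UNIV. \<bar>g k - E k kp\<bar>)"
  by (rule sc.contraction[OF g sc.admissible_E[OF True]])
 thus ?thesis using True by (simp add: entr_def sc.R_eq)
next
 case False
 thus ?thesis by (simp add: entr_def sum_negf sum_distrib_left[symmetric] sum_subtractf sc.R_sum)
qed

lemma entr_bound: assumes "\<bar>a\<bar> <= relaxation.bnd E U" shows "\<bar>entr kp i a\<bar> <= relaxation.bnd E U + \<bar>E i kp\<bar>"
proof -
 have "\<bar>entr kp i a\<bar> <= \<bar>a - E i kp\<bar>" by (auto simp: entr_def sgn_if)
 thus ?thesis using assms by linarith
qed

end

section \<open>Limit of the boundary entropy terms\<close>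

context lbm_test
begin

lemma bw_limit:
 assumes psi: "!!t x y. 0 <= t ==> 0 <= x ==> 0 <= y ==> 0 <= ps t x y" and ga: "is_trace ga"
 obtains b where "b ----> (LBINT q. ind (face T) q * (sgn (uW q - kp) * (\<phi>x (ga q) - \<phi>x kp) * ps (fst q) 0 (snd q)))"
  "!!p. bw (entr kp) p <= b p"
proof
 let ?F = "ind (face T) :: _ => real" and ?b = "relaxation.bnd E U"
 let ?s = "%q. sgn (uW q - kp)" and ?ps = "%q. ps (fst q) 0 (snd q)"
 define Wst where "Wst p q = W p (ix (dt p) (fst q)) (ix (dx p) (snd q))" for p q
 define g where "g p q = lam * (entr kp XP (E XP (Wst p q)) - entr kp XM (post p (ix (dt p) (fst q)) XM (0, ix (dx p) (snd q))))" for p q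
 define g1 where "g1 p q = ?s q * (wflux p q - \<phi>x kp)" for p q
 define g2 where "g2 p q = \<bar>Wst p q - uW q\<bar>" for p q
 \<comment> \<open>The bound replaces the entropies by an expression linear in the numerical flux,
   with the sign of the exact datum \<open>uW\<close>. The averaged datum is exchanged for
   \<open>uW\<close> twice, once inside the entropy and once back in the linear expression, and each
   exchange costs \<open>g2\<close>.\<close>
 define b where "b p = (LBINT q. ?F q * (g1 p q * edge p q)) + (2 * lam) * (LBINT q. ?F q * (g2 p q * edge p q))" for p
 have gam [measurable]: "ga : Bor" and gaU: "!!q. \<bar>ga q\<bar> <= U"
  using ga by (auto simp: is_trace_def)
 have Wm [measurable]: "Wst p : Bor" for p
  unfolding Wst_def[abs_def] by (rule measurable_step2[of "%n k. W p n k"])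
 have gm: "g p : Bor" for p
  unfolding g_def[abs_def] Wst_def
  by (rule measurable_step2[of "%n k. lam * (entr kp XP (E XP (W p n k)) - entr kp XM (post p n XM (0, k)))"])
 have gm1: "g1 p : Bor" for p unfolding g1_def[abs_def] by measurable
 have gm2: "g2 p : Bor" for p unfolding g2_def[abs_def] by measurable
 have Wb: "\<bar>Wst p q\<bar> <= U" for p q unfolding Wst_def by (rule sc.W_bound)
 have s1: "\<bar>?s q\<bar> <= 1" for q by (simp add: abs_sgn_eq)
 have ab: "\<bar>E XP (Wst p q)\<bar> <= ?b" "\<bar>post p n XM j\<bar> <= ?b" for p q n j
  using sc.admissible_abs_le[OF sc.admissible_E[OF Wb]] sc.admissible_abs_le[OF sc.admissible_post] by blast+
 have gb: "\<bar>g p q\<bar> <= lam * ((?b + \<bar>E XP kp\<bar>) + (?b + \<bar>E XM kp\<bar>))" for p q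
 proof -
  have "\<bar>g p q\<bar> = lam * \<bar>entr kp XP (E XP (Wst p q)) - entr kp XM (post p (ix (dt p) (fst q)) XM (0, ix (dx p) (snd q)))\<bar>"
   unfolding g_def abs_mult using lam_pos by simp
  also have "... <= lam * ((?b + \<bar>E XP kp\<bar>) + (?b + \<bar>E XM kp\<bar>))"
   using lam_pos by (intro mult_left_mono order_trans[OF abs_triangle_ineq4] add_mono entr_bound ab) simp
  finally show ?thesis .
 qed
 have gb1: "\<bar>g1 p q\<bar> <= fbnd + \<bar>\<phi>x kp\<bar>" for p q
 proof -
  have "\<bar>g1 p q\<bar> <= 1 * (fbnd + \<bar>\<phi>x kp\<bar>)"
   unfolding g1_def abs_mult using wflux_bound[of p q] by (intro mult_mono s1) auto
  thus ?thesis by simp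
 qed
 have gb2: "\<bar>g2 p q\<bar> <= 2 * U" for p q
  using Wb[of p q] data_bound(2)[of q] by (simp add: g2_def)
 note i0 = edge_replace(2)[where g = g, OF gm gb] and i1 = edge_replace(2)[where g = g1, OF gm1 gb1]
  and i2 = edge_replace(2)[where g = g2, OF gm2 gb2]
 show "bw (entr kp) p <= b p" for p
 proof -
  have "bw (entr kp) p = (LBINT q. ?F q * (g p q * edge p q))"
   unfolding bw_eq_integral g_def Wst_def by (rule refl)
  also have "... <= (LBINT q. ?F q * (g1 p q * edge p q) + (2 * lam) * (?F q * (g2 p q * edge p q)))"
  proof (rule integral_mono)
   fix q
   have le: "g p q <= g1 p q + 2 * lam * g2 p q"
   proof -
    define h where "h = post p (ix (dt p) (fst q)) XM (0, ix (dx p) (snd q))"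
    have uu: "\<bar>uW q\<bar> <= U" by (rule data_bound)
    have d: "\<bar>E XP (Wst p q) - E XP (uW q)\<bar> <= g2 p q" unfolding g2_def by (rule sc.E_dist_le[OF Wb uu])
    hence "entr kp XP (E XP (Wst p q)) - entr kp XP (E XP (uW q)) <= g2 p q"
    using entr_lip[of kp XP "E XP (Wst p q)" "E XP (uW q)"] by linarith
    moreover have "entr kp XP (E XP (uW q)) = ?s q * (E XP (uW q) - E XP kp)" by (rule entr_E[OF uu])
    moreover have "?s q * (h - E XM kp) <= entr kp XM h" by (rule entr_ge[OF uu])
    moreover have "?s q * (E XP (uW q) - E XP (Wst p q)) <= g2 p q"
    proof -
    have "\<bar>?s q * (E XP (uW q) - E XP (Wst p q))\<bar> <= 1 * g2 p q"
    unfolding abs_mult using d by (intro mult_mono s1) (auto simp: abs_minus_commute)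
    thus ?thesis by linarith
    qed
    moreover have "?s q * (E XP (uW q) - E XP (Wst p q)) = ?s q * (E XP (uW q) - E XP kp) - ?s q * (E XP (Wst p q) - E XP kp)"
    by (simp add: algebra_simps)
    ultimately have "entr kp XP (E XP (Wst p q)) - entr kp XM h
    <= ?s q * (E XP (Wst p q) - E XP kp) - ?s q * (h - E XM kp) + 2 * g2 p q"
    by linarith
    hence "lam * (entr kp XP (E XP (Wst p q)) - entr kp XM h)
    <= lam * (?s q * (E XP (Wst p q) - E XP kp) - ?s q * (h - E XM kp) + 2 * g2 p q)"
    using lam_pos by (intro mult_left_mono) auto
    also have "... = ?s q * (lam * (E XP (Wst p q) - h) - lam * (E XP kp - E XM kp)) + 2 * lam * g2 p q"
    by (simp add: algebra_simps)
    finally show ?thesis unfolding g_def g1_def wflux_def h_def[symmetric] Wst_def[symmetric] flux_x .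
   qed
   have "0 <= edge p q" unfolding edge_def sample_def by (rule psi; rule less_imp_le; rule half_pos)
   hence "g p q * edge p q <= (g1 p q + 2 * lam * g2 p q) * edge p q" by (intro mult_right_mono le)
   thus "?F q * (g p q * edge p q) <= ?F q * (g1 p q * edge p q) + (2 * lam) * (?F q * (g2 p q * edge p q))"
    by (cases "q : face T") (simp_all add: distrib_right mult.assoc)
  qed (intro i0 i1 i2 Bochner_Integration.integrable_add integrable_mult_right)+
  also have "... = b p" unfolding b_def using i1[of p] i2[of p] by simp
  finally show ?thesis .
 qed
 \<comment> \<open>Cell averages of the western datum converge in \<open>L1\<close> on bounded sets,
   so the price of averaging vanishes.\<close>
 have L2: "(%p. LBINT q. ?F q * (g2 p q * edge p q)) ----> 0"
 proof (rule tendsto_sandwich[OF _ _ tendsto_const])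
  have "(%p. LBINT q. ind ({0..T} \<times> {0..Rad + 2 * dx_max}) q * g2 p q) ----> 0"
   unfolding g2_def Wst_def W_eq
   using T_pos R_pos dx_max_pos by (intro cell_average_tendsto[OF data_borel(2) data_bound(2) dt_pos dx_pos dt_lim dx_lim]) auto
  hence "(%p. C * (LBINT q. ind fbox q * g2 p q)) ----> C * 0"
   unfolding fbox_def by (intro tendsto_mult tendsto_const)
  thus "(%p. C * (LBINT q. ind fbox q * g2 p q)) ----> 0" by simp
  have e0: "0 <= edge p q" for p q unfolding edge_def sample_def by (rule psi; rule less_imp_le; rule half_pos)
  have g0: "0 <= g2 p q" for p q by (simp add: g2_def)
  show "\<forall>\<^sub>F p in sequentially. 0 <= (LBINT q. ?F q * (g2 p q * edge p q))"
   using e0 g0 by (intro always_eventually allI integral_nonneg_AE AE_I2) auto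
  show "\<forall>\<^sub>F p in sequentially. (LBINT q. ?F q * (g2 p q * edge p q)) <= C * (LBINT q. ind fbox q * g2 p q)"
  proof (intro always_eventually allI)
   fix p
   have "(LBINT q. ?F q * (g2 p q * edge p q)) <= (LBINT q. C * (ind fbox q * g2 p q))"
   proof (rule integral_mono[OF i2])
    note [measurable] = gm2
    have "integ (%q. g2 p q * ind fbox q)"
    using gb2 fbox by (intro integrable_bounded_mult[of _ "2 * U"]) auto
    thus "integ (%q. C * (ind fbox q * g2 p q))" by (simp add: mult.commute)
    fix q
    show "?F q * (g2 p q * edge p q) <= C * (ind fbox q * g2 p q)"
    proof (cases "q : face T")
    case True
    hence "edge p q <= C * ind fbox q" using edge_bound[OF True, of p] by linarith
    hence "g2 p q * edge p q <= g2 p q * (C * ind fbox q)" by (intro mult_left_mono g0)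
    thus ?thesis using True by (simp add: mult_ac)
    qed (use g0 C_nonneg in simp)
   qed
   thus "(LBINT q. ?F q * (g2 p q * edge p q)) <= C * (LBINT q. ind fbox q * g2 p q)" by simp
  qed
 qed
 \<comment> \<open>Because of the sign of the datum this weight is merely measurable, which is why
   the weak limit was extended beyond smooth weights.\<close>
 define w where "w q = ?s q * (?F q * ?ps q)" for q
 have wm [measurable]: "w : Bor" unfolding w_def[abs_def] using edge_limit_borel by measurable
 have wb: "\<bar>w q\<bar> <= C" for q
 proof (cases "q : face T")
  case True
  have "\<bar>w q\<bar> = \<bar>?s q\<bar> * \<bar>?ps q\<bar>" using True by (simp add: w_def abs_mult)
  also have "... <= 1 * (C * ind fbox q)"
   by (rule mult_mono[OF s1 edge_limit_bound[OF True]]) auto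
  also have "... <= C" using C_nonneg by (simp add: indicator_def)
  finally show ?thesis .
 qed (simp add: w_def C_nonneg)
 have w0: "?F q * w q = 0" if "Rad <= snd q" for q
 proof (cases "q : face T")
  case True
  hence "?ps q = 0" using tf that unfolding test_fun_def by (auto simp: face_def)
  thus ?thesis by (simp add: w_def)
 qed simp
 note W = weak_flux[OF ga wm wb w0 R_pos]
 have iw: "integ (%q. ?F q * (a q * w q))" if [measurable]: "a : Bor" and a: "!!q. \<bar>a q\<bar> <= c" for a c
 proof -
  have "integ (%q. (?s q * a q) * (?F q * ?ps q))"
  proof (rule integrable_bounded_mult[OF _ _ edge_L1(4)])
   show "(%q. ?s q * a q) : Bor" by measurable
   have "\<bar>?s q * a q\<bar> <= 1 * c" for q unfolding abs_mult using a[of q] s1[of q] by (intro mult_mono) auto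
   thus "\<bar>?s q * a q\<bar> <= c" for q by simp
  qed
  moreover have "(?s q * a q) * (?F q * ?ps q) = ?F q * (a q * w q)" for q by (simp add: w_def indicator_def)
  ultimately show ?thesis by simp
 qed
 have split: "(LBINT q. ?F q * (?s q * (a q - \<phi>x kp) * ?ps q))
   = (LBINT q. ?F q * (a q * w q)) - (LBINT q. ?F q * (\<phi>x kp * w q))"
  if [measurable]: "a : Bor" and a: "!!q. \<bar>a q\<bar> <= c" for a c
 proof -
  have "?F q * (?s q * (a q - \<phi>x kp) * ?ps q) = ?F q * (a q * w q) - ?F q * (\<phi>x kp * w q)" for q
   by (simp add: w_def indicator_def algebra_simps)
  thus ?thesis using iw[of a c, OF that] iw[of "%_. \<phi>x kp" "\<bar>\<phi>x kp\<bar>"] by simp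
 qed
 have "(%p. LBINT q. ?F q * (g1 p q * ?ps q)) ----> (LBINT q. ?F q * (?s q * (\<phi>x (ga q) - \<phi>x kp) * ?ps q))"
  unfolding g1_def split[OF wflux_borel wflux_bound]
  by (subst split[of _ fbnd], measurable, rule phi_bounds[OF gaU]) (intro tendsto_diff W tendsto_const)
 from tendsto_add[OF edge_replace(1)[where g = g1, OF gm1 gb1] this]
 have L1: "(%p. LBINT q. ?F q * (g1 p q * edge p q)) ----> (LBINT q. ?F q * (?s q * (\<phi>x (ga q) - \<phi>x kp) * ?ps q))"
  by simp
 show "b ----> (LBINT q. ?F q * (?s q * (\<phi>x (ga q) - \<phi>x kp) * ?ps q))"
  unfolding b_def using tendsto_add[OF L1 tendsto_mult[OF tendsto_const[of "2 * lam"] L2]] by simp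
qed

end

section \<open>Reflection in the diagonal and the entropy inequality\<close>

definition swap_xy :: "R3 => R3" where
 "swap_xy z = (fst z, snd (snd z), fst (snd z))"

lemma swap_xy_simps [simp]: "fst (swap_xy z) = fst z" "fst (snd (swap_xy z)) = snd (snd z)" "snd (snd (swap_xy z)) = fst (snd z)"
 "swap_xy (swap_xy z) = z" "swap_xy z : space_time T \<longleftrightarrow> z : space_time T"
 by (auto simp: swap_xy_def space_time_def quarter_def mem_Times_iff)

lemma continuous_on_swap_xy [continuous_intros]: "continuous_on S g ==> continuous_on S (%x. swap_xy (g x))"
 unfolding swap_xy_def by (intro continuous_intros)

lemma borel_measurable_swap_xy [measurable]: "swap_xy : Bor"
 by (intro borel_measurable_continuous_onI continuous_intros continuous_on_id)

lemma nn_integral_swap_xy: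
 assumes [measurable]: "g : Bor"
 shows "(NN z. g (swap_xy z)) = (NN z. g z)"
proof -
 have "(NN z. g z) = (NN x. (NN q. g (fst q, x, snd q)))"
  by (rule nn_integral_lborel_reorder) measurable
 also have "... = (NN x. (NN t. (NN y. g (t, x, y))))"
 proof (rule nn_integral_cong)
  fix x :: real
  have "(\<integral>\<^sup>+ q. g (fst q, x, snd q) \<partial>(lborel \<Otimes>\<^sub>M lborel)) = (NN t. (NN y. g (t, x, y)))"
   by (subst lborel.nn_integral_fst[symmetric]) (simp_all add: borel_prod)
  thus "(NN q. g (fst q, x, snd q)) = (NN t. (NN y. g (t, x, y)))"
   by (simp add: lborel_prod)
 qed
 also have "... = (NN t. (NN x. (NN y. g (t, x, y))))"
  by (rule lborel_pair.Fubini') (simp add: case_prod_beta')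
 also have "... = (NN t. (NN q. g (t, snd q, fst q)))"
 proof (rule nn_integral_cong)
  fix t :: real
  have "(\<integral>\<^sup>+ q. g (t, snd q, fst q) \<partial>(lborel \<Otimes>\<^sub>M lborel)) = (NN y. (NN x. g (t, x, y)))"
   by (subst lborel.nn_integral_fst[symmetric]) (simp_all add: borel_prod)
  also have "... = (NN x. (NN y. g (t, x, y)))"
   by (rule lborel_pair.Fubini') (simp add: case_prod_beta' lborel_prod)
  finally show "(NN x. (NN y. g (t, x, y))) = (NN q. g (t, snd q, fst q))"
   by (simp add: lborel_prod)
 qed
 also have "... = (NN z. g (swap_xy z))"
  unfolding swap_xy_def
  by (subst (2) lborel_prod[symmetric], subst lborel.nn_integral_fst[symmetric]) (simp_all add: lborel_prod borel_prod)
 finally show ?thesis by simp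
qed

context lbm_limit
begin

text \<open>The southern datum becomes the western one, so every result at \<open>x = 0\<close> also
  holds at \<open>y = 0\<close>.\<close>

lemma lbm_swapped:
 "lbm_limit (%i. E (vswap i)) (%g i. R (%k. g (vswap k)) (vswap i)) U M lam T \<phi>y \<phi>x (%p j. A p (prod.swap j)) S W
   (%p n i j. f p n (vswap i) (prod.swap j)) dt dx N (%z. u0 (prod.swap z)) uS uW (%z. v (swap_xy z))"
proof (rule lbm_limit.intro)
 show "bounded_scheme (%i. E (vswap i)) (%g i. R (%k. g (vswap k)) (vswap i)) U (%j. A p (prod.swap j)) (S p) (W p)
   (%n i j. f p n (vswap i) (prod.swap j)) (dx p) M (N p)" for p
  by (rule sc.bounded_swapped)
 show "A p (prod.swap (i, j)) = cell_int (%z. u0 (prod.swap z)) (dx p) (dx p) i j / (dx p * dx p)" for p i j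
  by (simp add: A_eq cell_int_swap[OF data_borel(1)])
 define g where "g p z = ennreal (ind (space_time T) z *
    (SUM i:UNIV. \<bar>f p (ix (dt p) (fst z)) i (ix (dx p) (fst (snd z)), ix (dx p) (snd (snd z))) - E i (v z)\<bar>))" for p z
 have gm: "g p : Bor" for p
 proof -
  have [measurable]: "(%z. f p (ix (dt p) (fst z)) i (ix (dx p) (fst (snd z)), ix (dx p) (snd (snd z)))) : Bor" for i
   by (rule measurable_step3[of "%n k l. f p n i (k, l)"])
  have [measurable]: "space_time T : sets borel" by (rule borel_domains)
  show ?thesis unfolding g_def[abs_def] by measurable
 qed
 have eq: "ennreal (ind (space_time T) z * (SUM i:UNIV. \<bar>f p (ix (dt p) (fst z)) (vswap i)
   (prod.swap (ix (dx p) (fst (snd z)), ix (dx p) (snd (snd z)))) - E (vswap i) (v (swap_xy z))\<bar>)) = g p (swap_xy z)" for p z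
  using sum_vswap[of "%i. \<bar>f p (ix (dt p) (fst z)) i (ix (dx p) (snd (snd z)), ix (dx p) (fst (snd z))) - E i (v (swap_xy z))\<bar>"]
  by (simp add: g_def indicator_def)
 show "(%p. NN z. ennreal (ind (space_time T) z * (SUM i:UNIV. \<bar>f p (ix (dt p) (fst z)) (vswap i)
   (prod.swap (ix (dx p) (fst (snd z)), ix (dx p) (snd (snd z)))) - E (vswap i) (v (swap_xy z))\<bar>))) ----> 0"
  unfolding eq nn_integral_swap_xy[OF gm] using f_lim unfolding g_def .
 show "(%z. u0 (prod.swap z)) : Bor" "(%z. v (swap_xy z)) : Bor"
  by measurable
qed (simp_all add: lam_pos T_pos dx_lim dt_eq[symmetric] N_eq flux_x flux_y E_borel data_borel data_bound W_eq S_eq v_bound)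

end

lemma test_fun_swap:
 assumes "test_fun T ps pst psx psy T' R C"
 shows "test_fun T (%t x y. ps t y x) (%t x y. pst t y x) (%t x y. psy t y x) (%t x y. psx t y x) T' R C"
proof -
 have sw: "continuous_on (A \<times> B \<times> B) (%(t, x, y). g t y x)" if "continuous_on (A \<times> B \<times> B) (%(t, x, y). g t x y)"
  for A B :: "real set" and g :: "real => real => real => real"
 proof -
  have "continuous_on (A \<times> B \<times> B) (%z. (%(t, x, y). g t x y) (swap_xy z))"
   by (rule continuous_on_compose2[OF that]) (auto intro!: continuous_intros simp: swap_xy_def)
  thus ?thesis by (simp add: swap_xy_def case_prod_beta')
 qed
 show ?thesis using assms unfolding test_fun_def by (auto intro!: sw)
qed

context lbm_limit
begin

lemma entropy_inequality:
 assumes tf: "test_fun T ps pst psx psy T' Rad C"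
  and psi: "!!t x y. 0 <= t ==> 0 <= x ==> 0 <= y ==> 0 <= ps t x y"
  and gaW: "is_trace gaW" and gaS: "lbm_limit.is_trace U T (%z. v (swap_xy z)) gaS"
 shows "0 <= (LBINT z. ind (space_time T) z * (\<bar>v z - kp\<bar> * pst (fst z) (fst (snd z)) (snd (snd z))
    + sgn (v z - kp) * ((\<phi>x (v z) - \<phi>x kp) * psx (fst z) (fst (snd z)) (snd (snd z))
    + (\<phi>y (v z) - \<phi>y kp) * psy (fst z) (fst (snd z)) (snd (snd z)))))
   + (LBINT q. ind (face T) q * (sgn (uW q - kp) * (\<phi>x (gaW q) - \<phi>x kp) * ps (fst q) 0 (snd q)))
   + (LBINT q. ind (face T) q * (sgn (uS q - kp) * (\<phi>y (gaS q) - \<phi>y kp) * ps (fst q) (snd q) 0))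
   + (LBINT z. ind quarter z * (\<bar>u0 z - kp\<bar> * ps 0 (fst z) (snd z)))"
  (is "0 <= ?I + ?W + ?S + ?O")
proof -
 interpret te: lbm_test E R U M lam T \<phi>x \<phi>y A W S f dt dx N u0 uW uS v ps pst psx psy T' Rad C
  by unfold_locales (use tf dt_pos dt_lim dx_pos dx_lim in auto)
 interpret sl: lbm_limit "%i. E (vswap i)" "%g i. R (%k. g (vswap k)) (vswap i)" U M lam T \<phi>y \<phi>x "%p j. A p (prod.swap j)" S W
   "%p n i j. f p n (vswap i) (prod.swap j)" dt dx N "%z. u0 (prod.swap z)" uS uW "%z. v (swap_xy z)"
  by (rule lbm_swapped)
 interpret st: lbm_test "%i. E (vswap i)" "%g i. R (%k. g (vswap k)) (vswap i)" U M lam T \<phi>y \<phi>x "%p j. A p (prod.swap j)" S W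
   "%p n i j. f p n (vswap i) (prod.swap j)" dt dx N "%z. u0 (prod.swap z)" uS uW "%z. v (swap_xy z)"
   "%t x y. ps t y x" "%t x y. pst t y x" "%t x y. psy t y x" "%t x y. psx t y x" T' Rad C
  by unfold_locales (use test_fun_swap[OF tf] dt_pos dt_lim dx_pos dx_lim in auto)
 obtain bW where bW: "bW ----> ?W" "!!p. te.bw (entr kp) p <= bW p"
  using te.bw_limit[OF psi gaW] by blast
 obtain bS where bS: "bS ----> ?S" "!!p. st.bw (sl.entr kp) p <= bS p"
  using st.bw_limit[of gaS kp] psi gaS by blast
 obtain c where c: "c ----> (LBINT z. ind (space_time T) z * te.interior (entr kp) z)
   + (LBINT z. ind quarter z * ((SUM k:UNIV. entr kp k (E k (u0 z))) * ps 0 (fst z) (snd z)))"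
  "!!p. 0 <= c p + te.bw (entr kp) p + te.bs (entr kp) p"
  using te.core[OF psi entr_lip entr_diss] by blast
 \<comment> \<open>The southern boundary sum is the western one of the reflected scheme, which makes
   the limit at \<open>x = 0\<close> available for it.\<close>
 have sw: "st.bw (sl.entr kp) p = te.bs (entr kp) p" for p
 proof -
  have "sl.entr kp i = entr kp (vswap i)" for i unfolding sl.entr_def[abs_def] entr_def[abs_def] by (rule refl)
  moreover have "st.Jmax p = te.Jmax p" unfolding st.Jmax_def te.Jmax_def by (rule refl)
  moreover have "st.sm p n 0 k = te.sm p n k 0" for n k by (simp add: sample_def)
  moreover have "sl.post p n XM (0, k) = post p n YM (k, 0)" for n k
   unfolding sl.sc.post_def sc.post_def by simp
  ultimately show ?thesis unfolding st.bw_def te.bs_def by simp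
 qed
 have "te.interior (entr kp) z = \<bar>v z - kp\<bar> * pst (fst z) (fst (snd z)) (snd (snd z))
    + sgn (v z - kp) * ((\<phi>x (v z) - \<phi>x kp) * psx (fst z) (fst (snd z)) (snd (snd z))
    + (\<phi>y (v z) - \<phi>y kp) * psy (fst z) (fst (snd z)) (snd (snd z)))" for z
 proof -
  have "lam * (entr kp i (E i (v z)) - entr kp j (E j (v z)))
    = sgn (v z - kp) * (lam * (E i (v z) - E j (v z)) - lam * (E i kp - E j kp))" for i j
   unfolding entr_E[OF v_bound] by (simp add: algebra_simps)
  note e = this[of XP XM, unfolded flux_x] this[of YP YM, unfolded flux_y]
  have d: "lam * (a * x + b * y) = lam * a * x + lam * b * y" for a b x y :: real by (simp add: algebra_simps)
  show ?thesis unfolding te.interior_def entr_sum[OF v_bound] d e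
   by (simp add: case_prod_beta' algebra_simps)
 qed
 hence "c ----> ?I + ?O" using c(1) by (simp add: entr_sum[OF data_bound(1)])
 hence "(%p. c p + bW p + bS p) ----> ?I + ?O + ?W + ?S" by (intro tendsto_add bW bS)
 moreover have "0 <= c p + bW p + bS p" for p
  using c(2)[of p] bW(2)[of p] bS(2)[of p] sw[of p] by linarith
 ultimately have "0 <= ?I + ?O + ?W + ?S" by (intro LIMSEQ_le_const) auto
 thus ?thesis by simp
qed

end

section \<open>The monotonicity condition implies a monotone relaxation\<close>

lemma C1_flux:
 assumes "\<phi> C1_differentiable_on UNIV"
 shows "(\<phi> has_real_derivative deriv \<phi> x) (at x)" "continuous_on S (deriv \<phi>)"
proof -
 obtain D where D: "!!x. (\<phi> has_vector_derivative D x) (at x)" "continuous_on UNIV D"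
  using assms unfolding C1_differentiable_on_def by auto
 hence d: "(\<phi> has_real_derivative D x) (at x)" for x by (simp add: has_real_derivative_iff_has_vector_derivative)
 hence "deriv \<phi> = D" by (auto intro!: DERIV_imp_deriv)
 thus "(\<phi> has_real_derivative deriv \<phi> x) (at x)" "continuous_on S (deriv \<phi>)"
  using d D(2) by (auto intro: continuous_on_subset)
qed

lemma flux_lipschitz:
 assumes C1: "\<phi> C1_differentiable_on UNIV" and U: "0 <= U" and ab: "a <= b" "- U <= a" "b <= U"
 shows "\<bar>\<phi> b - \<phi> a\<bar> <= max_speed \<phi> U * (b - a)"
proof (cases "a = b")
 case False
 hence "a < b" using ab by simp
 from MVT2[OF this, of \<phi> "deriv \<phi>"] obtain z where z: "a < z" "z < b" "\<phi> b - \<phi> a = (b - a) * deriv \<phi> z"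
  using C1_flux(1)[OF C1] by blast
 have "bdd_above ((%u. \<bar>deriv \<phi> u\<bar>) ` {-U..U})"
  by (intro bounded_imp_bdd_above compact_imp_bounded compact_continuous_image continuous_on_rabs C1_flux(2)[OF C1] compact_Icc)
 hence "\<bar>deriv \<phi> z\<bar> <= max_speed \<phi> U"
  unfolding max_speed_def using z ab by (intro cSUP_upper) auto
 hence "(b - a) * \<bar>deriv \<phi> z\<bar> <= (b - a) * max_speed \<phi> U" using ab by (intro mult_left_mono) auto
 thus ?thesis using z ab by (simp add: abs_mult mult.commute)
qed simp

lemma max_speed_nonneg:
 assumes C1: "\<phi> C1_differentiable_on UNIV" and U: "0 <= U" shows "0 <= max_speed \<phi> U"
proof -
 have "bdd_above ((%u. \<bar>deriv \<phi> u\<bar>) ` {-U..U})"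
  by (intro bounded_imp_bdd_above compact_imp_bounded compact_continuous_image continuous_on_rabs C1_flux(2)[OF C1] compact_Icc)
 hence "\<bar>deriv \<phi> 0\<bar> <= max_speed \<phi> U" unfolding max_speed_def using U by (intro cSUP_upper) auto
 thus ?thesis by linarith
qed

lemma Min3_le:
 fixes a b c :: real shows "Min {a, b, c} <= a" "Min {a, b, c} <= b" "Min {a, b, c} <= c"
 by (rule Min_le; simp)+

text \<open>Here \<open>s\<close> stands for half the maximal speed divided by \<open>lam\<close>,
  and \<open>s <= L\<close> makes the equilibria nondecreasing. If \<open>\<omega>s\<close> exceeds
  \<open>\<omega>a\<close>, the bound \<open>m <= \<omega>a - \<omega>s\<close> turns the condition
  into a comparison of the distances of \<open>L\<close> and \<open>s\<close> from
  \<open>1/2\<close>, where the order of the two rates decides.\<close>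

lemma half_speed_le:
 fixes \<omega>s \<omega>a L s m :: real
 assumes w: "0 < \<omega>s" "0 < \<omega>a" and L: "L <= 1/2" and s: "0 <= s"
  and M: "\<omega>a * s <= \<omega>s * L + 1 / 2 * m"
  and m: "m <= 2 - \<omega>s - \<omega>a" "m <= 0" "m <= \<omega>a - \<omega>s"
 shows "s <= L"
proof (cases "\<omega>s <= \<omega>a")
 case True
 have "\<omega>s * s <= \<omega>a * s" using True s by (intro mult_right_mono)
 also have "... <= \<omega>s * L" using M m by linarith
 finally show ?thesis using w by simp
next
 case False
 have "1 / 2 * m <= 1 / 2 * (\<omega>a - \<omega>s)" using m by simp
 hence "\<omega>a * s <= \<omega>s * L + 1 / 2 * (\<omega>a - \<omega>s)" using M by linarith
 hence *: "\<omega>s * (1/2 - L) <= \<omega>a * (1/2 - s)" by (simp add: algebra_simps diff_divide_distrib)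
 have "0 <= \<omega>a * (1/2 - s)" using * w L by (intro order_trans[OF _ *]) auto
 hence "0 <= 1/2 - s" using w by (simp add: zero_le_mult_iff)
 hence "\<omega>a * (1/2 - s) <= \<omega>s * (1/2 - s)" using False by (intro mult_right_mono) auto
 with * have "\<omega>s * (1/2 - L) <= \<omega>s * (1/2 - s)" by linarith
 thus ?thesis using w by simp
qed

text \<open>\<open>di\<close> and \<open>dj\<close> are increments of a velocity and its opposite,
  \<open>D\<close> of the mass, \<open>F\<close> of the flux. Their coefficients are at least
  \<open>m / 2\<close>, by the first and third bound on \<open>m\<close>; as \<open>m <= 0\<close>
  and \<open>di + dj <= D\<close>, the slack \<open>- m / 2\<close> times \<open>D\<close> left by
  the condition compensates them.\<close>

lemma relaxed_pair_mono:
 fixes \<omega>s \<omega>a L s m di dj D F :: real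
 assumes M: "\<omega>a * s <= \<omega>s * L + 1 / 2 * m"
  and m: "m <= 2 - \<omega>s - \<omega>a" "m <= 0" "m <= \<omega>a - \<omega>s" and w: "0 < \<omega>a"
  and d: "0 <= di" "0 <= dj" "di + dj <= D" and F: "- (s * D) <= F"
 shows "0 <= (1 - (\<omega>s + \<omega>a) / 2) * di - (\<omega>s - \<omega>a) / 2 * dj + \<omega>s * L * D + \<omega>a * F"
proof -
 have m': "0 <= 1 - (\<omega>s + \<omega>a) / 2 - m / 2" "(\<omega>s - \<omega>a) / 2 <= - m / 2"
  using m by (auto simp: field_simps)
 have "\<omega>a * - (s * D) <= \<omega>a * F" using F w by (intro mult_left_mono) auto
 moreover have "(- m / 2) * D <= (\<omega>s * L - \<omega>a * s) * D" using M d by (intro mult_right_mono) auto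
 moreover have "(- m / 2) * (di + dj) <= (- m / 2) * D" using d m by (intro mult_left_mono) auto
 moreover have "0 <= (1 - (\<omega>s + \<omega>a) / 2 - m / 2) * di" "0 <= (- m / 2 - (\<omega>s - \<omega>a) / 2) * dj" using m' d by (auto intro!: mult_nonneg_nonneg)
 ultimately show ?thesis by (simp add: algebra_simps add_divide_distrib diff_divide_distrib)
qed

lemma relaxation_feq:
 assumes C1: "\<phi>x C1_differentiable_on UNIV" "\<phi>y C1_differentiable_on UNIV" and z: "\<phi>x 0 = 0" "\<phi>y 0 = 0"
  and lam: "0 < lam" and w: "0 < \<omega>s" "0 < \<omega>a" and U: "0 <= U"
  and M: "monotonicity_condition lam \<phi>x \<phi>y Lx Ly \<omega>s \<omega>a U"
 shows "relaxation (feq lam \<phi>x \<phi>y Lx Ly) (relax (feq lam \<phi>x \<phi>y Lx Ly) \<omega>s \<omega>a) U"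
proof -
 let ?E = "feq lam \<phi>x \<phi>y Lx Ly"
 define sx where "sx = max_speed \<phi>x U / (2 * lam)"
 define sy where "sy = max_speed \<phi>y U / (2 * lam)"
 have s0: "0 <= sx" "0 <= sy" unfolding sx_def sy_def using max_speed_nonneg[OF _ U] C1 lam by auto
 define m where "m = Min {2 - \<omega>s - \<omega>a, 0, \<omega>a - \<omega>s}"
 have m: "m <= 2 - \<omega>s - \<omega>a" "m <= 0" "m <= \<omega>a - \<omega>s" unfolding m_def by (rule Min3_le)+
 have M0: "max 0 (\<omega>s - 1) <= \<omega>s * (1 - 2 * Lx - 2 * Ly)"
  and Mx: "\<omega>a * sx <= \<omega>s * Lx + 1 / 2 * m"
  and My: "\<omega>a * sy <= \<omega>s * Ly + 1 / 2 * m"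
 proof -
  have e: "\<omega>a * (s / (2 * lam)) = \<omega>a / 2 * (s / lam)" for s by simp
  show "max 0 (\<omega>s - 1) <= \<omega>s * (1 - 2 * Lx - 2 * Ly)"
   "\<omega>a * sx <= \<omega>s * Lx + 1 / 2 * m"
   "\<omega>a * sy <= \<omega>s * Ly + 1 / 2 * m"
   using M unfolding monotonicity_condition_def sx_def sy_def m_def e by blast+
 qed
 have "0 <= \<omega>s * (1 - 2 * Lx - 2 * Ly)" using M0 by (rule order_trans[OF max.cobounded1])
 \<comment> \<open>With \<open>Lx\<close> and \<open>Ly\<close> nonnegative this yields
   \<open>Lx <= 1/2\<close> and \<open>Ly <= 1/2\<close>, as \<open>half_speed_le\<close>
   requires.\<close>
 hence c0: "0 <= 1 - 2 * Lx - 2 * Ly" using w(1) by (simp only: zero_le_mult_iff) linarith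
 have L0: "0 <= Lx" "0 <= Ly"
 proof -
  have "0 <= \<omega>s * L" if "\<omega>a * s <= \<omega>s * L + 1 / 2 * m" "0 <= s" for L s
  proof -
   have "0 <= \<omega>a * s" using w that by simp
   thus ?thesis using that(1) m(2) by linarith
  qed
  from this[OF Mx s0(1)] this[OF My s0(2)] show "0 <= Lx" "0 <= Ly" using w by (auto simp: zero_le_mult_iff)
 qed
 have sL: "sx <= Lx" "sy <= Ly"
  using half_speed_le[OF w _ s0(1) Mx m] half_speed_le[OF w _ s0(2) My m] c0 L0 by auto
 define fx where "fx u = 1 / (2 * lam) * \<phi>x u" for u
 define fy where "fy u = 1 / (2 * lam) * \<phi>y u" for u
 have lip: "\<bar>fx v - fx u\<bar> <= sx * (v - u)" "\<bar>fy v - fy u\<bar> <= sy * (v - u)" if "- U <= u" "u <= v" "v <= U" for u v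
 proof -
  have "\<bar>1 / (2 * lam) * \<phi> v - 1 / (2 * lam) * \<phi> u\<bar> <= max_speed \<phi> U / (2 * lam) * (v - u)"
   if C: "\<phi> C1_differentiable_on UNIV" for \<phi>
  proof -
   have "\<bar>1 / (2 * lam) * \<phi> v - 1 / (2 * lam) * \<phi> u\<bar> = \<bar>\<phi> v - \<phi> u\<bar> / (2 * lam)"
    using lam by (simp add: right_diff_distrib[symmetric] abs_mult diff_divide_distrib[symmetric])
   also have "... <= max_speed \<phi> U * (v - u) / (2 * lam)"
    using flux_lipschitz[OF C U \<open>u \<le> v\<close> \<open>- U \<le> u\<close> \<open>v \<le> U\<close>] lam by (intro divide_right_mono) auto
   finally show ?thesis by simp
  qed
  from this[OF C1(1)] this[OF C1(2)]
  show "\<bar>fx v - fx u\<bar> <= sx * (v - u)" "\<bar>fy v - fy u\<bar> <= sy * (v - u)"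
   unfolding fx_def fy_def sx_def sy_def by auto
 qed
 have E: "?E Rest u = (1 - 2 * Lx - 2 * Ly) * u" "?E XP u = Lx * u + fx u" "?E XM u = Lx * u - fx u"
  "?E YP u = Ly * u + fy u" "?E YM u = Ly * u - fy u" for u by (simp_all add: fx_def fy_def)
 have E_sum: "(SUM i:UNIV. ?E i u) = u" for u by (simp add: sum_vel E algebra_simps)
 have E_mono: "?E i u <= ?E i v" if uv: "- U <= u" "u <= v" "v <= U" for i u v
 proof -
  have "sx * (v - u) <= Lx * (v - u)" "sy * (v - u) <= Ly * (v - u)" using sL uv by (auto intro!: mult_right_mono)
  moreover have "(1 - 2 * Lx - 2 * Ly) * u <= (1 - 2 * Lx - 2 * Ly) * v" using c0 uv by (intro mult_left_mono)
  ultimately show ?thesis using lip[OF uv] by (cases i) (auto simp only: E right_diff_distrib abs_le_iff)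
 qed
 have sum4: "(SUM i:UNIV. g i) = g Rest + g XP + g XM + g YP + g YM" for g :: "vel => real" by (simp add: sum_vel)
 show ?thesis
 proof
  show "?E i 0 = 0" for i using z by (cases i) auto
  show "(SUM i:UNIV. relax ?E \<omega>s \<omega>a g i) = (SUM i:UNIV. g i)" for g
  proof -
   define u where "u = (SUM i:UNIV. g i)"
   have u: "u = g Rest + g XP + g XM + g YP + g YM" unfolding u_def sum4 ..
   have "(SUM i:UNIV. relax ?E \<omega>s \<omega>a g i) = (1 - \<omega>s) * u + \<omega>s * (SUM i:UNIV. ?E i u)"
    unfolding sum4 relax_def Let_def u_def[symmetric] by (simp add: u field_simps)
   thus ?thesis by (simp add: E_sum u_def algebra_simps)
  qed
  show "relax ?E \<omega>s \<omega>a (%i. ?E i u) = (%i. ?E i u)" for u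
  proof
   fix i show "relax ?E \<omega>s \<omega>a (%i. ?E i u) i = ?E i u"
    unfolding relax_def Let_def E_sum by (simp add: algebra_simps)
  qed
  fix i and g h :: "vel => real"
  assume K: "!!i. ?E i (- U) <= g i" "!!i. g i <= h i" "!!i. h i <= ?E i U"
  define u where "u = (SUM i:UNIV. g i)"
  define v where "v = (SUM i:UNIV. h i)"
  have "- U <= u" unfolding u_def using sum_mono[of UNIV "%i. ?E i (- U)" g] K(1) E_sum[of "- U"] by simp
  moreover have "u <= v" unfolding u_def v_def using K(2) by (intro sum_mono) auto
  moreover have "v <= U" unfolding v_def using sum_mono[of UNIV h "%i. ?E i U"] K(3) E_sum[of U] by simp
  ultimately have uv: "- U <= u" "u <= v" "v <= U" .
  define d where "d i = h i - g i" for i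
  have d0: "0 <= d i" for i using K(2)[of i] by (simp add: d_def)
  have D: "v - u = d Rest + d XP + d XM + d YP + d YM" unfolding u_def v_def sum4 d_def by simp
  have dle: "d Rest <= v - u" "d XP + d XM <= v - u" "d YP + d YM <= v - u"
   using d0[of Rest] d0[of XP] d0[of XM] d0[of YP] d0[of YM] D by linarith+
  have "0 <= relax ?E \<omega>s \<omega>a h i - relax ?E \<omega>s \<omega>a g i"
  proof (cases "i = Rest")
   case True
   \<comment> \<open>For \<open>\<omega>s > 1\<close> the coefficient \<open>1 - \<omega>s\<close>
     is negative; the first part of the monotonicity condition pays for it.\<close>
   have "max 0 (\<omega>s - 1) * d Rest <= \<omega>s * (1 - 2 * Lx - 2 * Ly) * (v - u)"
    using M0 dle d0[of Rest] w c0 by (intro mult_mono) auto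
   moreover have "0 <= (1 - \<omega>s + max 0 (\<omega>s - 1)) * d Rest" using d0 by (intro mult_nonneg_nonneg) auto
   moreover have "relax ?E \<omega>s \<omega>a h i - relax ?E \<omega>s \<omega>a g i = (1 - \<omega>s) * d Rest + \<omega>s * (1 - 2 * Lx - 2 * Ly) * (v - u)"
    unfolding relax_def Let_def u_def[symmetric] v_def[symmetric] using True by (simp add: d_def algebra_simps)
   ultimately show ?thesis by (simp add: distrib_right)
  next
   case False
   define \<alpha> where "\<alpha> = (\<omega>s + \<omega>a) / 2"
   define bet where "bet = (\<omega>s - \<omega>a) / 2"
   have "relax ?E \<omega>s \<omega>a h i - relax ?E \<omega>s \<omega>a g i = (1 - (\<omega>s + \<omega>a) / 2) * d i - (\<omega>s - \<omega>a) / 2 * d (opposite i)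
    + ((\<omega>s + \<omega>a) / 2 * (?E i v - ?E i u) + (\<omega>s - \<omega>a) / 2 * (?E (opposite i) v - ?E (opposite i) u))"
    using False unfolding relax_def Let_def u_def[symmetric] v_def[symmetric] \<alpha>_def[symmetric] bet_def[symmetric]
    by (simp add: d_def algebra_simps)
   moreover have "(\<omega>s + \<omega>a) / 2 * (?E i v - ?E i u) + (\<omega>s - \<omega>a) / 2 * (?E (opposite i) v - ?E (opposite i) u)
    = (case i of XP => \<omega>s * Lx * (v - u) + \<omega>a * (fx v - fx u) | XM => \<omega>s * Lx * (v - u) + \<omega>a * - (fx v - fx u)
    | YP => \<omega>s * Ly * (v - u) + \<omega>a * (fy v - fy u) | YM => \<omega>s * Ly * (v - u) + \<omega>a * - (fy v - fy u) | _ => 0)"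
    using False by (cases i) (simp_all del: feq.simps add: E field_simps)
   ultimately show ?thesis
    using False d0 dle lip[OF uv] relaxed_pair_mono[OF Mx m w(2) d0[of XP] d0[of XM], of "v - u" "fx v - fx u"]
    relaxed_pair_mono[OF Mx m w(2) d0[of XM] d0[of XP], of "v - u" "- (fx v - fx u)"]
    relaxed_pair_mono[OF My m w(2) d0[of YP] d0[of YM], of "v - u" "fy v - fy u"]
    relaxed_pair_mono[OF My m w(2) d0[of YM] d0[of YP], of "v - u" "- (fy v - fy u)"]
    by (cases i) (simp_all add: abs_le_iff add.commute)
  qed
  thus "relax ?E \<omega>s \<omega>a g i <= relax ?E \<omega>s \<omega>a h i" by simp
 qed (use U E_sum E_mono in auto)
qed

section \<open>From Lebesgue classes to bounded Borel functions\<close>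

lemma borel_version:
 fixes u :: "'a::euclidean_space => real"
 assumes u: "u : borel_measurable (lebesgue_on Om)" and Om [measurable]: "Om : sets borel"
  and b: "AE z in lebesgue_on Om. \<bar>u z\<bar> <= U" and U: "0 <= U"
 obtains u' where "u' : Bor" "!!z. \<bar>u' z\<bar> <= U" "!!z. z \<notin> Om ==> u' z = 0"
  "AE z in lebesgue. z : Om --> u z = u' z"
proof -
 have Oml: "Om : sets lebesgue" using Om by simp
 have "(%z. if z : Om then u z else 0) : borel_measurable lebesgue" using borel_measurable_if[OF Oml] u by blast
 then obtain g where g: "g : borel_measurable lborel" "AE z in lborel. (if z : Om then u z else 0) = g z"
  using completion_ex_borel_measurable_real by blast
 define u' where "u' z = ind Om z * max (- U) (min U (g z))" for z
 have [measurable]: "g : Bor" using g(1) by simp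
 show ?thesis
 proof (rule that[of u'])
  show "u' : Bor" unfolding u'_def[abs_def] by measurable
  show "\<bar>u' z\<bar> <= U" for z using U by (auto simp: u'_def indicator_def)
  show "u' z = 0" if "z \<notin> Om" for z using that by (simp add: u'_def)
  have "AE z in lebesgue. z : Om --> \<bar>u z\<bar> <= U" using b Oml by (simp add: AE_restrict_space_iff)
  moreover have "AE z in lebesgue. (if z : Om then u z else 0) = g z" using g(2) by (simp add: AE_completion_iff)
  ultimately show "AE z in lebesgue. z : Om --> u z = u' z"
   by eventually_elim (auto simp: u'_def)
 qed
qed

lemma lebesgue_on_to_lborel:
 fixes u g :: "'a::euclidean_space => real"
 assumes [measurable]: "Om : sets borel" "g : Bor" and ae: "AE z in lebesgue. z : Om --> u z = g z"
 shows "(LINT z|lebesgue_on Om. u z) = (LBINT z. ind Om z * g z)"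
  "integrable (lebesgue_on Om) u \<longleftrightarrow> integ (%z. ind Om z * g z)"
  "(\<integral>\<^sup>+ z. ennreal \<bar>u z\<bar> \<partial>lebesgue_on Om) = (NN z. ennreal (ind Om z * \<bar>g z\<bar>))"
proof -
 have Oml: "Om \<inter> space lebesgue : sets lebesgue" by simp
 have m: "(%z. ind Om z * g z) : Bor" by measurable
 hence ml: "(%z. ind Om z * g z) : borel_measurable lebesgue" by (simp add: measurable_completion)
 have ae': "AE z in lebesgue. ind Om z * g z = ind Om z * u z"
  using ae by eventually_elim (auto simp: indicator_def)
 have mu: "(%z. ind Om z * u z) : borel_measurable lebesgue" by (rule borel_measurable_AE[OF ml ae'])
 have "(LINT z|lebesgue_on Om. u z) = (LINT z|lebesgue. ind Om z * u z)"
  using integral_restrict_space[OF Oml, of u] by simp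
 also have "... = (LINT z|lebesgue. ind Om z * g z)"
  using ae' by (intro integral_cong_AE mu ml) auto
 also have "... = (LBINT z. ind Om z * g z)" using m by (simp add: integral_completion)
 finally show "(LINT z|lebesgue_on Om. u z) = (LBINT z. ind Om z * g z)" .
 have "integrable (lebesgue_on Om) u \<longleftrightarrow> integrable lebesgue (%z. ind Om z * u z)"
  using integrable_restrict_space[OF Oml, of u] by simp
 also have "... \<longleftrightarrow> integrable lebesgue (%z. ind Om z * g z)"
  using ae' by (intro integrable_cong_AE mu ml) auto
 also have "... \<longleftrightarrow> integ (%z. ind Om z * g z)" using m by (simp add: integrable_completion)
 finally show "integrable (lebesgue_on Om) u \<longleftrightarrow> integ (%z. ind Om z * g z)" .
 have "(\<integral>\<^sup>+ z. ennreal \<bar>u z\<bar> \<partial>lebesgue_on Om) = (\<integral>\<^sup>+ z. ennreal \<bar>u z\<bar> * ind Om z \<partial>lebesgue)"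
  by (rule nn_integral_restrict_space[OF Oml])
 also have "... = (\<integral>\<^sup>+ z. ennreal (ind Om z * \<bar>g z\<bar>) \<partial>lebesgue)"
  by (rule nn_integral_cong_AE, use ae in eventually_elim) (auto simp: indicator_def)
 finally show "(\<integral>\<^sup>+ z. ennreal \<bar>u z\<bar> \<partial>lebesgue_on Om) = (NN z. ennreal (ind Om z * \<bar>g z\<bar>))"
  by (simp add: nn_integral_completion)
qed

lemma cell_int_eq_box:
 assumes [measurable]: "u : Bor"
 shows "(LINT z|lebesgue_on ({real i * h <..< (real i + 1) * h} \<times> {real j * k <..< (real j + 1) * k}). u z) = cell_int u h k i j"
proof -
 let ?B = "{real i * h <..< (real i + 1) * h} \<times> {real j * k <..< (real j + 1) * k}"
 have B: "?B : sets borel" by (intro borel_open open_Times) auto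
 have "(LINT z|lebesgue_on ?B. u z) = (LBINT z. ind ?B z * u z)"
  by (rule lebesgue_on_to_lborel(1)[OF B]) auto
 also have "... = cell_int u h k i j"
  unfolding cell_int_def
  by (intro Bochner_Integration.integral_cong refl) (auto simp: indicator_def mem_Times_iff algebra_simps)
 finally show ?thesis .
qed

lemma cell_int_cong_box:
 assumes [measurable]: "u' : Bor" and Om: "Om : sets borel"
  and ae: "AE z in lebesgue. z : Om --> u z = u' z"
  and sub: "{real i * h <..< (real i + 1) * h} \<times> {real j * k <..< (real j + 1) * k} \<subseteq> Om"
 shows "(LINT z|lebesgue_on ({real i * h <..< (real i + 1) * h} \<times> {real j * k <..< (real j + 1) * k}). u z) = cell_int u' h k i j"
proof -
 let ?B = "{real i * h <..< (real i + 1) * h} \<times> {real j * k <..< (real j + 1) * k}"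
 have B: "?B : sets borel" by (intro borel_open open_Times) auto
 have "AE z in lebesgue. z : ?B --> u z = u' z" using ae by eventually_elim (use sub in blast)
 hence "(LINT z|lebesgue_on ?B. u z) = (LBINT z. ind ?B z * u' z)"
  by (intro lebesgue_on_to_lborel(1) B) auto
 also have "... = (LINT z|lebesgue_on ?B. u' z)"
  by (rule lebesgue_on_to_lborel(1)[OF B, symmetric]) auto
 finally show ?thesis by (simp add: cell_int_eq_box)
qed

lemma averages_eq_cell_int:
 assumes u: "u' : Bor" and Om: "Om : sets borel" and ae: "AE z in lebesgue. z : Om --> u z = u' z"
 shows "{real n * dt <..< (real n + 1) * dt} \<times> {real j * dx <..< (real j + 1) * dx} \<subseteq> Om ==>
   boundary_average dt dx u n j = cell_int u' dt dx n j / (dt * dx)"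
  "{real i * dx <..< (real i + 1) * dx} \<times> {real j * dx <..< (real j + 1) * dx} \<subseteq> Om ==>
   initial_average dx u (i, j) = cell_int u' dx dx i j / (dx * dx)"
 unfolding boundary_average_def initial_average_def cell_def fst_conv snd_conv
 using cell_int_cong_box[OF u Om ae] by (simp_all add: power2_eq_square)

section \<open>Discrete bounds for the averaged data\<close>

lemma C1_test_swap:
 assumes "C1_test K ps ps1 ps2"
 shows "C1_test (prod.swap ` K) (%p. ps (prod.swap p)) (%p. ps2 (prod.swap p)) (%p. ps1 (prod.swap p))"
 unfolding C1_test_def
proof (intro conjI allI impI)
 have cs: "continuous_on S prod.swap" for S :: "(R2) set"
  unfolding prod.swap_def by (intro continuous_intros)
 have K: "compact K" "!!p. p \<notin> K ==> ps p = 0" "!!p. \<bar>ps p\<bar> <= 1" and c: "continuous_on UNIV ps1" "continuous_on UNIV ps2"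
  and d: "!!p. (ps has_derivative (%v. fst v * ps1 p + snd v * ps2 p)) (at p)"
  using assms unfolding C1_test_def by blast+
 show "compact (prod.swap ` K)" by (rule compact_continuous_image[OF cs K(1)])
 show "ps (prod.swap p) = 0" if "p \<notin> prod.swap ` K" for p
  using that K(2)[of "prod.swap p"] by (metis imageI swap_swap)
 show "\<bar>ps (prod.swap p)\<bar> <= 1" for p by (rule K)
 show "continuous_on UNIV (%p. ps2 (prod.swap p))" "continuous_on UNIV (%p. ps1 (prod.swap p))"
  by (rule continuous_on_compose2[OF c(2) cs] continuous_on_compose2[OF c(1) cs]; simp)+
 fix p :: "R2"
 have "(prod.swap has_derivative prod.swap) (at p)"
  unfolding prod.swap_def by (auto intro!: derivative_eq_intros)
 from has_derivative_compose[OF this d[of "prod.swap p"]]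
 show "((%p. ps (prod.swap p)) has_derivative (%v. fst v * ps2 (prod.swap p) + snd v * ps1 (prod.swap p))) (at p)"
  by (simp add: add.commute)
qed

text \<open>As \<open>u'\<close> vanishes outside \<open>Om\<close>, integrals over
  \<open>Om\<close> become integrals over the plane. One constant serves both variables.\<close>

lemma BV_var_bound:
 assumes BV: "BV Om u" and Om: "open Om" and u' [measurable]: "u' : Bor"
  and z: "!!z. z \<notin> Om ==> u' z = 0" and ae: "AE z in lebesgue. z : Om --> u z = u' z"
 obtains M where "0 <= M" "var_bound Om u' M" "var_bound (prod.swap ` Om) (%p. u' (prod.swap p)) M" "integ u'"
proof -
 have Omb: "Om : sets borel" using Om by simp
 have ind: "ind Om p * u' p = u' p" for p by (cases "p : Om") (use z in auto)
 from BV_C1_test[OF BV Om] obtain M where M: "!!K ps ps1 ps2. C1_test K ps ps1 ps2 ==> K \<subseteq> Om ==>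
   \<bar>LINT p|lebesgue_on Om. u p * ps1 p\<bar> <= M & \<bar>LINT p|lebesgue_on Om. u p * ps2 p\<bar> <= M" by blast
 have eq: "(LINT p|lebesgue_on Om. u p * \<zeta> p) = (LBINT p. u' p * \<zeta> p)" if "continuous_on UNIV \<zeta>" for \<zeta>
 proof -
  have [measurable]: "\<zeta> : Bor" by (rule borel_measurable_continuous_onI[OF that])
  have "AE p in lebesgue. p : Om --> u p * \<zeta> p = u' p * \<zeta> p" using ae by eventually_elim auto
  hence "(LINT p|lebesgue_on Om. u p * \<zeta> p) = (LBINT p. ind Om p * (u' p * \<zeta> p))"
   by (intro lebesgue_on_to_lborel(1) Omb) measurable
  thus ?thesis by (simp only: mult.assoc[symmetric] ind)
 qed
 show ?thesis
 proof (rule that[of "max M 0"])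
  show "var_bound Om u' (max M 0)"
   unfolding var_bound_def
  proof (intro allI impI, elim conjE)
   fix K ps ps1 ps2 assume T: "C1_test K ps ps1 ps2" "K \<subseteq> Om"
   hence "continuous_on UNIV ps1" unfolding C1_test_def by blast
   from eq[OF this] show "\<bar>LBINT p. u' p * ps1 p\<bar> <= max M 0" using M[OF T] by (simp add: le_max_iff_disj)
  qed
  show "var_bound (prod.swap ` Om) (%p. u' (prod.swap p)) (max M 0)"
   unfolding var_bound_def
  proof (intro allI impI, elim conjE)
   fix K ps ps1 ps2 assume T: "C1_test K ps ps1 ps2" "K \<subseteq> prod.swap ` Om"
   have sub: "prod.swap ` K \<subseteq> Om" using T(2) by (auto simp: swap_eq_case_prod)
   note T' = C1_test_swap[OF T(1)]
   have c: "continuous_on UNIV ps1" "continuous_on UNIV (%p. ps1 (prod.swap p))"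
    using T(1) T' unfolding C1_test_def by blast+
   have [measurable]: "ps1 : Bor" by (rule borel_measurable_continuous_onI[OF c(1)])
   have "(LBINT p. u' (prod.swap p) * ps1 p) = (LBINT p. u' p * ps1 (prod.swap p))"
    using lborel_swap_integral[of "%p. u' p * ps1 (prod.swap p)"] by simp
   thus "\<bar>LBINT p. u' (prod.swap p) * ps1 p\<bar> <= max M 0"
    using M[OF T' sub] eq[OF c(2)] by (simp add: le_max_iff_disj)
  qed
  have "integrable (lebesgue_on Om) u" using BV by (simp add: BV_def)
  thus "integ u'" using lebesgue_on_to_lborel(2)[OF Omb u' ae] by (simp add: ind)
 qed simp
qed

lemma scaled_sum:
 fixes c :: real and a :: "'a => real"
 assumes "0 < c" shows "(SUM i:I. SUM j:J. \<bar>g i j / c - h i j / c\<bar>) = (SUM i:I. SUM j:J. \<bar>g i j - h i j\<bar>) / c"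
  "(SUM i:I. SUM j:J. \<bar>g i j / c\<bar>) = (SUM i:I. SUM j:J. \<bar>g i j\<bar>) / c"
  "(SUM i:I. \<bar>a i / c\<bar>) = (SUM i:I. \<bar>a i\<bar>) / c"
 using assms by (simp_all add: diff_divide_distrib[symmetric] sum_divide_distrib)

lemma quarter_bounds:
 assumes v: "var_bound quarter u M" and u: "integ u" and h: "0 < h"
 defines "A \<equiv> %i j. cell_int u h h i j / (h * h)"
 shows "h * (SUM i<m. SUM j<l. \<bar>A (Suc i) j - A i j\<bar>) <= M" "h * (SUM j<l. \<bar>A 0 j\<bar>) <= M + (LBINT p. \<bar>u p\<bar>)"
  "h\<^sup>2 * (SUM i<m. SUM j<l. \<bar>A i j\<bar>) <= (LBINT p. \<bar>u p\<bar>)"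
proof -
 have hh: "0 < h * h" using h by simp
 have sub: "{0<..<a} \<times> {0<..<b} \<subseteq> quarter" for a b by (auto simp: quarter_def)
 have "(SUM i<m. SUM j<l. \<bar>cell_int u h h (Suc i) j - cell_int u h h i j\<bar>) <= h * M" by (rule discrete_var[OF v u h h sub])
 thus "h * (SUM i<m. SUM j<l. \<bar>A (Suc i) j - A i j\<bar>) <= M"
  unfolding A_def scaled_sum[OF hh] using h by (simp add: field_simps)
 \<comment> \<open>Enough rows to reach width 1, so that the mean over rows in
   \<open>first_row_le\<close> costs at most the full norm.\<close>
 define k where "k = Suc (nat \<lceil>1 / h\<rceil>)"
 have "1 / h <= real k" unfolding k_def by linarith
 hence k: "1 <= h * real k" "0 < k" using h by (simp_all add: field_simps k_def)
 have L: "0 <= (LBINT p. \<bar>u p\<bar>)" by simp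
 have "(SUM j<l. \<bar>cell_int u h h 0 j\<bar>) <= h * M + (LBINT p. \<bar>u p\<bar>) / real k" by (rule first_row_le[OF v u h h sub k(2)])
 also have "... <= h * M + h * (LBINT p. \<bar>u p\<bar>)"
  using mult_right_mono[OF k(1) L] k(2) by (simp add: field_simps)
 finally show "h * (SUM j<l. \<bar>A 0 j\<bar>) <= M + (LBINT p. \<bar>u p\<bar>)"
  unfolding A_def scaled_sum[OF hh] using h by (simp add: field_simps)
 show "h\<^sup>2 * (SUM i<m. SUM j<l. \<bar>A i j\<bar>) <= (LBINT p. \<bar>u p\<bar>)"
  unfolding A_def scaled_sum(2)[OF hh] using sum_cell_int_le[OF u h h, where m = m and l = l] h by (simp add: power2_eq_square)
qed

text \<open>In time only the \<open>N\<close> rows before \<open>T\<close> are available for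
  averaging, which gives the norm divided by \<open>T\<close>. The factors \<open>lam\<close> come
  from the ratio of the space-step \<open>lam * k\<close> to the time-step \<open>k\<close>.\<close>

lemma face_bounds:
 assumes v: "var_bound (face T) u M" "var_bound (prod.swap ` face T) (%p. u (prod.swap p)) M" and u: "integ u"
  and h: "0 < k" "0 < lam" and N: "real N * k = T" "N > 0"
 defines "W \<equiv> %n j. cell_int u k (lam * k) n j / (k * (lam * k))"
 shows "lam * k * (SUM j<l. \<bar>W 0 j\<bar>) <= M + (LBINT p. \<bar>u p\<bar>) / T"
  "lam * k * (SUM n<N - 1. SUM j<l. \<bar>W (Suc n) j - W n j\<bar>) <= M"
  "lam * k * (SUM n<N. SUM j<l. \<bar>W n (Suc j) - W n j\<bar>) <= lam * M"
  "(lam * k)\<^sup>2 * (SUM n<N. SUM j<l. \<bar>W n j\<bar>) <= lam * (LBINT p. \<bar>u p\<bar>)"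
proof -
 have lk: "0 < lam * k" and klk: "0 < k * (lam * k)" using h by auto
 have um: "u : Bor" using borel_measurable_integrable[OF u] by simp
 have sub: "{0<..<real N * k} \<times> {0<..<b} \<subseteq> face T" for b by (auto simp: face_def N)
 have N1: "Suc (N - 1) = N" using N by simp
 have "(SUM j<l. \<bar>cell_int u k (lam * k) 0 j\<bar>) <= k * M + (LBINT p. \<bar>u p\<bar>) / real N"
  by (rule first_row_le[OF v(1) u h(1) lk sub N(2)])
 also have "(LBINT p. \<bar>u p\<bar>) / real N = k * ((LBINT p. \<bar>u p\<bar>) / T)"
  using N h by (simp add: field_simps N(1)[symmetric])
 finally show "lam * k * (SUM j<l. \<bar>W 0 j\<bar>) <= M + (LBINT p. \<bar>u p\<bar>) / T"
  unfolding W_def scaled_sum[OF klk] using h by (simp add: field_simps)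
 have "(SUM n<N - 1. SUM j<l. \<bar>cell_int u k (lam * k) (Suc n) j - cell_int u k (lam * k) n j\<bar>) <= k * M"
  by (rule discrete_var[OF v(1) u h(1) lk]) (unfold N1, rule sub)
 thus "lam * k * (SUM n<N - 1. SUM j<l. \<bar>W (Suc n) j - W n j\<bar>) <= M"
  unfolding W_def scaled_sum[OF klk] using h by (simp add: field_simps)
 have "(SUM j<l. SUM n<N. \<bar>cell_int (%p. u (prod.swap p)) (lam * k) k (Suc j) n - cell_int (%p. u (prod.swap p)) (lam * k) k j n\<bar>) <= lam * k * M"
 proof (rule discrete_var[OF v(2) lborel_swap_integrable[OF u] lk h(1)])
  show "{0<..<real (Suc l) * (lam * k)} \<times> {0<..<real N * k} \<subseteq> prod.swap ` face T"
   by (auto simp: face_def N image_def simp del: of_nat_Suc)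
 qed
 hence "(SUM n<N. SUM j<l. \<bar>cell_int u k (lam * k) n (Suc j) - cell_int u k (lam * k) n j\<bar>) <= lam * k * M"
  unfolding cell_int_swap[OF um] by (subst sum.swap)
 thus "lam * k * (SUM n<N. SUM j<l. \<bar>W n (Suc j) - W n j\<bar>) <= lam * M"
  unfolding W_def scaled_sum[OF klk] using h by (simp add: field_simps)
 have "(SUM n<N. SUM j<l. \<bar>cell_int u k (lam * k) n j\<bar>) * (k * lam * k) <= (LBINT p. \<bar>u p\<bar>) * (k * lam * k)"
  using sum_cell_int_le[OF u h(1) lk, where m = N and l = l] h by (intro mult_right_mono) auto
 thus "(lam * k)\<^sup>2 * (SUM n<N. SUM j<l. \<bar>W n j\<bar>) <= lam * (LBINT p. \<bar>u p\<bar>)"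
  unfolding W_def scaled_sum(2)[OF klk] using h by (simp add: field_simps power2_eq_square)
qed

section \<open>Reconstructions and the convergence hypothesis\<close>

lemma reconstruct_eq:
 assumes dt: "0 < dt" and dx: "0 < dx" and t: "0 <= t" "t < real N * dt" and x: "0 < fst x" "0 < snd x"
  and grid: "!!k::nat. fst x ~= real k * dx & snd x ~= real k * dx"
 shows "reconstruct N dt dx g (t, x) = g (ix dt t) (ix dx (fst x), ix dx (snd x))"
proof -
 let ?j = "(ix dx (fst x), ix dx (snd x))"
 have it: "ind {real n * dt ..< (real n + 1) * dt} t = (if n = ix dt t then 1 else 0 :: real)" for n
  using ix_eq_iff[OF dt t(1), of n] by (auto simp: indicator_def add.commute)
 have strict: "i = ix dx s \<longleftrightarrow> s : {real i * dx <..< (real i + 1) * dx}" if "0 < s" "!!k::nat. s ~= real k * dx" for i s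
 proof -
  have "s ~= real i * dx" by (rule that)
  thus ?thesis using ix_eq_iff[OF dx less_imp_le[OF that(1)], of i] by (auto simp: add.commute)
 qed
 have ij: "ind (cell dx j) x = (if j = ?j then 1 else 0 :: real)" for j
  using strict[OF x(1), of "fst j"] strict[OF x(2), of "snd j"] grid
  by (auto simp: cell_def indicator_def mem_Times_iff prod_eq_iff)
 have inner: "(\<Sum>\<^sub>\<infinity>j\<in>UNIV. g n j * ind (cell dx j) x * ind {real n * dt ..< (real n + 1) * dt} t)
   = (if n = ix dt t then g n ?j else 0)" for n
 proof -
  have "(\<Sum>\<^sub>\<infinity>j\<in>UNIV. g n j * ind (cell dx j) x * ind {real n * dt ..< (real n + 1) * dt} t)
   = (\<Sum>\<^sub>\<infinity>j\<in>{?j}. if n = ix dt t then g n j else 0)"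
   unfolding ij it by (rule infsum_cong_neutral) auto
  thus ?thesis by simp
 qed
 have "ix dt t < N" using ix_less_iff[OF dt t(1), of N] t(2) by simp
 thus ?thesis unfolding reconstruct_def prod.case inner by simp
qed

text \<open>Cells are open, so the reconstruction vanishes on the grid lines in space; these form a
  null set.\<close>

lemma AE_off_grid:
 "AE x :: R2 in lborel. \<forall>k::nat. fst x ~= real k * dx & snd x ~= real k * dx"
proof -
 have "AE x :: R2 in lborel. fst x ~= real k * dx & snd x ~= real k * dx" for k :: nat
 proof -
  have "AE x :: R2 in lborel. x \<bullet> (1, 0) ~= real k * dx" "AE x :: R2 in lborel. x \<bullet> (0, 1) ~= real k * dx"
   by (intro AE_inner_neq, simp add: Basis_prod_def)+
  thus ?thesis by eventually_elim (simp add: inner_prod_def)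
 qed
 thus ?thesis by (simp add: AE_all_countable)
qed

locale lbm_convergence =
 fixes T lam Lx Ly \<omega>s \<omega>a :: real and \<phi>x \<phi>y :: "real => real" and u0 uW uS :: "R2 => real"
  and dx :: "nat => real" and N :: "nat => nat"
  and fbar :: "vel => R3 => real" and ubar :: "R3 => real"
  and E :: "vel => real => real" and U :: real and dt :: "nat => real"
 assumes E_def: "E = feq lam \<phi>x \<phi>y Lx Ly" and U_def: "U = u_inf T u0 uW uS" and dt_def: "dt = (%p. dx p / lam)"
  and T_pos: "T > 0" and lam_pos: "lam > 0"
  and C1: "\<phi>x C1_differentiable_on UNIV" "\<phi>y C1_differentiable_on UNIV" and zero: "\<phi>x 0 = 0" "\<phi>y 0 = 0"
  and data: "Linf_BV_L1 quarter u0" "Linf_BV_L1 (face T) uW" "Linf_BV_L1 (face T) uS"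
  and w_pos: "0 < \<omega>s" "0 < \<omega>a"
  and mono: "monotonicity_condition lam \<phi>x \<phi>y Lx Ly \<omega>s \<omega>a U"
  and dx_pos: "!!p. dx p > 0" and dx_lim: "dx ----> 0" and N_eq: "!!p. real (N p) * dt p = T"
  and fbar_meas: "!!i. fbar i : borel_measurable (lebesgue_on (space_time T))"
  and ubar_eq: "!!z. z : space_time T ==> ubar z = (SUM i:UNIV. fbar i z)"
  and equil: "!!t. t : {0<..<T} ==> AE x in lebesgue_on quarter. ubar (t, x) : {- U..U} & (ALL i. fbar i (t, x) = E i (ubar (t, x)))"
  and conv: "(%p. LinfL1_norm_vec T (%i z. f_rec E \<omega>s \<omega>a u0 uW uS (N p) (dt p) (dx p) i z - fbar i z)) ----> 0"
begin

lemma U_nonneg: "0 <= U" unfolding U_def u_inf_def by simp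

lemma dt_pos: "0 < dt p" using dx_pos lam_pos by (simp add: dt_def)
lemma dx_eq: "dx p = lam * dt p" using lam_pos by (simp add: dt_def)
lemma N_pos: "N p > 0" using N_eq[of p] T_pos by (cases "N p") auto

lemma data_AE_bound: "AE z in lebesgue_on quarter. \<bar>u0 z\<bar> <= U" "AE z in lebesgue_on (face T). \<bar>uW z\<bar> <= U" "AE z in lebesgue_on (face T). \<bar>uS z\<bar> <= U"
proof -
 let ?m = "max (Linf_norm quarter u0) (max (Linf_norm (face T) uW) (Linf_norm (face T) uS))"
 have "?m < \<infinity>" using data by (simp add: Linf_BV_L1_def)
 hence m: "ennreal U = ?m" unfolding U_def u_inf_def by simp
 have *: "AE z in lebesgue_on Om. \<bar>u z\<bar> <= U" if "Linf_norm Om u <= ennreal U" for Om and u :: "R2 => real"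
  using esssup_AE[of "%p. ennreal \<bar>u p\<bar>" "lebesgue_on Om"]
 proof eventually_elim
  case (elim z)
  hence "ennreal \<bar>u z\<bar> <= ennreal U" using that unfolding Linf_norm_def by (rule order_trans)
  thus ?case using U_nonneg by simp
 qed
 show "AE z in lebesgue_on quarter. \<bar>u0 z\<bar> <= U" "AE z in lebesgue_on (face T). \<bar>uW z\<bar> <= U" "AE z in lebesgue_on (face T). \<bar>uS z\<bar> <= U"
  by (intro *, simp add: m le_max_iff_disj)+
qed

lemma relaxation: "relaxation E (relax E \<omega>s \<omega>a) U"
 unfolding E_def using mono unfolding E_def by (intro relaxation_feq C1 zero lam_pos w_pos U_nonneg)

lemma E_borel [measurable]: "E i : Bor"
proof -
 have "continuous_on UNIV \<phi>x" "continuous_on UNIV \<phi>y"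
  using C1_flux(1)[OF C1(1)] C1_flux(1)[OF C1(2)] by (auto intro!: continuous_at_imp_continuous_on DERIV_isCont)
 hence [measurable]: "\<phi>x : Bor" "\<phi>y : Bor"
  by (auto intro: borel_measurable_continuous_onI)
 have "(%u. E i u) : Bor" unfolding E_def by (cases i) simp_all
 thus ?thesis by simp
qed

text \<open>The equilibrium relation is given for each time and almost every point. To combine these
  into one statement almost everywhere in space-time, Fubini requires a measurable set; hence the
  Borel representatives \<open>g i\<close> and the predicate \<open>P\<close> formulated with
  them.\<close>

lemma limit_version:
 obtains v where "v : Bor" "!!z. \<bar>v z\<bar> <= U" "!!z. z \<notin> space_time T ==> v z = 0"
  "AE z in lebesgue. z : space_time T --> ubar z = v z"
  "AE z in lebesgue. z : space_time T --> (ALL i. fbar i z = E i (v z))"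
proof -
 have STl: "space_time T : sets lebesgue" using borel_domains(1)[of T] by simp
 have "EX g:borel_measurable lborel. AE z in lborel. (if z : space_time T then fbar i z else 0) = g z" for i
  using borel_measurable_if[OF STl, of "fbar i"] fbar_meas by (intro completion_ex_borel_measurable_real) blast
 hence "ALL i. EX g. g : Bor & (AE z in lborel. (if z : space_time T then fbar i z else 0) = g z)"
 proof (intro allI)
  fix i
  assume ex: "!!i. EX g:borel_measurable lborel. AE z in lborel. (if z : space_time T then fbar i z else 0) = g z"
  from ex[of i] obtain g where "g : borel_measurable lborel" "AE z in lborel. (if z : space_time T then fbar i z else 0) = g z"
   by blast
  moreover from this(1) have "g : Bor" by simp
  ultimately show "EX g. g : Bor & (AE z in lborel. (if z : space_time T then fbar i z else 0) = g z)"
   by blast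
 qed
 from choice[OF this] obtain g where gm [measurable]: "!!i. g i : Bor"
  and g: "!!i. AE z in lborel. (if z : space_time T then fbar i z else 0) = g i z" by blast
 define s where "s z = (SUM i:UNIV. g i z)" for z
 have sm [measurable]: "s : Bor" unfolding s_def[abs_def] by measurable
 have "AE z in lborel. ALL i:UNIV. (if z : space_time T then fbar i z else 0) = g i z"
  using g by (intro AE_finite_allI) auto
 hence gall: "AE z in lborel. ALL i. (if z : space_time T then fbar i z else 0) = g i z" by simp
 hence "AE z in lborel \<Otimes>\<^sub>M lborel. ALL i. (if z : space_time T then fbar i z else 0) = g i z" unfolding lborel_prod .
 hence sec: "AE t in lborel. AE x in lborel. ALL i. (if (t, x) : space_time T then fbar i (t, x) else 0) = g i (t, x)"
  by (rule lborel_pair.AE_pair)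
 define P where "P z \<longleftrightarrow> \<bar>s z\<bar> <= U & (ALL i:UNIV. g i z = E i (s z))" for z
 have "AE t in lborel. AE x in lborel. (t, x) : space_time T --> P (t, x)"
  using sec
 proof eventually_elim
  case (elim t)
  show ?case
  proof (cases "t : {0<..<T}")
   case True
   have "AE x in lebesgue. x : quarter --> ubar (t, x) : {- U..U} & (ALL i. fbar i (t, x) = E i (ubar (t, x)))"
   proof -
    have qb: "quarter \<inter> space lebesgue : sets lebesgue" using borel_domains(3) by simp
    show ?thesis using equil[OF True] unfolding AE_restrict_space_iff[OF qb] .
   qed
   hence "AE x in lborel. x : quarter --> ubar (t, x) : {- U..U} & (ALL i. fbar i (t, x) = E i (ubar (t, x)))"
    by (simp add: AE_completion_iff)
   with elim show ?thesis
   proof eventually_elim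
    case (elim x)
    show ?case
    proof
    assume z: "(t, x) : space_time T"
    hence "g i (t, x) = fbar i (t, x)" for i using elim(1) by auto
    moreover from this have "s (t, x) = ubar (t, x)" unfolding s_def ubar_eq[OF z] by simp
    moreover have "x : quarter" using z by (simp add: space_time_def)
    ultimately show "P (t, x)" using elim(2) unfolding P_def by auto
    qed
   qed
  qed (rule AE_I2, auto simp: space_time_def)
 qed
 moreover have "{z : space (lborel \<Otimes>\<^sub>M lborel). z : space_time T --> P z} : sets (lborel \<Otimes>\<^sub>M lborel)"
 proof -
  have "{z : space borel. z : space_time T --> P z} : sets borel" unfolding P_def by measurable
  thus ?thesis unfolding lborel_prod by simp
 qed
 ultimately have "AE z in lborel \<Otimes>\<^sub>M lborel. z : space_time T --> P z" by (intro lborel_pair.AE_pair_measure) auto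
 hence PA: "AE z in lborel. z : space_time T --> P z" unfolding lborel_prod .
 define v where "v z = ind (space_time T) z * max (- U) (min U (s z))" for z
 have good: "AE z in lborel. z : space_time T --> ubar z = v z & (ALL i. fbar i z = E i (v z))"
  using PA gall
 proof eventually_elim
  case (elim z)
  show ?case
  proof
   assume z: "z : space_time T"
   hence gf: "g i z = fbar i z" for i using elim(2) by auto
   hence "s z = ubar z" unfolding s_def ubar_eq[OF z] by simp
   moreover have "v z = s z" using elim(1) z by (auto simp: v_def P_def)
   ultimately show "ubar z = v z & (ALL i. fbar i z = E i (v z))" using elim(1) z gf unfolding P_def by auto
  qed
 qed
 show ?thesis
 proof (rule that[of v])
  show "v : Bor" unfolding v_def[abs_def] by measurable
  show "\<bar>v z\<bar> <= U" for z using U_nonneg by (auto simp: v_def indicator_def)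
  show "v z = 0" if "z \<notin> space_time T" for z using that by (simp add: v_def)
  show "AE z in lebesgue. z : space_time T --> ubar z = v z"
   unfolding AE_completion_iff using good by eventually_elim auto
  show "AE z in lebesgue. z : space_time T --> (ALL i. fbar i z = E i (v z))"
   unfolding AE_completion_iff using good by eventually_elim auto
 qed
qed

text \<open>Up to step \<open>N p\<close> the scheme reads the data only through averages over cells
  inside their domains, where null sets do not matter.\<close>

lemma lbm_cong:
 assumes u0: "u0' : Bor" "AE z in lebesgue. z : quarter --> u0 z = u0' z"
  and uW: "uW' : Bor" "AE z in lebesgue. z : face T --> uW z = uW' z"
  and uS: "uS' : Bor" "AE z in lebesgue. z : face T --> uS z = uS' z" and n: "n <= N p"
 shows "lbm E \<omega>s \<omega>a u0 uW uS (dt p) (dx p) n = lbm E \<omega>s \<omega>a u0' uW' uS' (dt p) (dx p) n"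
 using n
proof (induction n)
 case 0
 have "initial_average (dx p) u0 j = initial_average (dx p) u0' j" for j
 proof -
  obtain i k where j: "j = (i, k)" by (cases j)
  have "0 <= real i * dx p" "0 <= real k * dx p" using dx_pos[of p] by auto
  hence "{real i * dx p <..< (real i + 1) * dx p} \<times> {real k * dx p <..< (real k + 1) * dx p} \<subseteq> quarter"
   by (auto simp: quarter_def)
  thus ?thesis unfolding j
   using averages_eq_cell_int(2)[OF u0(1) borel_domains(3) u0(2)] averages_eq_cell_int(2)[OF u0(1), of UNIV u0'] by simp
 qed
 thus ?case by simp
next
 case (Suc n)
 have "boundary_average (dt p) (dx p) u n j = boundary_average (dt p) (dx p) u' n j"
  if u: "u' : Bor" "AE z in lebesgue. z : face T --> u z = u' z" for u u' j
 proof -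
  have "0 <= real n * dt p" "0 <= real j * dx p" using dx_pos[of p] dt_pos[of p] by auto
  moreover have "(real n + 1) * dt p <= real (N p) * dt p" using Suc.prems dt_pos[of p] by (intro mult_right_mono) auto
  ultimately have "{real n * dt p <..< (real n + 1) * dt p} \<times> {real j * dx p <..< (real j + 1) * dx p} \<subseteq> face T"
   unfolding N_eq by (auto simp: face_def)
  thus ?thesis
   using averages_eq_cell_int(1)[OF u(1) borel_domains(2) u(2)] averages_eq_cell_int(1)[OF u(1), of UNIV u'] by simp
 qed
 from this[OF uW] this[OF uS] show ?case using Suc by simp
qed

lemma AE_slices:
 assumes "AE z in lebesgue. z : space_time T --> Q z"
 shows "AE t in lborel. 0 < t & t < T --> (AE x in lborel. x : quarter --> Q (t, x))"
proof -
 have "AE z in lborel \<Otimes>\<^sub>M lborel. z : space_time T --> Q z" using assms unfolding AE_completion_iff lborel_prod .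
 hence "AE t in lborel. AE x in lborel. (t, x) : space_time T --> Q (t, x)" by (rule lborel_pair.AE_pair)
 thus ?thesis
 proof eventually_elim
  case (elim t)
  show ?case
  proof
   assume t: "0 < t & t < T"
   show "AE x in lborel. x : quarter --> Q (t, x)"
    using elim by eventually_elim (use t in \<open>simp add: space_time_def\<close>)
  qed
 qed
qed

text \<open>Integrating the slice norms over \<open>(0, T)\<close> bounds the space-time norm by
  \<open>T\<close> times the essential supremum.\<close>

lemma step_L1_limit:
 assumes v [measurable]: "v : Bor" and vE: "AE z in lebesgue. z : space_time T --> (ALL i. fbar i z = E i (v z))"
  and f: "!!p n. n <= N p ==> lbm E \<omega>s \<omega>a u0 uW uS (dt p) (dx p) n = f p n"
 shows "(%p. NN z. ennreal (ind (space_time T) z *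
    (SUM i:UNIV. \<bar>f p (ix (dt p) (fst z)) i (ix (dx p) (fst (snd z)), ix (dx p) (snd (snd z))) - E i (v z)\<bar>))) ----> 0"
proof -
 define c where "c p = LinfL1_norm_vec T (%i z. f_rec E \<omega>s \<omega>a u0 uW uS (N p) (dt p) (dx p) i z - fbar i z)" for p
 define G where "G p z = ennreal (ind (space_time T) z *
    (SUM i:UNIV. \<bar>f p (ix (dt p) (fst z)) i (ix (dx p) (fst (snd z)), ix (dx p) (snd (snd z))) - E i (v z)\<bar>))" for p z
 have Gm: "G p : Bor" for p
 proof -
  have [measurable]: "(%z. f p (ix (dt p) (fst z)) i (ix (dx p) (fst (snd z)), ix (dx p) (snd (snd z)))) : Bor" for i
   by (rule measurable_step3[of "%n k l. f p n i (k, l)"])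
  show ?thesis unfolding G_def[abs_def] by measurable
 qed
 have le: "(NN z. G p z) <= ennreal T * c p" for p
 proof -
  note [measurable] = Gm
  have fub: "(NN z. G p z) = (NN t. (NN x. G p (t, x)))"
   by (subst lborel_prod[symmetric], subst lborel.nn_integral_fst[symmetric]) (simp_all add: lborel_prod borel_prod)
  have "AE t in lebesgue_on {0<..<T}. (\<integral>\<^sup>+ x. ennreal \<bar>SUM i:UNIV. \<bar>f_rec E \<omega>s \<omega>a u0 uW uS (N p) (dt p) (dx p) i (t, x) - fbar i (t, x)\<bar>\<bar>
    \<partial>lebesgue_on quarter) <= c p"
   unfolding c_def LinfL1_norm_vec_def LinfL1_norm_def by (rule esssup_AE)
  hence "AE t in lborel. t : {0<..<T} --> (\<integral>\<^sup>+ x. ennreal \<bar>SUM i:UNIV. \<bar>f_rec E \<omega>s \<omega>a u0 uW uS (N p) (dt p) (dx p) i (t, x) - fbar i (t, x)\<bar>\<bar>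
    \<partial>lebesgue_on quarter) <= c p"
   by (simp add: AE_restrict_space_iff AE_completion_iff)
  with AE_slices[OF vE] have "AE t in lborel. (NN x. G p (t, x)) <= c p * ind {0<..<T} t"
  proof eventually_elim
   case (elim t)
   show ?case
   proof (cases "t : {0<..<T}")
    case True
    have qb: "quarter \<inter> space lebesgue : sets lebesgue" using borel_domains(3) by simp
    have "(NN x. G p (t, x)) = (NN x. ennreal \<bar>SUM i:UNIV. \<bar>f_rec E \<omega>s \<omega>a u0 uW uS (N p) (dt p) (dx p) i (t, x) - fbar i (t, x)\<bar>\<bar>
    * ind quarter x)"
    proof (rule nn_integral_cong_AE)
    have "AE x in lborel. x : quarter --> (ALL i. fbar i (t, x) = E i (v (t, x)))" using elim(1) True by simp
    with AE_off_grid[of "dx p"]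
    show "AE x in lborel. G p (t, x) = ennreal \<bar>SUM i:UNIV. \<bar>f_rec E \<omega>s \<omega>a u0 uW uS (N p) (dt p) (dx p) i (t, x) - fbar i (t, x)\<bar>\<bar>
    * ind quarter x"
    proof eventually_elim
    case (elim x)
    show ?case
    proof (cases "x : quarter")
    case xq: True
    have n: "ix (dt p) t <= N p" using ix_less_iff[OF dt_pos, of t p "N p"] True by (simp add: N_eq)
    have "f_rec E \<omega>s \<omega>a u0 uW uS (N p) (dt p) (dx p) i (t, x) = f p (ix (dt p) t) i (ix (dx p) (fst x), ix (dx p) (snd x))" for i
    unfolding f_rec_def using True xq elim(1)
    by (subst reconstruct_eq[OF dt_pos dx_pos]) (auto simp: N_eq quarter_def f[OF n])
    moreover have "(t, x) : space_time T" using True xq by (simp add: space_time_def)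
    ultimately show ?thesis using elim(2) xq by (simp add: G_def sum_nonneg)
    qed (simp add: G_def space_time_def)
    qed
    qed
    also have "... = (\<integral>\<^sup>+ x. ennreal \<bar>SUM i:UNIV. \<bar>f_rec E \<omega>s \<omega>a u0 uW uS (N p) (dt p) (dx p) i (t, x) - fbar i (t, x)\<bar>\<bar> \<partial>lebesgue_on quarter)"
    by (simp only: nn_integral_restrict_space[OF qb] nn_integral_completion)
    also have "... <= c p" using elim(2) True by simp
    finally show ?thesis using True by simp
   next
    case False
    hence "(t, x) \<notin> space_time T" for x by (auto simp: space_time_def)
    hence "G p (t, x) = 0" for x by (simp add: G_def)
    thus ?thesis by simp
   qed
  qed
  hence "(NN t. (NN x. G p (t, x))) <= (NN t. c p * ind {0<..<T} t)"
   by (rule nn_integral_mono_AE)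
  also have "... = ennreal T * c p" using T_pos by (simp add: nn_integral_cmult_indicator mult.commute)
  finally show ?thesis unfolding fub .
 qed
 have "(%p. ennreal T * c p) ----> ennreal T * 0"
  using conv unfolding c_def[symmetric] by (intro ennreal_tendsto_cmult) auto
 hence "(%p. ennreal T * c p) ----> 0" by simp
 hence "(%p. NN z. G p z) ----> 0"
  by (rule tendsto_sandwich[OF _ _ tendsto_const, rotated 2]) (use le in auto)
 thus ?thesis unfolding G_def .
qed

end

text \<open>\<open>X\<close> is covered by the open sets \<open>Om\<close>, where nothing changes,
  and \<open>- K\<close>, where everything is zero. For interior test functions \<open>X\<close> is
  the whole space; for those up to the boundary it is the open octant, since \<open>K\<close> may
  touch the faces.\<close>

lemma zero_extension:
 fixes F :: "'a::euclidean_space => real"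
 assumes Om: "open Om" and d: "!!p. p : Om ==> (F has_derivative F' p) (at p)" and K: "closed K"
  and z: "!!p. p : Om ==> p \<notin> K ==> F p = 0" and X: "open X" "X \<inter> K \<subseteq> Om"
 shows "p : X ==> ((%p. if p : Om then F p else 0) has_derivative (%h. if p : Om then F' p h else 0)) (at p)"
  "continuous_on Om (%p. F' p c) ==> continuous_on X (%p. if p : Om then F' p c else 0)"
  "p : Om ==> p \<notin> K ==> F' p c = 0"
proof -
 have Kc: "open (- K)" by (rule open_Compl[OF K])
 have F'0: "F' p c = 0" if p: "p : Om" "p \<notin> K" for p c
 proof -
  have "((%_. 0) has_derivative F' p) (at p)"
   by (rule has_derivative_transform_within_open[OF d[OF p(1)], of "Om \<inter> - K"]) (use Om Kc p z in auto)
  from has_derivative_unique[OF this has_derivative_const] show ?thesis by simp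
 qed
 thus "p : Om ==> p \<notin> K ==> F' p c = 0" .
 show "((%p. if p : Om then F p else 0) has_derivative (%h. if p : Om then F' p h else 0)) (at p)" if p: "p : X"
 proof (cases "p : Om")
  case True
  have "((%p. if p : Om then F p else 0) has_derivative F' p) (at p)"
   by (rule has_derivative_transform_within_open[OF d[OF True] Om True]) simp
  thus ?thesis using True by simp
 next
  case False
  hence pK: "p : - K" using X p by auto
  have "((%p. if p : Om then F p else 0) has_derivative (%_. 0)) (at p)"
   by (rule has_derivative_transform_within_open[OF has_derivative_const Kc pK]) (use z in auto)
  thus ?thesis using False by simp
 qed
 assume c: "continuous_on Om (%p. F' p c)"
 let ?g = "%p. if p : Om then F' p c else 0"
 have "continuous_on (X \<inter> Om) ?g" using c by (rule continuous_on_eq[OF continuous_on_subset]) auto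
 moreover have "continuous_on (X \<inter> - K) ?g" by (rule continuous_on_eq[OF continuous_on_const[of _ 0]]) (use F'0 in auto)
 ultimately have "continuous_on (X \<inter> Om \<union> X \<inter> - K) ?g"
  using X Om Kc by (intro continuous_on_open_Un) auto
 moreover have "X \<inter> Om \<union> X \<inter> - K = X" using X by auto
 ultimately show "continuous_on X ?g" by simp
qed

lemma line_derivatives:
 fixes G :: "R3 => real"
 assumes "(G has_derivative G') (at (t, x, y))"
 shows "((%s. G (s, x, y)) has_real_derivative G' (1, 0, 0)) (at t)"
  "((%s. G (t, s, y)) has_real_derivative G' (0, 1, 0)) (at x)"
  "((%s. G (t, x, s)) has_real_derivative G' (0, 0, 1)) (at y)"
proof -
 have lin: "G' (r *\<^sub>R h) = r * G' h" for r h
  using linear_cmul[OF has_derivative_linear[OF assms]] by simp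
 have g: "((%s. G (j s)) has_real_derivative G' h) (at a)"
  if "(j has_derivative (%r. r *\<^sub>R h)) (at a)" "j a = (t, x, y)" for j h a
 proof -
  have "((%s. G (j s)) has_derivative (%r. G' (r *\<^sub>R h))) (at a)"
   using that(1) by (rule has_derivative_compose) (use that assms in simp)
  moreover have "(*) (G' h) = (%r. r * G' h)" by (simp add: fun_eq_iff mult.commute)
  ultimately show ?thesis unfolding has_field_derivative_def lin by simp
 qed
 show "((%s. G (s, x, y)) has_real_derivative G' (1, 0, 0)) (at t)"
  by (rule g[of "%s. (s, x, y)"]) (auto intro!: derivative_eq_intros simp: fun_eq_iff zero_prod_def)
 show "((%s. G (t, s, y)) has_real_derivative G' (0, 1, 0)) (at x)"
  by (rule g[of "%s. (t, s, y)"]) (auto intro!: derivative_eq_intros simp: fun_eq_iff zero_prod_def)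
 show "((%s. G (t, x, s)) has_real_derivative G' (0, 0, 1)) (at y)"
  by (rule g[of "%s. (t, x, s)"]) (auto intro!: derivative_eq_intros simp: fun_eq_iff zero_prod_def)
qed

lemma compact_strict_bound:
 fixes f :: "'a::topological_space => real"
 assumes "compact K" "continuous_on K f" "!!p. p : K ==> f p < c"
 obtains c' where "c' < c" "!!p. p : K ==> f p <= c'"
proof (cases "K = {}")
 case True
 thus ?thesis using that[of "c - 1"] by auto
next
 case False
 from continuous_attains_sup[OF assms(1) this assms(2)] obtain p where "p : K" "ALL q:K. f q <= f p" by blast
 thus ?thesis using that[of "f p"] assms(3) by auto
qed

lemma compact_bound:
 fixes f :: "'a::topological_space => real"
 assumes "compact K" "continuous_on K f"
 obtains c where "0 < c" "!!p. p : K ==> \<bar>f p\<bar> <= c"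
proof -
 have "bounded (f ` K)" by (intro compact_imp_bounded compact_continuous_image assms)
 thus ?thesis unfolding bounded_pos using that by auto
qed



lemma Basis_real3: "(Basis :: (R3) set) = {(1, 0, 0), (0, 1, 0), (0, 0, 1)}"
 by (auto simp: Basis_prod_def zero_prod_def)

lemma compact_in_space_time:
 assumes K: "compact K" "K \<subseteq> test_domain T" and T: "T > 0"
 obtains T' R where "0 < T'" "T' < T" "0 < R" "!!t x y. (t, x, y) : K ==> t < T' & x < R & y < R"
proof -
 have "fst p < T" if "p : K" for p using that K by (auto simp: test_domain_def)
 from compact_strict_bound[OF K(1) _ this] obtain T0 where T0: "T0 < T" "!!p. p : K ==> fst p <= T0"
  by (auto intro!: continuous_intros)
 have "continuous_on K (%p. fst (snd p))" "continuous_on K (%p. snd (snd p))" by (intro continuous_intros)+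
 from compact_bound[OF K(1) this(1)] compact_bound[OF K(1) this(2)] obtain a b
  where ab: "0 < a" "0 < b" "!!p. p : K ==> \<bar>fst (snd p)\<bar> <= a" "!!p. p : K ==> \<bar>snd (snd p)\<bar> <= b" by metis
 show ?thesis
 proof (rule that[of "(max T0 0 + T) / 2" "a + b"])
  fix t x y assume "(t, x, y) : K"
  hence "t <= T0" "\<bar>x\<bar> <= a" "\<bar>y\<bar> <= b" using T0(2) ab(3,4) by force+
  thus "t < (max T0 0 + T) / 2 & x < a + b & y < a + b" using T0(1) T ab by (auto simp: max_def)
 qed (use T T0 ab in \<open>auto simp: max_def\<close>)
qed

lemma interior_test_fun:
 fixes \<Phi> :: "R3 => R3"
 assumes C1: "C1_on (space_time T) \<Phi>" and supp: "compact_support_in (space_time T) \<Phi>"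
  and le1: "!!p. p : space_time T ==> norm (\<Phi> p) <= 1" and T: "T > 0" and b: "b : Basis"
 defines "ps \<equiv> %t x y. if (t, x, y) : space_time T then \<Phi> (t, x, y) \<bullet> b else 0"
  and "D \<equiv> %c t x y. if (t, x, y) : space_time T then partial (space_time T) c \<Phi> (t, x, y) \<bullet> b else 0"
 obtains T' R C r where "test_fun T ps (D (1, 0, 0)) (D (0, 1, 0)) (D (0, 0, 1)) T' R C" "0 < r"
  "!!t x y. t <= r \<or> x <= r \<or> y <= r ==> ps t x y = 0" "!!t x y. \<bar>ps t x y\<bar> <= 1"
proof -
 let ?ST = "space_time T"
 obtain K where K: "compact K" "K \<subseteq> ?ST" "!!p. p : ?ST ==> p \<notin> K ==> \<Phi> p = 0"
  using supp unfolding compact_support_in_def by blast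
 have od: "open ?ST" by (rule open_space_time)
 define F' where "F' p h = frechet_derivative \<Phi> (at p) h \<bullet> b" for p h
 have d: "((%p. \<Phi> p \<bullet> b) has_derivative F' p) (at p)" if "p : ?ST" for p
 proof -
  have "\<Phi> differentiable (at p)" using C1 that at_within_open[OF that od] unfolding C1_on_def by auto
  thus ?thesis unfolding F'_def[abs_def] frechet_derivative_works by (rule has_derivative_inner_left)
 qed
 have F'p: "F' p c = partial ?ST c \<Phi> p \<bullet> b" if "p : ?ST" for p c
  using at_within_open[OF that od] by (simp add: F'_def partial_def)
 have F'c: "continuous_on ?ST (%p. F' p c)" if "c : Basis" for c
 proof -
  have "continuous_on ?ST (%p. partial ?ST c \<Phi> p \<bullet> b)"
   using C1 that unfolding C1_on_def by (intro continuous_on_inner continuous_on_const) auto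
  thus ?thesis by (rule continuous_on_eq) (simp add: F'p)
 qed
 note ext = zero_extension[OF od d compact_imp_closed[OF K(1)], of UNIV, OF _ _ open_UNIV]
 have z: "p : ?ST ==> p \<notin> K ==> \<Phi> p \<bullet> b = 0" for p using K(3) by simp
 have KU: "UNIV \<inter> K \<subseteq> ?ST" using K by simp
 have dG: "((%p. if p : ?ST then \<Phi> p \<bullet> b else 0) has_derivative (%h. if p : ?ST then F' p h else 0)) (at p)" for p
  using ext(1)[of p] z KU by blast
 have cG: "continuous_on UNIV (%p. if p : ?ST then F' p c else 0)" if "c : Basis" for c
  using zero_extension(2)[OF od d compact_imp_closed[OF K(1)] z open_UNIV KU F'c[OF that]] .
 have zG: "F' p c = 0" if "p : ?ST" "p \<notin> K" for p c
  using zero_extension(3)[OF od d compact_imp_closed[OF K(1)] z open_UNIV KU that] .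
 have DF: "D c t x y = (if (t, x, y) : ?ST then F' (t, x, y) c else 0)" for c t x y
  by (simp add: D_def F'p)
 have Bs: "(1, 0, 0) : (Basis :: (R3) set)" "(0, 1, 0) : (Basis :: (R3) set)"
  "(0, 0, 1) : (Basis :: (R3) set)" by (simp_all add: Basis_real3)
 have "K \<subseteq> test_domain T" using K(2) by (auto simp: space_time_def quarter_def test_domain_def)
 from compact_in_space_time[OF K(1) this T] obtain T' R where TR: "0 < T'" "T' < T" "0 < R"
  "!!t x y. (t, x, y) : K ==> t < T' & x < R & y < R" by blast
 \<comment> \<open>Compactness keeps the support at a distance of at least \<open>- r\<close> from
   the three faces; halving it later makes the separation strict.\<close>
 obtain r where r: "r < 0" "!!p. p : K ==> - min (fst p) (min (fst (snd p)) (snd (snd p))) <= r"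
 proof (rule compact_strict_bound[OF K(1), of "%p. - min (fst p) (min (fst (snd p)) (snd (snd p)))" 0])
  show "continuous_on K (%p. - min (fst p) (min (fst (snd p)) (snd (snd p))))" by (intro continuous_intros)
  show "- min (fst p) (min (fst (snd p)) (snd (snd p))) < 0" if "p : K" for p
   using that K(2) by (auto simp: space_time_def quarter_def)
 qed blast
 have Cb: "EX C>0. ALL t x y. \<bar>D c t x y\<bar> <= C" if "c : Basis" for c
 proof -
  from compact_bound[OF K(1) continuous_on_subset[OF cG[OF that] subset_UNIV]] obtain C
   where C: "0 < C" "!!p. p : K ==> \<bar>if p : ?ST then F' p c else 0\<bar> <= C" by blast
  have "\<bar>D c t x y\<bar> <= C" for t x y
   using C(1) C(2)[of "(t, x, y)"] zG[of "(t, x, y)" c] by (cases "(t, x, y) : K") (auto simp: DF)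
  thus ?thesis using C(1) by blast
 qed
 obtain C1 C2 C3 where C: "0 < C1" "0 < C2" "0 < C3" "!!t x y. \<bar>D (1, 0, 0) t x y\<bar> <= C1"
  "!!t x y. \<bar>D (0, 1, 0) t x y\<bar> <= C2" "!!t x y. \<bar>D (0, 0, 1) t x y\<bar> <= C3"
  using Cb[OF Bs(1)] Cb[OF Bs(2)] Cb[OF Bs(3)] by blast
 have p1: "\<bar>ps t x y\<bar> <= 1" for t x y
 proof (cases "(t, x, y) : ?ST")
  case True
  have "\<bar>\<Phi> (t, x, y) \<bullet> b\<bar> <= norm (\<Phi> (t, x, y))" using Basis_le_norm[OF b] by simp
  thus ?thesis using le1[OF True] True by (simp add: ps_def)
 qed (simp add: ps_def)
 have p0: "ps t x y = 0" if "(t, x, y) \<notin> K" for t x y using that z by (simp add: ps_def)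
 have Dc: "continuous_on S (%(t, x, y). D c t x y)" if "c : Basis" for S c
  using continuous_on_subset[OF cG[OF that], of S] by (simp add: DF case_prod_beta' cong: if_cong)
 have psc: "continuous_on S (%(t, x, y). ps t x y)" for S
 proof -
  have "continuous_on S (%p. if p : ?ST then \<Phi> p \<bullet> b else 0)"
   using dG by (intro continuous_at_imp_continuous_on ballI has_derivative_continuous) blast
  thus ?thesis by (simp add: ps_def case_prod_beta' cong: if_cong)
 qed
 show ?thesis
 proof (rule that[of T' R "C1 + C2 + C3 + 1" "- r / 2"])
  show "test_fun T ps (D (1, 0, 0)) (D (0, 1, 0)) (D (0, 0, 1)) T' R (C1 + C2 + C3 + 1)"
   unfolding test_fun_def
  proof (intro conjI allI impI ballI TR psc)
   fix t x y :: real
   show "((%s. ps s x y) has_real_derivative D (1, 0, 0) t x y) (at t)"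
    "((%s. ps t s y) has_real_derivative D (0, 1, 0) t x y) (at x)"
    "((%s. ps t x s) has_real_derivative D (0, 0, 1) t x y) (at y)"
    unfolding ps_def DF using line_derivatives[OF dG[of "(t, x, y)"]] by blast+
   show "\<bar>D (1, 0, 0) t x y\<bar> <= C1 + C2 + C3 + 1" "\<bar>D (0, 1, 0) t x y\<bar> <= C1 + C2 + C3 + 1" "\<bar>D (0, 0, 1) t x y\<bar> <= C1 + C2 + C3 + 1"
    using C(1-3) C(4)[of t x y] C(5)[of t x y] C(6)[of t x y] by linarith+
   show "\<bar>ps t x y\<bar> <= C1 + C2 + C3 + 1" using p1[of t x y] C(1-3) by linarith
   show "ps t x y = 0" if "T' <= t \<or> R <= x \<or> R <= y"
    using TR(4)[of t x y] that by (intro p0) auto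
  next
   fix f assume "f : {D (1, 0, 0), D (0, 1, 0), D (0, 0, 1)}"
   thus "continuous_on ({0<..} \<times> {0<..} \<times> {0<..}) (%(t, x, y). f t x y)" using Dc Bs by auto
  qed (use C in simp)
  show "0 < - r / 2" using r by simp
  show "ps t x y = 0" if "t <= - r / 2 \<or> x <= - r / 2 \<or> y <= - r / 2" for t x y
  proof (rule p0, rule notI)
   assume "(t, x, y) : K"
   from r(2)[OF this] have "- r <= min t (min x y)" unfolding fst_conv snd_conv by linarith
   thus False using that r(1) by auto
  qed
 qed (rule p1)
qed

text \<open>The cutoff is \<open>t < T\<close> alone, so that \<open>ps\<close> keeps its values on
  the faces \<open>t = 0\<close>, \<open>x = 0\<close> and \<open>y = 0\<close>. Derivatives matter
  only inside and are set to 0 elsewhere.\<close>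

lemma closed_test_fun:
 assumes C1: "C1_on (test_domain T) F" and supp: "compact_support_in (test_domain T) F" and T: "T > 0"
 defines "ps \<equiv> %t x y. if t < T then F (t, x, y) else 0"
  and "D \<equiv> %c t x y. if (t, x, y) : space_time T then partial (test_domain T) c F (t, x, y) else (0::real)"
 obtains T' R C where "test_fun T ps (D (1, 0, 0)) (D (0, 1, 0)) (D (0, 0, 1)) T' R C"
proof -
 let ?ST = "space_time T" and ?td = "test_domain T" and ?X = "{0<..} \<times> {0<..} \<times> {0<..} :: (R3) set"
 obtain K where K: "compact K" "K \<subseteq> ?td" "!!p. p : ?td ==> p \<notin> K ==> F p = 0"
  using supp unfolding compact_support_in_def by blast
 have od: "open ?ST" by (rule open_space_time)
 have sub: "?ST \<subseteq> ?td" by (auto simp: space_time_def quarter_def test_domain_def)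
 define F' where "F' p h = frechet_derivative F (at p) h" for p h
 have at: "at p within ?td = at p" if "p : ?ST" for p
  using at_within_open_subset[OF that od sub] .
 have d: "(F has_derivative F' p) (at p)" if "p : ?ST" for p
 proof -
  have "F differentiable (at p within ?td)" using C1 that sub unfolding C1_on_def by blast
  thus ?thesis unfolding at[OF that] F'_def[abs_def] frechet_derivative_works .
 qed
 have F'p: "F' p c = partial ?td c F p" if "p : ?ST" for p c
  using at[OF that] by (simp add: F'_def partial_def)
 have F'c: "continuous_on ?ST (%p. F' p c)" if "c : Basis" for c
 proof -
  have "continuous_on ?ST (partial ?td c F)"
   using C1 that continuous_on_subset[OF _ sub] unfolding C1_on_def by blast
  thus ?thesis by (rule continuous_on_eq) (simp add: F'p)
 qed
 have z: "p : ?ST ==> p \<notin> K ==> F p = 0" for p using K(3) sub by blast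
 have X: "open ?X" by (intro open_Times) auto
 have XK: "?X \<inter> K \<subseteq> ?ST" using K(2) by (auto simp: space_time_def quarter_def test_domain_def)
 note Kc = compact_imp_closed[OF K(1)]
 have ext: "p : ?X ==> ((%p. if p : ?ST then F p else 0) has_derivative (%h. if p : ?ST then F' p h else 0)) (at p)"
  "continuous_on ?ST (%p. F' p c) ==> continuous_on ?X (%p. if p : ?ST then F' p c else 0)"
  "p : ?ST ==> p \<notin> K ==> F' p c = 0" for p c
 proof -
  show "p : ?X ==> ((%p. if p : ?ST then F p else 0) has_derivative (%h. if p : ?ST then F' p h else 0)) (at p)"
   by (rule zero_extension(1)[OF od d Kc z X XK])
  show "continuous_on ?ST (%p. F' p c) ==> continuous_on ?X (%p. if p : ?ST then F' p c else 0)"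
   by (rule zero_extension(2)[OF od d Kc z X XK])
  show "p : ?ST ==> p \<notin> K ==> F' p c = 0"
   by (rule zero_extension(3)[OF od d Kc z X XK])
 qed
 have DF: "D c t x y = (if (t, x, y) : ?ST then F' (t, x, y) c else 0)" for c t x y
  by (simp add: D_def F'p)
 have Bs: "(1, 0, 0) : (Basis :: (R3) set)" "(0, 1, 0) : (Basis :: (R3) set)"
  "(0, 0, 1) : (Basis :: (R3) set)" by (simp_all add: Basis_real3)
 from compact_in_space_time[OF K(1,2) T] obtain T' R where TR: "0 < T'" "T' < T" "0 < R"
  "!!t x y. (t, x, y) : K ==> t < T' & x < R & y < R" by blast
 have Fc: "continuous_on ?td F"
  using C1 unfolding C1_on_def by (intro differentiable_imp_continuous_on) (simp add: differentiable_on_def)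
 have Cb: "EX C>0. ALL t x y. \<bar>D c t x y\<bar> <= C" if "c : Basis" for c
 proof -
  have "continuous_on K (partial ?td c F)" using C1 that continuous_on_subset[OF _ K(2)] unfolding C1_on_def by blast
  from compact_bound[OF K(1) this] obtain C where C: "0 < C" "!!p. p : K ==> \<bar>partial ?td c F p\<bar> <= C" by blast
  have "\<bar>D c t x y\<bar> <= C" for t x y
   using C(1) C(2)[of "(t, x, y)"] ext(3)[of "(t, x, y)" c] F'p[of "(t, x, y)" c]
   by (cases "(t, x, y) : ?ST"; cases "(t, x, y) : K") (auto simp: DF)
  thus ?thesis using C(1) by blast
 qed
 obtain C1 C2 C3 where C: "0 < C1" "0 < C2" "0 < C3" "!!t x y. \<bar>D (1, 0, 0) t x y\<bar> <= C1"
  "!!t x y. \<bar>D (0, 1, 0) t x y\<bar> <= C2" "!!t x y. \<bar>D (0, 0, 1) t x y\<bar> <= C3"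
  using Cb[OF Bs(1)] Cb[OF Bs(2)] Cb[OF Bs(3)] by blast
 from compact_bound[OF K(1) continuous_on_subset[OF Fc K(2)]] obtain C0
  where C0: "0 < C0" "!!p. p : K ==> \<bar>F p\<bar> <= C0" by blast
 have td: "(t, x, y) : ?td \<longleftrightarrow> 0 <= t & t < T & 0 <= x & 0 <= y" for t x y by (auto simp: test_domain_def)
 have p0: "ps t x y = 0" if "(t, x, y) \<notin> K" "0 <= t" "0 <= x" "0 <= y" for t x y
  using that K(3)[of "(t, x, y)"] by (simp add: ps_def td)
 have pb: "\<bar>ps t x y\<bar> <= C0" if "0 <= t" "0 <= x" "0 <= y" for t x y
  using C0(1) C0(2)[of "(t, x, y)"] p0[of t x y] that by (cases "(t, x, y) : K") (auto simp: ps_def)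
 have der: "((%p. case p of (t, x, y) => ps t x y) has_derivative (%h. if p : ?ST then F' p h else 0)) (at p)" if "p : ?X" for p
 proof (rule has_derivative_transform_within_open[OF ext(1)[OF that] X that])
  show "(if q : ?ST then F q else 0) = (case q of (t, x, y) => ps t x y)" if "q : ?X" for q
   using that by (auto simp: ps_def space_time_def quarter_def split: prod.splits)
 qed
 show ?thesis
 proof (rule that[of T' R "C0 + C1 + C2 + C3"])
  show "test_fun T ps (D (1, 0, 0)) (D (0, 1, 0)) (D (0, 0, 1)) T' R (C0 + C1 + C2 + C3)"
   unfolding test_fun_def
  proof (intro conjI allI impI ballI TR)
   fix t x y :: real assume "0 < t" "0 < x" "0 < y"
   hence "(t, x, y) : ?X" by simp
   from line_derivatives[OF der[OF this]]
   show "((%s. ps s x y) has_real_derivative D (1, 0, 0) t x y) (at t)"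
    "((%s. ps t s y) has_real_derivative D (0, 1, 0) t x y) (at x)"
    "((%s. ps t x s) has_real_derivative D (0, 0, 1) t x y) (at y)"
    unfolding DF by simp_all
   show "\<bar>D (1, 0, 0) t x y\<bar> <= C0 + C1 + C2 + C3" "\<bar>D (0, 1, 0) t x y\<bar> <= C0 + C1 + C2 + C3" "\<bar>D (0, 0, 1) t x y\<bar> <= C0 + C1 + C2 + C3"
    using C0(1) C(1-3) C(4)[of t x y] C(5)[of t x y] C(6)[of t x y] by linarith+
  next
   fix t x y :: real assume nn: "0 <= t" "0 <= x" "0 <= y"
   show "\<bar>ps t x y\<bar> <= C0 + C1 + C2 + C3" using pb[OF nn] C(1-3) by linarith
   show "ps t x y = 0" if "T' <= t \<or> R <= x \<or> R <= y"
    using TR(4)[of t x y] that nn by (intro p0) auto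
  next
   fix f assume "f : {D (1, 0, 0), D (0, 1, 0), D (0, 0, 1)}"
   moreover have "continuous_on ?X (%(t, x, y). D c t x y)" if "c : Basis" for c
    using ext(2)[OF F'c[OF that]] by (simp add: DF case_prod_beta' cong: if_cong)
   ultimately show "continuous_on ?X (%(t, x, y). f t x y)" using Bs by auto
  next
   show "0 <= C0 + C1 + C2 + C3" using C C0 by simp
   let ?Y = "{0..} \<times> {0..} \<times> {0..} :: (R3) set"
   let ?V = "?Y \<inter> {T'<..} \<times> UNIV"
   have TT: "?td = ?Y \<inter> {..<T} \<times> UNIV" by (auto simp: test_domain_def)
   have YU: "?td \<union> ?V = ?Y" using TR(2) by (auto simp: test_domain_def)
   \<comment> \<open>Continuity on the closed octant is glued from the part \<open>t < T\<close> and
     the part \<open>t > T'\<close>, where the function is zero.\<close>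
   have "continuous_on (?td \<union> ?V) (%(t, x, y). ps t x y)"
   proof (rule continuous_on_Un_local_open)
    have "openin (top_of_set ?Y) ?td" unfolding TT by (intro openin_open_Int open_Times) auto
    thus "openin (top_of_set (?td \<union> ?V)) ?td" unfolding YU .
    show "openin (top_of_set (?td \<union> ?V)) ?V" unfolding YU by (intro openin_open_Int open_Times) auto
    show "continuous_on ?td (%(t, x, y). ps t x y)"
    by (rule continuous_on_eq[OF Fc]) (auto simp: ps_def test_domain_def)
    show "continuous_on ?V (%(t, x, y). ps t x y)"
    proof (rule continuous_on_eq[OF continuous_on_const[of _ 0]])
    fix p assume "p : ?V"
    moreover obtain t x y where p: "p = (t, x, y)" by (cases p) auto
    ultimately have "ps t x y = 0" using TR(4)[of t x y] by (intro p0) auto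
    thus "0 = (case p of (t, x, y) => ps t x y)" using p by simp
    qed
   qed
   thus "continuous_on ?Y (%(t, x, y). ps t x y)" unfolding YU .
  qed
 qed
qed

section \<open>Verification of the abstract hypotheses\<close>

context lbm_convergence
begin

lemma ex_lbm_limit:
 obtains M A W S f u0' uW' uS' v where
  "lbm_limit E (relax E \<omega>s \<omega>a) U M lam T \<phi>x \<phi>y A W S f dt dx N u0' uW' uS' v"
  "AE z in lebesgue. z : quarter --> u0 z = u0' z" "AE z in lebesgue. z : face T --> uW z = uW' z"
  "AE z in lebesgue. z : face T --> uS z = uS' z" "AE z in lebesgue. z : space_time T --> ubar z = v z"
proof -
 have meas: "u : borel_measurable (lebesgue_on Om)" if "Linf_BV_L1 Om u" for Om and u :: "R2 => real"
  using that unfolding Linf_BV_L1_def by (auto dest: borel_measurable_integrable)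
 obtain u0' where u0': "u0' : Bor" "!!z. \<bar>u0' z\<bar> <= U" "!!z. z \<notin> quarter ==> u0' z = 0"
  "AE z in lebesgue. z : quarter --> u0 z = u0' z"
  using borel_version[OF meas[OF data(1)] borel_domains(3) data_AE_bound(1) U_nonneg] by blast
 obtain uW' where uW': "uW' : Bor" "!!z. \<bar>uW' z\<bar> <= U" "!!z. z \<notin> face T ==> uW' z = 0"
  "AE z in lebesgue. z : face T --> uW z = uW' z"
  using borel_version[OF meas[OF data(2)] borel_domains(2) data_AE_bound(2) U_nonneg] by blast
 obtain uS' where uS': "uS' : Bor" "!!z. \<bar>uS' z\<bar> <= U" "!!z. z \<notin> face T ==> uS' z = 0"
  "AE z in lebesgue. z : face T --> uS z = uS' z"
  using borel_version[OF meas[OF data(3)] borel_domains(2) data_AE_bound(3) U_nonneg] by blast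
 obtain v where v: "v : Bor" "!!z. \<bar>v z\<bar> <= U" "!!z. z \<notin> space_time T ==> v z = 0"
  "AE z in lebesgue. z : space_time T --> ubar z = v z"
  "AE z in lebesgue. z : space_time T --> (ALL i. fbar i z = E i (v z))"
  by (rule limit_version, rule that; assumption)
 have BV: "BV quarter u0" "BV (face T) uW" "BV (face T) uS" using data unfolding Linf_BV_L1_def by blast+
 obtain M0 where M0: "0 <= M0" "var_bound quarter u0' M0" "var_bound (prod.swap ` quarter) (%p. u0' (prod.swap p)) M0" "integ u0'"
  using BV_var_bound[OF BV(1) open_quarter u0'(1,3,4)] by blast
 obtain MW where MW: "0 <= MW" "var_bound (face T) uW' MW" "var_bound (prod.swap ` face T) (%p. uW' (prod.swap p)) MW" "integ uW'"
  using BV_var_bound[OF BV(2) open_face uW'(1,3,4)] by blast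
 obtain MS where MS: "0 <= MS" "var_bound (face T) uS' MS" "var_bound (prod.swap ` face T) (%p. uS' (prod.swap p)) MS" "integ uS'"
  using BV_var_bound[OF BV(3) open_face uS'(1,3,4)] by blast
 have sq: "prod.swap ` quarter = quarter" by (auto simp: quarter_def image_def)
 define L where "L u = (LBINT p. \<bar>u p\<bar>)" for u :: "R2 => real"
 have L0: "0 <= L u" for u unfolding L_def by simp
 have Lsw: "L (%p. u0' (prod.swap p)) = L u0'"
  unfolding L_def using lborel_swap_integral[of "%p. \<bar>u0' p\<bar>"] u0'(1) by simp
 \<comment> \<open>A crude common majorant of the four bounds of \<open>face_bounds\<close>; like
   \<open>M\<close> below, it does not depend on \<open>p\<close>.\<close>
 define G where "G m l = m + l / T + lam * m + lam * l" for m l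
 have G: "m + l / T <= G m l" "m <= G m l" "lam * m <= G m l" "lam * l <= G m l" "0 <= G m l" if "0 <= m" "0 <= l" for m l
 proof -
  have "0 <= l / T" "0 <= lam * m" "0 <= lam * l" using that T_pos lam_pos by auto
  thus "m + l / T <= G m l" "m <= G m l" "lam * m <= G m l" "lam * l <= G m l" "0 <= G m l"
   unfolding G_def using that by linarith+
 qed
 define M where "M = lam * T + (M0 + L u0') + G MW (L uW') + G MS (L uS')"
 have lT: "0 <= lam * T" using lam_pos T_pos by simp
 note GW = G[OF MW(1) L0[of uW']] and GS = G[OF MS(1) L0[of uS']]
 have Mle: "lam * T <= M" "M0 + L u0' <= M" "M0 <= M" "L u0' <= M" "G MW (L uW') <= M" "G MS (L uS') <= M"
  unfolding M_def using lT M0(1) L0[of u0'] GW(5) GS(5) by linarith+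
 define A where "A p = (%j. cell_int u0' (dx p) (dx p) (fst j) (snd j) / (dx p * dx p))" for p
 define W where "W p n j = cell_int uW' (dt p) (dx p) n j / (dt p * dx p)" for p n j
 define S where "S p n j = cell_int uS' (dt p) (dx p) n j / (dt p * dx p)" for p n j
 define f where "f p n = lbm E \<omega>s \<omega>a u0' uW' uS' (dt p) (dx p) n" for p n
 have avb: "\<bar>cell_int u h k i j / (h * k)\<bar> <= U" if "u : Bor" "!!z. \<bar>u z\<bar> <= U" "0 < h" "0 < k" for u h k i j
 proof -
  have hk: "0 < h * k" using that by simp
  show ?thesis using cell_int_bound[OF that, of i j] unfolding abs_divide abs_of_pos[OF hk] pos_divide_le_eq[OF hk] .
 qed
 have scheme: "scheme E (relax E \<omega>s \<omega>a) U (A p) (W p) (S p) (f p)" for p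
 proof -
  interpret relaxation E "relax E \<omega>s \<omega>a" U by (rule relaxation)
  show ?thesis
  proof
   show "\<bar>A p j\<bar> <= U" for j unfolding A_def by (intro avb u0' dx_pos)
   show "\<bar>W p n k\<bar> <= U" for n k unfolding W_def by (intro avb uW' dx_pos dt_pos)
   show "\<bar>S p n k\<bar> <= U" for n k unfolding S_def by (intro avb uS' dx_pos dt_pos)
   show "f p 0 i j = E i (A p j)" for i j
    using averages_eq_cell_int(2)[OF u0'(1), of UNIV u0' "fst j" "dx p" "snd j"] by (simp add: f_def A_def)
   show "f p (Suc n) = transport (%k. E XP (W p n k)) (%k. E YP (S p n k)) (%i j. relax E \<omega>s \<omega>a (%k. f p n k j) i)" for n
    using averages_eq_cell_int(1)[OF uW'(1), of UNIV uW'] averages_eq_cell_int(1)[OF uS'(1), of UNIV uS']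
    by (simp add: f_def W_def S_def)
  qed
 qed
 have bscheme: "bounded_scheme E (relax E \<omega>s \<omega>a) U (A p) (W p) (S p) (f p) (dx p) M (N p)" for p
 proof -
  interpret scheme E "relax E \<omega>s \<omega>a" U "A p" "W p" "S p" "f p" by (rule scheme)
  have sw: "cell_int (%q. u0' (prod.swap q)) (dx p) (dx p) i j = cell_int u0' (dx p) (dx p) j i" for i j
   by (rule cell_int_swap[OF u0'(1)])
  note q = quarter_bounds[OF M0(2,4) dx_pos[of p], folded L_def]
  note q' = quarter_bounds[OF M0(3)[unfolded sq] lborel_swap_integrable[OF M0(4)] dx_pos[of p], folded L_def, unfolded Lsw sw]
  note w = face_bounds[OF MW(2-4) dt_pos[of p] lam_pos N_eq[of p] N_pos[of p], folded L_def dx_eq, folded W_def]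
  note s = face_bounds[OF MS(2-4) dt_pos[of p] lam_pos N_eq[of p] N_pos[of p], folded L_def dx_eq, folded S_def]
  show ?thesis
  proof
   show "0 < dx p" by (rule dx_pos)
   have "dx p * real (N p) = lam * T" unfolding dx_eq N_eq[of p, symmetric] by simp
   thus "dx p * real (N p) <= M" using Mle by simp
   show "dx p * (SUM jx<J. SUM jy<J. \<bar>A p (Suc jx, jy) - A p (jx, jy)\<bar>) <= M" for J
    unfolding A_def fst_conv snd_conv using q(1)[of J J] Mle(3) by linarith
   show "dx p * (SUM jx<J. SUM jy<J. \<bar>A p (jx, Suc jy) - A p (jx, jy)\<bar>) <= M" for J
    unfolding A_def fst_conv snd_conv by (subst sum.swap) (use q'(1)[of J J] Mle(3) in linarith)
   show "dx p * (SUM k<J. \<bar>A p (0, k)\<bar>) <= M" for J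
    unfolding A_def fst_conv snd_conv using q(2)[of J] Mle(2) by linarith
   show "dx p * (SUM k<J. \<bar>A p (k, 0)\<bar>) <= M" for J
    unfolding A_def fst_conv snd_conv using q'(2)[of J] Mle(2) by linarith
   show "(dx p)\<^sup>2 * (SUM jx<J. SUM jy<J. \<bar>A p (jx, jy)\<bar>) <= M" for J
    unfolding A_def fst_conv snd_conv using q(3)[of J J] Mle(4) by linarith
   show "dx p * (SUM k<J. \<bar>W p 0 k\<bar>) <= M" "dx p * (SUM n<N p - 1. SUM k<J. \<bar>W p (Suc n) k - W p n k\<bar>) <= M"
    "dx p * (SUM n<N p. SUM k<J. \<bar>W p n (Suc k) - W p n k\<bar>) <= M" "(dx p)\<^sup>2 * (SUM n<N p. SUM k<J. \<bar>W p n k\<bar>) <= M" for J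
    using w(1-4)[of J] GW Mle(5) by linarith+
   show "dx p * (SUM k<J. \<bar>S p 0 k\<bar>) <= M" "dx p * (SUM n<N p - 1. SUM k<J. \<bar>S p (Suc n) k - S p n k\<bar>) <= M"
    "dx p * (SUM n<N p. SUM k<J. \<bar>S p n (Suc k) - S p n k\<bar>) <= M" "(dx p)\<^sup>2 * (SUM n<N p. SUM k<J. \<bar>S p n k\<bar>) <= M" for J
    using s(1-4)[of J] GS Mle(6) by linarith+
  qed
 qed
 have fx: "lam * (E XP u - E XM u) = \<phi>x u" "lam * (E YP u - E YM u) = \<phi>y u" for u
  unfolding E_def using lam_pos by simp_all
 have lim: "lbm_limit E (relax E \<omega>s \<omega>a) U M lam T \<phi>x \<phi>y A W S f dt dx N u0' uW' uS' v"
 proof (rule lbm_limit.intro)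
  show "(%p. NN z. ennreal (ind (space_time T) z *
    (SUM i:UNIV. \<bar>f p (ix (dt p) (fst z)) i (ix (dx p) (fst (snd z)), ix (dx p) (snd (snd z))) - E i (v z)\<bar>))) ----> 0"
   by (rule step_L1_limit[OF v(1,5)])
    (unfold f_def, rule lbm_cong[OF u0'(1,4) uW'(1,4) uS'(1,4)])
 qed (use bscheme lam_pos T_pos dx_lim dx_eq N_eq fx E_borel u0' uW' uS' v in \<open>auto simp: A_def W_def S_def\<close>)
 show ?thesis by (rule that[OF lim u0'(4) uW'(4) uS'(4) v(4)])
qed

end

section \<open>Conclusions for the given representative of the limit\<close>

lemma AE_lborel_reorder:
 fixes Q :: "R3 => bool"
 assumes "AE z in lborel. Q z"
 shows "AE x in lborel. AE q in lborel. Q (fst q, x, snd q)" "AE z in lborel. Q (swap_xy z)"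
proof -
 obtain Z where Z: "{z : space lborel. \<not> Q z} \<subseteq> Z" "emeasure lborel Z = 0" "Z : sets lborel"
  using AE_E[OF assms] by blast
 have Zb [measurable]: "Z : sets borel" using Z(3) by simp
 have 0: "(NN z. ind Z z) = (0 :: ennreal)" using Z(2,3) by simp
 have gm: "(ind Z :: _ => ennreal) : Bor" by measurable
 have pm: "(%q :: R2. (fst q, x, snd q)) : Bor" for x :: real
  by (intro borel_measurable_continuous_onI continuous_intros)
 have im: "(%q. ind Z (fst q, x, snd q) :: ennreal) : Bor" for x
  by (rule measurable_compose[OF pm gm])
 have m: "(%x. NN q. ind Z (fst q, x, snd q)) : borel_measurable lborel" by measurable
 have "(NN x. (NN q. ind Z (fst q, x, snd q))) = (0 :: ennreal)"
  using nn_integral_lborel_reorder[OF gm] 0 by simp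
 hence "AE x in lborel. (NN q. ind Z (fst q, x, snd q)) = (0 :: ennreal)"
  unfolding nn_integral_0_iff_AE[OF m] .
 thus "AE x in lborel. AE q in lborel. Q (fst q, x, snd q)"
 proof eventually_elim
  case (elim x)
  have imx: "(%q. ind Z (fst q, x, snd q) :: ennreal) : borel_measurable lborel" using im[of x] by simp
  have "AE q in lborel. ind Z (fst q, x, snd q) = (0 :: ennreal)"
   using elim unfolding nn_integral_0_iff_AE[OF imx] .
  thus ?case by eventually_elim (use Z(1) in \<open>auto simp: indicator_def split: if_splits\<close>)
 qed
 have sm: "(%z. ind Z (swap_xy z) :: ennreal) : borel_measurable lborel" by measurable
 have "(NN z. ind Z (swap_xy z)) = (0 :: ennreal)"
  using nn_integral_swap_xy[OF gm] 0 by simp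
 hence "AE z in lborel. ind Z (swap_xy z) = (0 :: ennreal)" unfolding nn_integral_0_iff_AE[OF sm] .
 thus "AE z in lborel. Q (swap_xy z)"
  by eventually_elim (use Z(1) in \<open>auto simp: indicator_def split: if_splits\<close>)
qed

text \<open>Almost every slice of a null set is a null set, so a trace of the Borel version
  \<open>v\<close> is a trace of \<open>u\<close>.\<close>

lemma is_trace_WI:
 assumes v: "v : Bor" and ga: "ga : Bor" "integ (%q. ind (face T) q * ga q)"
  and ae: "AE z in lborel. z : space_time T --> u z = v z"
  and lim: "!!ep. 0 < ep ==> \<exists>\<delta>>0. AE s in lborel. 0 < s & s < \<delta> -->
    (NN q. ennreal (ind (face T) q * \<bar>v (fst q, s, snd q) - ga q\<bar>)) < ennreal ep"
 shows "is_trace_W T u ga"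
 unfolding is_trace_W_def
proof (intro conjI allI impI)
 have fb: "face T : sets borel" by (rule borel_domains)
 show "integrable (lebesgue_on (face T)) ga" using ga(2) lebesgue_on_to_lborel(2)[OF fb ga(1), of ga] by simp
 fix ep :: real assume "ep > 0"
 from lim[OF this] obtain \<delta> where d: "\<delta> > 0" "AE s in lborel. 0 < s & s < \<delta> -->
    (NN q. ennreal (ind (face T) q * \<bar>v (fst q, s, snd q) - ga q\<bar>)) < ennreal ep" by blast
 have "AE s in lborel. 0 < s & s < \<delta> -->
    (\<integral>\<^sup>+ (t, y). ennreal \<bar>u (t, s, y) - ga (t, y)\<bar> \<partial>lebesgue_on (face T)) < ennreal ep"
  using d(2) AE_lborel_reorder(1)[OF ae]
 proof eventually_elim
  case (elim s)
  show ?case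
  proof
   assume s: "0 < s & s < \<delta>"
   have pm: "(%q :: R2. (fst q, s, snd q)) : Bor"
    by (intro borel_measurable_continuous_onI continuous_intros)
   have gm: "(%q. v (fst q, s, snd q) - ga q) : Bor"
    by (intro borel_measurable_diff ga(1) measurable_compose[OF pm v])
   have "AE q in lborel. q : face T --> u (fst q, s, snd q) - ga q = v (fst q, s, snd q) - ga q"
    using elim(2) by eventually_elim (use s in \<open>auto simp: face_def space_time_def quarter_def mem_Times_iff\<close>)
   hence "AE q in lebesgue. q : face T --> u (fst q, s, snd q) - ga q = v (fst q, s, snd q) - ga q"
    unfolding AE_completion_iff .
   from lebesgue_on_to_lborel(3)[OF fb gm this] elim(1) s
   show "(\<integral>\<^sup>+ (t, y). ennreal \<bar>u (t, s, y) - ga (t, y)\<bar> \<partial>lebesgue_on (face T)) < ennreal ep"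
    by (simp add: case_prod_beta')
  qed
 qed
 thus "\<exists>\<delta>>0. AE s in lebesgue. 0 < s & s < \<delta> -->
    (\<integral>\<^sup>+ (t, y). ennreal \<bar>u (t, s, y) - ga (t, y)\<bar> \<partial>lebesgue_on (face T)) < ennreal ep"
  unfolding AE_completion_iff using d(1) by blast
qed

lemma is_trace_S_swap: "is_trace_S T u ga \<longleftrightarrow> is_trace_W T (%z. u (swap_xy z)) ga"
 by (simp add: is_trace_S_def is_trace_W_def swap_xy_def)

context lbm_limit
begin

lemma ex_trace: "\<exists>ga. is_trace ga"
 by (rule trace_exists) (unfold is_trace_def, blast)

text \<open>The bounds in time and in space are added to give one constant for all three components
  of a test field.\<close>

lemma component_variation:
 assumes C1: "C1_on (space_time T) \<Phi>" and supp: "compact_support_in (space_time T) \<Phi>"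
  and le1: "!!p. p : space_time T ==> norm (\<Phi> p) <= 1" and b: "b : Basis"
 shows "integ (%z. ind (space_time T) z * (v z * (partial (space_time T) b \<Phi> z \<bullet> b)))"
  "(LBINT z. ind (space_time T) z * (v z * (partial (space_time T) b \<Phi> z \<bullet> b)))
   <= T * ((6 + 2 * U) * M) + 2 * lam * T * ((6 + 2 * U) * M)"
proof -
 define ps where "ps t x y = (if (t, x, y) : space_time T then \<Phi> (t, x, y) \<bullet> b else 0)" for t x y
 define D where "D c t x y = (if (t, x, y) : space_time T then partial (space_time T) c \<Phi> (t, x, y) \<bullet> b else 0)" for c t x y
 have pse: "ps = (%t x y. if (t, x, y) : space_time T then \<Phi> (t, x, y) \<bullet> b else 0)"
  and De: "D = (%c t x y. if (t, x, y) : space_time T then partial (space_time T) c \<Phi> (t, x, y) \<bullet> b else 0)"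
  by (simp_all add: fun_eq_iff ps_def D_def)
 have "EX T' R' C r. test_fun T ps (D (1, 0, 0)) (D (0, 1, 0)) (D (0, 0, 1)) T' R' C & 0 < r &
  (ALL t x y. t <= r \<or> x <= r \<or> y <= r --> ps t x y = 0) & (ALL t x y. \<bar>ps t x y\<bar> <= 1)"
  unfolding pse De by (rule interior_test_fun[OF C1 supp le1 T_pos b]; blast)
 then obtain T' R' C r where tf: "test_fun T ps (D (1, 0, 0)) (D (0, 1, 0)) (D (0, 0, 1)) T' R' C" and r: "0 < r"
  "!!t x y. t <= r \<or> x <= r \<or> y <= r ==> ps t x y = 0" "!!t x y. \<bar>ps t x y\<bar> <= 1"
  by blast
 interpret te: lbm_test E R U M lam T \<phi>x \<phi>y A W S f dt dx N u0 uW uS v ps "D (1, 0, 0)" "D (0, 1, 0)" "D (0, 0, 1)" T' R' C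
  by unfold_locales (use tf dt_pos dt_lim dx_pos dx_lim in auto)
 note V = te.variation_bounds[OF r]
 have e: "ind (space_time T) z * (v z * (case z of (t, x, y) => D c t x y))
   = ind (space_time T) z * (v z * (partial (space_time T) c \<Phi> z \<bullet> b))" for z c
  by (auto simp: D_def indicator_def split: prod.splits)
 have nn: "0 <= T * ((6 + 2 * U) * M)" "0 <= 2 * lam * T * ((6 + 2 * U) * M)"
  using tv_nonneg T_pos lam_pos by (auto intro!: mult_nonneg_nonneg)
 have bs: "b = (1, 0, 0) \<or> b = (0, 1, 0) \<or> b = (0, 0, 1)" using b unfolding Basis_real3 by simp
 let ?i = "%b' z. ind (space_time T) z * (v z * (partial (space_time T) b' \<Phi> z \<bullet> b))"
 have "integ (?i b) & (LBINT z. ?i b z) <= T * ((6 + 2 * U) * M) + 2 * lam * T * ((6 + 2 * U) * M)"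
  using bs
 proof (elim disjE)
  assume h: "b = (1, 0, 0)"
  have "integ (?i (1, 0, 0))" "\<bar>LBINT z. ?i (1, 0, 0) z\<bar> <= 2 * lam * T * ((6 + 2 * U) * M)"
   using V(6,3) unfolding e by blast+
  thus ?thesis unfolding h[symmetric] using nn by linarith
 next
  assume h: "b = (0, 1, 0)"
  have "integ (?i (0, 1, 0))" "\<bar>LBINT z. ?i (0, 1, 0) z\<bar> <= T * ((6 + 2 * U) * M)"
   using V(4,1) unfolding e by blast+
  thus ?thesis unfolding h[symmetric] using nn by linarith
 next
  assume h: "b = (0, 0, 1)"
  have "integ (?i (0, 0, 1))" "\<bar>LBINT z. ?i (0, 0, 1) z\<bar> <= T * ((6 + 2 * U) * M)"
   using V(5,2) unfolding e by blast+
  thus ?thesis unfolding h[symmetric] using nn by linarith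
 qed
 thus "integ (?i b)" "(LBINT z. ?i b z) <= T * ((6 + 2 * U) * M) + 2 * lam * T * ((6 + 2 * U) * M)"
  by blast+
qed

lemma BV_limit:
 assumes ae: "AE z in lebesgue. z : space_time T --> u z = v z"
 shows "BV (space_time T) u"
 unfolding BV_def
proof (intro conjI exI[of _ "SUM b:(Basis :: (R3) set). T * ((6 + 2 * U) * M) + 2 * lam * T * ((6 + 2 * U) * M)"] allI impI)
 show "integrable (lebesgue_on (space_time T)) u" using lebesgue_on_to_lborel(2)[OF borel_domains(1) v_borel ae] v_integrable by simp
next
 fix \<Phi> :: "R3 => R3"
 assume 2: "C1_on (space_time T) \<Phi> & compact_support_in (space_time T) \<Phi> & (ALL p:space_time T. norm (\<Phi> p) <= 1)"
 let ?c = "%b z. ind (space_time T) z * (v z * (partial (space_time T) b \<Phi> z \<bullet> b))"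
 define g where "g z = (SUM b:Basis. ?c b z)" for z
 have C: "integ (?c b)" "(LBINT z. ?c b z) <= T * ((6 + 2 * U) * M) + 2 * lam * T * ((6 + 2 * U) * M)"
  if "b : Basis" for b using 2 that by (intro component_variation; simp)+
 have gi: "integ g" unfolding g_def[abs_def] by (rule Bochner_Integration.integrable_sum) (rule C)
 hence gm: "g : Bor" using borel_measurable_integrable by fastforce
 have ug: "AE z in lebesgue. z : space_time T --> u z * divergence (space_time T) \<Phi> z = g z"
  using ae by eventually_elim (simp add: divergence_def g_def sum_distrib_left)
 have "(LINT z|lebesgue_on (space_time T). u z * divergence (space_time T) \<Phi> z) = (LBINT z. ind (space_time T) z * g z)"
  by (rule lebesgue_on_to_lborel(1)[OF borel_domains(1) gm ug])
 also have "... = (LBINT z. g z)"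
  by (intro Bochner_Integration.integral_cong refl) (auto simp: g_def indicator_def)
 also have "... = (SUM b:Basis. LBINT z. ?c b z)"
  unfolding g_def[abs_def] by (rule Bochner_Integration.integral_sum) (rule C)
 also have "... <= (SUM b:(Basis :: (R3) set). T * ((6 + 2 * U) * M) + 2 * lam * T * ((6 + 2 * U) * M))"
  by (intro sum_mono C)
 finally show "(LINT z|lebesgue_on (space_time T). u z * divergence (space_time T) \<Phi> z)
  <= (SUM b:(Basis :: (R3) set). T * ((6 + 2 * U) * M) + 2 * lam * T * ((6 + 2 * U) * M))" .
qed

text \<open>On each of the four domains the integrand agrees almost everywhere with a Borel one
  built from the extended test function, which reduces the claim to
  \<open>entropy_inequality\<close>.\<close>

lemma entropy_functional_nonneg:
 assumes ae: "AE z in lebesgue. z : quarter --> w0 z = u0 z" "AE z in lebesgue. z : face T --> wW z = uW z"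
  "AE z in lebesgue. z : face T --> wS z = uS z" "AE z in lebesgue. z : space_time T --> w z = v z"
  and gaW: "is_trace gaW" and gaS: "lbm_limit.is_trace U T (%z. v (swap_xy z)) gaS"
  and gam [measurable]: "gaW : Bor" "gaS : Bor"
  and F: "C2_on (test_domain T) F" "compact_support_in (test_domain T) F" "!!p. p : test_domain T ==> 0 <= F p"
 shows "0 <= entropy_functional T \<phi>x \<phi>y w0 wW wS w gaW gaS kp F"
proof -
 have C1: "C1_on (test_domain T) F" using F(1) by (simp add: C2_on_def)
 define ps where "ps t x y = (if t < T then F (t, x, y) else 0)" for t x y
 define D where "D c t x y = (if (t, x, y) : space_time T then partial (test_domain T) c F (t, x, y) else 0)" for c t x y
 have pse: "ps = (%t x y. if t < T then F (t, x, y) else 0)"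
  and De: "D = (%c t x y. if (t, x, y) : space_time T then partial (test_domain T) c F (t, x, y) else 0)"
  by (simp_all add: fun_eq_iff ps_def D_def)
 obtain T' R' C where tf: "test_fun T ps (D (1, 0, 0)) (D (0, 1, 0)) (D (0, 0, 1)) T' R' C"
  unfolding pse De by (rule closed_test_fun[OF C1 F(2) T_pos])
 have psi: "0 <= ps t x y" if "0 <= t" "0 <= x" "0 <= y" for t x y
  using F(3)[of "(t, x, y)"] that by (simp add: ps_def test_domain_def)
 let ?X = "{0<..} \<times> {0<..} \<times> {0<..} :: (R3) set" and ?Y = "{0..} \<times> {0..} \<times> {0..} :: (R3) set"
 have cD: "continuous_on ?X (%(t, x, y). D c t x y)" if "c : {(1, 0, 0), (0, 1, 0), (0, 0, 1)}" for c
  using tf that unfolding test_fun_def by auto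
 have cps: "continuous_on ?Y (%(t, x, y). ps t x y)" using tf unfolding test_fun_def by blast
 have Xb: "?X : sets borel" by (intro borel_open open_Times) auto
 have Dm: "(%z. D c (fst z) (fst (snd z)) (snd (snd z))) : Bor" if "c : {(1, 0, 0), (0, 1, 0), (0, 0, 1)}" for c
 proof -
  have "(%z. ind ?X z *\<^sub>R (case z of (t, x, y) => D c t x y)) : Bor"
   by (rule borel_measurable_continuous_on_indicator[OF Xb cD[OF that]])
  moreover have "ind ?X z *\<^sub>R (case z of (t, x, y) => D c t x y) = D c (fst z) (fst (snd z)) (snd (snd z))" for z
   by (auto simp: D_def indicator_def space_time_def quarter_def split: prod.splits)
  ultimately show ?thesis by simp
 qed
 note [measurable] = Dm[of "(1, 0, 0)", simplified] Dm[of "(0, 1, 0)", simplified] Dm[of "(0, 0, 1)", simplified]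
 have jm: "(%q. ind B q * ps (fst (j q)) (fst (snd (j q))) (snd (snd (j q)))) : Bor"
  if "B : sets borel" "continuous_on B j" "j ` B \<subseteq> ?Y" for B :: "(R2) set" and j
  using borel_measurable_continuous_on_indicator[OF that(1) continuous_on_compose2[OF cps that(2,3)]] by (simp add: case_prod_beta')
 have Wps [measurable]: "(%q. ind (face T) q * ps (fst q) 0 (snd q)) : Bor"
 proof -
  have c: "continuous_on (face T) (%q. (fst q, 0 :: real, snd q))" by (intro continuous_intros)
  have i: "(%q. (fst q, 0 :: real, snd q)) ` face T \<subseteq> ?Y" by (auto simp: face_def)
  from jm[OF borel_domains(2) c i] show ?thesis by simp
 qed
 have Sps [measurable]: "(%q. ind (face T) q * ps (fst q) (snd q) 0) : Bor"
 proof -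
  have c: "continuous_on (face T) (%q. (fst q, snd q, 0 :: real))" by (intro continuous_intros)
  have i: "(%q. (fst q, snd q, 0 :: real)) ` face T \<subseteq> ?Y" by (auto simp: face_def)
  from jm[OF borel_domains(2) c i] show ?thesis by simp
 qed
 have Ops [measurable]: "(%q. ind quarter q * ps 0 (fst q) (snd q)) : Bor"
 proof -
  have c: "continuous_on quarter (%q. (0 :: real, fst q, snd q))" by (intro continuous_intros)
  have i: "(%q. (0 :: real, fst q, snd q)) ` quarter \<subseteq> ?Y" by (auto simp: quarter_def)
  from jm[OF borel_domains(3) c i] show ?thesis by simp
 qed
 let ?td = "test_domain T"
 define gI where "gI z = \<bar>v z - kp\<bar> * D (1, 0, 0) (fst z) (fst (snd z)) (snd (snd z))
    + sgn (v z - kp) * ((\<phi>x (v z) - \<phi>x kp) * D (0, 1, 0) (fst z) (fst (snd z)) (snd (snd z))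
    + (\<phi>y (v z) - \<phi>y kp) * D (0, 0, 1) (fst z) (fst (snd z)) (snd (snd z)))" for z
 have gIm: "gI : Bor" unfolding gI_def[abs_def] by measurable
 have Iae: "AE z in lebesgue. z : space_time T --> \<bar>w z - kp\<bar> * partial ?td (1, 0, 0) F z
    + sgn (w z - kp) * ((\<phi>x (w z) - \<phi>x kp) * partial ?td (0, 1, 0) F z + (\<phi>y (w z) - \<phi>y kp) * partial ?td (0, 0, 1) F z) = gI z"
  using ae(4) by eventually_elim (auto simp: gI_def D_def)
 note I = lebesgue_on_to_lborel(1)[OF borel_domains(1) gIm Iae]
 define gW where "gW q = sgn (uW q - kp) * (\<phi>x (gaW q) - \<phi>x kp) * (ind (face T) q * ps (fst q) 0 (snd q))" for q
 have gWm: "gW : Bor" unfolding gW_def[abs_def] by measurable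
 have Wae: "AE q in lebesgue. q : face T -->
   (case q of (t, y) => sgn (wW (t, y) - kp) * (\<phi>x (gaW (t, y)) - \<phi>x kp) * F (t, 0, y)) = gW q"
  using ae(2) by eventually_elim (auto simp: gW_def ps_def face_def split: prod.splits)
 note W = lebesgue_on_to_lborel(1)[OF borel_domains(2) gWm Wae]
 have W': "ind (face T) q * gW q = ind (face T) q * (sgn (uW q - kp) * (\<phi>x (gaW q) - \<phi>x kp) * ps (fst q) 0 (snd q))" for q
  by (simp add: gW_def indicator_def)
 define gS where "gS q = sgn (uS q - kp) * (\<phi>y (gaS q) - \<phi>y kp) * (ind (face T) q * ps (fst q) (snd q) 0)" for q
 have gSm: "gS : Bor" unfolding gS_def[abs_def] by measurable
 have Sae: "AE q in lebesgue. q : face T -->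
   (case q of (t, x) => sgn (wS (t, x) - kp) * (\<phi>y (gaS (t, x)) - \<phi>y kp) * F (t, x, 0)) = gS q"
  using ae(3) by eventually_elim (auto simp: gS_def ps_def face_def split: prod.splits)
 note S = lebesgue_on_to_lborel(1)[OF borel_domains(2) gSm Sae]
 have S': "ind (face T) q * gS q = ind (face T) q * (sgn (uS q - kp) * (\<phi>y (gaS q) - \<phi>y kp) * ps (fst q) (snd q) 0)" for q
  by (simp add: gS_def indicator_def)
 define gO where "gO q = \<bar>u0 q - kp\<bar> * (ind quarter q * ps 0 (fst q) (snd q))" for q
 have gOm: "gO : Bor" unfolding gO_def[abs_def] by measurable
 have Oae: "AE q in lebesgue. q : quarter --> (case q of (x, y) => \<bar>w0 (x, y) - kp\<bar> * F (0, x, y)) = gO q"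
  using ae(1) by eventually_elim (auto simp: gO_def ps_def T_pos split: prod.splits)
 note O = lebesgue_on_to_lborel(1)[OF borel_domains(3) gOm Oae]
 have O': "ind quarter q * gO q = ind quarter q * (\<bar>u0 q - kp\<bar> * ps 0 (fst q) (snd q))" for q
  by (simp add: gO_def indicator_def)
 have "entropy_functional T \<phi>x \<phi>y w0 wW wS w gaW gaS kp F
  = (LBINT z. ind (space_time T) z * gI z) + (LBINT q. ind (face T) q * gW q)
   + (LBINT q. ind (face T) q * gS q) + (LBINT q. ind quarter q * gO q)"
  unfolding entropy_functional_def I W S O by (rule refl)
 also have "0 <= ..."
  unfolding W' S' O' gI_def by (rule entropy_inequality[OF tf psi gaW gaS])
 finally show ?thesis .
qed

end

lemma (in lbm_convergence) weak_entropy_solution: "weak_entropy_solution T \<phi>x \<phi>y u0 uW uS ubar"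
proof -
 obtain M A W S f u0' uW' uS' v where
  lim: "lbm_limit E (relax E \<omega>s \<omega>a) U M lam T \<phi>x \<phi>y A W S f dt dx N u0' uW' uS' v"
  and ae: "AE z in lebesgue. z : quarter --> u0 z = u0' z" "AE z in lebesgue. z : face T --> uW z = uW' z"
  "AE z in lebesgue. z : face T --> uS z = uS' z" "AE z in lebesgue. z : space_time T --> ubar z = v z"
  by (rule ex_lbm_limit, rule that; assumption)
 interpret L: lbm_limit E "relax E \<omega>s \<omega>a" U M lam T \<phi>x \<phi>y A W S f dt dx N u0' uW' uS' v by (rule lim)
 note Ls = L.lbm_swapped
 obtain gaW where gaW: "L.is_trace gaW" using L.ex_trace by blast
 \<comment> \<open>The southern trace is the western trace of the reflected limit.\<close>
 obtain gaS where gaS: "lbm_limit.is_trace U T (%z. v (swap_xy z)) gaS" using lbm_limit.ex_trace[OF Ls] by blast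
 note tW = gaW[unfolded L.is_trace_def] and tS = gaS[unfolded lbm_limit.is_trace_def[OF Ls]]
 have aeL: "AE z in lborel. z : space_time T --> ubar z = v z" using ae(4) unfolding AE_completion_iff .
 have "is_trace_W T ubar gaW" using tW by (intro is_trace_WI[OF L.v_borel _ _ aeL]) auto
 moreover have "is_trace_S T ubar gaS"
  unfolding is_trace_S_swap
 proof (rule is_trace_WI[where v = "%z. v (swap_xy z)"])
  show "(%z. v (swap_xy z)) : Bor"
   by (rule measurable_compose[OF borel_measurable_swap_xy L.v_borel])
  show "AE z in lborel. z : space_time T --> ubar (swap_xy z) = v (swap_xy z)"
   using AE_lborel_reorder(2)[OF aeL] by simp
 qed (use tS in blast)+
 moreover have "0 <= entropy_functional T \<phi>x \<phi>y u0 uW uS ubar gaW gaS kp ps"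
  if "C2_on (test_domain T) ps" "compact_support_in (test_domain T) ps" "ALL p:test_domain T. 0 <= ps p" for kp ps
  by (rule L.entropy_functional_nonneg[OF ae gaW gaS]) (use tW tS that in blast)+
 ultimately show ?thesis
  unfolding weak_entropy_solution_def using L.BV_limit[OF ae(4)] by blast
qed

theorem theorem4:
  fixes T lam Lx Ly \<omega>s \<omega>a :: real
    and \<phi>x \<phi>y :: "real \<Rightarrow> real"
    and u0 uW uS :: "real \<times> real \<Rightarrow> real"
    and dx dt :: "nat \<Rightarrow> real"
    and N :: "nat \<Rightarrow> nat"
    and E :: "vel \<Rightarrow> real \<Rightarrow> real"
    and U :: real
    and fbar :: "vel \<Rightarrow> real \<times> real \<times> real \<Rightarrow> real"
    and ubar :: "real \<times> real \<times> real \<Rightarrow> real"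
  defines "E \<equiv> feq lam \<phi>x \<phi>y Lx Ly"
    and "U \<equiv> u_inf T u0 uW uS"
    and "dt \<equiv> (\<lambda>p. dx p / lam)"
  assumes "T > 0" and "lam > 0"
    and "\<phi>x C1_differentiable_on UNIV" and "\<phi>y C1_differentiable_on UNIV"
    and "\<phi>x 0 = 0" and "\<phi>y 0 = 0"
    and "Linf_BV_L1 quarter u0"
    and "Linf_BV_L1 (face T) uW" and "Linf_BV_L1 (face T) uS"
    and "0 < \<omega>s" and "\<omega>s \<le> 2" and "0 < \<omega>a" and "\<omega>a \<le> 2"
    and "monotonicity_condition lam \<phi>x \<phi>y Lx Ly \<omega>s \<omega>a U"
    and "\<not> (max_speed \<phi>x U = 0 \<and> max_speed \<phi>y U = 0)"
    and "\<And>p. dx p > 0" and "dx \<longlonglongrightarrow> 0"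
    and "\<And>p. N p \<ge> 1" and "\<And>p. real (N p) * dt p = T"
    and "\<And>i. fbar i \<in> borel_measurable (lebesgue_on (space_time T))"
    and "\<And>i t. t \<in> {0<..<T} \<Longrightarrow> integrable (lebesgue_on quarter) (\<lambda>x. fbar i (t, x))"
    and "\<And>z. z \<in> space_time T \<Longrightarrow> ubar z = (\<Sum>i\<in>UNIV. fbar i z)"
    and "\<And>t. t \<in> {0<..<T} \<Longrightarrow> AE x in lebesgue_on quarter.
           (\<forall>i. fbar i (t, x) \<in> {E i (- U)..E i U}) \<and> ubar (t, x) \<in> {- U..U} \<and>
           (\<forall>i. fbar i (t, x) = E i (ubar (t, x)))"
    and "(\<lambda>p. LinfL1_norm_vec T
           (\<lambda>i z. f_rec E \<omega>s \<omega>a u0 uW uS (N p) (dt p) (dx p) i z - fbar i z)) \<longlonglongrightarrow> 0"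
    and "(\<lambda>p. LinfL1_norm T
           (\<lambda>z. u_rec E \<omega>s \<omega>a u0 uW uS (N p) (dt p) (dx p) z - ubar z)) \<longlonglongrightarrow> 0"
  shows "weak_entropy_solution T \<phi>x \<phi>y u0 uW uS ubar"
proof -
 interpret lbm_convergence T lam Lx Ly \<omega>s \<omega>a \<phi>x \<phi>y u0 uW uS dx N fbar ubar E U dt
 proof (rule lbm_convergence.intro)
  show "E = feq lam \<phi>x \<phi>y Lx Ly" "U = u_inf T u0 uW uS" "dt = (%p. dx p / lam)"
   by (simp_all only: E_def U_def dt_def)
  show "AE x in lebesgue_on quarter. ubar (t, x) : {- U..U} & (ALL i. fbar i (t, x) = E i (ubar (t, x)))"
   if "t : {0<..<T}" for t
   using assms(26)[OF that] by eventually_elim blast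
 qed (fact assms)+
 show ?thesis by (rule weak_entropy_solution)
qed

end
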